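(* For every $r\ge2$, the distance $d_{\mathfrak h}$ is finite on $\mathcal X^1(\mathbb F_r)$ and the metric topology of $(\mathcal X^1(\mathbb F_r),d_{\mathfrak h})$ coincides with the weak topology on $\mathcal X^1(\mathbb F_r)$.
   Context: Graphs are finite connected graphs in Serre's sense ($E$ oriented edges, involution $e\mapsto\bar e$, orientation $E_+$); $\mathcal M(G)=\mathbb R_{>0}^{|E_+|}$ is the set of length functions; entropy $\mathfrak h_G(\ell)=\lim_{t\to\infty}\frac1t\log\#\{\text{based circuits }\gamma:\ell(\gamma)\le t\}$ (based circuit = reduced closed edge path $(e_1,\ldots,e_n)$ with $e_{i+1}\neq\bar e_i$, $e_n\ne\bar e_1$); $\mathcal M^1(G)=\{\mathfrak h_G=1\}$ with entropy norm $\|(\ell,v)\|^2_{\mathfrak h,G}=\langle v,\operatorname{Hess}\mathfrak h_G(\ell)v\rangle$ on tangent vectors. Outer space: marked metric graphs $(G,\rho,\ell)$ with $G$ without valence 1 or 2 vertices, $\rho\colon\mathcal R_r\to G$ a homotopy equivalence from the $r$-rose, $\ell\in\mathcal M(G)$, modulo isomorphisms respecting lengths and markings up to homotopy; $\mathcal X(\mathbb F_r)$ the set of classes, $\mathcal X^1(\mathbb F_r)$ those of unit entropy, and $\mathcal X(G,\rho)$, $\mathcal X^1(G,\rho)$ the (unit entropy) classes with marked graph $(G,\rho)$. A collapse $c\colon G\to G_0$ (surjection sending edges to edges or vertices with contractible point preimages) induces $c^*\colon\mathcal M(G_0)\to\mathbb R^{|E_+|}_{\ge0}$, $c^*(\ell)(e)=\ell(c(e))$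 or $0$ if $c(e)$ is a vertex; $(G_0,\rho_0)\le(G,\rho)$ if some collapse $c$ has $\rho_0\simeq c\circ\rho$. The closed cell $\overline{\mathcal X}(G,\rho)=\bigcup_{(G_0,\rho_0)\le(G,\rho)}\mathcal X(G_0,\rho_0)$ is identified via these $c^*$ with a subset of $\mathbb R_{\ge0}^{|E_+|}$. The weak topology: $U$ is open iff $U\cap\overline{\mathcal X}(G,\rho)$ is open in this subset for every marked graph $(G,\rho)$; $\mathcal X^1(\mathbb F_r)$ gets the subspace topology. $d_{\mathfrak h}$ is the infimum of lengths of continuous paths in $\mathcal X^1(\mathbb F_r)$ which, off a finite partition of $[0,1]$, are smooth paths in single cells $\mathcal X^1(G_k,\rho_k)\cong\mathcal M^1(G_k)$, the length being the sum of entropy lengths of the pieces. *)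

theory Defs
  imports "HOL-Analysis.Analysis"
begin

record sgraph =
  gV :: "nat set"
  gE :: "nat set"
  gorg :: "nat \<Rightarrow> nat"
  gbar :: "nat \<Rightarrow> nat"
  gEp :: "nat set"

definition tm :: "sgraph \<Rightarrow> nat \<Rightarrow> nat" where
  "tm G e = gorg G (gbar G e)"

definition serre_graph :: "sgraph \<Rightarrow> bool" where
  "serre_graph G \<longleftrightarrow> finite (gV G) \<and> finite (gE G) \<and> gV G \<noteq> {} \<and> gEp G \<subseteq> gE G \<and>
     (\<forall>e\<in>gE G. gorg G e \<in> gV G \<and> gbar G e \<in> gE G \<and> gbar G e \<noteq> e \<and>
        gbar G (gbar G e) = e \<and> (e \<in> gEp G \<longleftrightarrow> gbar G e \<notin> gEp G))"

fun walk :: "sgraph \<Rightarrow> nat set \<Rightarrow> nat list \<Rightarrow> nat \<Rightarrow> nat \<Rightarrow> bool" where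
  "walk G F [] a b \<longleftrightarrow> a = b \<and> a \<in> gV G"
| "walk G F (e # p) a b \<longleftrightarrow> e \<in> F \<and> gorg G e = a \<and> walk G F p (tm G e) b"

definition connected_graph :: "sgraph \<Rightarrow> bool" where
  "connected_graph G \<longleftrightarrow> (\<forall>a\<in>gV G. \<forall>b\<in>gV G. \<exists>p. walk G (gE G) p a b)"

text \<open>Graphs allowed in Outer space: finite connected, no vertices of valence 1 or 2
  (and, being connected with a marking, no isolated vertex either).\<close>
definition outer_graph :: "sgraph \<Rightarrow> bool" where
  "outer_graph G \<longleftrightarrow> serre_graph G \<and> connected_graph G \<and>
     (\<forall>v\<in>gV G. card {e\<in>gE G. gorg G e = v} \<ge> 3)"

fun red :: "sgraph \<Rightarrow> nat list \<Rightarrow> nat list" where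
  "red G [] = []"
| "red G (e # p) = (case red G p of [] \<Rightarrow> [e] | f # q \<Rightarrow> (if f = gbar G e then q else e # f # q))"

definition rev_path :: "sgraph \<Rightarrow> nat list \<Rightarrow> nat list" where
  "rev_path G p = rev (map (gbar G) p)"

definition reduced :: "sgraph \<Rightarrow> nat list \<Rightarrow> bool" where
  "reduced G p \<longleftrightarrow> (\<forall>i. Suc i < length p \<longrightarrow> p ! Suc i \<noteq> gbar G (p ! i))"

text \<open>Words in the free group on r generators: letters (i, True) = x_i, (i, False) = x_i^-1.\<close>
definition letter_img :: "sgraph \<Rightarrow> nat list list \<Rightarrow> nat \<times> bool \<Rightarrow> nat list" where
  "letter_img G ws x = (if snd x then ws ! fst x else rev_path G (ws ! fst x))"

definition eval_word :: "sgraph \<Rightarrow> nat list list \<Rightarrow> (nat \<times> bool) list \<Rightarrow> nat list" where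
  "eval_word G ws u = red G (concat (map (letter_img G ws) u))"

definition freely_reduced :: "(nat \<times> bool) list \<Rightarrow> bool" where
  "freely_reduced u \<longleftrightarrow> (\<forall>i. Suc i < length u \<longrightarrow>
      \<not> (fst (u ! Suc i) = fst (u ! i) \<and> snd (u ! Suc i) \<noteq> snd (u ! i)))"

text \<open>A marking \<rho> : R_r \<rightarrow> G, taken cellular: the vertex of the rose goes to v and the
  i-th petal to the reduced closed edge path ws!i at v.  It is a homotopy equivalence iff
  the induced map F_r \<rightarrow> \<pi>_1(G,v) is bijective.\<close>
definition valid_marking :: "nat \<Rightarrow> sgraph \<Rightarrow> nat \<times> nat list list \<Rightarrow> bool" where
  "valid_marking r G M \<longleftrightarrow> (case M of (v, ws) \<Rightarrow>
     v \<in> gV G \<and> length ws = r \<and>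
     (\<forall>i<r. walk G (gE G) (ws ! i) v v \<and> reduced G (ws ! i)) \<and>
     (\<forall>c. walk G (gE G) c v v \<and> reduced G c \<longrightarrow>
         (\<exists>u. set (map fst u) \<subseteq> {..<r} \<and> eval_word G ws u = c)) \<and>
     (\<forall>u. set (map fst u) \<subseteq> {..<r} \<and> freely_reduced u \<and> eval_word G ws u = [] \<longrightarrow> u = []))"

text \<open>Free homotopy of (cellular) maps R_r \<rightarrow> G: change of base point along an edge path p.\<close>
definition marking_equiv :: "sgraph \<Rightarrow> nat \<times> nat list list \<Rightarrow> nat \<times> nat list list \<Rightarrow> bool" where
  "marking_equiv G M M' \<longleftrightarrow> (case M of (v, ws) \<Rightarrow> case M' of (v', ws') \<Rightarrow>
     length ws = length ws' \<and>
     (\<exists>p. walk G (gE G) p v v' \<and> (\<forall>i<length ws. ws' ! i = red G (rev_path G p @ ws ! i @ p))))"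

definition len :: "sgraph \<Rightarrow> (nat \<Rightarrow> real) \<Rightarrow> nat \<Rightarrow> real" where
  "len G l e = (if e \<in> gEp G then l e else l (gbar G e))"

definition lengths :: "sgraph \<Rightarrow> (nat \<Rightarrow> real) set" where
  "lengths G = {l. (\<forall>e\<in>gEp G. l e > 0) \<and> (\<forall>e. e \<notin> gEp G \<longrightarrow> l e = 0)}"

definition based_circuit :: "sgraph \<Rightarrow> nat list \<Rightarrow> bool" where
  "based_circuit G p \<longleftrightarrow> p \<noteq> [] \<and> walk G (gE G) p (gorg G (hd p)) (gorg G (hd p)) \<and>
     reduced G p \<and> last p \<noteq> gbar G (hd p)"

definition circuit_count :: "sgraph \<Rightarrow> (nat \<Rightarrow> real) \<Rightarrow> real \<Rightarrow> nat" where
  "circuit_count G l t = card {p. based_circuit G p \<and> sum_list (map (len G l) p) \<le> t}"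

definition entropy :: "sgraph \<Rightarrow> (nat \<Rightarrow> real) \<Rightarrow> real" where
  "entropy G l = Lim at_top (\<lambda>t. ln (real (circuit_count G l t)) / t)"

definition partial_der :: "((nat \<Rightarrow> real) \<Rightarrow> real) \<Rightarrow> nat \<Rightarrow> (nat \<Rightarrow> real) \<Rightarrow> real" where
  "partial_der F e l = deriv (\<lambda>s. F (l(e := l e + s))) 0"

definition hess_form :: "sgraph \<Rightarrow> (nat \<Rightarrow> real) \<Rightarrow> (nat \<Rightarrow> real) \<Rightarrow> real" where
  "hess_form G l v = (\<Sum>e\<in>gEp G. \<Sum>f\<in>gEp G.
      v e * v f * partial_der (\<lambda>m. partial_der (entropy G) f m) e l)"

type_synonym mmg = "sgraph \<times> (nat \<times> nat list list) \<times> (nat \<Rightarrow> real)"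

definition valid_mmg :: "nat \<Rightarrow> mmg \<Rightarrow> bool" where
  "valid_mmg r t \<longleftrightarrow> (case t of (G, M, l) \<Rightarrow>
     outer_graph G \<and> valid_marking r G M \<and> l \<in> lengths G)"

definition graph_iso :: "sgraph \<Rightarrow> sgraph \<Rightarrow> (nat \<Rightarrow> nat) \<Rightarrow> (nat \<Rightarrow> nat) \<Rightarrow> bool" where
  "graph_iso G G' fV fE \<longleftrightarrow> bij_betw fV (gV G) (gV G') \<and> bij_betw fE (gE G) (gE G') \<and>
     (\<forall>e\<in>gE G. gorg G' (fE e) = fV (gorg G e) \<and> fE (gbar G e) = gbar G' (fE e))"

definition mmg_equiv :: "mmg \<Rightarrow> mmg \<Rightarrow> bool" where
  "mmg_equiv t t' \<longleftrightarrow> (case t of (G, M, l) \<Rightarrow> case t' of (G', M', l') \<Rightarrow>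
     (\<exists>fV fE. graph_iso G G' fV fE \<and> (\<forall>e\<in>gE G. len G' l' (fE e) = len G l e) \<and>
        marking_equiv G' (fV (fst M), map (map fE) (snd M)) M'))"

definition cls :: "nat \<Rightarrow> mmg \<Rightarrow> mmg set" where
  "cls r t = {t'. valid_mmg r t' \<and> mmg_equiv t t'}"

definition outer_space :: "nat \<Rightarrow> mmg set set" where
  "outer_space r = cls r ` {t. valid_mmg r t}"

definition outer_space1 :: "nat \<Rightarrow> mmg set set" where
  "outer_space1 r = cls r ` {(G, M, l). valid_mmg r (G, M, l) \<and> entropy G l = 1}"

definition collapse :: "sgraph \<Rightarrow> sgraph \<Rightarrow> (nat \<Rightarrow> nat) \<Rightarrow> (nat \<Rightarrow> nat option) \<Rightarrow> bool" where
  "collapse G G0 cV cE \<longleftrightarrow> cV ` gV G = gV G0 \<and>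
     (\<forall>e\<in>gE G. case cE e of
         Some f \<Rightarrow> f \<in> gE G0 \<and> gorg G0 f = cV (gorg G e) \<and> cE (gbar G e) = Some (gbar G0 f)
       | None \<Rightarrow> cV (gorg G e) = cV (tm G e) \<and> cE (gbar G e) = None) \<and>
     (\<forall>f\<in>gE G0. \<exists>!e. e \<in> gE G \<and> cE e = Some f) \<and>
     (\<forall>w\<in>gV G0.
        (\<forall>a\<in>{v\<in>gV G. cV v = w}. \<forall>b\<in>{v\<in>gV G. cV v = w}.
            \<exists>p. walk G {e\<in>gE G. cE e = None \<and> cV (gorg G e) = w} p a b) \<and>
        card {e\<in>gE G. cE e = None \<and> cV (gorg G e) = w} = 2 * (card {v\<in>gV G. cV v = w} - 1))"

definition collapse_path :: "(nat \<Rightarrow> nat option) \<Rightarrow> nat list \<Rightarrow> nat list" where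
  "collapse_path cE p = concat (map (\<lambda>e. case cE e of None \<Rightarrow> [] | Some f \<Rightarrow> [f]) p)"

definition comp_marking :: "sgraph \<Rightarrow> (nat \<Rightarrow> nat) \<Rightarrow> (nat \<Rightarrow> nat option) \<Rightarrow>
    nat \<times> nat list list \<Rightarrow> nat \<times> nat list list" where
  "comp_marking G0 cV cE M = (cV (fst M), map (\<lambda>w. red G0 (collapse_path cE w)) (snd M))"

definition pullback :: "sgraph \<Rightarrow> (nat \<Rightarrow> nat option) \<Rightarrow> sgraph \<Rightarrow> (nat \<Rightarrow> real) \<Rightarrow> nat \<Rightarrow> real" where
  "pullback G cE G0 l0 = (\<lambda>e. if e \<in> gEp G then (case cE e of Some f \<Rightarrow> len G0 l0 f | None \<Rightarrow> 0) else 0)"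

text \<open>cell_rel r G M lam x: the point x of the closed cell of (G,M) has coordinates lam \<in> R_{\<ge>0}^{E_+}.\<close>
definition cell_rel :: "nat \<Rightarrow> sgraph \<Rightarrow> nat \<times> nat list list \<Rightarrow> (nat \<Rightarrow> real) \<Rightarrow> mmg set \<Rightarrow> bool" where
  "cell_rel r G M lam x \<longleftrightarrow> (\<exists>G0 M0 l0 cV cE. valid_mmg r (G0, M0, l0) \<and> collapse G G0 cV cE \<and>
     marking_equiv G0 M0 (comp_marking G0 cV cE M) \<and> lam = pullback G cE G0 l0 \<and> x = cls r (G0, M0, l0))"

definition weak_open :: "nat \<Rightarrow> mmg set set \<Rightarrow> bool" where
  "weak_open r U \<longleftrightarrow> U \<subseteq> outer_space r \<and>
     (\<forall>G M. outer_graph G \<and> valid_marking r G M \<longrightarrow>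
        openin (top_of_set {lam. \<exists>x. cell_rel r G M lam x}) {lam. \<exists>x\<in>U. cell_rel r G M lam x})"

definition smooth_on :: "real set \<Rightarrow> (real \<Rightarrow> real) \<Rightarrow> bool" where
  "smooth_on S f \<longleftrightarrow> (\<forall>n. \<forall>x\<in>S. ((deriv ^^ n) f) differentiable (at x))"

definition weak_cont :: "nat \<Rightarrow> (real \<Rightarrow> mmg set) \<Rightarrow> bool" where
  "weak_cont r \<gamma> \<longleftrightarrow> (\<forall>V. weak_open r V \<longrightarrow> openin (top_of_set {0..1}) {t\<in>{0..1}. \<gamma> t \<in> V})"

definition smooth_piece :: "nat \<Rightarrow> real \<Rightarrow> real \<Rightarrow> (real \<Rightarrow> mmg set) \<Rightarrow> real \<Rightarrow> bool" where
  "smooth_piece r a b \<gamma> I \<longleftrightarrow> (\<exists>G M L. outer_graph G \<and> valid_marking r G M \<and>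
     (\<forall>t\<in>{a<..<b}. L t \<in> lengths G \<and> entropy G (L t) = 1 \<and> \<gamma> t = cls r (G, M, L t)) \<and>
     (\<forall>e\<in>gEp G. smooth_on {a<..<b} (\<lambda>t. L t e)) \<and>
     ((\<lambda>t. sqrt (hess_form G (L t) (\<lambda>e. deriv (\<lambda>s. L s e) t))) has_integral I) {a..b})"

definition path_lengths :: "nat \<Rightarrow> mmg set \<Rightarrow> mmg set \<Rightarrow> real set" where
  "path_lengths r x y = {s. \<exists>\<gamma> ts I. \<gamma> 0 = x \<and> \<gamma> 1 = y \<and>
     (\<forall>t\<in>{0..1}. \<gamma> t \<in> outer_space1 r) \<and> weak_cont r \<gamma> \<and>
     length ts \<ge> 2 \<and> hd ts = 0 \<and> last ts = 1 \<and> sorted_wrt (<) ts \<and>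
     (\<forall>k. Suc k < length ts \<longrightarrow> smooth_piece r (ts ! k) (ts ! Suc k) \<gamma> (I k)) \<and>
     s = (\<Sum>k<length ts - 1. I k)}"

definition d_h :: "nat \<Rightarrow> mmg set \<Rightarrow> mmg set \<Rightarrow> ereal" where
  "d_h r x y = Inf (ereal ` path_lengths r x y)"

end

theory Submission
  imports Defs "HOL-Real_Asymp.Real_Asymp"
begin

text \<open>
  Cutting a nonbacktracking circuit at its visits to a fixed oriented edge shows that the entropy is the
  unique zero of the pressure of the first-return loops: \<open>h(l) = 1\<close> iff the sum of \<open>exp (- l(p))\<close> over these
  loops \<open>p\<close> is 1. Differentiating this identity gives, for \<open>v\<close> tangent to the unit entropy hypersurface,
  \<open>\<langle>v, Hess h(l) v\<rangle>\<close> as the sum of \<open>v(p)^2 exp (- l(p))\<close> divided by the sum of \<open>l(p) exp (- l(p))\<close>.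
  The numerator stays bounded along normalized segments into a face of a closed cell, so that weakly close
  points are metrically close; conversely it dominates the squares of the coordinates of \<open>v\<close>, uniformly on
  the finitely many cells around a point, so that short paths cannot leave a weak neighbourhood. Finiteness
  amounts to connecting every marked graph to the rose by collapses and expansions; these are found by
  labelling the edges with words of the free group and shortening the labels by folds.
\<close>

section \<open>Reduction of edge paths\<close>

text \<open>Two obstacles shape the proof. The topologies must be compared at points where edge
  lengths tend to zero, whereas entropy and its Hessian belong to open cells. Cutting at an edge
  that survives the collapse settles this: a collapse is bijective on the first-return loops at such
  an edge (\<open>cp_bij\<close>), so the series of a face is the series of the large graph at a
  degenerate length vector, and \<open>cone\<close> admits zero coordinates everywhere except at the
  base edge. The second obstacle is uniformity, since an unknown short path may cross many cells.
  The constant of the lower bound, \<open>lower_const\<close>, depends only on a bound for the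
  number of oriented edges and a bound for the lengths. Both are under control in the star of a
  point, because Euler characteristic and valence at least 3 bound the size of all graphs that
  collapse to a given one (\<open>coll_card_bound\<close>). Convergence with an exponential margin,
  which permits differentiation, comes from an elementary contraction of tail sums
  (\<open>T_add\<close>); the same estimate bounds the mean number of edges of a loop.\<close>

definition cons_red :: "sgraph => nat => nat list => nat list" where
 "cons_red G e q = (case q of [] => [e] | f#q' => (if f = gbar G e then q' else e#f#q'))"

lemma red_Cons: "red G (e#p) = cons_red G e (red G p)"
 by (simp add: cons_red_def)

declare red.simps(2)[simp del]

lemma reduced_iff: "reduced G p \<longleftrightarrow> successively (%e f. f ~= gbar G e) p"
 by (auto simp: reduced_def successively_conv_nth)

lemma reduced_Nil [simp]: "reduced G []" by (simp add: reduced_def)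
lemma reduced_single [simp]: "reduced G [e]" by (simp add: reduced_def)

lemma reduced_Cons: "reduced G (e#p) \<longleftrightarrow> (p = [] | hd p ~= gbar G e) & reduced G p"
 by (auto simp: reduced_iff successively_Cons)

lemma reduced_append:
 "reduced G (p@q) \<longleftrightarrow> reduced G p & reduced G q & (p = [] | q = [] | hd q ~= gbar G (last p))"
 by (auto simp: reduced_iff successively_append_iff)

lemma cons_red_reduced: "reduced G q ==> reduced G (cons_red G e q)"
 by (cases q) (auto simp: cons_red_def reduced_Cons)

lemma red_reduced [simp]: "reduced G (red G p)"
 by (induction p) (auto simp: red_Cons cons_red_reduced)

lemma red_id: "reduced G p ==> red G p = p"
 by (induction p) (auto simp: red_Cons reduced_Cons cons_red_def split: list.splits)

lemma red_red [simp]: "red G (red G p) = red G p"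
 by (simp add: red_id)

lemma set_red: "set (red G p) <= set p"
proof (induction p)
 case (Cons e p)
 then show ?case by (cases "red G p") (auto simp: red_Cons cons_red_def)
qed simp

lemma length_red: "length (red G p) <= length p"
proof (induction p)
 case (Cons e p)
 then show ?case by (cases "red G p") (auto simp: red_Cons cons_red_def)
qed simp

lemma serreD:
 assumes "serre_graph G" "e:gE G"
 shows "gorg G e:gV G" "gbar G e:gE G" "gbar G e ~= e" "gbar G (gbar G e) = e"
  "tm G e:gV G" "tm G (gbar G e) = gorg G e"
  "gorg G (gbar G e) = tm G e"
proof -
 have *: "gorg G e:gV G" "gbar G e:gE G" "gbar G e ~= e" "gbar G (gbar G e) = e"
  using assms unfolding serre_graph_def by blast+
 have "gorg G (gbar G e):gV G" using assms(1) *(2) unfolding serre_graph_def by blast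
 then show "gorg G e:gV G" "gbar G e:gE G" "gbar G e ~= e" "gbar G (gbar G e) = e"
  "tm G e:gV G" "tm G (gbar G e) = gorg G e" "gorg G (gbar G e) = tm G e"
  using * by (simp_all add: tm_def)
qed

lemma serre_Ep: "serre_graph G ==> e:gE G ==> gbar G e:gEp G \<longleftrightarrow> e ~: gEp G"
 unfolding serre_graph_def by blast

lemma serre_fin:
 assumes "serre_graph G"
 shows "finite (gV G)" "finite (gE G)" "gEp G <= gE G" "gV G ~= {}" "finite (gEp G)"
 using assms unfolding serre_graph_def by (blast intro: finite_subset)+

lemma gbar_eq_iff:
 assumes "serre_graph G" "e:gE G" "f:gE G"
 shows "gbar G e = gbar G f \<longleftrightarrow> e = f" "gbar G e = f \<longleftrightarrow> e = gbar G f"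
 using serreD(4)[OF assms(1,2)] serreD(4)[OF assms(1,3)] by metis+

text \<open>This is van der Waerden's argument for normal forms in free groups: each edge acts on
  reduced paths by \<open>cons_red\<close>, and opposite edges act by inverse maps. Independence of
  the order of cancellations (\<open>red_append_left\<close>) follows from it without a confluence
  argument.\<close>

lemma cons_red_cancel:
 assumes "serre_graph G" "e:gE G" "reduced G q"
 shows "cons_red G e (cons_red G (gbar G e) q) = q"
proof (cases q)
 case Nil
 then show ?thesis by (simp add: cons_red_def)
next
 case (Cons f q')
 show ?thesis
 proof (cases "f = e")
  case True
  then show ?thesis using assms Cons
   by (cases q') (auto simp: cons_red_def serreD reduced_Cons)
 next
  case False
  then show ?thesis using assms Cons by (auto simp: cons_red_def serreD)
 qed
qed

lemma red_append_right: "red G (p@red G q) = red G (p@q)"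
 by (induction p) (auto simp: red_Cons)

lemma red_append_left:
 assumes "serre_graph G" "set p <= gE G"
 shows "red G (red G p@q) = red G (p@q)"
 using assms(2)
proof (induction p)
 case (Cons e p)
 have IH: "red G (red G p@q) = red G (p@q)" using Cons by auto
 show ?case
 proof (cases "red G p")
  case Nil
  then show ?thesis using IH by (simp add: red_Cons cons_red_def)
 next
  case (Cons f s)
  show ?thesis
  proof (cases "f = gbar G e")
   case True
   have "red G (e#p@q) = cons_red G e (red G (red G p@q))" by (simp add: red_Cons IH)
   also have "... = red G (s@q)"
    using True Cons cons_red_cancel[OF assms(1), of e "red G (s@q)"] \<open>set (e # p) <= gE G\<close>
    by (simp add: red_Cons)
   finally show ?thesis using True Cons by (simp add: red_Cons cons_red_def)
  next
   case False
   then show ?thesis using Cons IH by (auto simp: red_Cons cons_red_def)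
  qed
 qed
qed simp

lemma red_append_cong:
 assumes "serre_graph G" "set p <= gE G" "set p' <= gE G" "red G p = red G p'" "red G q = red G q'"
 shows "red G (p@q) = red G (p'@q')"
 by (metis assms red_append_left red_append_right)

lemma rev_path_simps [simp]:
 "rev_path G [] = []" "rev_path G (e#p) = rev_path G p@[gbar G e]"
 "rev_path G (p@q) = rev_path G q@rev_path G p"
 "length (rev_path G p) = length p" "rev_path G p = [] \<longleftrightarrow> p = []"
 by (auto simp: rev_path_def)

lemma set_rev_path: "serre_graph G ==> set p <= gE G ==> set (rev_path G p) <= gE G"
 by (auto simp: rev_path_def serreD)

lemma rev_path_rev_path: "serre_graph G ==> set p <= gE G ==> rev_path G (rev_path G p) = p"
 by (induction p) (auto simp: serreD)

lemma red_rev_path_left: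
 assumes "serre_graph G" "set p <= gE G"
 shows "red G (rev_path G p@p@q) = red G q"
 using assms(2)
proof (induction p arbitrary: q)
 case (Cons e p)
 have "red G (gbar G e#e#p@q) = red G (p@q)"
  using Cons cons_red_cancel[OF assms(1), of "gbar G e" "red G (p@q)"] assms(1)
  by (simp add: red_Cons serreD)
 then have "red G (rev_path G p@gbar G e#e#p@q) = red G (rev_path G p@p@q)"
  by (metis red_append_right)
 then show ?case using Cons by simp
qed simp

lemma red_rev_path_right:
 assumes "serre_graph G" "set p <= gE G"
 shows "red G (p@rev_path G p@q) = red G q"
 using red_rev_path_left[OF assms(1) set_rev_path[OF assms], of q] by (simp add: rev_path_rev_path assms)

lemma red_rev_path_Nil:
 assumes "serre_graph G" "set p <= gE G"
 shows "red G (p@rev_path G p) = []" "red G (rev_path G p@p) = []"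
 using red_rev_path_left[OF assms, of "[]"] red_rev_path_right[OF assms, of "[]"] by auto

lemma reduced_rev_path:
 assumes "serre_graph G" "set p <= gE G" "reduced G p"
 shows "reduced G (rev_path G p)"
 using assms(2,3)
proof (induction p)
 case (Cons e p)
 have "p ~= [] ==> last (rev_path G p) = gbar G (hd p)" by (cases p) auto
 then show ?case using Cons assms(1) by (auto simp: reduced_append reduced_Cons serreD hd_in_set subset_iff)
qed simp

lemma red_rev_path:
 assumes "serre_graph G" "set p <= gE G"
 shows "red G (rev_path G p) = rev_path G (red G p)"
proof -
 let ?r = "red G p"
 have sr: "set ?r <= gE G" using set_red assms(2) by blast
 have "red G (rev_path G p) = red G (rev_path G p@p@rev_path G ?r)"
  using red_rev_path_Nil(1)[OF assms(1) sr] red_append_left[OF assms, of "rev_path G ?r"]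
  by (metis append_Nil2 red_append_right red.simps(1))
 also have "... = red G (rev_path G ?r)" using red_rev_path_left[OF assms] by simp
 also have "... = rev_path G ?r" using reduced_rev_path[OF assms(1) sr] by (simp add: red_id)
 finally show ?thesis .
qed

lemma red_eq_iff:
 assumes "serre_graph G" "set p <= gE G" "set q <= gE G"
 shows "red G p = red G q \<longleftrightarrow> red G (p@rev_path G q) = []"
proof
 assume "red G p = red G q"
 then show "red G (p@rev_path G q) = []"
  using red_append_cong[OF assms, of "rev_path G q"] red_rev_path_Nil assms by metis
next
 assume *: "red G (p@rev_path G q) = []"
 have "red G p = red G (p@rev_path G q@q)"
  using red_rev_path_left[OF assms(1,3), of "[]"] by (metis append_Nil2 red_append_right red.simps(1))
 also have "... = red G (red G (p@rev_path G q)@q)"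
  using red_append_left[OF assms(1), of "p@rev_path G q" q] set_rev_path[OF assms(1,3)] assms by auto
 finally show "red G p = red G q" using * by simp
qed

lemma walk_append:
 "walk G F (p@q) a c \<longleftrightarrow> (EX b. walk G F p a b & walk G F q b c)" if "serre_graph G" "F <= gE G"
proof (induction p arbitrary: a)
 case Nil
 have "walk G F q a c ==> a:gV G" for a using that
  by (cases q) (auto simp: serreD)
 then show ?case by auto
qed auto

lemma walk_ends:
 assumes "serre_graph G" "F <= gE G" "walk G F p a b"
 shows "a:gV G" "b:gV G" "set p <= F"
proof -
 show "b:gV G" "set p <= F" using assms(3) by (induction p arbitrary: a) auto
 show "a:gV G" using assms by (cases p) (auto simp: serreD)
qed

lemma walk_E: "serre_graph G ==> walk G (gE G) p a b ==> set p <= gE G"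
 by (rule walk_ends(3)[OF _ order_refl])

lemma walk_mono: "F <= F' ==> walk G F p a b ==> walk G F' p a b"
 by (induction p arbitrary: a) auto

lemma walk_restrict: "walk G F p a b ==> set p <= F' ==> walk G F' p a b"
 by (induction p arbitrary: a) auto


lemma walk_hd_last:
 assumes "walk G F p a b" "p ~= []"
 shows "gorg G (hd p) = a" "tm G (last p) = b"
proof -
 show "gorg G (hd p) = a" using assms by (cases p) auto
 show "tm G (last p) = b" using assms by (induction p arbitrary: a) (auto split: if_splits)
qed

lemma walk_rev:
 assumes "serre_graph G" "F <= gE G" "!!e. e:F ==> gbar G e:F" "walk G F p a b"
 shows "walk G F (rev_path G p) b a"
 using assms(4)
proof (induction p arbitrary: a)
 case (Cons e p)
 then have "walk G F (rev_path G p) b (tm G e)" "e:F" "gorg G e = a" by auto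
 moreover have "walk G F [gbar G e] (tm G e) a"
  using assms \<open>e : F\<close> \<open>gorg G e = a\<close> by (auto simp: serreD subset_iff)
 ultimately show ?case using walk_append[OF assms(1,2)] by auto
qed auto

lemma walk_rev_E:
 "serre_graph G ==> walk G (gE G) p a b ==> walk G (gE G) (rev_path G p) b a"
 by (rule walk_rev) (auto simp: serreD)

lemma walk_red:
 assumes "serre_graph G" "F <= gE G" "walk G F p a b"
 shows "walk G F (red G p) a b"
 using assms(3)
proof (induction p arbitrary: a)
 case (Cons e p)
 then have *: "walk G F (red G p) (tm G e) b" and e: "e:F" "gorg G e = a" by auto
 show ?case
 proof (cases "red G p")
  case Nil
  then show ?thesis using * e by (auto simp: red_Cons cons_red_def)
 next
  case (Cons f q)
  then show ?thesis using * e assms(1,2) by (auto simp: red_Cons cons_red_def serreD subset_iff)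
 qed
qed auto

subsection \<open>Substitutions of paths for edges\<close>

definition subst :: "(nat => nat list) => nat list => nat list" where
 "subst \<phi> p = concat (map \<phi> p)"

lemma subst_simps [simp]:
 "subst \<phi> [] = []" "subst \<phi> (e#p) = \<phi> e@subst \<phi> p" "subst \<phi> (p@q) = subst \<phi> p@subst \<phi> q"
 by (auto simp: subst_def)

text \<open>Compatibility with reversal is asked only up to reduction. One notion then covers
  collapses (\<open>cmap\<close>), markings (\<open>petal\<close>) and word labels
  (\<open>labelling\<close>), and \<open>red_subst_red\<close> handles all of them.\<close>

definition hom_map :: "sgraph => sgraph => (nat => nat list) => bool" where
 "hom_map G H \<phi> \<longleftrightarrow> (ALL e:gE G. set (\<phi> e) <= gE H & red H (\<phi> (gbar G e)) = red H (rev_path H (\<phi> e)))"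

lemma set_subst: "hom_map G H \<phi> ==> set p <= gE G ==> set (subst \<phi> p) <= gE H"
 by (induction p) (auto simp: hom_map_def)

lemma red_subst_cancel:
 assumes "serre_graph G" "serre_graph H" "hom_map G H \<phi>" "e:gE G"
 shows "red H (\<phi> e@\<phi> (gbar G e)@q) = red H q"
proof -
 have s: "set (\<phi> e) <= gE H" "set (\<phi> (gbar G e)) <= gE H"
  using assms by (auto simp: hom_map_def serreD)
 have "red H (\<phi> (gbar G e)@q) = red H (rev_path H (\<phi> e)@q)"
  using assms s by (intro red_append_cong) (auto simp: hom_map_def set_rev_path)
 then show ?thesis using red_rev_path_right[OF assms(2) s(1), of q] by (metis red_append_right)
qed

lemma red_subst_red:
 assumes "serre_graph G" "serre_graph H" "hom_map G H \<phi>" "set p <= gE G"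
 shows "red H (subst \<phi> (red G p)) = red H (subst \<phi> p)"
 using assms(4)
proof (induction p)
 case (Cons e p)
 then have IH: "red H (subst \<phi> (red G p)) = red H (subst \<phi> p)" by auto
 then have IH2: "red H (\<phi> e@subst \<phi> (red G p)) = red H (\<phi> e@subst \<phi> p)"
  by (metis red_append_right)
 show ?case
 proof (cases "red G p")
  case Nil
  then show ?thesis using IH2 by (simp add: red_Cons cons_red_def)
 next
  case (Cons f s)
  have "e:gE G" using \<open>set (e # p) <= gE G\<close> by auto
  then show ?thesis
   using Cons IH2 red_subst_cancel[OF assms(1-3), of e "subst \<phi> s"]
   by (auto simp: red_Cons cons_red_def)
 qed
qed simp

lemma red_subst_cong:
 assumes "serre_graph G" "serre_graph H" "hom_map G H \<phi>" "set p <= gE G" "set q <= gE G"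
  "red G p = red G q"
 shows "red H (subst \<phi> p) = red H (subst \<phi> q)"
 by (metis assms red_subst_red)

lemma red_subst_rev_path:
 assumes "serre_graph G" "serre_graph H" "hom_map G H \<phi>" "set p <= gE G"
 shows "red H (subst \<phi> (rev_path G p)) = red H (rev_path H (subst \<phi> p))"
 using assms(4)
proof (induction p)
 case (Cons e p)
 have s: "set (subst \<phi> (rev_path G p)) <= gE H" "set (rev_path H (subst \<phi> p)) <= gE H"
  using Cons.prems set_subst[OF assms(3)] set_rev_path[OF assms(1)] set_rev_path[OF assms(2)] by auto
 have "red H (\<phi> (gbar G e)) = red H (rev_path H (\<phi> e))"
  using assms(3) Cons.prems by (auto simp: hom_map_def)
 then show ?case using Cons red_append_cong[OF assms(2) s] by simp
qed simp

lemma red_subst_letterwise: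
 assumes "serre_graph H" "!!e. e:set p ==> set (\<phi> e) <= gE H & set (\<psi> e) <= gE H & red H (\<phi> e) = red H (\<psi> e)"
 shows "red H (subst \<phi> p) = red H (subst \<psi> p)"
 using assms(2)
proof (induction p)
 case (Cons e p)
 then show ?case using red_append_cong[OF assms(1), of "\<phi> e" "\<psi> e"] by simp
qed simp

section \<open>First-return loops in a strongly connected digraph\<close>

lemma successively_join: "successively R (p@[y]) ==> successively R (y#w) ==> successively R (p@y#w)"
 by (simp add: successively_append_iff)

locale strong_digraph =
 fixes E :: "nat set" and R :: "nat => nat => bool" and e0 :: nat
 assumes finE: "finite E" and e0E: "e0:E" and RE: "R e f ==> e:E & f:E"
  and strong: "e:E ==> f:E ==> EX p. p ~= [] & successively R (e#p) & last p = f"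
begin

text \<open>A path is stored without its start \<open>e\<close> but with its end \<open>e0\<close>.
  The first-return loops at \<open>e0\<close> are thus the elements of \<open>hit e0\<close>, and
  they are concatenated by plain append.\<close>

definition hit :: "nat => nat list set" where
 "hit e = {p. p ~= [] & successively R (e#p) & last p = e0 & e0 ~: set (butlast p)}"

definition wt :: "(nat => real) => nat list => real" where
 "wt L p = exp (- sum_list (map L p))"

definition hitsum :: "(nat => real) => nat => nat => real" where
 "hitsum L n e = (\<Sum>p\<in>{p:hit e. length p = n}. wt L p)"

lemma wt_pos: "wt L p > 0" by (simp add: wt_def)

lemma wt_append: "wt L (p@q) = wt L p * wt L q"
 by (simp add: wt_def exp_add[symmetric])

lemma path_set: "successively R (e#p) ==> set p <= E"
 by (induction p arbitrary: e) (auto simp: RE)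

lemma hit_set: "p:hit e ==> set p <= E"
 by (auto simp: hit_def dest: path_set)

lemma finite_slice: "finite {p:hit e. length p = n}"
 by (rule finite_subset[OF _ finite_lists_length_eq[OF finE, of n]]) (use hit_set in auto)

lemma hit_Cons: "f#p:hit e \<longleftrightarrow> R e f & (if p = [] then f = e0 else f ~= e0 & p:hit f)"
 by (auto simp: hit_def)

lemma hitsum_nonneg: "hitsum L n e >= 0"
 unfolding hitsum_def by (intro sum_nonneg) (simp add: wt_pos less_imp_le)

lemma hitsum_0: "hitsum L 0 e = 0"
proof -
 have "{p:hit e. length p = 0} = {}" by (auto simp: hit_def)
 then show ?thesis unfolding hitsum_def by (simp only: sum.empty)
qed

lemma finite_succ: "finite {f. R e f & f ~= e0}"
 by (rule finite_subset[OF _ finE]) (auto simp: RE)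

lemma hitsum_Suc:
 assumes "n > 0"
 shows "hitsum L (Suc n) e = (\<Sum>f\<in>{f. R e f & f ~= e0}. exp (- L f) * hitsum L n f)"
proof -
 let ?S = "SIGMA f:{f. R e f & f ~= e0}. {p:hit f. length p = n}"
 have im: "{p:hit e. length p = Suc n} = (%(f,p). f#p) ` ?S"
 proof (intro set_eqI iffI)
  fix p assume "p:{p:hit e. length p = Suc n}"
  then obtain f q where "p = f#q" "length q = n" "f#q:hit e" by (cases p) auto
  moreover have "q ~= []" using assms \<open>length q = n\<close> by auto
  ultimately show "p:(%(f,p). f#p) ` ?S" by (auto simp: hit_Cons intro!: image_eqI[of _ _ "(f,q)"])
 qed (use assms in \<open>auto simp: hit_Cons\<close>)
 have "hitsum L (Suc n) e = (\<Sum>x\<in>?S. wt L (fst x#snd x))"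
  unfolding hitsum_def im by (subst sum.reindex) (auto simp: inj_on_def case_prod_beta)
 also have "... = (\<Sum>f\<in>{f. R e f & f ~= e0}. \<Sum>p\<in>{p:hit f. length p = n}. wt L (f#p))"
  by (subst sum.Sigma) (auto simp: finite_succ finite_slice case_prod_beta)
 also have "... = (\<Sum>f\<in>{f. R e f & f ~= e0}. exp (- L f) * hitsum L n f)"
  unfolding hitsum_def by (intro sum.cong) (auto simp: sum_distrib_left wt_def exp_diff exp_minus field_simps)
 finally show ?thesis .
qed

text \<open>A shortest path repeats no edge, hence has at most \<open>card E\<close> edges, and it
  cannot pass through either end on its way. The bound on its length is what makes later constants
  depend only on the number of edges.\<close>

lemma short_path:
 assumes "e:E" "f:E"
 shows "EX p. p ~= [] & successively R (e#p) & last p = f & length p <= card E &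
  f ~: set (butlast p) & e ~: set (butlast p)"
proof -
 define Q where "Q p \<longleftrightarrow> p ~= [] & successively R (e#p) & last p = f" for p
 obtain p0 where "Q p0" using strong[OF assms] Q_def by auto
 then obtain p where p: "Q p" and pmin: "!!q. Q q ==> length p <= length q"
  using ex_has_least_nat[of Q p0 length] by auto
 have "distinct p"
 proof (rule ccontr)
  assume "~ distinct p"
  then obtain x y z w where w: "p = x@[y]@z@[y]@w"
   using not_distinct_decomp by blast
  have "successively R ((e#x)@[y]@z@[y]@w)" using p unfolding Q_def w by simp
  then have "successively R ((e#x)@[y])" "successively R (y#w)"
   by (metis append.assoc successively_append_iff, metis append_Cons append_Nil append.assoc successively_append_iff)
  then have "successively R (e#x@[y]@w)" "last (x@[y]@w) = f"
   using successively_join p unfolding Q_def w by fastforce+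
  then have "Q (x@[y]@w)" unfolding Q_def by auto
  from pmin[OF this] show False unfolding w by auto
 qed
 moreover have "e ~: set (butlast p)"
 proof
  assume "e:set (butlast p)"
  then obtain x w where "butlast p = x@e#w" by (meson split_list)
  then have w: "p = x@e#(w@[last p])" using p unfolding Q_def
   by (metis append_butlast_last_id append.assoc append_Cons)
  have "successively R ((e#x)@(e#w@[last p]))" using p w unfolding Q_def by (metis append_Cons)
  then have "successively R (e#w@[last p])" using successively_append_iff by blast
  then have "Q (w@[last p])" using p unfolding Q_def by simp
  from pmin[OF this] show False using arg_cong[OF w, of length] by auto
 qed
 moreover have "length p <= card E" using \<open>distinct p\<close> p path_set[of e p] finE unfolding Q_def
  by (metis card_mono distinct_card)
 moreover have "f ~: set (butlast p)" using \<open>distinct p\<close> p unfolding Q_def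
  by (metis append_butlast_last_id distinct_butlast not_distinct_conv_prefix)
 ultimately show ?thesis using p Q_def by blast
qed

lemma wt_lower:
 assumes "set p <= E" "!!e. e:E ==> L e <= m" "0 <= m" "length p <= N"
 shows "wt L p >= exp (- (real N * m))"
proof -
 have "sum_list (map L p) <= real (length p) * m"
  using assms(1) by (induction p) (auto simp: algebra_simps intro: add_mono assms(2))
 also have "... <= real N * m" using assms by (intro mult_right_mono) auto
 finally show ?thesis by (simp add: wt_def)
qed

section \<open>Geometric decay of the first-return series, with explicit constants\<close>

context
 fixes L :: "nat => real" and N :: nat and m g :: real
 assumes summ: "summable (%n. hitsum L n e0)" and g: "(\<Sum>n. hitsum L n e0) = g"
  and N: "card E <= N" and Lm: "!!e. e:E ==> L e <= m" and m: "0 <= m"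
begin

text \<open>From any edge a path of at most \<open>N\<close> edges reaches \<open>e0\<close>, so
  mass at least \<open>exp (- (real N * m))\<close> has arrived within \<open>N\<close> steps, while
  the whole mass is at most \<open>g * exp (real N * m)\<close> by \<open>hitsum_from\<close>. The
  quotient of these two numbers is what is subtracted from 1.\<close>

private definition \<theta> where "\<theta> = 1-exp (- (2 * real N * m))/g"

text \<open>A short path \<open>q\<close> from \<open>e0\<close> to \<open>e\<close> that does not
  meet \<open>e0\<close> again turns each path of \<open>hit e\<close> into a first-return loop at
  \<open>e0\<close>. So the sum from \<open>e\<close>, times the weight of \<open>q\<close>, is a
  part of the total sum \<open>g\<close>.\<close>

lemma hitsum_from:
 assumes "e:E"
 shows "summable (%n. hitsum L n e)" "(\<Sum>n. hitsum L n e) <= g * exp (real N * m)"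
proof -
 have "0 <= g" unfolding g[symmetric] by (rule suminf_nonneg[OF summ]) (rule hitsum_nonneg)
 have "summable (%n. hitsum L n e) & (\<Sum>n. hitsum L n e) <= g * exp (real N * m)"
 proof (cases "e = e0")
  case True
  then show ?thesis using summ g \<open>0 <= g\<close> m mult_left_mono[of 1 "exp (real N * m)" g] by auto
 next
  case False
  obtain q where q: "q ~= []" "successively R (e0#q)" "last q = e" "length q <= card E" "e0 ~: set (butlast q)"
   using short_path[OF e0E assms] by blast
  have q0: "e0 ~: set q" using q False by (metis append_butlast_last_id set_ConsD rotate1.simps(2) set_rotate1)
  have wq: "wt L q >= exp (- (real N * m))"
   using wt_lower[OF path_set[OF q(2)] Lm m] q(4) N by auto
  have le: "wt L q * hitsum L n e <= hitsum L (n+length q) e0" for n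
  proof -
   have "wt L q * hitsum L n e = (\<Sum>p\<in>{p:hit e. length p = n}. wt L (q@p))"
    by (simp add: hitsum_def sum_distrib_left wt_append)
   also have "... = (\<Sum>p\<in>(@) q ` {p:hit e. length p = n}. wt L p)"
    by (subst sum.reindex) (auto simp: inj_on_def)
   also have "... <= hitsum L (n+length q) e0"
    unfolding hitsum_def
   proof (rule sum_mono2[OF finite_slice])
    show "(@) q ` {p:hit e. length p = n} <= {p:hit e0. length p = n+length q}"
     using q q0 by (auto simp: hit_def successively_append_iff butlast_append successively_Cons)
   qed (simp add: wt_pos less_imp_le)
   finally show ?thesis .
  qed
  have s2: "summable (%n. hitsum L (n+length q) e0)"
   using summ by (subst summable_iff_shift[where f = "%n. hitsum L n e0" and k = "length q"])
  have "summable (%n. wt L q * hitsum L n e)"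
   by (rule summable_comparison_test'[OF s2, of 0]) (use le in \<open>auto simp: abs_of_nonneg wt_pos less_imp_le hitsum_nonneg\<close>)
  then have s1: "summable (%n. hitsum L n e)" using wt_pos[of L q] by (subst (asm) summable_cmult_iff) auto
  have "wt L q*(\<Sum>n. hitsum L n e) = (\<Sum>n. wt L q * hitsum L n e)" using s1 by (simp add: suminf_mult)
  also have "... <= (\<Sum>n. hitsum L (n+length q) e0)"
   by (rule suminf_le[OF le]) (use s1 s2 in \<open>auto intro: summable_mult\<close>)
  also have "... <= g" unfolding g[symmetric] suminf_split_initial_segment[OF summ, of "length q"]
   by (simp add: sum_nonneg hitsum_nonneg)
  finally have "wt L q*(\<Sum>n. hitsum L n e) <= g" .
  moreover have "exp (- (real N * m))*(\<Sum>n. hitsum L n e) <= wt L q*(\<Sum>n. hitsum L n e)"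
   using wq by (intro mult_right_mono suminf_nonneg s1 hitsum_nonneg)
  ultimately have "exp (- (real N * m))*(\<Sum>n. hitsum L n e) <= g" by linarith
  then show ?thesis using s1 by (simp add: exp_minus field_simps)
 qed
 then show "summable (%n. hitsum L n e)" "(\<Sum>n. hitsum L n e) <= g * exp (real N * m)" by auto
qed

text \<open>The tail over lengths greater than \<open>n\<close>. As \<open>hitsum L 0 e\<close>
  vanishes, \<open>T 0\<close> is the full sum.\<close>

private definition T where "T n e = (\<Sum>i. hitsum L (i+Suc n) e)"

lemma T_nonneg: "e:E ==> T n e >= 0"
 unfolding T_def using hitsum_from(1)[of e]
 by (intro suminf_nonneg hitsum_nonneg) (subst summable_iff_shift[where f = "%n. hitsum L n e" and k = "Suc n"])

lemma T_Suc:
 assumes "e:E"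
 shows "T (Suc n) e = (\<Sum>f\<in>{f. R e f & f ~= e0}. exp (- L f) * T n f)"
proof -
 have s: "summable (%i. hitsum L (i+Suc n) f)" if "f:E" for f
  using hitsum_from(1)[OF that] by (subst summable_iff_shift[where f = "%n. hitsum L n f" and k = "Suc n"])
 have "T (Suc n) e = (\<Sum>i. \<Sum>f\<in>{f. R e f & f ~= e0}. exp (- L f) * hitsum L (i+Suc n) f)"
  unfolding T_def by (simp add: hitsum_Suc)
 also have "... = (\<Sum>f\<in>{f. R e f & f ~= e0}. \<Sum>i. exp (- L f) * hitsum L (i+Suc n) f)"
  by (rule suminf_sum) (use s RE in \<open>auto intro!: summable_mult\<close>)
 also have "... = (\<Sum>f\<in>{f. R e f & f ~= e0}. exp (- L f) * T n f)"
  unfolding T_def by (intro sum.cong refl suminf_mult) (use s RE in auto)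
 finally show ?thesis .
qed

lemma g_pos: "0 < g"
proof -
 obtain p where p: "p:hit e0" using short_path[OF e0E e0E] unfolding hit_def by auto
 have "0 < hitsum L (length p) e0" unfolding hitsum_def
  by (rule sum_pos2[OF finite_slice, of p]) (use p in \<open>auto simp: wt_pos less_imp_le\<close>)
 then show ?thesis unfolding g[symmetric] by (intro suminf_pos2[OF summ, of "length p"] hitsum_nonneg)
qed

lemma T_N:
 assumes "e:E"
 shows "T N e <= \<theta> * T 0 e"
proof -
 let ?H = "\<Sum>n. hitsum L n e"
 have T0: "T 0 e = ?H" using suminf_split_head[OF hitsum_from(1)[OF assms]] by (simp add: T_def hitsum_0)
 obtain p where p: "p:hit e" "length p <= card E" using short_path[OF assms e0E] unfolding hit_def by auto
 have "exp (- (real N * m)) <= wt L p" using wt_lower[OF hit_set[OF p(1)] Lm m] p N by auto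
 also have "... <= hitsum L (length p) e" unfolding hitsum_def
  by (rule member_le_sum) (use p in \<open>auto simp: finite_slice wt_pos less_imp_le\<close>)
 also have "... <= (\<Sum>n<Suc N. hitsum L n e)"
  by (rule member_le_sum) (use p N hitsum_nonneg in auto)
 finally have "T N e <= ?H-exp (- (real N * m))"
  using suminf_split_initial_segment[OF hitsum_from(1)[OF assms], of "Suc N"] by (simp add: T_def)
 also have "exp (- (real N * m)) >= exp (- (2 * real N * m))/g*?H"
 proof -
  have "exp (- (2 * real N * m))/g*?H <= exp (- (2 * real N * m))/g*(g * exp (real N * m))"
   using hitsum_from(2)[OF assms] g_pos by (intro mult_left_mono) auto
  also have "... = exp (- (real N * m))" using g_pos by (simp add: exp_add[symmetric])
  finally show ?thesis .
 qed
 then have "?H-exp (- (real N * m)) <= \<theta>*?H" by (simp add: \<theta>_def algebra_simps)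
 finally show ?thesis using T0 by simp
qed

text \<open>\<open>T_Suc\<close> expresses each tail by the preceding tails at the successor edges,
  linearly and with nonnegative coefficients. The contraction found at index 0 in \<open>T_N\<close>
  therefore propagates to every index.\<close>

lemma T_add: "e:E ==> T (n+N) e <= \<theta> * T n e"
proof (induction n arbitrary: e)
 case 0
 then show ?case using T_N by simp
next
 case (Suc n)
 have "T (Suc n+N) e = (\<Sum>f\<in>{f. R e f & f ~= e0}. exp (- L f) * T (n+N) f)"
  using T_Suc[OF Suc.prems, of "n+N"] by simp
 also have "... <= (\<Sum>f\<in>{f. R e f & f ~= e0}. exp (- L f)*(\<theta> * T n f))"
  using Suc.IH RE by (intro sum_mono mult_left_mono) auto
 also have "... = \<theta> * T (Suc n) e" using T_Suc[OF Suc.prems, of n]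
  by (simp add: sum_distrib_left mult_ac)
 finally show ?case .
qed

lemma hitsum_tail:
 assumes "n >= 1"
 shows "hitsum L n e0 <= g*(1-exp (- (2 * real N * m))/g)^((n-1) div N)"
  "0 <= 1-exp (- (2 * real N * m))/g" "1-exp (- (2 * real N * m))/g < 1"
proof -
 have Npos: "N > 0" using N e0E finE card_gt_0_iff by fastforce
 have T0: "T 0 e0 = g" using suminf_split_head[OF summ] g by (simp add: T_def hitsum_0)
 show th1: "1-exp (- (2 * real N * m))/g < 1" using g_pos by simp
 have "0 <= T N e0" by (rule T_nonneg[OF e0E])
 also have "T N e0 <= \<theta> * g" using T_N[OF e0E] T0 by simp
 finally have th0: "0 <= \<theta>" using g_pos by (simp add: zero_le_mult_iff)
 then show "0 <= 1-exp (- (2 * real N * m))/g" by (simp add: \<theta>_def)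
 have pw: "T (k * N+j) e0 <= \<theta>^k * T j e0" for k j
 proof (induction k)
  case (Suc k)
  have "T (Suc k * N+j) e0 <= \<theta> * T (k * N+j) e0" using T_add[OF e0E, of "k * N+j"] by (simp add: add_ac)
  also have "... <= \<theta>*(\<theta>^k * T j e0)" using Suc th0 by (intro mult_left_mono) auto
  finally show ?case by simp
 qed simp
 have "T (Suc j) e0 <= T j e0" for j
 proof -
  have "summable (%i. hitsum L (i+Suc j) e0)" using summ by (subst summable_iff_shift[where f = "%n. hitsum L n e0" and k = "Suc j"])
  from suminf_split_head[OF this] show ?thesis using hitsum_nonneg[of L "Suc j" e0] by (simp add: T_def)
 qed
 then have dec: "T j e0 <= T 0 e0" for j by (induction j) (auto intro: order_trans)
 have sT: "hitsum L n e0 <= T (n-1) e0"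
 proof -
  have s: "summable (%i. hitsum L (i+Suc (n-1)) e0)"
   using summ by (subst summable_iff_shift[where f = "%n. hitsum L n e0" and k = "Suc (n-1)"])
  have "hitsum L (0+Suc (n-1)) e0 <= T (n-1) e0" unfolding T_def
   using sum_le_suminf[OF s, of "{0}"] hitsum_nonneg by simp
  then show ?thesis using assms by simp
 qed
 let ?k = "(n-1) div N"
 have "T (n-1) e0 = T (?k * N+(n-1) mod N) e0" by simp
 also have "... <= \<theta>^?k * T ((n-1) mod N) e0" by (rule pw)
 also have "... <= \<theta>^?k * g" using dec[of "(n-1) mod N"] T0 th0 by (intro mult_left_mono) auto
 finally show "hitsum L n e0 <= g*(1-exp (- (2 * real N * m))/g)^?k"
  using sT by (simp add: \<theta>_def mult.commute)
qed

end

end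

lemma geometric_div_bound:
 fixes \<theta> :: real
 assumes "0 < N" "0 <= \<theta>" "\<theta> < 1"
 shows "EX \<rho> C. 0 < \<rho> & \<rho> < 1 & 0 <= C & (ALL n>=1. \<theta>^((n-1) div N) <= C*\<rho>^n)"
proof -
 \<comment> \<open>\<theta> may be 0, but the root \<rho> has to be positive because
   \<open>\<rho>^N\<close> becomes a denominator.\<close>
 define t where "t = max \<theta> (1/2)"
 have t: "0 < t" "t < 1" "\<theta> <= t" using assms by (auto simp: t_def)
 define \<rho> where "\<rho> = root N t"
 have r: "0 < \<rho>" "\<rho> < 1" "\<rho>^N = t" using t assms(1) by (auto simp: \<rho>_def real_root_pow_pos2)
 have "\<theta>^((n-1) div N) <= (1/\<rho>^N)*\<rho>^n" if "n >= 1" for n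
 proof -
  have n: "n <= N*((n-1) div N)+N"
   using mult_div_mod_eq[of N "n-1"] mod_less_divisor[OF assms(1), of "n-1"] that by linarith
  have "\<theta>^((n-1) div N) <= t^((n-1) div N)" using t assms by (intro power_mono) auto
  also have "... = \<rho>^(N*((n-1) div N)+N)/\<rho>^N" using r t(1) by (simp add: power_mult power_add)
  also have "... <= \<rho>^n/\<rho>^N" using r n by (intro divide_right_mono power_decreasing) auto
  finally show ?thesis by simp
 qed
 then show ?thesis using r by (intro exI[of _ \<rho>] exI[of _ "1/\<rho>^N"]) auto
qed

text \<open>Unordered sums over loops suit reindexing and differentiation, series over the number of
  edges suit geometric comparison. This lemma and \<open>summable_slices\<close> pass between the
  two.\<close>

lemma summable_on_slices:
 fixes f :: "'a list => real"
 assumes fin: "!!n. finite {p:P. length p = n}" and nn: "!!p. p:P ==> f p >= 0"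
  and s: "summable (%n. \<Sum>p\<in>{p:P. length p = n}. f p)"
 shows "f summable_on P" "infsum f P = (\<Sum>n. \<Sum>p\<in>{p:P. length p = n}. f p)"
proof -
 let ?a = "%n. \<Sum>p\<in>{p:P. length p = n}. f p"
 have a0: "?a n >= 0" for n by (intro sum_nonneg) (use nn in auto)
 have slice: "(\<Sum>n<k. ?a n) = sum f {p:P. length p < k}" for k
 proof (induction k)
  case (Suc k)
  have "{p:P. length p < Suc k} = {p:P. length p < k} \<union> {p:P. length p = k}" by auto
  moreover have "finite {p:P. length p < k}"
  proof -
   have "{p:P. length p < k} = (\<Union>n<k. {p:P. length p = n})" by auto
   then show ?thesis using fin by auto
  qed
  ultimately show ?case using Suc fin[of k] by (simp add: sum.union_disjoint disjoint_iff)
 qed simp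
 have finlt: "finite {p:P. length p < k}" for k
 proof -
  have "{p:P. length p < k} = (\<Union>n<k. {p:P. length p = n})" by auto
  then show ?thesis using fin by auto
 qed
 have bd: "sum f X <= suminf ?a" if X: "finite X" "X <= P" for X
 proof -
  define k where "k = Suc (Max (insert 0 (length ` X)))"
  have "X <= {p:P. length p < k}" using X by (auto simp: k_def less_Suc_eq_le)
  then have "sum f X <= sum f {p:P. length p < k}" by (intro sum_mono2 finlt) (use nn in auto)
  also have "... <= suminf ?a" unfolding slice[symmetric] by (rule sum_le_suminf[OF s]) (use a0 in auto)
  finally show ?thesis .
 qed
 show sP: "f summable_on P"
  by (rule nonneg_bdd_above_summable_on) (use nn bd in \<open>auto intro!: bdd_aboveI[of _ "suminf ?a"]\<close>)
 have "infsum f P <= suminf ?a" by (rule infsum_le_finite_sums[OF sP bd])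
 moreover have "suminf ?a <= infsum f P"
 proof (rule suminf_le_const[OF s])
  fix k show "(\<Sum>n<k. ?a n) <= infsum f P"
   unfolding slice by (rule finite_sum_le_infsum[OF sP finlt]) (use nn in auto)
 qed
 ultimately show "infsum f P = suminf ?a" by simp
qed

lemma summable_slices:
 fixes f :: "'a list => real"
 assumes fin: "!!n. finite {p:P. length p = n}" and nn: "!!p. p:P ==> f p >= 0"
  and s: "f summable_on P"
 shows "summable (%n. \<Sum>p\<in>{p:P. length p = n}. f p)"
proof (rule bounded_imp_summable)
 show "0 <= (\<Sum>p\<in>{p:P. length p = n}. f p)" for n by (intro sum_nonneg) (use nn in auto)
 fix k
 have "(\<Sum>n\<le>k. \<Sum>p\<in>{p:P. length p = n}. f p) = sum f (\<Union>n\<in>{..k}. {p:P. length p = n})"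
  by (subst sum.UNION_disjoint) (use fin in auto)
 also have "... <= infsum f P" by (rule finite_sum_le_infsum[OF s]) (use nn fin in auto)
 finally show "(\<Sum>n\<le>k. \<Sum>p\<in>{p:P. length p = n}. f p) <= infsum f P" .
qed

context strong_digraph
begin

text \<open>Convergence improves itself: the terms grouped by length decay geometrically, so a
  factor that grows exponentially in the length can be afforded. This is why convergence is an open
  condition on \<open>L\<close> and the series can be differentiated at its root.\<close>

lemma exp_slack:
 assumes "wt L summable_on hit e0"
 shows "EX \<eta>::real. \<eta> > 0 & (%p. exp (\<eta> * real (length p)) * wt L p) summable_on hit e0"
proof -
 have s: "summable (%n. hitsum L n e0)" unfolding hitsum_def
  by (rule summable_slices[OF finite_slice _ assms]) (simp add: wt_pos less_imp_le)
 define m where "m = Max (insert 0 (L ` E))"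
 have m: "0 <= m" "!!e. e:E ==> L e <= m" using finE by (auto simp: m_def)
 have cE: "0 < card E" using finE e0E card_gt_0_iff by blast
 define g where "g = (\<Sum>n. hitsum L n e0)"
 have g: "0 < g" unfolding g_def by (rule g_pos[OF s refl order_refl m(2,1)])
 have t: "hitsum L n e0 <= g*(1-exp (- (2 * real (card E) * m))/g)^((n-1) div card E)"
  "0 <= 1-exp (- (2 * real (card E) * m))/g" "1-exp (- (2 * real (card E) * m))/g < 1"
  if "n >= 1" for n
  using hitsum_tail[OF s g_def[symmetric] order_refl _ m(1) that] m(2) by auto
 obtain \<rho> C where r: "0 < \<rho>" "\<rho> < 1" "0 <= C"
  "!!n. n >= 1 ==> (1-exp (- (2 * real (card E) * m))/g)^((n-1) div card E) <= C*\<rho>^n"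
  using geometric_div_bound[OF cE t(2,3)[OF order_refl]] by auto
 \<comment> \<open>With this choice the new ratio \<open>exp \<eta> * \<rho>\<close> is the square
   root of \<rho>.\<close>
 define \<eta> where "\<eta> = - ln \<rho>/2"
 have eta: "\<eta> > 0" "exp \<eta>*\<rho> < 1"
 proof -
  show "\<eta> > 0" using r by (simp add: \<eta>_def)
  have "exp \<eta> * exp (ln \<rho>) = exp (ln \<rho>/2)" unfolding exp_add[symmetric] by (simp add: \<eta>_def)
  also have "... < 1" using r by simp
  finally show "exp \<eta>*\<rho> < 1" using r by simp
 qed
 have b: "exp (\<eta> * real n) * hitsum L n e0 <= g * C*(exp \<eta>*\<rho>)^n" if "n >= 1" for n
 proof -
  have "exp (\<eta> * real n) * hitsum L n e0 <= exp (\<eta> * real n)*(g*(C*\<rho>^n))"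
   using t(1)[OF that] r(4)[OF that] g by (intro mult_left_mono) (auto intro: order_trans mult_left_mono)
  then show ?thesis by (simp add: power_mult_distrib exp_of_nat_mult[symmetric] mult_ac)
 qed
 have "summable (%n. exp (\<eta> * real n) * hitsum L n e0)"
 proof (rule summable_comparison_test'[of "%n. g * C*(exp \<eta>*\<rho>)^n" 1])
  show "summable (%n. g * C*(exp \<eta>*\<rho>)^n)"
   using eta r by (intro summable_mult summable_geometric) auto
 qed (use b hitsum_nonneg in \<open>auto simp: abs_mult\<close>)
 then have "summable (%n. \<Sum>p\<in>{p:hit e0. length p = n}. exp (\<eta> * length p) * wt L p)"
  unfolding hitsum_def sum_distrib_left by (rule back_subst[of summable]) (auto intro!: ext sum.cong)
 from summable_on_slices(1)[OF finite_slice _ this] show ?thesis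
  using eta by (auto simp: wt_pos less_imp_le)
qed

text \<open>With total mass 1 the decay rate no longer contains \<open>g\<close>, so the mean number
  of edges of a loop is bounded in terms of \<open>N\<close> and \<open>m\<close> alone. It later
  bounds the denominator of the Hessian, uniformly over all graphs with at most \<open>N\<close>
  oriented edges.\<close>

lemma mean_length_bound:
 assumes "N > 0" "m >= 0"
 defines "\<theta> \<equiv> 1-exp (- (2 * real N * m))"
 assumes s: "wt L summable_on hit e0" and one: "infsum (wt L) (hit e0) = 1"
  and N: "card E <= N" and Lm: "!!e. e:E ==> L e <= m"
 shows "(%p. length p * wt L p) summable_on hit e0"
  "infsum (%p. length p * wt L p) (hit e0) <= (\<Sum>n. real n*\<theta>^((n-1) div N))"
proof -
 have th: "0 <= \<theta>" "\<theta> < 1" using assms by (auto simp: \<theta>_def)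
 have s': "summable (%n. hitsum L n e0)" unfolding hitsum_def
  by (rule summable_slices[OF finite_slice _ s]) (simp add: wt_pos less_imp_le)
 have g: "(\<Sum>n. hitsum L n e0) = 1" using summable_on_slices(2)[OF finite_slice _ s'[unfolded hitsum_def]] one
  by (simp add: hitsum_def wt_pos less_imp_le)
 obtain \<rho> C where r: "0 < \<rho>" "\<rho> < 1" "0 <= C" "!!n. n >= 1 ==> \<theta>^((n-1) div N) <= C*\<rho>^n"
  using geometric_div_bound[OF assms(1) th] by auto
 \<comment> \<open>Termwise differentiation of the geometric series yields summability of
   \<open>real (Suc n) * \<rho>^n\<close>.\<close>
 have "summable (%n. diffs (%n. 1::real) n*\<rho>^n)"
  by (rule termdiff_converges[of _ 1]) (use r in \<open>auto intro: summable_geometric\<close>)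
 then have s1: "summable (%n. C*(real (Suc n)*\<rho>^n))" by (intro summable_mult) (simp add: diffs_def)
 have s2: "summable (%n. real n*\<theta>^((n-1) div N))"
 proof (rule summable_comparison_test'[OF s1, of 1])
  fix n :: nat assume "1 <= n"
  then have "real n*\<theta>^((n-1) div N) <= real (Suc n)*(C*\<rho>^n)"
   using r(4)[of n] th r(1,3) by (intro mult_mono) auto
  then show "norm (real n*\<theta>^((n-1) div N)) <= C*(real (Suc n)*\<rho>^n)"
   using th by (simp add: abs_mult mult_ac)
 qed
 have le: "real n * hitsum L n e0 <= real n*\<theta>^((n-1) div N)" for n
  using hitsum_tail(1)[OF s' g N Lm assms(2), of n] by (cases "n = 0") (auto simp: \<theta>_def intro!: mult_left_mono)
 have s3: "summable (%n. real n * hitsum L n e0)"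
  by (rule summable_comparison_test'[OF s2, of 0]) (use le hitsum_nonneg in \<open>auto simp: abs_mult\<close>)
 have eq: "real n * hitsum L n e0 = (\<Sum>p\<in>{p:hit e0. length p = n}. length p * wt L p)" for n
  unfolding hitsum_def sum_distrib_left by (intro sum.cong) auto
 note q = summable_on_slices[OF finite_slice _ s3[unfolded eq]]
 show "(%p. length p * wt L p) summable_on hit e0"
  by (rule q(1)) (simp add: wt_pos less_imp_le)
 have "infsum (%p. length p * wt L p) (hit e0) = (\<Sum>n. real n * hitsum L n e0)"
  unfolding eq by (rule q(2)) (simp add: wt_pos less_imp_le)
 also have "... <= (\<Sum>n. real n*\<theta>^((n-1) div N))" by (rule suminf_le[OF le s3 s2])
 finally show "infsum (%p. length p * wt L p) (hit e0) <= (\<Sum>n. real n*\<theta>^((n-1) div N))" .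
qed

end

section \<open>Counting circuits by a renewal argument\<close>

context strong_digraph
begin

text \<open>The concatenations of first-return loops, the empty one included, that is, the free
  monoid on \<open>hit e0\<close>: factorizations exist by \<open>cyc_decomp\<close> and are unique
  by \<open>hit_prefix_unique\<close>. Growth is computed for \<open>cyc\<close> and then carried
  over to the circuits in \<open>circ\<close>.\<close>

definition cyc :: "nat list set" where
 "cyc = {p. p = [] | successively R (e0#p) & last p = e0}"

definition circ :: "nat list set" where
 "circ = {p. p ~= [] & successively R p & R (last p) (hd p)}"

lemma circ_set: "p:circ ==> set p <= E"
proof -
 assume "p:circ"
 then have "successively R (last p#p)" by (cases p) (auto simp: circ_def)
 then show ?thesis by (rule path_set)
qed

lemma hitE:
 assumes "p:hit e"
 obtains a where "p = a@[e0]" "e0 ~: set a"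
proof -
 have "p = butlast p@[e0]" using assms append_butlast_last_id[of p] by (simp add: hit_def)
 moreover have "e0 ~: set (butlast p)" using assms by (simp add: hit_def)
 ultimately show ?thesis using that by blast
qed

text \<open>First-return loops form a prefix code, because the first occurrence of \<open>e0\<close>
  marks the end of the loop.\<close>

lemma hit_prefix_unique:
 assumes "p:hit e" "p':hit e'" "p@q = p'@q'"
 shows "p = p'" "q = q'"
proof -
 obtain a where a: "p = a@[e0]" "e0 ~: set a" using hitE[OF assms(1)] by blast
 obtain a' where a': "p' = a'@[e0]" "e0 ~: set a'" using hitE[OF assms(2)] by blast
 have "a@e0#q = a'@e0#q'" using assms(3) a a' by simp
 moreover have "takeWhile (%x. x ~= e0) (b@e0#w) = b" if "e0 ~: set b" for b w
  using that by (induction b) auto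
 ultimately have "a = a' & q = q'" using a(2) a'(2) by (metis same_append_eq list.inject)
 then show "p = p'" "q = q'" using a a' by auto
qed

lemma hit_cyc_append:
 assumes "\<gamma>:hit e0" "p:cyc"
 shows "\<gamma>@p:cyc-{[]}"
 using assms unfolding hit_def cyc_def
 by (cases "p = []") (auto simp: successively_append_iff successively_Cons)

lemma cyc_decomp:
 assumes "p:cyc" "p ~= []"
 shows "EX \<gamma>:hit e0. EX q:cyc. p = \<gamma>@q"
proof -
 have p: "successively R (e0#p)" "last p = e0" using assms by (auto simp: cyc_def)
 then have "e0:set p" using assms(2) last_in_set by metis
 then obtain a q where a: "p = a@e0#q" "e0 ~: set a" by (meson split_list_first)
 have "successively R ((e0#a)@[e0]@q)" using p a by simp
 then have "successively R (e0#a@[e0])" "successively R (e0#q)"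
  by (metis append_Cons append.assoc successively_append_iff, metis append_Cons append_Nil successively_append_iff)
 moreover have "q ~= [] ==> last q = e0" using p a by auto
 ultimately have "a@[e0]:hit e0" "q:cyc" using a by (auto simp: hit_def cyc_def)
 then show ?thesis using a by (intro bexI[of _ "a@[e0]"] bexI[of _ q]) auto
qed

lemma cyc_circ: "cyc-{[]} <= circ"
 by (auto simp: cyc_def circ_def successively_Cons)

context
 fixes l :: "nat => real" and s :: real
 assumes lpos: "!!e. e:E ==> l e > 0" and spos: "s > 0"
  and root: "wt (%e. s * l e) summable_on hit e0" "infsum (wt (%e. s * l e)) (hit e0) = 1"
begin

private abbreviation len' :: "nat list => real" where "len' p \<equiv> sum_list (map l p)"
private abbreviation \<mu> :: real where "\<mu> \<equiv> l e0"
private definition z :: "real => nat" where "z t = card {p:cyc. len' p <= t}"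
private definition c :: "real => nat" where "c t = card {p:circ. len' p <= t}"

private lemma mu: "\<mu> > 0" using lpos e0E by auto

private lemma wt_s: "wt (%e. s * l e) p = exp (- s * len' p)"
 by (simp add: wt_def sum_list_const_mult)

private lemma len_nonneg: "set p <= E ==> len' p >= 0"
 by (induction p) (auto simp: lpos less_imp_le add_nonneg_nonneg)

private lemma fin_len: "finite {p. set p <= E & len' p <= t}"
proof -
 define k where "k = Min (l ` E)"
 have ne: "l ` E ~= {}" using e0E by auto
 have k: "k > 0" unfolding k_def using finE lpos ne by simp
 have kl: "!!e. e:E ==> k <= l e" unfolding k_def using finE by simp
 have ge: "set p <= E ==> len' p >= real (length p) * k" for p
  by (induction p) (auto simp: algebra_simps intro: add_mono kl)
 have "{p. set p <= E & len' p <= t} <= {p. set p <= E & length p <= nat \<lfloor>t/k\<rfloor>}"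
 proof safe
  fix p assume p: "set p <= E" "len' p <= t"
  then have "real (length p) <= t/k" using ge[OF p(1)] k by (simp add: field_simps)
  then show "length p <= nat \<lfloor>t/k\<rfloor>" by linarith
 qed
 then show ?thesis by (rule finite_subset) (rule finite_lists_length_le[OF finE])
qed

private lemma cyc_set: "p:cyc ==> set p <= E" by (auto simp: cyc_def dest: path_set)

private lemma fin_cyc: "finite {p:cyc. len' p <= t}"
 by (rule finite_subset[OF _ fin_len[of t]]) (use cyc_set in auto)

private lemma fin_circ: "finite {p:circ. len' p <= t}"
 by (rule finite_subset[OF _ fin_len[of t]]) (use circ_set in auto)

private lemma fin_hit: "finite {p:hit e0. len' p <= t}"
 by (rule finite_subset[OF _ fin_len[of t]]) (use hit_set in auto)

private lemma hit_len: "p:hit e0 ==> len' p >= \<mu>"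
proof -
 assume p: "p:hit e0"
 obtain a where a: "p = a@[e0]" using hitE[OF p] by blast
 have "len' a >= 0" using len_nonneg[of a] hit_set[OF p] a by auto
 then show ?thesis using a by simp
qed

text \<open>Splitting off the first loop gives a renewal inequality for \<open>z\<close>, and the
  induction proceeds in strips of width \<mu>, a lower bound for the length of every loop. The
  linear factor is chosen so that \<open>1 + (t - len' \<gamma>)/\<mu>\<close> is at most
  \<open>t/\<mu>\<close>, which leaves room for the empty path; the remaining sum over loops is at
  most 1 by the root equation.\<close>

private lemma z_upper: "0 <= t ==> t < real k*\<mu> ==> real (z t) <= (1+t/\<mu>) * exp (s * t)"
proof (induction k arbitrary: t)
 case 0
 then show ?case using mu by auto
next
 case (Suc k)
 let ?G = "{p:hit e0. len' p <= t}"
 have "{p:cyc. len' p <= t} <= insert [] (\<Union>\<gamma>\<in>?G. (@) \<gamma> ` {p:cyc. len' p <= t-len' \<gamma>})"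
 proof
  fix p assume p: "p:{p:cyc. len' p <= t}"
  show "p:insert [] (\<Union>\<gamma>\<in>?G. (@) \<gamma> ` {p:cyc. len' p <= t-len' \<gamma>})"
  proof (cases "p = []")
   case False
   then obtain \<gamma> q where q: "\<gamma>:hit e0" "q:cyc" "p = \<gamma>@q" using cyc_decomp p by blast
   then have "len' \<gamma> <= t" "len' q <= t-len' \<gamma>" using p len_nonneg[OF cyc_set[OF q(2)]] by auto
   then show ?thesis using q by auto
  qed auto
 qed
 then have "z t <= card (insert [] (\<Union>\<gamma>\<in>?G. (@) \<gamma> ` {p:cyc. len' p <= t-len' \<gamma>}))"
  unfolding z_def using fin_hit fin_cyc by (intro card_mono) auto
 also have "... <= Suc (card (\<Union>\<gamma>\<in>?G. (@) \<gamma> ` {p:cyc. len' p <= t-len' \<gamma>}))"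
  using fin_hit fin_cyc by (intro card_insert_le_m1[THEN order_trans] card_insert_if[THEN eq_refl, THEN order_trans]) auto
 also have "card (\<Union>\<gamma>\<in>?G. (@) \<gamma> ` {p:cyc. len' p <= t-len' \<gamma>}) <= (\<Sum>\<gamma>\<in>?G. card ((@) \<gamma> ` {p:cyc. len' p <= t-len' \<gamma>}))"
  by (rule card_UN_le[OF fin_hit])
 also have "... <= (\<Sum>\<gamma>\<in>?G. z (t-len' \<gamma>))"
  unfolding z_def by (intro sum_mono card_image_le fin_cyc)
 finally have "real (z t) <= 1+(\<Sum>\<gamma>\<in>?G. real (z (t-len' \<gamma>)))" by (simp add: of_nat_sum[symmetric] del: of_nat_sum)
 also have "(\<Sum>\<gamma>\<in>?G. real (z (t-len' \<gamma>))) <= (\<Sum>\<gamma>\<in>?G. (t/\<mu> * exp (s * t)) * exp (- s * len' \<gamma>))"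
 proof (rule sum_mono)
  fix \<gamma> assume g: "\<gamma>:?G"
  have m: "len' \<gamma> >= \<mu>" using hit_len g by auto
  have "real (z (t-len' \<gamma>)) <= (1+(t-len' \<gamma>)/\<mu>) * exp (s*(t-len' \<gamma>))"
   using g m Suc.prems by (intro Suc.IH) (auto simp: algebra_simps)
  also have "... <= (t/\<mu>) * exp (s*(t-len' \<gamma>))"
   using m mu by (intro mult_right_mono) (auto simp: field_simps)
  also have "... = (t/\<mu> * exp (s * t)) * exp (- s * len' \<gamma>)" by (simp add: exp_add[symmetric] algebra_simps exp_diff exp_minus divide_inverse)
  finally show "real (z (t-len' \<gamma>)) <= (t/\<mu> * exp (s * t)) * exp (- s * len' \<gamma>)" .
 qed
 also have "... = (t/\<mu> * exp (s * t))*(\<Sum>\<gamma>\<in>?G. wt (%e. s * l e) \<gamma>)" by (simp add: wt_s sum_distrib_left)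
 also have "... <= (t/\<mu> * exp (s * t))*1"
  unfolding root(2)[symmetric] using Suc.prems mu
  by (intro mult_left_mono finite_sum_le_infsum[OF root(1)] fin_hit) (auto simp: wt_pos less_imp_le)
 finally have "real (z t) <= 1+t/\<mu> * exp (s * t)" by simp
 also have "1 <= exp (s * t)" using spos Suc.prems by simp
 finally show ?case by (simp add: algebra_simps)
qed

text \<open>Finitely many loops carry mass above \<open>exp (- (s-s')*\<mu>)\<close> at exponent
  \<open>s\<close>. Passing to the smaller exponent \<open>s'\<close> multiplies each weight by at
  least \<open>exp ((s-s')*\<mu>)\<close>, so these loops have mass at least 1 at \<open>s'\<close>
  and the renewal inequality for their concatenations can be iterated. \<open>K\<close> bounds their
  lengths; for times up to \<open>K\<close> the empty path suffices.\<close>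

private lemma z_lower:
 assumes "0 < s'" "s' < s"
 shows "EX K. ALL t>=0. real (z t) >= exp (s'*(t-K))"
proof -
 have "exp (- (s-s')*\<mu>) < infsum (wt (%e. s * l e)) (hit e0)" using root(2) assms mu by (simp add: mult_neg_pos)
 then obtain \<Gamma> where G: "finite \<Gamma>" "\<Gamma> <= hit e0" "(\<Sum>\<gamma>\<in>\<Gamma>. wt (%e. s * l e) \<gamma>) > exp (- (s-s')*\<mu>)"
  using infsum_le_finite_sums[OF root(1), of "exp (- (s-s')*\<mu>)"] by (meson not_le)
 have one: "1 <= (\<Sum>\<gamma>\<in>\<Gamma>. exp (- s' * len' \<gamma>))"
 proof -
  have "1 = exp ((s-s')*\<mu>) * exp (- (s-s')*\<mu>)" by (simp add: exp_add[symmetric] algebra_simps)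
  also have "... <= exp ((s-s')*\<mu>)*(\<Sum>\<gamma>\<in>\<Gamma>. wt (%e. s * l e) \<gamma>)" using G by (intro mult_left_mono) auto
  also have "... = (\<Sum>\<gamma>\<in>\<Gamma>. exp ((s-s')*\<mu>) * exp (- s * len' \<gamma>))" by (simp add: wt_s sum_distrib_left)
  also have "... <= (\<Sum>\<gamma>\<in>\<Gamma>. exp (- s' * len' \<gamma>))"
  proof (rule sum_mono)
   fix \<gamma> assume "\<gamma>:\<Gamma>"
   then have "\<mu> <= len' \<gamma>" using hit_len G by auto
   then have "(s-s')*\<mu> <= (s-s') * len' \<gamma>" using assms by (intro mult_left_mono) auto
   then show "exp ((s-s')*\<mu>) * exp (- s * len' \<gamma>) <= exp (- s' * len' \<gamma>)"
    unfolding exp_add[symmetric] by (simp add: algebra_simps)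
  qed
  finally show ?thesis .
 qed
 define K where "K = Max (insert 0 (len' ` \<Gamma>))"
 have K: "0 <= K" "!!\<gamma>. \<gamma>:\<Gamma> ==> len' \<gamma> <= K" using G by (auto simp: K_def)
 have "real (z t) >= exp (s'*(t-K))" if "0 <= t" "t < real k*\<mu>" for k t
  using that
 proof (induction k arbitrary: t)
  case 0
  then show ?case by auto
 next
  case (Suc k)
  show ?case
  proof (cases "t <= K")
   case True
   have "[]:{p:cyc. len' p <= t}" using Suc.prems by (auto simp: cyc_def)
   then have "z t >= 1" unfolding z_def using fin_cyc[of t] by (metis One_nat_def Suc_leI card_gt_0_iff empty_iff)
   moreover have "exp (s'*(t-K)) <= 1" using True assms by (simp add: mult_le_0_iff)
   ultimately show ?thesis by linarith
  next
   case False
   let ?U = "\<Union>\<gamma>\<in>\<Gamma>. (@) \<gamma> ` {p:cyc. len' p <= t-len' \<gamma>}"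
   have "?U <= {p:cyc. len' p <= t}" using hit_cyc_append G by auto
   then have "card ?U <= z t" unfolding z_def by (rule card_mono[OF fin_cyc])
   moreover have "card ?U = (\<Sum>\<gamma>\<in>\<Gamma>. card ((@) \<gamma> ` {p:cyc. len' p <= t-len' \<gamma>}))"
   proof (rule card_UN_disjoint[OF G(1)])
    have "i@p ~= j@q" if "i:\<Gamma>" "j:\<Gamma>" "i ~= j" for i j p q
     using hit_prefix_unique(1)[of i e0 j e0 p q] G(2) that by auto
    then show "ALL i:\<Gamma>. ALL j:\<Gamma>. i ~= j -->
     (@) i ` {p:cyc. len' p <= t-len' i} \<inter> (@) j ` {p:cyc. len' p <= t-len' j} = {}"
     unfolding disjoint_iff image_iff by metis
   qed (use fin_cyc in auto)
   moreover have "... = (\<Sum>\<gamma>\<in>\<Gamma>. z (t-len' \<gamma>))"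
    unfolding z_def by (intro sum.cong card_image refl) (auto simp: inj_on_def)
   ultimately have "(\<Sum>\<gamma>\<in>\<Gamma>. real (z (t-len' \<gamma>))) <= real (z t)"
    by (simp add: of_nat_sum[symmetric] del: of_nat_sum)
   moreover have "exp (s'*(t-K)) * exp (- s' * len' \<gamma>) <= real (z (t-len' \<gamma>))" if "\<gamma>:\<Gamma>" for \<gamma>
   proof -
    have "len' \<gamma> >= \<mu>" "len' \<gamma> <= K" using that G hit_len K by auto
    then have "exp (s'*(t-len' \<gamma>-K)) <= real (z (t-len' \<gamma>))"
     using Suc.prems False by (intro Suc.IH) (auto simp: algebra_simps)
    then show ?thesis unfolding exp_add[symmetric] by (simp add: algebra_simps)
   qed
   then have "(\<Sum>\<gamma>\<in>\<Gamma>. exp (s'*(t-K)) * exp (- s' * len' \<gamma>)) <= (\<Sum>\<gamma>\<in>\<Gamma>. real (z (t-len' \<gamma>)))"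
    by (rule sum_mono)
   moreover have "exp (s'*(t-K)) <= (\<Sum>\<gamma>\<in>\<Gamma>. exp (s'*(t-K)) * exp (- s' * len' \<gamma>))"
    unfolding sum_distrib_left[symmetric] using mult_left_mono[OF one, of "exp (s'*(t-K))"] by simp
   ultimately show ?thesis by linarith
  qed
 qed
 moreover have "EX k. t < real k*\<mu>" for t using mu reals_Archimedean3 by blast
 ultimately show ?thesis by blast
qed

text \<open>A fixed loop is prefixed in order to exclude the empty path, which is no circuit. The
  cost is a shift of the time.\<close>

private lemma c_lower:
 assumes "0 < s'" "s' < s"
 shows "EX K. ALL t>=K. real (c t) >= exp (s'*(t-K))"
proof -
 obtain K where K: "!!t. t >= 0 ==> real (z t) >= exp (s'*(t-K))" using z_lower[OF assms] by auto
 obtain \<gamma> where g: "\<gamma>:hit e0" using short_path[OF e0E e0E] unfolding hit_def by auto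
 have "real (c t) >= exp (s'*(t-(\<bar>K\<bar>+len' \<gamma>)))" if "t >= \<bar>K\<bar>+len' \<gamma>" for t
 proof -
  have "(@) \<gamma> ` {p:cyc. len' p <= t-len' \<gamma>} <= {p:circ. len' p <= t}"
   using hit_cyc_append[OF g] cyc_circ by (auto simp del: Diff_iff)
  from card_mono[OF fin_circ this] have "z (t-len' \<gamma>) <= c t"
   unfolding z_def c_def by (simp add: card_image inj_on_def)
  moreover have "exp (s'*(t-len' \<gamma>-K)) <= real (z (t-len' \<gamma>))" using that by (intro K) auto
  moreover have "exp (s'*(t-(\<bar>K\<bar>+len' \<gamma>))) <= exp (s'*(t-len' \<gamma>-K))"
   using assms by (auto intro!: mult_left_mono)
  ultimately show ?thesis by linarith
 qed
 then show ?thesis by blast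
qed

private lemma c_upper: "EX A>0. EX B>0. ALL t>=0. real (c t) <= (A+B * t) * exp (s * t)"
proof -
 have "ALL e:E. EX a. a ~= [] & successively R (e0#a) & last a = e" using strong e0E by blast
 then obtain \<alpha> where al: "!!e. e:E ==> \<alpha> e ~= [] & successively R (e0#\<alpha> e) & last (\<alpha> e) = e" by metis
 have "ALL e:E. EX b. b ~= [] & successively R (e#b) & last b = e0" using strong e0E by blast
 then obtain \<beta> where be: "!!e. e:E ==> \<beta> e ~= [] & successively R (e#\<beta> e) & last (\<beta> e) = e0" by metis
 \<comment> \<open>The path \<open>\<alpha>\<close> already ends with the first edge of
   \<open>p\<close>, so this edge is moved to the end of the circuit; then \<open>\<beta>\<close>
   leads back to \<open>e0\<close>. For a fixed first edge the map is injective.\<close>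
 define f where "f p = \<alpha> (hd p)@(tl p@[hd p])@\<beta> (hd p)" for p
 define K where "K = Max ((%e. len' (\<alpha> e)+len' (\<beta> e)) ` E)"
 have K: "len' (\<alpha> e)+len' (\<beta> e) <= K" if "e:E" for e unfolding K_def using that finE by auto
 have "0 <= K" using K[OF e0E] len_nonneg path_set al[OF e0E] be[OF e0E] by (smt (verit))
 have inj: "inj_on f {p:circ. hd p = e}" for e
  by (rule inj_onI) (auto simp: f_def circ_def, metis list.collapse)
 have im: "f p:cyc & len' (f p) <= len' p+K" if p: "p:circ" for p
 proof -
  obtain e q where pe: "p = e#q" using p by (cases p) (auto simp: circ_def)
  have e: "e:E" using circ_set[OF p] pe by auto
  have 1: "successively R (e#q)" "R (last (e#q)) e" using p pe by (auto simp: circ_def)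
  have "successively R (e#q@[e])" using 1 by (auto simp: successively_append_iff successively_Cons split: if_splits)
  then have "successively R (e#q@e#\<beta> e)" using successively_join[of R "e#q" e "\<beta> e"] be[OF e] by simp
  moreover have "successively R ((e0#butlast (\<alpha> e))@[e])" using al[OF e] by (metis append_Cons append_butlast_last_id)
  ultimately have "successively R ((e0#butlast (\<alpha> e))@e#q@e#\<beta> e)" using successively_join by metis
  then have "successively R (e0#f p)" using al[OF e] pe by (metis append_Cons append_Nil append.assoc append_butlast_last_id f_def list.sel(1) list.sel(3))
  moreover have "last (f p) = e0" using be[OF e] pe by (simp add: f_def)
  moreover have "len' (f p) <= len' p+K" using K[OF e] pe by (simp add: f_def)
  ultimately show ?thesis by (simp add: cyc_def)
 qed
 have le: "c t <= card E * z (t+K)" for t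
 proof -
  have hdE: "hd p:E" if "p:circ" for p
  proof -
   have "p ~= []" using that by (simp add: circ_def)
   then show ?thesis using circ_set[OF that] hd_in_set by blast
  qed
  have "{p:circ. len' p <= t} = (\<Union>e\<in>E. {p:circ. hd p = e & len' p <= t})"
   using hdE by auto
  then have "c t <= (\<Sum>e\<in>E. card {p:circ. hd p = e & len' p <= t})"
   unfolding c_def by (simp only: card_UN_le[OF finE])
  also have "... <= (\<Sum>e\<in>E. z (t+K))"
  proof (rule sum_mono)
   fix e
   show "card {p:circ. hd p = e & len' p <= t} <= z (t+K)" unfolding z_def
   proof (rule card_inj_on_le[of f])
    show "inj_on f {p:circ. hd p = e & len' p <= t}" by (rule inj_on_subset[OF inj[of e]]) auto
    show "f ` {p:circ. hd p = e & len' p <= t} <= {p:cyc. len' p <= t+K}" using im by fastforce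
   qed (rule fin_cyc)
  qed
  finally show ?thesis by simp
 qed
 define D where "D = real (card E) * exp (s * K)"
 have "0 < card E" using finE e0E card_gt_0_iff by blast
 then have D: "D > 0" by (simp add: D_def)
 have "real (c t) <= (D*(1+K/\<mu>)+D/\<mu> * t) * exp (s * t)" if "t >= 0" for t
 proof -
  obtain k where "t+K < real k*\<mu>" using mu reals_Archimedean3 by blast
  then have "real (z (t+K)) <= (1+(t+K)/\<mu>) * exp (s*(t+K))"
   using z_upper that \<open>0 <= K\<close> by auto
  then have "real (card E) * real (z (t+K)) <= real (card E)*((1+(t+K)/\<mu>) * exp (s*(t+K)))"
   by (intro mult_left_mono) auto
  moreover have "real (c t) <= real (card E) * real (z (t+K))" using le[of t] by (metis of_nat_le_iff of_nat_mult)
  ultimately have "real (c t) <= real (card E)*((1+(t+K)/\<mu>) * exp (s*(t+K)))" by linarith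
  also have "... = (D*(1+K/\<mu>)+D/\<mu> * t) * exp (s * t)"
   by (simp add: D_def algebra_simps exp_add add_divide_distrib)
  finally show ?thesis .
 qed
 moreover have "D*(1+K/\<mu>) > 0" "D/\<mu> > 0" using D mu \<open>0 <= K\<close> by (auto intro!: mult_pos_pos add_pos_nonneg)
 ultimately show ?thesis by blast
qed

lemma circuit_growth:
 "((%t. ln (real (card {p:circ. sum_list (map l p) <= t}))/t) \<longlongrightarrow> s) at_top"
 unfolding c_def[symmetric]
proof (rule order_tendstoI)
 fix a assume "a < s"
 define s' where "s' = (max a 0+s)/2"
 have s': "0 < s'" "a < s'" "s' < s" using \<open>a < s\<close> spos by (auto simp: s'_def max_def)
 obtain K where K: "!!t. t >= K ==> real (c t) >= exp (s'*(t-K))" using c_lower[OF s'(1,3)] by auto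
 have "((%t. s'*(t-K)/t) \<longlongrightarrow> s') at_top" by real_asymp
 then have "eventually (%t. a < s'*(t-K)/t) at_top" using s'(2) by (rule order_tendstoD)
 then show "eventually (%t. a < ln (real (c t))/t) at_top"
  using eventually_ge_at_top[of K] eventually_gt_at_top[of 0]
 proof eventually_elim
  case (elim t)
  have "s'*(t-K) <= ln (real (c t))"
   using K[OF elim(2)] by (metis exp_gt_zero ln_exp ln_le_cancel_iff less_le_trans)
  then have "s'*(t-K)/t <= ln (real (c t))/t" using elim by (intro divide_right_mono) auto
  then show ?case using elim by linarith
 qed
next
 fix a assume "s < a"
 obtain A B where AB: "A > 0" "B > 0" "!!t. t >= 0 ==> real (c t) <= (A+B * t) * exp (s * t)" using c_upper by auto
 obtain K where K: "!!t. t >= K ==> real (c t) >= exp (s/2*(t-K))" using c_lower[of "s/2"] spos by auto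
 have "((%t. ln (A+B * t)/t+s) \<longlongrightarrow> s) at_top" using AB(1,2) by real_asymp
 then have "eventually (%t. ln (A+B * t)/t+s < a) at_top" using \<open>s < a\<close> by (rule order_tendstoD)
 then show "eventually (%t. ln (real (c t))/t < a) at_top"
  using eventually_ge_at_top[of K] eventually_gt_at_top[of 0]
 proof eventually_elim
  case (elim t)
  have pos: "real (c t) > 0" using K[OF elim(2)] by (meson exp_gt_zero less_le_trans)
  have "ln (real (c t)) <= ln ((A+B * t) * exp (s * t))"
   using AB elim pos by (intro ln_mono) auto
  also have "... = ln (A+B * t)+s * t" using add_pos_pos[OF AB(1) mult_pos_pos[OF AB(2) elim(3)]] by (simp add: ln_mult)
  finally have "ln (real (c t))/t <= (ln (A+B * t)+s * t)/t" using elim by (intro divide_right_mono) auto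
  also have "... = ln (A+B * t)/t+s" using elim by (simp add: field_simps)
  finally show ?case using elim by linarith
 qed
qed

end

end

section \<open>Exponential sums over loops\<close>

lemma has_sum_finite_sum:
 fixes f :: "'i => 'a => real"
 assumes "finite A" "!!i. i:A ==> f i summable_on P"
 shows "((%p. \<Sum>i\<in>A. f i p) has_sum (\<Sum>i\<in>A. infsum (f i) P)) P"
 using assms by (induction A rule: finite_induct) (auto intro!: has_sum_add)

lemma has_sum_diff:
 fixes f g :: "'a => real"
 assumes "(f has_sum a) P" "(g has_sum b) P"
 shows "((%p. f p-g p) has_sum (a-b)) P"
 using has_sum_add[OF assms(1) has_sum_uminusI[OF assms(2)]] by simp

text \<open>Only the multiplicities of edges in loops matter for the calculus, so it is developed
  for an arbitrary index set \<open>P\<close> with nonnegative multiplicities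
  \<open>n p i\<close>.\<close>

locale exp_sums =
 fixes I :: "nat set" and P :: "'a set" and n :: "'a => nat => real"
 assumes finI: "finite I" and n_nonneg: "!!p i. n p i >= 0"
begin

definition ev :: "(nat => real) => 'a => real" where "ev L p = (\<Sum>i\<in>I. n p i * L i)"
definition sz :: "'a => real" where "sz p = (\<Sum>i\<in>I. n p i)"
text \<open>Convergence with an exponential margin in the total multiplicity. The margin pays for
  polynomial weights (\<open>good_slack\<close>) and for small changes of \<open>L\<close>
  (\<open>good_near\<close>).\<close>

definition good :: "(nat => real) => bool" where
 "good L \<longleftrightarrow> (EX \<eta>>0. (%p. exp (\<eta> * sz p-ev L p)) summable_on P)"
definition F :: "('a => real) => (nat => real) => real" where
 "F w L = infsum (%p. w p * exp (- ev L p)) P"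
text \<open>Each differentiation of \<open>F w\<close> multiplies the weight by some
  \<open>n p i\<close>, and this class of weights is closed under such products.\<close>

definition pol :: "('a => real) => bool" where
 "pol w \<longleftrightarrow> (EX C k. ALL p:P. \<bar>w p\<bar> <= C*(1+sz p)^k)"

lemma sz_nonneg: "sz p >= 0" unfolding sz_def by (intro sum_nonneg) (simp add: n_nonneg)

lemma n_le_sz: "i:I ==> n p i <= sz p"
 unfolding sz_def by (rule member_le_sum) (auto simp: n_nonneg finI)


lemma ev_diff: "ev (%i. L i-M i) p = ev L p-ev M p"
 by (simp add: ev_def sum_subtractf algebra_simps)

lemma ev_scale: "ev (%i. k * L i) p = k * ev L p"
 by (simp add: ev_def sum_distrib_left mult_ac)

lemma ev_bound: "(!!i. i:I ==> \<bar>L i\<bar> <= b) ==> \<bar>ev L p\<bar> <= b * sz p"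
proof -
 assume b: "!!i. i:I ==> \<bar>L i\<bar> <= b"
 have "\<bar>ev L p\<bar> <= (\<Sum>i\<in>I. \<bar>n p i * L i\<bar>)" unfolding ev_def by (rule sum_abs)
 also have "... <= (\<Sum>i\<in>I. n p i * b)"
  by (intro sum_mono) (auto simp: abs_mult n_nonneg intro!: mult_left_mono b)
 finally show ?thesis by (simp add: sz_def sum_distrib_left mult.commute)
qed

lemma pol_const [simp]: "pol (%p. c)" unfolding pol_def by (intro exI[of _ "\<bar>c\<bar>"] exI[of _ 0]) auto

lemma pol_n: "i:I ==> pol (%p. n p i)"
 unfolding pol_def using n_le_sz[of i] n_nonneg by (intro exI[of _ 1] exI[of _ 1]) (auto intro!: add_increasing)

lemma pol_sz: "pol sz"
 unfolding pol_def using sz_nonneg by (intro exI[of _ 1] exI[of _ 1]) auto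

lemma pol_mult:
 assumes "pol w" "pol w'"
 shows "pol (%p. w p * w' p)"
proof -
 obtain C k where 1: "ALL p:P. \<bar>w p\<bar> <= C*(1+sz p)^k" using assms(1) pol_def by auto
 obtain D j where 2: "ALL p:P. \<bar>w' p\<bar> <= D*(1+sz p)^j" using assms(2) pol_def by auto
 have "\<bar>w p * w' p\<bar> <= (C * D)*(1+sz p)^(k+j)" if "p:P" for p
 proof -
  have "\<bar>w p\<bar>*\<bar>w' p\<bar> <= (C*(1+sz p)^k)*(D*(1+sz p)^j)"
   using 1 2 that by (intro mult_mono) (auto intro: order_trans[OF abs_ge_zero])
  then show ?thesis by (simp add: abs_mult power_add mult_ac)
 qed
 then show ?thesis unfolding pol_def by blast
qed

lemma pol_add:
 assumes "pol w" "pol w'"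
 shows "pol (%p. w p+w' p)"
proof -
 obtain C k where 1: "ALL p:P. \<bar>w p\<bar> <= C*(1+sz p)^k" using assms(1) pol_def by auto
 obtain D j where 2: "ALL p:P. \<bar>w' p\<bar> <= D*(1+sz p)^j" using assms(2) pol_def by auto
 have up: "C*(1+sz p)^k <= \<bar>C\<bar>*(1+sz p)^(max k j)" "D*(1+sz p)^j <= \<bar>D\<bar>*(1+sz p)^(max k j)" for p
  using sz_nonneg[of p] by (intro mult_mono power_increasing; simp)+
 have "\<bar>w p+w' p\<bar> <= (\<bar>C\<bar>+\<bar>D\<bar>)*(1+sz p)^(max k j)" if "p:P" for p
 proof -
  have "\<bar>w p+w' p\<bar> <= \<bar>w p\<bar>+\<bar>w' p\<bar>" by simp
  also have "... <= \<bar>C\<bar>*(1+sz p)^(max k j)+\<bar>D\<bar>*(1+sz p)^(max k j)"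
   using 1 2 that up[of p] by fastforce
  finally show ?thesis by (simp add: algebra_simps)
 qed
 then show ?thesis unfolding pol_def by blast
qed

lemma pol_sum: "finite A ==> (!!i. i:A ==> pol (w i)) ==> pol (%p. \<Sum>i\<in>A. w i p)"
 by (induction A rule: finite_induct) (auto intro: pol_add)

lemma pol_ev: "pol (ev L)"
 unfolding ev_def[abs_def] by (intro pol_sum finI pol_mult pol_n) auto

lemma power_le_exp:
 fixes \<epsilon> :: real
 assumes "\<epsilon> > 0"
 shows "EX C>=0. ALL x>=0. (1+x)^k <= C * exp (\<epsilon> * x)"
proof (cases "k = 0")
 case True
 then show ?thesis using assms by (intro exI[of _ 1]) auto
next
 case False
 define d where "d = max 1 (real k/\<epsilon>)"
 have d: "d >= 1" "d*(\<epsilon>/real k) >= 1" using assms False by (auto simp: d_def max_def field_simps)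
 have "(1+x)^k <= d^k * exp (\<epsilon> * x)" if "x >= 0" for x
 proof -
  have "1+x <= d*(1+\<epsilon>/real k * x)"
   using d that mult_right_mono[OF d(2) that] by (simp add: algebra_simps)
  also have "... <= d * exp (\<epsilon>/real k * x)" using d exp_ge_add_one_self by (intro mult_left_mono) auto
  finally have "(1+x)^k <= (d * exp (\<epsilon>/real k * x))^k" using that by (intro power_mono) auto
  also have "... = d^k * exp (\<epsilon> * x)" using False
   by (simp add: power_mult_distrib exp_of_nat_mult[symmetric])
  finally show ?thesis .
 qed
 then show ?thesis using d by (intro exI[of _ "d^k"]) auto
qed

text \<open>Half of the margin pays for the polynomial weight, the other half remains.\<close>

lemma good_slack:
 assumes "good L" "pol w"
 shows "EX \<eta>>0. (%p. \<bar>w p\<bar> * exp (\<eta> * sz p-ev L p)) summable_on P"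
proof -
 obtain \<eta> where e: "\<eta> > 0" "(%p. exp (\<eta> * sz p-ev L p)) summable_on P" using assms(1) good_def by auto
 obtain C k where w: "ALL p:P. \<bar>w p\<bar> <= C*(1+sz p)^k" using assms(2) pol_def by auto
 obtain D where D: "D >= 0" "!!x. x >= 0 ==> (1+x)^k <= D * exp (\<eta>/2 * x)"
  using power_le_exp[of "\<eta>/2" k] e by auto
 have "(%p. \<bar>w p\<bar> * exp (\<eta>/2 * sz p-ev L p)) summable_on P"
 proof (rule summable_on_comparison_test[OF summable_on_cmult_right[OF e(2), of "\<bar>C\<bar> * D"]])
  fix p assume p: "p:P"
  have "C*(1+sz p)^k <= \<bar>C\<bar>*(1+sz p)^k" using sz_nonneg[of p] by (intro mult_right_mono) auto
  with w p have "\<bar>w p\<bar> <= \<bar>C\<bar>*(1+sz p)^k" by (metis order_trans)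
  also have "... <= \<bar>C\<bar>*(D * exp (\<eta>/2 * sz p))" using D(2)[OF sz_nonneg] by (intro mult_left_mono) auto
  finally have "\<bar>w p\<bar> * exp (\<eta>/2 * sz p-ev L p) <= (\<bar>C\<bar>*(D * exp (\<eta>/2 * sz p))) * exp (\<eta>/2 * sz p-ev L p)"
   by (intro mult_right_mono) auto
  also have "... = \<bar>C\<bar> * D * exp (\<eta> * sz p-ev L p)" by (simp add: mult.assoc exp_add[symmetric])
  finally show "\<bar>w p\<bar> * exp (\<eta>/2 * sz p-ev L p) <= \<bar>C\<bar> * D * exp (\<eta> * sz p-ev L p)" .
  show "0 <= \<bar>w p\<bar> * exp (\<eta>/2 * sz p-ev L p)" by simp
 qed
 then show ?thesis using e by (intro exI[of _ "\<eta>/2"]) auto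
qed

lemma good_abs_summable:
 assumes "good L" "pol w"
 shows "(%p. \<bar>w p\<bar> * exp (- ev L p)) summable_on P"
proof -
 obtain \<eta> where e: "\<eta> > 0" "(%p. \<bar>w p\<bar> * exp (\<eta> * sz p-ev L p)) summable_on P" using good_slack[OF assms] by auto
 show ?thesis
  by (rule summable_on_comparison_test[OF e(2)]) (use e(1) sz_nonneg in \<open>auto intro!: mult_left_mono\<close>)
qed

lemma good_summable:
 assumes "good L" "pol w"
 shows "(%p. w p * exp (- ev L p)) summable_on P"
 using good_abs_summable[OF assms] by (rule_tac abs_summable_summable) (simp add: abs_mult)

lemma good_near:
 assumes "good L"
 shows "EX \<eta>>0. ALL M. (ALL i:I. \<bar>M i-L i\<bar> <= \<eta>) --> good M"
proof -
 obtain \<eta> where e: "\<eta> > 0" "(%p. exp (\<eta> * sz p-ev L p)) summable_on P" using assms(1) good_def by auto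
 have "good M" if M: "ALL i:I. \<bar>M i-L i\<bar> <= \<eta>/2" for M
 proof -
  have "(%p. exp (\<eta>/2 * sz p-ev M p)) summable_on P"
  proof (rule summable_on_comparison_test[OF e(2)])
   fix p
   have "\<bar>ev M p-ev L p\<bar> <= \<eta>/2 * sz p" using ev_bound[of "%i. M i-L i" "\<eta>/2" p] M by (simp add: ev_diff)
   then show "exp (\<eta>/2 * sz p-ev M p) <= exp (\<eta> * sz p-ev L p)" unfolding exp_le_cancel_iff
    using abs_ge_self[of "ev L p-ev M p"] by (simp add: field_simps abs_minus_commute)
  qed auto
  then show ?thesis using e unfolding good_def by (intro exI[of _ "\<eta>/2"]) auto
 qed
 then show ?thesis using e by (intro exI[of _ "\<eta>/2"]) auto
qed

lemma exp_remainder: "\<bar>exp (- x)-1+x\<bar> <= x\<^sup>2 * exp \<bar>x::real\<bar>"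
proof -
 obtain t where t: "\<bar>t\<bar> <= \<bar>-x\<bar>" "exp (-x) = (\<Sum>m<2. (-x)^m/fact m)+exp t/fact 2*(-x)^2"
  using Maclaurin_exp_le[of "-x" 2] by blast
 have "exp (- x)-1+x = exp t/2 * x\<^sup>2" using t(2) by (simp add: numeral_2_eq_2)
 moreover have "exp t <= exp \<bar>x\<bar>" using t(1) by auto
 ultimately have "\<bar>exp (- x)-1+x\<bar> = exp t/2 * x\<^sup>2" "exp t/2 * x\<^sup>2 <= exp \<bar>x\<bar> * x\<^sup>2"
 proof -
  assume *: "exp (- x)-1+x = exp t/2 * x\<^sup>2" "exp t <= exp \<bar>x\<bar>"
  show "\<bar>exp (- x)-1+x\<bar> = exp t/2 * x\<^sup>2" unfolding *(1) by (rule abs_of_nonneg) simp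
  have "exp t/2 <= exp \<bar>x\<bar>" using *(2) exp_gt_zero[of t] by linarith
  then show "exp t/2 * x\<^sup>2 <= exp \<bar>x\<bar> * x\<^sup>2" by (rule mult_right_mono) simp
 qed
 then show ?thesis by (simp add: mult.commute)
qed

text \<open>A Taylor estimate with quadratic remainder in the finitely many coordinates from
  \<open>I\<close>. It stands in for a derivative of \<open>F w\<close> in \<open>L\<close> as a
  whole: limits along filters and derivatives along parametrized families are read off from it. The
  exponential factor in \<open>exp_remainder\<close> is absorbed by the margin
  \<open>\<eta>1\<close>.\<close>

lemma F_quadratic:
 assumes "good L" "pol w"
 shows "EX K>=0. EX \<eta>>0. ALL M. (ALL i:I. \<bar>M i-L i\<bar> <= \<eta>) -->
  \<bar>F w M-F w L+(\<Sum>i\<in>I. (M i-L i) * F (%p. w p * n p i) L)\<bar> <= K*(\<Sum>i\<in>I. \<bar>M i-L i\<bar>)\<^sup>2"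
proof -
 have p2: "pol (%p. w p*(sz p * sz p))" by (intro pol_mult assms pol_sz)
 obtain \<eta>1 where e1: "\<eta>1 > 0" "(%p. \<bar>w p*(sz p * sz p)\<bar> * exp (\<eta>1 * sz p-ev L p)) summable_on P"
  using good_slack[OF assms(1) p2] by auto
 obtain \<eta>2 where e2: "\<eta>2 > 0" "!!M. (ALL i:I. \<bar>M i-L i\<bar> <= \<eta>2) ==> good M" using good_near[OF assms(1)] by auto
 define K where "K = infsum (%p. \<bar>w p*(sz p * sz p)\<bar> * exp (\<eta>1 * sz p-ev L p)) P"
 have K0: "K >= 0" unfolding K_def by (intro infsum_nonneg) auto
 have "\<bar>F w M-F w L+(\<Sum>i\<in>I. (M i-L i) * F (%p. w p * n p i) L)\<bar> <= K*(\<Sum>i\<in>I. \<bar>M i-L i\<bar>)\<^sup>2"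
  if M: "ALL i:I. \<bar>M i-L i\<bar> <= min \<eta>1 \<eta>2" for M
 proof -
  define S where "S = (\<Sum>i\<in>I. \<bar>M i-L i\<bar>)"
  have S0: "S >= 0" unfolding S_def by (intro sum_nonneg) auto
  let ?d = "%p. ev M p-ev L p"
  have gM: "good M" using e2 M by auto
  have s1: "(%p. w p * exp (- ev M p)) summable_on P" "(%p. w p * exp (- ev L p)) summable_on P"
   using good_summable gM assms by auto
  have s2: "(%p. (w p * n p i) * exp (- ev L p)) summable_on P" if "i:I" for i
   using that by (intro good_summable assms pol_mult pol_n)
  have hs: "((%p. \<Sum>i\<in>I. (M i-L i)*((w p * n p i) * exp (- ev L p))) has_sum
    (\<Sum>i\<in>I. infsum (%p. (M i-L i)*((w p * n p i) * exp (- ev L p))) P)) P"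
   by (rule has_sum_finite_sum[OF finI]) (intro summable_on_cmult_right s2)
  then have s3: "(%p. \<Sum>i\<in>I. (M i-L i)*((w p * n p i) * exp (- ev L p))) summable_on P"
   by (rule has_sum_imp_summable)
  have "(\<Sum>i\<in>I. (M i-L i) * F (%p. w p * n p i) L) = infsum (%p. \<Sum>i\<in>I. (M i-L i)*((w p * n p i) * exp (- ev L p))) P"
   unfolding infsumI[OF hs] F_def by (intro sum.cong refl infsum_cmult_right'[symmetric])
  then have "F w M-F w L+(\<Sum>i\<in>I. (M i-L i) * F (%p. w p * n p i) L)
   = infsum (%p. w p * exp (- ev M p)-w p * exp (- ev L p)+(\<Sum>i\<in>I. (M i-L i)*((w p * n p i) * exp (- ev L p)))) P"
   unfolding F_def using infsumI[OF has_sum_add[OF has_sum_diff[OF has_sum_infsum[OF s1(1)] has_sum_infsum[OF s1(2)]] has_sum_infsum[OF s3]]]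
   by simp
  also have "... = infsum (%p. (w p * exp (- ev L p))*(exp (- ?d p)-1+?d p)) P"
  proof (rule infsum_cong)
   fix p
   have "(\<Sum>i\<in>I. (M i-L i)*((w p * n p i) * exp (- ev L p))) = (w p * exp (- ev L p))*?d p"
    unfolding ev_diff[symmetric] by (simp add: ev_def sum_distrib_left mult_ac)
   moreover have "exp (- ev M p) = exp (- ev L p) * exp (- ?d p)" by (simp add: exp_add[symmetric])
   ultimately show "w p * exp (- ev M p)-w p * exp (- ev L p)+(\<Sum>i\<in>I. (M i-L i)*((w p * n p i) * exp (- ev L p)))
    = (w p * exp (- ev L p))*(exp (- ?d p)-1+?d p)" by (simp add: algebra_simps)
  qed
  finally have eq: "F w M-F w L+(\<Sum>i\<in>I. (M i-L i) * F (%p. w p * n p i) L) = ..." .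
  have bd: "norm ((w p * exp (- ev L p))*(exp (- ?d p)-1+?d p))
    <= S\<^sup>2*(\<bar>w p*(sz p * sz p)\<bar> * exp (\<eta>1 * sz p-ev L p))" for p
  proof -
   have d1: "\<bar>?d p\<bar> <= S * sz p" unfolding ev_diff[symmetric]
    by (rule ev_bound) (auto simp: S_def finI intro: member_le_sum)
   have d2: "\<bar>?d p\<bar> <= \<eta>1 * sz p" unfolding ev_diff[symmetric] by (rule ev_bound) (use M in auto)
   have "\<bar>exp (- ?d p)-1+?d p\<bar> <= (?d p)\<^sup>2 * exp \<bar>?d p\<bar>" by (rule exp_remainder)
   also have "... <= (S * sz p)\<^sup>2 * exp (\<eta>1 * sz p)"
    using d1 d2 by (intro mult_mono) (auto intro!: abs_le_square_iff[THEN iffD1] simp: abs_mult S0 sz_nonneg)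
   finally have "(\<bar>w p\<bar> * exp (- ev L p))*\<bar>exp (- ?d p)-1+?d p\<bar> <= (\<bar>w p\<bar> * exp (- ev L p))*((S * sz p)\<^sup>2 * exp (\<eta>1 * sz p))"
    by (intro mult_left_mono) auto
   then show ?thesis using sz_nonneg[of p]
    by (simp add: abs_mult power_mult_distrib power2_eq_square mult_ac exp_diff exp_minus divide_inverse)
  qed
  have sm: "(%p. S\<^sup>2*(\<bar>w p*(sz p * sz p)\<bar> * exp (\<eta>1 * sz p-ev L p))) summable_on P"
   by (rule summable_on_cmult_right[OF e1(2)])
  have sn: "(%p. norm ((w p * exp (- ev L p))*(exp (- ?d p)-1+?d p))) summable_on P"
   by (rule summable_on_comparison_test[OF sm]) (use bd in auto)
  have "\<bar>infsum (%p. (w p * exp (- ev L p))*(exp (- ?d p)-1+?d p)) P\<bar>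
   <= infsum (%p. norm ((w p * exp (- ev L p))*(exp (- ?d p)-1+?d p))) P"
   using norm_infsum_bound[OF sn] by simp
  also have "... <= infsum (%p. S\<^sup>2*(\<bar>w p*(sz p * sz p)\<bar> * exp (\<eta>1 * sz p-ev L p))) P"
   by (rule infsum_mono[OF sn sm bd])
  also have "... = K * S\<^sup>2" unfolding K_def by (simp add: infsum_cmult_right'[of "S\<^sup>2"] mult.commute)
  finally show ?thesis unfolding eq S_def .
 qed
 then show ?thesis using K0 e1 e2 by (intro exI[of _ K] conjI exI[of _ "min \<eta>1 \<eta>2"]) auto
qed

end

section \<open>Differentiation of exponential sums and of implicit roots\<close>

lemma has_derivative_squeeze_0:
 fixes g R :: "'b::real_normed_vector => real"
 assumes "(g has_derivative (%_. 0)) (at x)" "g x = 0" "R x = 0"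
  and "eventually (%y. \<bar>R y\<bar> <= g y) (at x)"
 shows "(R has_derivative (%_. 0)) (at x)"
proof -
 have g: "((%y. norm (g y-g x-0)/norm (y-x)) \<longlongrightarrow> 0) (at x)"
  using assms(1) by (simp add: has_derivative_iff_norm)
 have "((%y. norm (R y-R x-0)/norm (y-x)) \<longlongrightarrow> 0) (at x)"
 proof (rule Lim_null_comparison[OF _ g])
  show "eventually (%y. norm (norm (R y-R x-0)/norm (y-x)) <= norm (g y-g x-0)/norm (y-x)) (at x)"
   using assms(4) by eventually_elim (auto simp: assms(2,3) intro!: divide_right_mono)
 qed
 then show ?thesis by (simp add: has_derivative_iff_norm)
qed

text \<open>Implicit differentiation from differentiability of \<open>H\<close> at a single point:
  existence and continuity of the solution \<open>k\<close> are supplied from outside.\<close>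

lemma implicit_DERIV:
 fixes H :: "real \<times> real => real"
 assumes H: "(H has_derivative (%z. a * fst z+b * snd z)) (at (t0,k t0))" and "b ~= 0"
  and k: "isCont k t0" and z: "eventually (%t. H (t,k t) = H (t0,k t0)) (at t0)"
 shows "(k has_real_derivative (- a/b)) (at t0)"
proof -
 \<comment> \<open>A Lipschitz constant of \<open>k\<close> at \<open>t0\<close>: once the error is
   below \<open>\<bar>b\<bar>/2\<close> times the increments, half of the term with \<open>b\<close>
   is absorbed on the left.\<close>
 define C where "C = (\<bar>a\<bar>+\<bar>b\<bar>)/(\<bar>b\<bar>/2)"
 have C0: "C >= 0" by (simp add: C_def)
 have *: "EX d>0. ALL t. 0 < \<bar>t-t0\<bar> & \<bar>t-t0\<bar> < d --> \<bar>k t-k t0-(- a/b)*(t-t0)\<bar> <= e*\<bar>t-t0\<bar>"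
  if "e > 0" for e
 proof -
  define e' where "e' = min (\<bar>b\<bar>/2) (e*\<bar>b\<bar>/(1+C))"
  have "1+C > 0" using C0 by simp
  then have "e' > 0" "e'*(1+C) <= e*\<bar>b\<bar>"
   using that \<open>b ~= 0\<close> pos_le_divide_eq[of "1+C" e' "e*\<bar>b\<bar>"] by (auto simp: e'_def)
  moreover have "e' <= \<bar>b\<bar>/2" unfolding e'_def by (rule min.cobounded1)
  ultimately have e': "e' > 0" "e' <= \<bar>b\<bar>/2" "e'*(1+C) <= e*\<bar>b\<bar>" by auto
  obtain d1 where d1: "d1 > 0" "!!y. norm (y-(t0,k t0)) < d1 ==>
   norm (H y-H (t0,k t0)-(a * fst (y-(t0,k t0))+b * snd (y-(t0,k t0)))) <= e' * norm (y-(t0,k t0))"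
   using H e'(1) unfolding has_derivative_at_alt by blast
  obtain d2 where d2: "d2 > 0" "!!t. \<bar>t-t0\<bar> < d2 ==> \<bar>k t-k t0\<bar> < d1/2"
   using k d1(1) unfolding continuous_at_eps_delta dist_real_def by (meson half_gt_zero)
  obtain d3 where d3: "d3 > 0" "!!t. t ~= t0 ==> \<bar>t-t0\<bar> < d3 ==> H (t,k t) = H (t0,k t0)"
   using z unfolding eventually_at dist_real_def by auto
  have "\<bar>k t-k t0-(- a/b)*(t-t0)\<bar> <= e*\<bar>t-t0\<bar>"
   if t: "0 < \<bar>t-t0\<bar>" "\<bar>t-t0\<bar> < min (d1/2) (min d2 d3)" for t
  proof -
   let ?u = "t-t0" and ?v = "k t-k t0"
   have nn: "norm (?u,?v) <= \<bar>?u\<bar>+\<bar>?v\<bar>" using norm_Pair_le[of ?u ?v] by simp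
   moreover have "\<bar>?v\<bar> < d1/2" using d2 t by auto
   ultimately have "norm ((t,k t)-(t0,k t0)) < d1" using t by auto
   from d1(2)[OF this] have "\<bar>a*?u+b*?v\<bar> <= e' * norm (?u,?v)" using d3 t by (auto simp: abs_minus_commute)
   also have "... <= e'*(\<bar>?u\<bar>+\<bar>?v\<bar>)" using nn e' by (intro mult_left_mono) auto
   finally have 1: "\<bar>a*?u+b*?v\<bar> <= e'*(\<bar>?u\<bar>+\<bar>?v\<bar>)" .
   have "\<bar>b\<bar>*\<bar>?v\<bar> <= \<bar>a*?u+b*?v\<bar>+\<bar>a\<bar>*\<bar>?u\<bar>"
    using abs_triangle_ineq4[of "a*?u+b*?v" "a*?u"] by (simp add: abs_mult)
   also have "... <= \<bar>b\<bar>/2*(\<bar>?u\<bar>+\<bar>?v\<bar>)+\<bar>a\<bar>*\<bar>?u\<bar>"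
    using 1 e'(2) mult_right_mono[OF e'(2), of "\<bar>?u\<bar>+\<bar>?v\<bar>"] by linarith
   finally have "\<bar>b\<bar>/2*\<bar>?v\<bar> <= (\<bar>a\<bar>+\<bar>b\<bar>)*\<bar>?u\<bar>"
    unfolding distrib_left distrib_right using mult_nonneg_nonneg[OF abs_ge_zero abs_ge_zero, of b ?u] by linarith
   then have v: "\<bar>?v\<bar> <= C*\<bar>?u\<bar>" using \<open>b ~= 0\<close> by (simp add: C_def field_simps)
   have "b*(?v-(- a/b)*?u) = a*?u+b*?v" using \<open>b ~= 0\<close> by (simp add: field_simps)
   then have "\<bar>b\<bar>*\<bar>?v-(- a/b)*?u\<bar> = \<bar>a*?u+b*?v\<bar>" by (metis abs_mult)
   also have "... <= e'*((1+C)*\<bar>?u\<bar>)"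
   proof -
    have "e'*(\<bar>?u\<bar>+\<bar>?v\<bar>) <= e'*((1+C)*\<bar>?u\<bar>)"
     using v e'(1) by (intro mult_left_mono) (auto simp: distrib_right)
    then show ?thesis using 1 by linarith
   qed
   also have "... <= e*\<bar>b\<bar>*\<bar>?u\<bar>" using mult_right_mono[OF e'(3), of "\<bar>?u\<bar>"] by (simp add: mult_ac)
   finally have "\<bar>b\<bar>*\<bar>?v-(- a/b)*?u\<bar> <= \<bar>b\<bar>*(e*\<bar>?u\<bar>)" by (simp add: mult_ac)
   then show ?thesis using \<open>b ~= 0\<close> by simp
  qed
  then show ?thesis using d1 d2 d3 by (intro exI[of _ "min (d1/2) (min d2 d3)"]) auto
 qed
 show ?thesis unfolding has_field_derivative_def has_derivative_at_alt
 proof (intro conjI allI impI)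
  show "bounded_linear ((*) (- a/b))" by (rule bounded_linear_mult_right)
  fix e :: real assume "e > 0"
  from *[OF this] obtain d where d: "d > 0"
   "!!t. 0 < \<bar>t-t0\<bar> ==> \<bar>t-t0\<bar> < d ==> \<bar>k t-k t0-(- a/b)*(t-t0)\<bar> <= e*\<bar>t-t0\<bar>" by blast
  show "EX d>0. ALL y. norm (y-t0) < d --> norm (k y-k t0 - - a/b*(y-t0)) <= e * norm (y-t0)"
  proof (intro exI[of _ d] conjI allI impI d(1))
   fix y assume "norm (y-t0) < d"
   then show "norm (k y-k t0 - - a/b*(y-t0)) <= e * norm (y-t0)"
    using d(2)[of y] by (cases "y = t0") auto
  qed
 qed
qed

context exp_sums
begin

lemma F_linear:
 assumes "good L" "pol w"
 shows "F (%p. w p * ev v p) L = (\<Sum>i\<in>I. v i * F (%p. w p * n p i) L)"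
proof -
 have s: "(%p. (w p * n p i) * exp (- ev L p)) summable_on P" if "i:I" for i
  using that by (intro good_summable assms pol_mult pol_n)
 have "((%p. \<Sum>i\<in>I. v i*((w p * n p i) * exp (- ev L p))) has_sum
   (\<Sum>i\<in>I. infsum (%p. v i*((w p * n p i) * exp (- ev L p))) P)) P"
  by (rule has_sum_finite_sum[OF finI]) (intro summable_on_cmult_right s)
 then have "infsum (%p. \<Sum>i\<in>I. v i*((w p * n p i) * exp (- ev L p))) P = (\<Sum>i\<in>I. v i * F (%p. w p * n p i) L)"
  unfolding F_def infsum_cmult_right' by (rule infsumI)
 moreover have "(\<Sum>i\<in>I. v i*((w p * n p i) * exp (- ev L p))) = (w p * ev v p) * exp (- ev L p)" for p
  by (simp add: ev_def sum_distrib_left sum_distrib_right mult_ac)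
 ultimately show ?thesis by (simp add: F_def)
qed

lemma F_linear1: "good L ==> F (ev v) L = (\<Sum>i\<in>I. v i * F (%p. n p i) L)"
 using F_linear[of L "%_. 1" v] by simp

text \<open>The filter is arbitrary because limits are taken at interior points, at the ends of
  segments and along the special filter in \<open>near_bound\<close>.\<close>

lemma F_tendsto:
 assumes c: "!!i. i:I ==> ((%y. c y i) \<longlongrightarrow> L i) net" and g: "good L" and w: "pol w"
 shows "((%y. F w (c y)) \<longlongrightarrow> F w L) net" "eventually (%y. good (c y)) net"
proof -
 have near: "eventually (%y. ALL i:I. \<bar>c y i-L i\<bar> <= \<eta>) net" if "\<eta> > 0" for \<eta>
 proof (rule eventually_ball_finite[OF finI, rule_format])
  fix i assume "i:I"
  from tendstoD[OF c[OF this] that] show "eventually (%y. \<bar>c y i-L i\<bar> <= \<eta>) net"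
   by eventually_elim (simp add: dist_real_def)
 qed
 obtain \<eta>' where "\<eta>' > 0" "!!M. (ALL i:I. \<bar>M i-L i\<bar> <= \<eta>') ==> good M" using good_near[OF g] by auto
 with near[of \<eta>'] show "eventually (%y. good (c y)) net" by (auto elim: eventually_mono)
 obtain K \<eta> where K: "K >= 0" "\<eta> > 0" "!!M. (ALL i:I. \<bar>M i-L i\<bar> <= \<eta>) ==>
  \<bar>F w M-F w L+(\<Sum>i\<in>I. (M i-L i) * F (%p. w p * n p i) L)\<bar> <= K*(\<Sum>i\<in>I. \<bar>M i-L i\<bar>)\<^sup>2"
  using F_quadratic[OF g w] by blast
 have "((%y. F w (c y)-F w L) \<longlongrightarrow> 0) net"
 proof (rule Lim_null_comparison)
  show "eventually (%y. norm (F w (c y)-F w L) <= K*(\<Sum>i\<in>I. \<bar>c y i-L i\<bar>)\<^sup>2+\<bar>\<Sum>i\<in>I. (c y i-L i) * F (%p. w p * n p i) L\<bar>) net"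
   using near[OF K(2)] by eventually_elim (use K(3) in \<open>fastforce simp: abs_le_iff\<close>)
  have "((%y. K*(\<Sum>i\<in>I. \<bar>c y i-L i\<bar>)\<^sup>2+\<bar>\<Sum>i\<in>I. (c y i-L i) * F (%p. w p * n p i) L\<bar>) \<longlongrightarrow>
   K*(\<Sum>i\<in>I. \<bar>L i-L i\<bar>)\<^sup>2+\<bar>\<Sum>i\<in>I. (L i-L i) * F (%p. w p * n p i) L\<bar>) net"
   by (intro tendsto_intros c)
  then show "((%y. K*(\<Sum>i\<in>I. \<bar>c y i-L i\<bar>)\<^sup>2+\<bar>\<Sum>i\<in>I. (c y i-L i) * F (%p. w p * n p i) L\<bar>) \<longlongrightarrow> 0) net" by simp
 qed
 then show "((%y. F w (c y)) \<longlongrightarrow> F w L) net" by (rule LIM_zero_cancel)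
qed

lemma F_has_derivative:
 fixes c :: "'b::real_normed_vector => nat => real"
 assumes c: "!!i. i:I ==> ((%y. c y i) has_derivative c' i) (at x)" and g: "good (c x)" and w: "pol w"
 shows "((%y. F w (c y)) has_derivative (%h. - (\<Sum>i\<in>I. c' i h * F (%p. w p * n p i) (c x)))) (at x)"
proof -
 obtain K \<eta> where K: "K >= 0" "\<eta> > 0" "!!M. (ALL i:I. \<bar>M i-c x i\<bar> <= \<eta>) ==>
  \<bar>F w M-F w (c x)+(\<Sum>i\<in>I. (M i-c x i) * F (%p. w p * n p i) (c x))\<bar> <= K*(\<Sum>i\<in>I. \<bar>M i-c x i\<bar>)\<^sup>2"
  using F_quadratic[OF g w] by blast
 define R where "R y = F w (c y)-F w (c x)+(\<Sum>i\<in>I. (c y i-c x i) * F (%p. w p * n p i) (c x))" for y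
 \<comment> \<open>By Cauchy-Schwarz \<open>q\<close> dominates the quadratic remainder. Being a sum
   of squares, it is differentiable by the usual rules, with derivative 0 at
   \<open>x\<close>.\<close>
 define q where "q y = K*(real (card I)*(\<Sum>i\<in>I. (c y i-c x i)\<^sup>2))" for y
 have "(q has_derivative (%h. K*(real (card I)*(\<Sum>i\<in>I. 2*(c' i h*(c x i-c x i)))))) (at x)"
  unfolding q_def by (auto intro!: derivative_eq_intros c)
 then have q: "(q has_derivative (%_. 0)) (at x)" by simp
 have near: "eventually (%y. ALL i:I. \<bar>c y i-c x i\<bar> <= \<eta>) (at x)"
 proof (rule eventually_ball_finite[OF finI, rule_format])
  fix i assume "i:I"
  then have "((%y. c y i) \<longlongrightarrow> c x i) (at x)" using has_derivative_continuous[OF c] by (simp add: isCont_def)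
  from tendstoD[OF this K(2)] show "eventually (%y. \<bar>c y i-c x i\<bar> <= \<eta>) (at x)"
   by eventually_elim (simp add: dist_real_def)
 qed
 have "(R has_derivative (%_. 0)) (at x)"
 proof (rule has_derivative_squeeze_0[OF q])
  show "q x = 0" "R x = 0" by (auto simp: q_def R_def)
  show "eventually (%y. \<bar>R y\<bar> <= q y) (at x)" using near
  proof eventually_elim
   case (elim y)
   have "(\<Sum>i\<in>I. \<bar>c y i-c x i\<bar>)\<^sup>2 <= (\<Sum>i\<in>I. 1\<^sup>2)*(\<Sum>i\<in>I. \<bar>c y i-c x i\<bar>\<^sup>2)"
    using Cauchy_Schwarz_ineq_sum[of "%_. 1" "%i. \<bar>c y i-c x i\<bar>" I] by simp
   then have "K*(\<Sum>i\<in>I. \<bar>c y i-c x i\<bar>)\<^sup>2 <= q y" unfolding q_def using K(1) by (intro mult_left_mono) auto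
   then show ?case using K(3)[OF elim] unfolding R_def by linarith
  qed
 qed
 moreover have "((%y. F w (c x)-(\<Sum>i\<in>I. (c y i-c x i) * F (%p. w p * n p i) (c x))) has_derivative
   (%h. - (\<Sum>i\<in>I. c' i h * F (%p. w p * n p i) (c x)))) (at x)"
  by (auto intro!: derivative_eq_intros c)
 ultimately have "((%y. R y+(F w (c x)-(\<Sum>i\<in>I. (c y i-c x i) * F (%p. w p * n p i) (c x)))) has_derivative
   (%h. 0 + - (\<Sum>i\<in>I. c' i h * F (%p. w p * n p i) (c x)))) (at x)" by (rule has_derivative_add)
 then show ?thesis by (simp add: R_def)
qed

lemma F_DERIV:
 fixes c :: "real => nat => real"
 assumes c: "!!i. i:I ==> ((%y. c y i) has_real_derivative c' i) (at x)" and g: "good (c x)" and w: "pol w"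
 shows "((%y. F w (c y)) has_real_derivative-(\<Sum>i\<in>I. c' i * F (%p. w p * n p i) (c x))) (at x)"
proof -
 have "((%y. F w (c y)) has_derivative (%h. - (\<Sum>i\<in>I. (c' i * h) * F (%p. w p * n p i) (c x)))) (at x)"
  by (rule F_has_derivative) (use c g w in \<open>simp_all add: has_field_derivative_def\<close>)
 moreover have "(%h. - (\<Sum>i\<in>I. (c' i * h) * F (%p. w p * n p i) (c x))) = (*) (- (\<Sum>i\<in>I. c' i * F (%p. w p * n p i) (c x)))"
  by (rule ext) (simp add: sum_distrib_left mult_ac)
 ultimately show ?thesis by (simp add: has_field_derivative_def)
qed

definition root :: "(nat => real) => bool" where "root L \<longleftrightarrow> F (%_. 1) L = 1"

text \<open>A divergent \<open>infsum\<close> has the value 0, which differs from 1; so the equation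
  \<open>root L\<close> contains convergence.\<close>

lemma root_summable: "root L ==> (%p. exp (- ev L p)) summable_on P"
proof (rule ccontr)
 assume r: "root L" and ns: "~ (%p. exp (- ev L p)) summable_on P"
 have "infsum (%p. exp (- ev L p)) P = 0" by (rule infsum_not_exists[OF ns])
 then show False using r by (simp add: root_def F_def)
qed

end

text \<open>\<open>i0\<close> stands for the base edge, which occurs in every loop. It makes the
  series strictly decreasing under scaling even where other coordinates vanish. For graphs,
  \<open>slack\<close> is provided by \<open>exp_slack\<close>.\<close>

locale loop_sums = exp_sums +
 fixes i0 :: nat
 assumes i0: "i0:I" and n_i0: "p:P ==> n p i0 >= 1"
  and slack: "(%p. exp (- ev L p)) summable_on P ==> good L"
begin

text \<open>Length vectors on a closed cell: every edge except the base edge may have length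
  zero.\<close>

definition cone :: "(nat => real) => bool" where "cone c \<longleftrightarrow> (ALL i:I. c i >= 0) & c i0 > 0"

lemma ev_cone: "cone c ==> p:P ==> ev c p >= c i0"
proof -
 assume c: "cone c" "p:P"
 have "c i0 <= n p i0 * c i0" using n_i0[OF c(2)] c(1) mult_right_mono[of 1 "n p i0" "c i0"] by (auto simp: cone_def)
 also have "... <= ev c p" unfolding ev_def
  by (rule member_le_sum) (use c i0 finI n_nonneg in \<open>auto simp: cone_def\<close>)
 finally show ?thesis .
qed

lemma root_good: "root L ==> good L" using root_summable slack by blast

lemma Phi_scale:
 assumes "cone c" "k <= k'" "(%p. exp (- ev (%i. k * c i) p)) summable_on P"
 shows "(%p. exp (- ev (%i. k' * c i) p)) summable_on P"
  "F (%_. 1) (%i. k' * c i) <= exp (- ((k'-k) * c i0)) * F (%_. 1) (%i. k * c i)"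
proof -
 have le: "exp (- ev (%i. k' * c i) p) <= exp (- ((k'-k) * c i0)) * exp (- ev (%i. k * c i) p)" if "p:P" for p
 proof -
  have "(k'-k) * c i0 <= (k'-k) * ev c p" using ev_cone[OF assms(1) that] assms(2) by (intro mult_left_mono) auto
  then show ?thesis unfolding exp_add[symmetric] exp_le_cancel_iff ev_scale by (simp add: algebra_simps)
 qed
 have s: "(%p. exp (- ((k'-k) * c i0)) * exp (- ev (%i. k * c i) p)) summable_on P"
  by (rule summable_on_cmult_right[OF assms(3)])
 show s': "(%p. exp (- ev (%i. k' * c i) p)) summable_on P"
  by (rule summable_on_comparison_test[OF s]) (use le in auto)
 show "F (%_. 1) (%i. k' * c i) <= exp (- ((k'-k) * c i0)) * F (%_. 1) (%i. k * c i)"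
  using infsum_mono[OF s' s le] by (simp add: F_def infsum_cmult_right')
qed

lemma F_cone_pos: "cone c ==> root L ==> F (ev c) L >= c i0"
proof -
 assume c: "cone c" "root L"
 have g: "good L" by (rule root_good[OF c(2)])
 have s: "(%p. c i0 * exp (- ev L p)) summable_on P" "(%p. ev c p * exp (- ev L p)) summable_on P"
  by (intro good_summable g pol_const pol_ev)+
 have "c i0 = infsum (%p. c i0 * exp (- ev L p)) P" using c(2) by (simp add: infsum_cmult_right' root_def F_def)
 also have "... <= F (ev c) L" unfolding F_def
  by (rule infsum_mono[OF s]) (use ev_cone[OF c(1)] in \<open>auto intro!: mult_right_mono\<close>)
 finally show ?thesis .
qed

lemma Phi_gt:
 assumes "cone c" "root (%i. k * c i)" "k' < k" "(%p. exp (- ev (%i. k' * c i) p)) summable_on P"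
 shows "F (%_. 1) (%i. k' * c i) > 1"
proof -
 have "1 <= exp (- ((k-k') * c i0)) * F (%_. 1) (%i. k' * c i)"
  using Phi_scale(2)[OF assms(1) _ assms(4), of k] assms by (simp add: root_def)
 moreover have "exp (- ((k-k') * c i0)) < 1" using assms by (auto simp: cone_def)
 moreover have "exp (- ((k-k') * c i0)) * F (%_. 1) (%i. k' * c i) <= exp (- ((k-k') * c i0))*1"
  if "F (%_. 1) (%i. k' * c i) <= 1" using that by (intro mult_left_mono) auto
 ultimately show ?thesis by fastforce
qed

lemma Phi_lt:
 assumes "cone c" "root (%i. k * c i)" "k < k'"
 shows "F (%_. 1) (%i. k' * c i) < 1" "(%p. exp (- ev (%i. k' * c i) p)) summable_on P"
proof -
 have "F (%_. 1) (%i. k' * c i) <= exp (- ((k'-k) * c i0))"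
  using Phi_scale(2)[OF assms(1) _ root_summable[OF assms(2)], of k'] assms by (simp add: root_def)
 also have "... < 1" using assms by (auto simp: cone_def)
 finally show "F (%_. 1) (%i. k' * c i) < 1" .
 show "(%p. exp (- ev (%i. k' * c i) p)) summable_on P"
  using Phi_scale(1)[OF assms(1) _ root_summable[OF assms(2)], of k'] assms by simp
qed

lemma root_unique: "cone c ==> root (%i. k * c i) ==> root (%i. k' * c i) ==> k = k'"
 by (metis Phi_lt(1) linorder_neqE_linordered_idom order_less_irrefl root_def)

text \<open>Continuity of the normalizing factor, also at degenerate vectors. The series decreases
  in the factor, so its values at two comparison factors on either side of \<open>k0\<close> confine
  \<open>k y\<close>.\<close>

lemma root_tendsto:
 assumes c: "!!i. i:I ==> ((%y. c y i) \<longlongrightarrow> c0 i) net" and c0: "cone c0" "root (%i. k0 * c0 i)"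
  and ev: "eventually (%y. cone (c y) & root (%i. k y * c y i)) net"
 shows "(k \<longlongrightarrow> k0) net"
proof (rule order_tendstoI)
 have tends: "((%y. F (%_. 1) (%i. b * c y i)) \<longlongrightarrow> F (%_. 1) (%i. b * c0 i)) net"
  "eventually (%y. good (%i. b * c y i)) net" if "good (%i. b * c0 i)" for b
  by (rule F_tendsto[OF _ that, of _ net "%_. 1"]; use c in \<open>auto intro!: tendsto_intros\<close>)+
 fix a assume "a < k0"
 obtain \<eta> where e: "\<eta> > 0" "!!M. (ALL i:I. \<bar>M i-k0 * c0 i\<bar> <= \<eta>) ==> good M"
  using good_near[OF root_good[OF c0(2)]] by auto
 define m where "m = 1+(\<Sum>i\<in>I. \<bar>c0 i\<bar>)"
 have m: "m > 0" "!!i. i:I ==> \<bar>c0 i\<bar> <= m"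
 proof -
  show "m > 0" unfolding m_def by (intro add_pos_nonneg sum_nonneg) auto
  fix i assume "i:I"
  then show "\<bar>c0 i\<bar> <= m" unfolding m_def using member_le_sum[of i I "%i. \<bar>c0 i\<bar>"] finI by auto
 qed
 \<comment> \<open>Below \<open>k0\<close> the series may diverge, so \<open>a'\<close> is taken
   close enough to \<open>k0\<close> for \<open>good\<close> to hold there; \<open>m\<close> bounds
   the coordinates of \<open>c0\<close>.\<close>
 define a' where "a' = max a (k0-\<eta>/m)"
 have a': "a <= a'" "a' < k0" "k0-a' <= \<eta>/m" using \<open>a < k0\<close> e m by (auto simp: a'_def)
 have ga: "good (%i. a' * c0 i)"
 proof (rule e(2), intro ballI)
  fix i assume i: "i:I"
  have "\<bar>a' * c0 i-k0 * c0 i\<bar> = (k0-a')*\<bar>c0 i\<bar>" using a' by (simp add: left_diff_distrib[symmetric] abs_mult)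
  also have "... <= \<eta>/m * m" using a' m(2)[OF i] m(1) e by (intro mult_mono) auto
  finally show "\<bar>a' * c0 i-k0 * c0 i\<bar> <= \<eta>" using m by simp
 qed
 have "F (%_. 1) (%i. a' * c0 i) > 1"
  using Phi_gt[OF c0 a'(2)] good_summable[OF ga, of "%_. 1"] by simp
 from order_tendstoD(1)[OF tends(1)[OF ga] this] tends(2)[OF ga] ev
 show "eventually (%y. a < k y) net"
 proof eventually_elim
  case (elim y)
  have "~ k y <= a'"
  proof
   assume le: "k y <= a'"
   have "F (%_. 1) (%i. a' * c y i) <= exp (- ((a'-k y) * c y i0))*1"
    using Phi_scale(2)[OF _ le root_summable] elim by (simp add: root_def)
   also have "... <= 1" using le elim by (auto simp: cone_def)
   finally show False using elim by simp
  qed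
  then show ?case using a' by simp
 qed
next
 have tends: "((%y. F (%_. 1) (%i. b * c y i)) \<longlongrightarrow> F (%_. 1) (%i. b * c0 i)) net"
  "eventually (%y. good (%i. b * c y i)) net" if "good (%i. b * c0 i)" for b
  by (rule F_tendsto[OF _ that, of _ net "%_. 1"]; use c in \<open>auto intro!: tendsto_intros\<close>)+
 fix b assume "k0 < b"
 have gb: "good (%i. b * c0 i)" by (rule slack[OF Phi_lt(2)[OF c0 \<open>k0 < b\<close>]])
 from order_tendstoD(2)[OF tends(1)[OF gb] Phi_lt(1)[OF c0 \<open>k0 < b\<close>]] tends(2)[OF gb] ev
 show "eventually (%y. k y < b) net"
 proof eventually_elim
  case (elim y)
  show ?case
  proof (rule ccontr)
   assume "~ k y < b"
   then have le: "b <= k y" by simp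
   have s: "(%p. exp (- ev (%i. b * c y i) p)) summable_on P" using good_summable[of _ "%_. 1"] elim by simp
   have "1 <= exp (- ((k y-b) * c y i0)) * F (%_. 1) (%i. b * c y i)"
    using Phi_scale(2)[OF _ le s] elim by (simp add: root_def)
   also have "... <= 1 * F (%_. 1) (%i. b * c y i)"
    using le elim by (intro mult_right_mono) (auto simp: cone_def F_def intro!: infsum_nonneg)
   finally show False using elim by simp
  qed
 qed
qed

text \<open>The root equation is an equation for the pair of parameter and factor, to which
  \<open>implicit_DERIV\<close> applies: the derivative in the direction of the factor is nonzero by
  \<open>F_cone_pos\<close>, and continuity of \<open>k\<close> is
  \<open>root_tendsto\<close>.\<close>

lemma root_DERIV:
 fixes c :: "real => nat => real"
 assumes c: "!!i. i:I ==> ((%t. c t i) has_real_derivative c' i) (at t0)"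
  and ev: "eventually (%t. cone (c t) & root (%i. k t * c t i)) (nhds t0)"
 shows "(k has_real_derivative (- (k t0 * F (ev c') (%i. k t0 * c t0 i))/F (ev (c t0)) (%i. k t0 * c t0 i))) (at t0)"
proof -
 let ?L = "%i. k t0 * c t0 i"
 have 0: "cone (c t0)" "root ?L" using eventually_nhds_x_imp_x[OF ev] by auto
 have evat: "eventually (%t. cone (c t) & root (%i. k t * c t i)) (at t0)"
  using ev by (simp add: eventually_nhds_conv_at)
 have g: "good ?L" by (rule root_good[OF 0(2)])
 have k: "isCont k t0" unfolding isCont_def
  by (rule root_tendsto[OF _ 0 evat]) (use c DERIV_isCont isCont_def in blast)
 define H where "H z = F (%_. 1) (%i. snd z * c (fst z) i)" for z
 have "(H has_derivative (%h. - (\<Sum>i\<in>I. (snd h * c t0 i+k t0*(c' i * fst h)) *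
   F (%p. 1 * n p i) (%i. snd (t0,k t0) * c (fst (t0,k t0)) i)))) (at (t0,k t0))"
  unfolding H_def
 proof (rule F_has_derivative)
  fix i assume i: "i:I"
  have "((%t. c t i) has_derivative (%x. c' i * x)) (at (fst (t0,k t0)))" using c[OF i] by (simp add: has_field_derivative_def)
  from has_derivative_compose[OF has_derivative_fst[OF has_derivative_ident] this]
  have 1: "((%z::real\<times>real. c (fst z) i) has_derivative (%h. c' i * fst h)) (at (t0,k t0))" by simp
  show "((%z::real\<times>real. snd z * c (fst z) i) has_derivative (%h. snd h * c t0 i+k t0*(c' i * fst h))) (at (t0,k t0))"
   by (rule derivative_eq_intros 1 refl)+ (auto simp: algebra_simps)
 qed (use g in auto)
 moreover have "- (\<Sum>i\<in>I. (snd h * c t0 i+k t0*(c' i * fst h)) * F (%p. 1 * n p i) ?L)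
  = (- (k t0 * F (ev c') ?L)) * fst h+(- F (ev (c t0)) ?L) * snd h" for h :: "real \<times> real"
  unfolding F_linear1[OF g]
  by (simp add: algebra_simps sum.distrib sum_distrib_left sum_distrib_right sum_negf[symmetric])
 ultimately have H: "(H has_derivative (%h. (- (k t0 * F (ev c') ?L)) * fst h+(- F (ev (c t0)) ?L) * snd h)) (at (t0,k t0))"
  by simp
 have pos: "F (ev (c t0)) ?L > 0" using F_cone_pos[OF 0] 0(1) by (auto simp: cone_def)
 have "(k has_real_derivative (- (- (k t0 * F (ev c') ?L))/(- F (ev (c t0)) ?L))) (at t0)"
 proof (rule implicit_DERIV[OF H _ k])
  show "eventually (%t. H (t,k t) = H (t0,k t0)) (at t0)"
   using evat by eventually_elim (use 0 in \<open>auto simp: H_def root_def\<close>)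
 qed (use pos in auto)
 then show ?thesis by simp
qed

end

section \<open>The Hessian of the normalizing factor on tangent vectors\<close>

context loop_sums
begin

lemma F_vv:
 assumes "good L"
 shows "(\<Sum>e\<in>I. \<Sum>f\<in>I. v e * v f * F (%p. n p f * n p e) L) = F (%p. (ev v p)\<^sup>2) L"
proof -
 have "F (%p. (ev v p)\<^sup>2) L = F (%p. ev v p * ev v p) L" by (simp add: power2_eq_square)
 also have "... = (\<Sum>e\<in>I. v e * F (%p. n p e * ev v p) L)"
  using F_linear[OF assms pol_ev, of v v] by (simp add: mult.commute)
 also have "... = (\<Sum>e\<in>I. v e*(\<Sum>f\<in>I. v f * F (%p. n p e * n p f) L))"
  by (intro sum.cong refl arg_cong2[of _ _ _ _ "(*)"] F_linear[OF assms] pol_n)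
 finally show ?thesis by (simp add: sum_distrib_left mult_ac)
qed

context
 fixes h :: "(nat => real) => real"
 assumes h: "!!l. (ALL i:I. l i > 0) ==> root (%i. h l * l i)"
begin

private abbreviation pos :: "(nat => real) => bool" where "pos l \<equiv> (ALL i:I. l i > 0)"
private abbreviation hl :: "(nat => real) => nat => real" where "hl l \<equiv> (%i. h l * l i)"
private definition N :: "nat => (nat => real) => real" where "N f l = F (%p. n p f) (hl l)"
private definition M :: "(nat => real) => real" where "M l = F (ev l) (hl l)"

private lemma pos_cone: "pos l ==> cone l" using i0 by (auto simp: cone_def less_imp_le)

private lemma M_pos: "pos l ==> M l > 0"
 using F_cone_pos[OF pos_cone h, of l l] i0 unfolding M_def by fastforce

private lemma pos_near: "pos l ==> eventually (%s. pos (l(e := l e+s))) (nhds 0)"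
proof -
 assume l: "pos l"
 have "eventually (%s. ALL i:I. (l(e := l e+s)) i > 0) (nhds (0::real))"
 proof (rule eventually_ball_finite[OF finI, rule_format])
  fix i assume i: "i:I"
  have "((%s. (l(e := l e+s)) i) \<longlongrightarrow> l i) (nhds 0)"
   by (cases "i = e") (auto intro!: tendsto_eq_intros filterlim_ident)
  then show "eventually (%s. (l(e := l e+s)) i > 0) (nhds 0)" using l i by (intro order_tendstoD(1)) auto
 qed
 then show ?thesis .
qed

private lemma h_DERIV:
 assumes l: "pos l" and f: "f:I"
 shows "((%s. h (l(f := l f+s))) has_real_derivative-(h l * N f l)/M l) (at 0)"
proof -
 let ?c = "%s. l(f := l f+s)" and ?c' = "%i. if i = f then 1 else 0"
 have c: "((%t. ?c t i) has_real_derivative ?c' i) (at 0)" for i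
  by (cases "i = f") (auto intro!: derivative_eq_intros)
 have "eventually (%t. cone (?c t) & root (%i. h (?c t)*?c t i)) (nhds 0)"
  using pos_near[OF l] by eventually_elim (use h pos_cone in blast)
 from root_DERIV[OF c this]
 have D: "((%s. h (?c s)) has_real_derivative
   - (h (?c 0) * F (ev ?c') (%i. h (?c 0)*?c 0 i))/F (ev (?c 0)) (%i. h (?c 0)*?c 0 i)) (at 0)" .
 have "?c 0 = l" by auto
 moreover have "ev ?c' = (%p. n p f)" using f finI by (auto simp: ev_def if_distrib sum.delta cong: if_cong)
 ultimately show ?thesis using D by (simp only: N_def M_def)
qed

private lemma h_partial:
 assumes "pos l" "f:I"
 shows "partial_der h f l = - (h l * N f l)/M l"
 unfolding partial_der_def by (rule DERIV_imp_deriv[OF h_DERIV[OF assms]])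

private definition N' :: "nat => nat => (nat => real) => real" where
 "N' f e l = - ((- (h l * N e l)/M l) * F (%p. n p f * ev l p) (hl l)+h l * F (%p. n p f * n p e) (hl l))"

private lemma N_DERIV:
 assumes l: "pos l" and f: "f:I" and e: "e:I"
 shows "((%s. N f (l(e := l e+s))) has_real_derivative N' f e l) (at 0)"
proof -
 let ?c = "%s. l(e := l e+s)" and ?\<kappa> = "- (h l * N e l)/M l"
 let ?d = "%i. ?\<kappa> * l i+h l*(if i = e then 1 else 0)"
 have g: "good (hl l)" by (rule root_good[OF h[OF l]])
 have c0: "?c 0 = l" by auto
 have c: "((%t. h (?c t)*?c t i) has_real_derivative ?d i) (at 0)" for i
  by (cases "i = e") (auto intro!: derivative_eq_intros h_DERIV[OF l e])
 have "((%s. F (%p. n p f) (%i. h (?c s)*?c s i)) has_real_derivative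
   - (\<Sum>i\<in>I. ?d i * F (%p. n p f * n p i) (%i. h (?c 0)*?c 0 i))) (at 0)"
  by (rule F_DERIV[OF c]) (use g c0 pol_n[OF f] in auto)
 then have D: "((%s. N f (?c s)) has_real_derivative-(\<Sum>i\<in>I. ?d i * F (%p. n p f * n p i) (hl l))) (at 0)"
  unfolding N_def c0 .
 have "(\<Sum>i\<in>I. (\<kappa> * l i+h l*(if i = e then 1 else 0)) * F (%p. n p f * n p i) (hl l))
  = (\<Sum>i\<in>I. \<kappa>*(l i * F (%p. n p f * n p i) (hl l))+h l*(if i = e then F (%p. n p f * n p i) (hl l) else 0))" for \<kappa>
  by (intro sum.cong) (auto simp: algebra_simps)
 moreover have "(\<Sum>i\<in>I. \<kappa>*(l i * F (%p. n p f * n p i) (hl l))+h l*(if i = e then F (%p. n p f * n p i) (hl l) else 0)) = \<kappa> * F (%p. n p f * ev l p) (hl l)+h l * F (%p. n p f * n p e) (hl l)" for \<kappa>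
  using F_linear[OF g pol_n[OF f], of l] e finI by (simp add: sum.distrib sum_distrib_left[symmetric] sum.delta)
 ultimately show ?thesis using D by (simp only: N'_def)
qed

text \<open>Only existence is recorded: in the Hessian this derivative multiplies the sum of
  \<open>v f * N f l\<close>, which vanishes for tangent \<open>v\<close>.\<close>

private lemma M_DERIV:
 assumes l: "pos l" and e: "e:I"
 shows "EX D. ((%s. M (l(e := l e+s))) has_real_derivative D) (at 0)"
proof -
 let ?c = "%s. l(e := l e+s)"
 have D: "((%s. \<Sum>i\<in>I. ?c s i * N i (?c s)) has_real_derivative (\<Sum>i\<in>I. (if i = e then 1 else 0) * N i (?c 0)+N' i e l*?c 0 i)) (at 0)"
 proof (rule DERIV_sum)
  fix i assume i: "i:I"
  have "((%t. ?c t i) has_real_derivative (if i = e then 1 else 0)) (at 0)"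
   by (cases "i = e") (auto intro!: derivative_eq_intros)
  then show "((%s. ?c s i * N i (?c s)) has_real_derivative (if i = e then 1 else 0) * N i (?c 0)+N' i e l*?c 0 i) (at 0)"
   using DERIV_mult[OF _ N_DERIV[OF l i e]] by blast
 qed
 have E: "eventually (%s. (\<Sum>i\<in>I. ?c s i * N i (?c s)) = M (?c s)) (nhds 0)"
  using pos_near[OF l, of e]
 proof eventually_elim
  case (elim s)
  show ?case unfolding M_def N_def by (rule F_linear1[OF root_good[OF h[OF elim]], symmetric])
 qed
 show ?thesis using iffD1[OF DERIV_cong_ev[OF refl E refl] D] by (rule exI)
qed

text \<open>The gradient of \<open>h\<close> is a multiple of the vector \<open>N\<close>, to which
  \<open>v\<close> is orthogonal. Among the second derivatives only the terms
  \<open>n p f * n p e\<close> survive; every other term contains the factor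
  \<open>\<Sum>f\<in>I. v f * N f l\<close> or the corresponding sum for \<kappa>, which is a
  multiple of it.\<close>

lemma hess_root:
 assumes l: "pos l" and v: "F (ev v) (%i. h l * l i) = 0"
 shows "(\<Sum>e\<in>I. \<Sum>f\<in>I. v e * v f * partial_der (%m. partial_der h f m) e l)
  = (h l)\<^sup>2 * F (%p. (ev v p)\<^sup>2) (%i. h l * l i)/F (ev l) (%i. h l * l i)"
proof -
 have g: "good (hl l)" by (rule root_good[OF h[OF l]])
 have "ALL e:I. EX D. ((%s. M (l(e := l e+s))) has_real_derivative D) (at 0)" using M_DERIV[OF l] by blast
 then obtain M' where M': "!!e. e:I ==> ((%s. M (l(e := l e+s))) has_real_derivative M' e) (at 0)" by metis
 define \<kappa> where "\<kappa> e = - (h l * N e l)/M l" for e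
 have Mp: "M l > 0" by (rule M_pos[OF l])
 have D2: "partial_der (%m. partial_der h f m) e l = (- (\<kappa> e * M l-h l * M' e)/(M l)\<^sup>2) * N f l-h l/M l * N' f e l"
  if e: "e:I" and f: "f:I" for e f
 proof -
  let ?c = "%s. l(e := l e+s)"
  have c0: "?c 0 = l" by auto
  have ev: "eventually (%s. partial_der h f (?c s) = - (h (?c s) * N f (?c s))/M (?c s)) (nhds 0)"
   using pos_near[OF l] by eventually_elim (use h_partial f in blast)
  have "((%s. - (h (?c s) * N f (?c s))/M (?c s)) has_real_derivative
   ((- (\<kappa> e * N f (?c 0)+N' f e l * h (?c 0))) * M (?c 0)-(- (h (?c 0) * N f (?c 0))) * M' e)/(M (?c 0) * M (?c 0))) (at 0)"
   unfolding \<kappa>_def using Mp c0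
   by (intro DERIV_divide DERIV_minus DERIV_mult h_DERIV[OF l e] N_DERIV[OF l f e] M'[OF e]) auto
  then have "((%s. partial_der h f (?c s)) has_real_derivative
   ((- (\<kappa> e * N f l+N' f e l * h l)) * M l-(- (h l * N f l)) * M' e)/(M l * M l)) (at 0)"
   unfolding c0 using DERIV_cong_ev[OF refl ev refl] by blast
  then have "partial_der (%m. partial_der h f m) e l = ((- (\<kappa> e * N f l+N' f e l * h l)) * M l-(- (h l * N f l)) * M' e)/(M l * M l)"
   unfolding partial_der_def[of "%m. partial_der h f m"] by (rule DERIV_imp_deriv)
  also have "... = (- (\<kappa> e * M l-h l * M' e)/(M l)\<^sup>2) * N f l-h l/M l * N' f e l"
   using Mp by (simp add: field_simps power2_eq_square)
  finally show ?thesis .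
 qed
 have Nv: "(\<Sum>f\<in>I. v f * N f l) = 0" using v F_linear1[OF g, of v] by (simp add: N_def)
 have kv: "(\<Sum>e\<in>I. v e*\<kappa> e) = 0"
 proof -
  have "(\<Sum>e\<in>I. v e*\<kappa> e) = - (h l/M l)*(\<Sum>f\<in>I. v f * N f l)"
   unfolding \<kappa>_def sum_distrib_left by (intro sum.cong) auto
  then show ?thesis using Nv by simp
 qed
 define B where "B f = F (%p. n p f * ev l p) (hl l)" for f
 define A where "A e = - (\<kappa> e * M l-h l * M' e)/(M l)\<^sup>2" for e
 have D2': "partial_der (%m. partial_der h f m) e l = A e * N f l-h l/M l * N' f e l"
  if "e:I" "f:I" for e f using D2[OF that] by (simp only: A_def)
 have N'eq: "N' f e l = - (\<kappa> e * B f+h l * F (%p. n p f * n p e) (hl l))" for f e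
  by (simp only: N'_def \<kappa>_def B_def)
 have "(\<Sum>e\<in>I. \<Sum>f\<in>I. v e * v f * partial_der (%m. partial_der h f m) e l)
  = (\<Sum>e\<in>I. \<Sum>f\<in>I. (v e * A e)*(v f * N f l)+(h l/M l)*((v e*\<kappa> e)*(v f * B f))
    + ((h l)\<^sup>2/M l)*(v e * v f * F (%p. n p f * n p e) (hl l)))"
  by (intro sum.cong refl) (auto simp: D2' N'eq algebra_simps power2_eq_square)
 also have "... = (\<Sum>e\<in>I. v e * A e)*(\<Sum>f\<in>I. v f * N f l)+(h l/M l)*((\<Sum>e\<in>I. v e*\<kappa> e)*(\<Sum>f\<in>I. v f * B f))
    + ((h l)\<^sup>2/M l)*(\<Sum>e\<in>I. \<Sum>f\<in>I. v e * v f * F (%p. n p f * n p e) (hl l))"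
  unfolding sum_product by (simp only: sum.distrib sum_distrib_left)
 also have "... = (h l)\<^sup>2/M l * F (%p. (ev v p)\<^sup>2) (hl l)" using Nv kv F_vv[OF g] by simp
 finally show ?thesis by (simp add: M_def)
qed

end

subsection \<open>Smoothness of normalized segments\<close>

context
 fixes a b :: "nat => real" and k :: "real => real"
 assumes seg: "!!t. t:{0<..<1} ==> cone (%i. a i+t*(b i-a i)) & root (%i. k t*(a i+t*(b i-a i)))"
begin

private abbreviation sg :: "real => nat => real" where "sg t \<equiv> (%i. a i+t*(b i-a i))"
private abbreviation L :: "real => nat => real" where "L t \<equiv> (%i. k t*(a i+t*(b i-a i)))"

private definition k' :: "real => real" where
 "k' t = - (k t * F (ev (%i. b i-a i)) (L t)) * inverse (F (ev (sg t)) (L t))"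

lemma seg_k_DERIV:
 assumes t: "t:{0<..<1}"
 shows "(k has_real_derivative (- (k t * F (ev (%i. b i-a i)) (%i. k t*(a i+t*(b i-a i)))) /
   F (ev (%i. a i+t*(b i-a i))) (%i. k t*(a i+t*(b i-a i))))) (at t)"
proof -
 have "((%t. sg t i) has_real_derivative b i-a i) (at t)" for i by (auto intro!: derivative_eq_intros)
 moreover have "eventually (%t. cone (sg t) & root (%i. k t * sg t i)) (nhds t)"
  using eventually_nhds_in_open[OF open_greaterThanLessThan t] by eventually_elim (use seg in blast)
 ultimately show ?thesis by (rule root_DERIV)
qed

private lemma kD: "t:{0<..<1} ==> (k has_real_derivative k' t) (at t)"
 using seg_k_DERIV by (simp add: k'_def divide_inverse)

private lemma L_DERIV: "t:{0<..<1} ==> ((%t. L t i) has_real_derivative k' t * sg t i+k t*(b i-a i)) (at t)"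
 by (rule derivative_eq_intros kD refl | simp)+

private lemma FL_DERIV:
 assumes "t:{0<..<1}" "pol w"
 shows "((%t. F w (L t)) has_real_derivative
   - (\<Sum>i\<in>I. (k' t * sg t i+k t*(b i-a i)) * F (%p. w p * n p i) (L t))) (at t)"
 by (rule F_DERIV) (use assms L_DERIV root_good seg in auto)

text \<open>An algebra of functions that contains \<open>k\<close> and is closed under
  differentiation on the open unit interval (\<open>sm_deriv\<close>). Smoothness then follows
  without formulas for higher derivatives. \<open>sm_inv\<close> is included because the derivative
  of \<open>k\<close> has this sum as its denominator.\<close>

private inductive sm :: "(real => real) => bool" where
 sm_const: "sm (%t. C)"
| sm_id: "sm (%t. t)"
| sm_k: "sm k"
| sm_F: "pol w ==> sm (%t. F w (L t))"
| sm_inv: "sm (%t. inverse (\<Sum>i\<in>I. sg t i * F (%p. n p i) (L t)))"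
| sm_add: "sm f ==> sm g ==> sm (%t. f t+g t)"
| sm_mult: "sm f ==> sm g ==> sm (%t. f t * g t)"

private lemma sm_sum: "finite A ==> (!!i. i:A ==> sm (f i)) ==> sm (%t. \<Sum>i\<in>A. f i t)"
 by (induction A rule: finite_induct) (auto intro: sm_const sm_add)

private lemma sm_minus: "sm f ==> sm (%t. - f t)"
 using sm_mult[OF sm_const[of "-1"], of f] by simp

private lemma sm_sg: "sm (%t. sg t i)" by (intro sm_add sm_mult sm_const sm_id)

text \<open>Equal to \<open>k'\<close> on the open interval, where linearity of \<open>F\<close> is
  available, and written so that membership in \<open>sm\<close> is immediate.\<close>

private definition kk :: "real => real" where
 "kk t = - (k t*(\<Sum>i\<in>I. (b i-a i) * F (%p. n p i) (L t))) * inverse (\<Sum>i\<in>I. sg t i * F (%p. n p i) (L t))"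

private lemma kk: "t:{0<..<1} ==> k' t = kk t"
 using F_linear1[OF root_good] seg unfolding k'_def kk_def by simp

private lemma sm_kk: "sm kk"
 unfolding kk_def[abs_def] by (intro sm_mult sm_minus sm_sum finI sm_k sm_F sm_inv sm_const pol_n)

private definition dF where
 "dF w t = - (\<Sum>i\<in>I. (kk t * sg t i+k t*(b i-a i)) * F (%p. w p * n p i) (L t))"

private lemma sm_dF: "pol w ==> sm (dF w)"
 unfolding dF_def[abs_def] by (intro sm_minus sm_sum finI sm_mult sm_add sm_kk sm_sg sm_k sm_const sm_F pol_mult pol_n)

private lemma sm_deriv: "sm f ==> EX g. sm g & (ALL t:{0<..<1}. (f has_real_derivative g t) (at t))"
proof (induction rule: sm.induct)
 case (sm_const C)
 show ?case by (rule exI[of _ "%_. 0"]) (auto intro: sm.sm_const)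
next
 case sm_id
 show ?case by (rule exI[of _ "%_. 1"]) (auto intro: sm.sm_const)
next
 case sm_k
 show ?case by (rule exI[of _ kk]) (use kD kk sm_kk in auto)
next
 case (sm_F w)
 have "((%t. F w (L t)) has_real_derivative dF w t) (at t)" if "t:{0<..<1}" for t
  using FL_DERIV[OF that sm_F] kk[OF that] by (simp add: dF_def)
 then show ?case using sm_dF[OF sm_F] by blast
next
 case sm_inv
 let ?S = "%t. \<Sum>i\<in>I. sg t i * F (%p. n p i) (L t)"
 let ?S' = "%t. \<Sum>i\<in>I. (b i-a i) * F (%p. n p i) (L t)+dF (%p. n p i) t * sg t i"
 have D: "((%t. inverse (?S t)) has_real_derivative-(inverse (?S t)*?S' t * inverse (?S t))) (at t)" if t: "t:{0<..<1}" for t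
 proof -
  have "F (ev (sg t)) (L t) = ?S t" using F_linear1[OF root_good] seg[OF t] by simp
  moreover have "F (ev (sg t)) (L t) > 0" using F_cone_pos[of "sg t" "L t"] seg[OF t] by (auto simp: cone_def)
  ultimately have ne: "?S t ~= 0" by simp
  have "(?S has_real_derivative ?S' t) (at t)"
  proof (rule DERIV_sum)
   fix i assume i: "i:I"
   have "((%t. sg t i) has_real_derivative b i-a i) (at t)" by (auto intro!: derivative_eq_intros)
   moreover have "((%t. F (%p. n p i) (L t)) has_real_derivative dF (%p. n p i) t) (at t)"
    using FL_DERIV[OF t pol_n[OF i]] kk[OF t] by (simp add: dF_def)
   ultimately show "((%t. sg t i * F (%p. n p i) (L t)) has_real_derivative
    (b i-a i) * F (%p. n p i) (L t)+dF (%p. n p i) t * sg t i) (at t)" by (rule DERIV_mult)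
  qed
  from DERIV_inverse'[OF this ne] show ?thesis .
 qed
 have "sm (%t. - (inverse (?S t)*?S' t * inverse (?S t)))"
  by (intro sm_minus sm_mult sm.sm_inv sm_sum finI sm_add sm.sm_const sm_F sm_dF sm_sg pol_n)
 with D show ?case by blast
next
 case (sm_add f g)
 then obtain f' g' where "sm f'" "sm g'" "ALL t:{0<..<1}. (f has_real_derivative f' t) (at t)"
  "ALL t:{0<..<1}. (g has_real_derivative g' t) (at t)" by auto
 then show ?case by (intro exI[of _ "%t. f' t+g' t"]) (auto intro: sm.sm_add DERIV_add)
next
 case (sm_mult f g)
 then obtain f' g' where *: "sm f'" "sm g'" "ALL t:{0<..<1}. (f has_real_derivative f' t) (at t)"
  "ALL t:{0<..<1}. (g has_real_derivative g' t) (at t)" by auto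
 have "sm (%t. f' t * g t+g' t * f t)" by (intro sm.sm_add sm.sm_mult * sm_mult)
 moreover have "ALL t:{0<..<1}. ((%t. f t * g t) has_real_derivative f' t * g t+g' t * f t) (at t)"
  using *(3,4) by (intro ballI DERIV_mult) auto
 ultimately show ?case by blast
qed

private lemma sm_smooth: "sm f ==> smooth_on {0<..<1} f"
proof -
 assume f: "sm f"
 have ex: "EX g. sm g & (ALL t:{0<..<1}. (deriv ^^ m) f t = g t)" for m
 proof (induction m)
  case 0
  then show ?case using f by auto
 next
  case (Suc m)
  then obtain g where g: "sm g" "ALL t:{0<..<1}. (deriv ^^ m) f t = g t" by auto
  obtain g' where g': "sm g'" "ALL t:{0<..<1}. (g has_real_derivative g' t) (at t)" using sm_deriv[OF g(1)] by auto
  have "(deriv ^^ Suc m) f t = g' t" if t: "t:{0<..<1}" for t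
  proof -
   have "eventually (%s. (deriv ^^ m) f s = g s) (nhds t)"
    using eventually_nhds_in_open[of "{0<..<1}" t] t g(2) by (auto elim!: eventually_mono)
   from deriv_cong_ev[OF this refl] show ?thesis using g'(2) t DERIV_imp_deriv by force
  qed
  then show ?case using g' by blast
 qed
 show ?thesis unfolding smooth_on_def
 proof (intro allI ballI)
  fix m and t :: real assume t: "t:{0<..<1}"
  obtain g where g: "sm g" "ALL t:{0<..<1}. (deriv ^^ m) f t = g t" using ex by auto
  obtain g' where g': "sm g'" "ALL t:{0<..<1}. (g has_real_derivative g' t) (at t)" using sm_deriv[OF g(1)] by auto
  have ev: "eventually (%s. (deriv ^^ m) f s = g s) (nhds t)"
   using eventually_nhds_in_open[of "{0<..<1}" t] t g(2) by (auto elim!: eventually_mono)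
  have "((deriv ^^ m) f has_real_derivative g' t) (at t)"
   using DERIV_cong_ev[OF refl ev refl] g'(2) t by blast
  then show "(deriv ^^ m) f differentiable (at t)" using real_differentiable_def by blast
 qed
qed

lemma seg_smooth: "smooth_on {0<..<1} (%t. k t*(a i+t*(b i-a i)))"
 by (rule sm_smooth) (intro sm_mult sm_k sm_sg)

lemma seg_DERIV:
 assumes t: "t:{0<..<1}"
 shows "((%t. k t*(a i+t*(b i-a i))) has_real_derivative
  (- (k t * F (ev (%i. b i-a i)) (%i. k t*(a i+t*(b i-a i)))) /
   F (ev (%i. a i+t*(b i-a i))) (%i. k t*(a i+t*(b i-a i))))*(a i+t*(b i-a i))+k t*(b i-a i)) (at t)"
 using L_DERIV[OF t, of i] by (simp add: k'_def divide_inverse)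

end

end

section \<open>Nonbacktracking paths in graphs\<close>

definition nb :: "sgraph => nat => nat => bool" where
 "nb G e f \<longleftrightarrow> e:gE G & f:gE G & gorg G f = tm G e & f ~= gbar G e"

lemma outerD:
 assumes "outer_graph G"
 shows "serre_graph G" "connected_graph G" "v:gV G ==> card {e:gE G. gorg G e = v} >= 3"
 using assms unfolding outer_graph_def by blast+

text \<open>Valence at least 3 leaves an outgoing edge different from the two reversals.\<close>

lemma outer_out2:
 assumes "outer_graph G" "e:gE G" "f:gE G" "tm G e = tm G f"
 shows "EX g. nb G e g & nb G f g"
proof (rule ccontr)
 note sg = outerD(1)[OF assms(1)]
 assume "\<nexists>g. nb G e g & nb G f g"
 then have "{g:gE G. gorg G g = tm G e} <= {gbar G e,gbar G f}" using assms unfolding nb_def by auto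
 then have "card {g:gE G. gorg G g = tm G e} <= card {gbar G e,gbar G f}" by (rule card_mono[rotated]) simp
 also have "... <= 2" by (simp add: card_insert_if)
 finally show False using outerD(3)[OF assms(1) serreD(5)[OF sg assms(2)]] by simp
qed

lemma nb_bar:
 assumes "serre_graph G" "nb G e f"
 shows "nb G (gbar G f) (gbar G e)"
 using assms unfolding nb_def by (auto simp: serreD gbar_eq_iff)

lemma nb_rtrancl_bar:
 assumes "serre_graph G" "(nb G)\<^sup>*\<^sup>* e f"
 shows "(nb G)\<^sup>*\<^sup>* (gbar G f) (gbar G e)"
 using assms(2) by (induction rule: rtranclp_induct) (auto intro: converse_rtranclp_into_rtranclp nb_bar[OF assms(1)])

lemma nb_rtrancl_E: "(nb G)\<^sup>*\<^sup>* e f ==> e:gE G ==> f:gE G"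
 by (induction rule: rtranclp_induct) (auto simp: nb_def)

text \<open>Suppose that \<open>e\<close> does not reach its reversal. Then the set \<open>S\<close>
  of edges reached never contains an edge together with its reversal, so no two edges of
  \<open>S\<close> end at the same vertex: each would reach the reversal of the other. But at least
  two edges of \<open>S\<close> leave every end vertex, whence \<open>S\<close> would have at least
  twice as many elements as it has.\<close>

lemma nb_reach_bar:
 assumes "outer_graph G" "e:gE G"
 shows "(nb G)\<^sup>*\<^sup>* e (gbar G e)"
proof (rule ccontr)
 note sg = outerD(1)[OF assms(1)]
 assume neg: "~ (nb G)\<^sup>*\<^sup>* e (gbar G e)"
 define S where "S = {f. (nb G)\<^sup>*\<^sup>* e f}"
 have SE: "S <= gE G" using nb_rtrancl_E assms(2) by (auto simp: S_def)
 have finS: "finite S" using SE serre_fin(2)[OF sg] finite_subset by blast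
 have cl: "g:S" if "f:S" "nb G f g" for f g using that by (auto simp: S_def)
 have disj: "gbar G f ~: S" if "f:S" for f
  using that neg nb_rtrancl_bar[OF sg, of e f] unfolding S_def by (auto dest: rtranclp_trans)
 have inj: "inj_on (tm G) S"
 proof (rule inj_onI, rule ccontr)
  fix f f' assume f: "f:S" "f':S" "tm G f = tm G f'" "f ~= f'"
  have fE: "f:gE G" "f':gE G" using f SE by auto
  then have "nb G f (gbar G f')" using f(3,4) gbar_eq_iff(1)[OF sg fE] by (simp add: nb_def serreD[OF sg])
  then show False using cl[OF f(1)] disj[OF f(2)] by blast
 qed
 have two: "2 <= card {g:S. gorg G g = w}" if w: "w:tm G ` S" for w
 proof -
  obtain f where f: "f:S" "w = tm G f" using w by auto
  have "{g:gE G. gorg G g = w} <= insert (gbar G f) {g:S. gorg G g = w}"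
   using cl[OF f(1)] f SE by (auto simp: nb_def)
  then have "card {g:gE G. gorg G g = w} <= card (insert (gbar G f) {g:S. gorg G g = w})"
   using finS by (intro card_mono) auto
  also have "... <= Suc (card {g:S. gorg G g = w})" by (rule card_insert_le_m1[THEN order_trans]) (use finS card_insert_if in auto)
  finally show ?thesis using outerD(3)[OF assms(1), of w] serreD(5)[OF sg] f SE by fastforce
 qed
 have "2 * card (tm G ` S) = (\<Sum>w\<in>tm G ` S. 2)" by simp
 also have "... <= (\<Sum>w\<in>tm G ` S. card {g:S. gorg G g = w})" by (rule sum_mono[OF two])
 also have "... = card (\<Union>w\<in>tm G ` S. {g:S. gorg G g = w})"
  by (subst card_UN_disjoint) (use finS in auto)
 also have "... <= card S" by (rule card_mono[OF finS]) auto
 finally have "2 * card S <= card S" by (simp add: card_image[OF inj])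
 then have "S = {}" using finS by simp
 then show False by (auto simp: S_def)
qed

text \<open>Connectedness provides a walk that may backtrack. At each backtracking point
  \<open>nb_reach_bar\<close> supplies a nonbacktracking detour that turns the last edge
  around.\<close>

lemma nb_reach:
 assumes "outer_graph G" "e:gE G" "f:gE G"
 shows "(nb G)\<^sup>*\<^sup>* e f"
proof -
 note sg = outerD(1)[OF assms(1)]
 have step: "(nb G)\<^sup>*\<^sup>* e d" if "(nb G)\<^sup>*\<^sup>* e g" "d:gE G" "gorg G d = tm G g" for g d
 proof (cases "d = gbar G g")
  case True
  then show ?thesis using that nb_reach_bar[OF assms(1) nb_rtrancl_E[OF that(1) assms(2)]] by auto
 next
  case False
  then have "nb G g d" using that nb_rtrancl_E[OF that(1) assms(2)] by (auto simp: nb_def)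
  then show ?thesis using that by auto
 qed
 have walkreach: "EX g. (nb G)\<^sup>*\<^sup>* e g & tm G g = b" if "walk G (gE G) p a b" "EX g. (nb G)\<^sup>*\<^sup>* e g & tm G g = a" for p a b
  using that
 proof (induction p arbitrary: a)
  case (Cons d p)
  then obtain g where g: "(nb G)\<^sup>*\<^sup>* e g" "tm G g = a" by auto
  have "(nb G)\<^sup>*\<^sup>* e d" using step[OF g(1)] Cons.prems(1) g(2) by auto
  then show ?case using Cons by auto
 qed auto
 obtain p where p: "walk G (gE G) p (tm G e) (gorg G f)"
  using bspec[OF bspec[OF outerD(2)[OF assms(1), unfolded connected_graph_def] serreD(5)[OF sg assms(2)]] serreD(1)[OF sg assms(3)]] by (rule exE)
 obtain g where "(nb G)\<^sup>*\<^sup>* e g" "tm G g = gorg G f" using walkreach[OF p] by blast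
 then show ?thesis using step[of g f] assms(3) by simp
qed

lemma rtranclp_path:
 assumes "R\<^sup>*\<^sup>* e f"
 shows "EX p. successively R (e#p) & last (e#p) = f"
 using assms
proof (induction rule: rtranclp_induct)
 case base
 show ?case by (rule exI[of _ "[]"]) auto
next
 case (step y z)
 then obtain p where "successively R (e#p)" "last (e#p) = y" by auto
 then have "successively R (e#p@[z])" "last (e#p@[z]) = z" using step successively_append_iff[of R "e#p" "[z]"] by auto
 then show ?case by blast
qed

lemma nb_strong:
 assumes "outer_graph G" "e:gE G" "f:gE G"
 shows "EX p. p ~= [] & successively (nb G) (e#p) & last p = f"
proof -
 obtain g where g: "nb G e g" using outer_out2[OF assms(1,2,2)] by auto
 then have "(nb G)\<^sup>*\<^sup>* g f" using nb_reach[OF assms(1) _ assms(3)] by (auto simp: nb_def)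
 from rtranclp_path[OF this] obtain p where "successively (nb G) (g#p)" "last (g#p) = f" by blast
 then show ?thesis using g by (intro exI[of _ "g#p"]) auto
qed

lemma walk_reduced_iff:
 assumes "serre_graph G" "p ~= []"
 shows "walk G (gE G) p a b & reduced G p \<longleftrightarrow>
  set p <= gE G & successively (nb G) p & gorg G (hd p) = a & tm G (last p) = b"
 using assms(2)
proof (induction p arbitrary: a)
 case (Cons e p)
 show ?case
 proof (cases "p = []")
  case True
  then show ?thesis by (auto simp: serreD[OF assms(1)])
 next
  case False
  have "walk G (gE G) (e#p) a b & reduced G (e#p) \<longleftrightarrow> e:gE G & gorg G e = a & hd p ~= gbar G e &
   (walk G (gE G) p (tm G e) b & reduced G p)" using False by (auto simp: reduced_Cons)
  also have "... \<longleftrightarrow> set (e#p) <= gE G & successively (nb G) (e#p) & gorg G (hd (e#p)) = a & tm G (last (e#p)) = b"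
   unfolding Cons.IH[OF False] using False hd_in_set[OF False] by (auto simp: successively_Cons nb_def)
  finally show ?thesis .
 qed
qed simp

definition cnt :: "sgraph => nat list => nat => real" where
 "cnt G p i = real (count_list p i+count_list p (gbar G i))"

lemma sum_cnt:
 assumes "serre_graph G" "set p <= gE G"
 shows "(\<Sum>i\<in>gEp G. cnt G p i * L i) = sum_list (map (len G L) p)"
 using assms(2)
proof (induction p)
 case (Cons e p)
 have e: "e:gE G" using Cons by auto
 define j where "j = (if e:gEp G then e else gbar G e)"
 have j: "j:gEp G" "L j = len G L e" using e serre_Ep[OF assms(1) e] by (auto simp: j_def len_def)
 have "cnt G (e#p) i = cnt G p i+(if i = j then 1 else 0)" if i: "i:gEp G" for i
 proof -
  have iE: "i:gE G" using i serre_fin(3)[OF assms(1)] by auto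
  have "e = gbar G i \<longleftrightarrow> gbar G e = i" using gbar_eq_iff(2)[OF assms(1) e iE] by auto
  moreover have "gbar G i ~: gEp G" using serre_Ep[OF assms(1) iE] i by auto
  ultimately show ?thesis using i serreD(3)[OF assms(1) iE] by (auto simp: cnt_def j_def)
 qed
 then have "(\<Sum>i\<in>gEp G. cnt G (e#p) i * L i) = (\<Sum>i\<in>gEp G. cnt G p i * L i+(if i = j then L i else 0))"
  by (intro sum.cong) (auto simp: algebra_simps)
 also have "... = (\<Sum>i\<in>gEp G. cnt G p i * L i)+L j"
  using j(1) serre_fin(5)[OF assms(1)] by (simp add: sum.distrib sum.delta)
 finally show ?case using Cons j by simp
qed (simp add: cnt_def)

locale outer_loops =
 fixes G :: sgraph and e0 :: nat
 assumes og: "outer_graph G" and e0: "e0:gE G"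
begin

lemma sg: "serre_graph G" by (rule outerD(1)[OF og])

sublocale strong_digraph "gE G" "nb G" e0
 by standard (use serre_fin[OF sg] e0 nb_strong[OF og] in \<open>auto simp: nb_def\<close>)

sublocale exp_sums "gEp G" "hit e0" "cnt G"
 by standard (use serre_fin[OF sg] in \<open>auto simp: cnt_def\<close>)

lemma ev_eq: "set p <= gE G ==> ev L p = sum_list (map (len G L) p)"
 unfolding ev_def by (rule sum_cnt[OF sg])

lemma len_1: "len G (%_. c) = (%_. c)" by (auto simp: len_def)

lemma sz_eq: "set p <= gE G ==> sz p = real (length p)"
 unfolding sz_def using sum_cnt[OF sg, of p "%_. 1"] by (simp add: len_1 sum_list_triv)

lemma wt_ev: "set p <= gE G ==> wt (len G L) p = exp (- ev L p)"
 by (simp add: wt_def ev_eq)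

definition i0 :: nat where "i0 = (if e0:gEp G then e0 else gbar G e0)"

lemma len_i0: "len G L e0 = L i0" by (simp add: len_def i0_def)

sublocale loop_sums "gEp G" "hit e0" "cnt G" i0
proof
 show "i0:gEp G" using e0 serre_Ep[OF sg e0] by (auto simp: i0_def)
 fix p assume p: "p:hit e0"
 then have "e0:set p" using hitE by force
 then have "count_list p e0 ~= 0" by (simp add: count_list_0_iff)
 then show "1 <= cnt G p i0" using serreD(4)[OF sg e0] by (simp add: cnt_def i0_def)
next
 fix L assume s: "(%p. exp (- ev L p)) summable_on hit e0"
 have "wt (len G L) summable_on hit e0"
  using s by (rule summable_on_cong[THEN iffD1, rotated]) (simp add: wt_ev hit_set)
 then obtain \<eta> :: real where e: "\<eta> > 0" "(%p. exp (\<eta> * real (length p)) * wt (len G L) p) summable_on hit e0"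
  using exp_slack by blast
 have "(%p. exp (\<eta> * sz p-ev L p)) summable_on hit e0"
  using e(2) by (rule summable_on_cong[THEN iffD1, rotated])
   (simp add: wt_ev hit_set sz_eq exp_diff exp_minus divide_inverse)
 then show "good L" using e(1) unfolding good_def by blast
qed

lemma circ_iff: "p:circ \<longleftrightarrow> based_circuit G p"
proof (cases "p = []")
 case False
 have E: "p:circ ==> set p <= gE G" by (rule circ_set)
 have bc: "based_circuit G p \<longleftrightarrow> (walk G (gE G) p (gorg G (hd p)) (gorg G (hd p)) & reduced G p) & last p ~= gbar G (hd p)"
  using False by (auto simp: based_circuit_def)
 have bar: "last p ~= gbar G (hd p) \<longleftrightarrow> hd p ~= gbar G (last p)" if "set p <= gE G"
 proof -
  have "hd p:gE G" "last p:gE G" using that hd_in_set[OF False] last_in_set[OF False] by blast+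
  then show ?thesis using gbar_eq_iff(2)[OF sg, of "last p" "hd p"] by metis
 qed
 have "p:circ \<longleftrightarrow> set p <= gE G & successively (nb G) p & gorg G (hd p) = tm G (last p) & hd p ~= gbar G (last p)"
  (is "_ \<longleftrightarrow> ?R")
 proof
  assume "p:circ"
  then show ?R using E by (simp add: circ_def nb_def)
 next
  assume R: ?R
  then have "hd p:gE G" "last p:gE G" using hd_in_set[OF False] last_in_set[OF False] by blast+
  then show "p:circ" using R False by (simp add: circ_def nb_def)
 qed
 then show ?thesis unfolding bc walk_reduced_iff[OF sg False] using bar by metis
qed (simp add: circ_def based_circuit_def)

lemma root_wt: "root L \<longleftrightarrow> infsum (wt (len G L)) (hit e0) = 1"
proof -
 have "infsum (wt (len G L)) (hit e0) = infsum (%p. 1 * exp (- ev L p)) (hit e0)"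
  by (rule infsum_cong) (simp add: wt_ev hit_set)
 then show ?thesis by (simp add: root_def F_def)
qed

lemma root_wt_summable: "root L ==> wt (len G L) summable_on hit e0"
 using root_summable[of L] by (rule summable_on_cong[THEN iffD1, rotated]) (simp_all add: wt_ev hit_set)

lemma len_pos: "ALL i:gEp G. l i > 0 ==> e:gE G ==> len G l e > 0"
 using serre_Ep[OF sg] by (auto simp: len_def)

lemma len_scale: "len G (%i. s * l i) = (%e. s * len G l e)" by (auto simp: len_def)

text \<open>The circuits counted by the entropy are the elements of \<open>circ\<close>, so
  \<open>circuit_growth\<close> computes the limit in its definition.\<close>

lemma entropy_eq:
 assumes l: "ALL i:gEp G. l i > 0" and s: "s > 0" and r: "root (%i. s * l i)"
 shows "entropy G l = s"
proof -
 have "((%t. ln (real (card {p:circ. sum_list (map (len G l) p) <= t}))/t) \<longlongrightarrow> s) at_top"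
 proof (rule circuit_growth[OF _ s])
  show "infsum (wt (%e. s * len G l e)) (hit e0) = 1" "wt (%e. s * len G l e) summable_on hit e0"
   using r root_wt[of "%i. s * l i"] root_wt_summable[OF r] by (simp_all add: len_scale)
 qed (use len_pos[OF l] in auto)
 then show ?thesis unfolding entropy_def circuit_count_def circ_iff
  by (intro tendsto_Lim) auto
qed

text \<open>Two loops push the series above 1 at exponent 0, which forces the root to be
  positive.\<close>

lemma two_loops: "EX p q. p:hit e0 & q:hit e0 & p ~= q"
proof -
 have "EX f g. nb G e0 f & nb G e0 g & f ~= g"
 proof (rule ccontr)
  assume neg: "~ ?thesis"
  obtain f where f: "nb G e0 f" using outer_out2[OF og e0 e0] by auto
  have "{g:gE G. gorg G g = tm G e0} <= {gbar G e0,f}" using neg f e0 by (auto simp: nb_def)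
  then have "card {g:gE G. gorg G g = tm G e0} <= card {gbar G e0,f}" by (intro card_mono) auto
  also have "... <= 2" by (simp add: card_insert_if)
  finally show False using outerD(3)[OF og serreD(5)[OF sg e0]] by simp
 qed
 then obtain f g where fg: "nb G e0 f" "nb G e0 g" "f ~= g" by auto
 have "EX p. p:hit e0 & hd p = f" if f: "nb G e0 f" for f
 proof (cases "f = e0")
  case True
  then show ?thesis using f by (intro exI[of _ "[e0]"]) (auto simp: hit_def)
 next
  case False
  obtain p where "p:hit f" using short_path[of f e0] f e0 unfolding hit_def nb_def by blast
  then have "f#p:hit e0" using f False by (auto simp: hit_Cons) (auto simp: hit_def)
  then show ?thesis by (intro exI[of _ "f#p"]) auto
 qed
 from this[OF fg(1)] this[OF fg(2)] fg(3) show ?thesis by metis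
qed

end

section \<open>Existence of the root, and lower bounds for the entropy norm\<close>

context outer_loops
begin

text \<open>The root is the infimum of the exponents with a convergent sum of at most 1. Finite
  partial sums are continuous in the exponent, so the sum is still at most 1 at the infimum; were it
  smaller, \<open>slack\<close> would allow a smaller exponent.\<close>

lemma root_ex:
 assumes l: "ALL i:gEp G. l i > 0"
 shows "EX s>0. root (%i. s * l i)"
proof -
 have lc: "cone l" using l i0 by (auto simp: cone_def less_imp_le)
 define \<Phi> where "\<Phi> s = F (%_. 1) (%i. s * l i)" for s
 let ?sum = "%s. (%p. exp (- ev (%i. s * l i) p)) summable_on hit e0"
 define S where "S = {s. s > 0 & ?sum s & \<Phi> s <= 1}"
 have "S ~= {}"
 proof -
  define k where "k = Min (len G l ` gE G)"
  have ne: "len G l ` gE G ~= {}" using e0 by auto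
  have k: "k > 0" unfolding k_def using finE ne len_pos[OF l] by simp
  have kl: "k <= len G l e" if "e:gE G" for e unfolding k_def using finE that by simp
  define N where "N = real (card (gE G))"
  have N: "N >= 1" using finE e0 card_gt_0_iff[of "gE G"] by (auto simp: N_def Suc_le_eq)
  \<comment> \<open>There are at most \<open>N^n\<close> loops with \<open>n\<close> edges, each of
    weight at most \<open>exp (- (s * k))^n\<close>. This \<open>s\<close> makes the ratio 1/3, and
    the sum of \<open>(1/3)^n\<close> over positive \<open>n\<close> is below 1.\<close>
  define s where "s = ln (3 * N)/k"
  have s: "s > 0" using k N by (simp add: s_def)
  have sk: "N * exp (- (s * k)) = 1/3" using k N by (simp add: s_def exp_minus field_simps)
  have b: "hitsum (len G (%i. s * l i)) n e0 <= (1/3)^n" for n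
  proof -
   have "hitsum (len G (%i. s * l i)) n e0 <= (\<Sum>p\<in>{p:hit e0. length p = n}. exp (- (s * k))^n)"
    unfolding hitsum_def
   proof (rule sum_mono)
    fix p assume p: "p:{p:hit e0. length p = n}"
    have "set p <= gE G" using p hit_set by auto
    then have "sum_list (map (len G l) p) >= real (length p) * k"
     by (induction p) (auto simp: algebra_simps intro: add_mono kl)
    then have "s*(real n * k) <= s * sum_list (map (len G l) p)" using p s by (intro mult_left_mono) auto
    then show "wt (len G (%i. s * l i)) p <= exp (- (s * k))^n"
     by (simp add: wt_def len_scale sum_list_const_mult exp_of_nat_mult[symmetric] algebra_simps)
   qed
   also have "... = real (card {p:hit e0. length p = n}) * exp (- (s * k))^n" by simp
   also have "... <= N^n * exp (- (s * k))^n"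
   proof (rule mult_right_mono)
    have "card {p:hit e0. length p = n} <= card {p. set p <= gE G & length p = n}"
     by (rule card_mono[OF finite_lists_length_eq[OF finE]]) (use hit_set in auto)
    also have "... = card (gE G)^n" by (rule card_lists_length_eq[OF finE])
    finally show "real (card {p:hit e0. length p = n}) <= N^n" unfolding N_def by (metis of_nat_le_iff of_nat_power)
   qed simp
   also have "... = (1/3)^n" by (simp add: power_mult_distrib[symmetric] sk)
   finally show ?thesis .
  qed
  let ?h = "%n. hitsum (len G (%i. s * l i)) n e0"
  have sg3: "summable (%n. (1/3::real)^n)" by (rule summable_geometric) simp
  have sh: "summable ?h" by (rule summable_comparison_test'[OF sg3, of 0]) (use b hitsum_nonneg in auto)
  have "suminf ?h = (\<Sum>n. ?h (n+1))" using suminf_split_head[OF sh] hitsum_0 by simp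
  also have "... <= (\<Sum>n. (1/3)^(n+1))"
   by (intro suminf_le b summable_ignore_initial_segment sh sg3)
  also have "... = (1/3)*(\<Sum>n. (1/3)^n)" using suminf_mult[OF sg3, of "1/3"] by simp
  also have "... <= 1" by (simp add: suminf_geometric)
  finally have le: "suminf ?h <= 1" .
  note sl = summable_on_slices[OF finite_slice _ sh[unfolded hitsum_def]]
  have 1: "wt (len G (%i. s * l i)) summable_on hit e0" by (rule sl(1)) (simp add: wt_pos less_imp_le)
  have 2: "infsum (wt (len G (%i. s * l i))) (hit e0) <= 1"
   using sl(2) le by (simp add: wt_pos less_imp_le hitsum_def)
  have "?sum s" using 1 by (rule summable_on_cong[THEN iffD1, rotated]) (simp add: wt_ev hit_set)
  moreover have "\<Phi> s = infsum (wt (len G (%i. s * l i))) (hit e0)"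
   unfolding \<Phi>_def F_def by (rule infsum_cong) (simp add: wt_ev hit_set)
  ultimately have "s:S" using s 2 by (simp add: S_def)
  then show ?thesis by auto
 qed
 define s0 where "s0 = Inf S"
 have bdd: "bdd_below S" by (rule bdd_belowI[of _ 0]) (auto simp: S_def)
 have s0: "0 <= s0" unfolding s0_def using \<open>S ~= {}\<close> by (intro cInf_greatest) (auto simp: S_def)
 have fin: "(\<Sum>p\<in>X. exp (- (s0 * ev l p))) <= 1" if X: "finite X" "X <= hit e0" for X
 proof (rule ccontr)
  assume gt: "~ ?thesis"
  have "((%s. \<Sum>p\<in>X. exp (- (s * ev l p))) \<longlongrightarrow> (\<Sum>p\<in>X. exp (- (s0 * ev l p)))) (at s0)"
   by (intro tendsto_intros)
  then have "eventually (%s. (\<Sum>p\<in>X. exp (- (s * ev l p))) > 1) (at s0)" using gt by (intro order_tendstoD(1)) auto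
  then obtain d where d: "d > 0" "!!s. s ~= s0 ==> dist s s0 < d ==> (\<Sum>p\<in>X. exp (- (s * ev l p))) > 1"
   unfolding eventually_at by auto
  obtain s where s: "s:S" "s < s0+d" using cInf_lessD[OF \<open>S ~= {}\<close>, of "s0+d"] d(1) by (auto simp: s0_def)
  have "s0 <= s" unfolding s0_def using s bdd by (intro cInf_lower)
  then have "(\<Sum>p\<in>X. exp (- (s * ev l p))) > 1" using d(2)[of s] s(2) gt by (cases "s = s0") (auto simp: dist_real_def)
  moreover have "(\<Sum>p\<in>X. exp (- (s * ev l p))) <= \<Phi> s"
   unfolding \<Phi>_def F_def using s(1) X
   by (intro order_trans[OF _ finite_sum_le_infsum[of _ _ X]]) (auto simp: S_def ev_scale)
  ultimately show False using s(1) by (simp add: S_def)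
 qed
 have sm: "?sum s0"
  unfolding ev_scale
  by (rule nonneg_bdd_above_summable_on) (use fin in \<open>auto intro!: bdd_aboveI[of _ 1]\<close>)
 have le1: "\<Phi> s0 <= 1" unfolding \<Phi>_def F_def
  using infsum_le_finite_sums[OF sm, of 1] fin by (simp add: ev_scale)
 have "s0 ~= 0"
 proof
  assume "s0 = 0"
  obtain p q where "p:hit e0" "q:hit e0" "p ~= q" using two_loops by auto
  then show False using fin[of "{p,q}"] \<open>s0 = 0\<close> by simp
 qed
 then have s0p: "s0 > 0" using s0 by simp
 have g: "good (%i. s0 * l i)" by (rule slack[OF sm])
 have "\<Phi> s0 = 1"
 proof (rule ccontr)
  assume "\<Phi> s0 ~= 1"
  then have lt: "\<Phi> s0 < 1" using le1 by simp
  have t: "((%s. s * l i) \<longlongrightarrow> s0 * l i) (at s0)" for i by (intro tendsto_intros)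
  have "(\<Phi> \<longlongrightarrow> \<Phi> s0) (at s0)" unfolding \<Phi>_def by (rule F_tendsto(1)[OF t g]) simp
  from order_tendstoD(2)[OF this lt] have 1: "eventually (%s. \<Phi> s < 1) (at s0)" .
  have 2: "eventually (%s. good (%i. s * l i)) (at s0)" by (rule F_tendsto(2)[OF t g, of "%_. 1"]) simp
  have "eventually (%s. \<Phi> s < 1 & good (%i. s * l i)) (at s0)" using 1 2 by eventually_elim simp
  then obtain d where d: "d > 0" "!!s. s ~= s0 ==> dist s s0 < d ==> \<Phi> s < 1 & good (%i. s * l i)"
   unfolding eventually_at by auto
  define s where "s = max (s0/2) (s0-d/2)"
  have s: "s > 0" "s < s0" "dist s s0 < d" using s0p d(1) by (auto simp: s_def dist_real_def)
  have "s:S" using d(2)[of s] s good_summable[of "%i. s * l i" "%_. 1"] by (auto simp: S_def)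
  then have "s0 <= s" unfolding s0_def using bdd by (intro cInf_lower)
  then show False using s by simp
 qed
 then show ?thesis using s0p unfolding root_def \<Phi>_def by blast
qed

lemma entropy_root:
 assumes "ALL i:gEp G. l i > 0"
 shows "root (%i. entropy G l * l i)" "entropy G l > 0"
 using root_ex[OF assms] entropy_eq[OF assms] by auto

lemma entropy_1_iff:
 assumes "ALL i:gEp G. l i > 0"
 shows "entropy G l = 1 \<longleftrightarrow> root l"
 using entropy_root(1)[OF assms] entropy_eq[OF assms, of 1] by auto

lemma hess_form_eq:
 assumes l: "ALL i:gEp G. l i > 0" "root l" and v: "F (ev v) l = 0"
 shows "hess_form G l v = F (%p. (ev v p)\<^sup>2) l/F (ev l) l"
proof -
 have h1: "entropy G l = 1" using entropy_1_iff[OF l(1)] l(2) by simp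
 show ?thesis unfolding hess_form_def
  using hess_root[of "entropy G" l v, OF entropy_root(1) l(1)] v by (simp add: h1)
qed

lemma hess_form_nonneg:
 assumes l: "ALL i:gEp G. l i > 0" "root l" and v: "F (ev v) l = 0"
 shows "hess_form G l v >= 0"
proof -
 have "cone l" using l i0 by (auto simp: cone_def less_imp_le)
 from F_cone_pos[OF this l(2)] have "F (ev l) l >= 0" using l i0 by force
 moreover have "F (%p. (ev v p)\<^sup>2) l >= 0" unfolding F_def by (intro infsum_nonneg) auto
 ultimately show ?thesis unfolding hess_form_eq[OF assms] by simp
qed

definition (in -) mean_const :: "nat => real => real" where
 "mean_const N m = (\<Sum>n. real n*(1-exp (- (2 * real N * m)))^((n-1) div N))"

text \<open>Under the root, \<open>m * mean_const N m\<close> bounds the denominator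
  \<open>F (ev l) l\<close> of the Hessian, and the exponential bounds the reciprocal weight of a
  loop with at most \<open>2 * N + 1\<close> edges. The factor 6 comes from
  \<open>edge_bound_from_loops\<close>.\<close>

definition (in -) lower_const :: "nat => real => real" where
 "lower_const N m = 6 * sqrt (m * mean_const N m * exp (real (2 * N+1) * m))"

text \<open>The numerator of the Hessian is a series of nonnegative terms, so it dominates the
  single term of the loop \<open>p\<close>.\<close>

lemma loop_bound:
 assumes l: "ALL i:gEp G. l i > 0" "root l" and v: "F (ev v) l = 0"
  and m: "m >= 0" "ALL i:gEp G. l i <= m" and N: "card (gE G) <= N"
  and p: "p:hit e0" "length p <= 2 * N+1"
 shows "6*\<bar>ev v p\<bar> <= lower_const N m * sqrt (hess_form G l v)"
proof -
 have "0 < card (gE G)" using finE e0 card_gt_0_iff by blast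
 then have Np: "N > 0" using N by simp
 have lm: "len G l e <= m" if "e:gE G" for e
  using m(2) that serre_Ep[OF sg that] by (auto simp: len_def)
 have pm: "ev l q <= m * real (length q)" if "set q <= gE G" for q
  unfolding ev_eq[OF that] using that by (induction q) (auto simp: algebra_simps intro: add_mono lm)
 have g: "good l" by (rule root_good[OF l(2)])
 have s2: "(%q. (ev v q)\<^sup>2 * exp (- ev l q)) summable_on hit e0"
  using good_summable[OF g pol_mult[OF pol_ev pol_ev], of v v] by (simp add: power2_eq_square)
 have s1: "(%q. ev l q * exp (- ev l q)) summable_on hit e0" by (rule good_summable[OF g pol_ev])
 note ml = mean_length_bound[OF Np m(1) root_wt_summable[OF l(2)] _ N lm]
 have one: "infsum (wt (len G l)) (hit e0) = 1" using root_wt l(2) by simp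
 have ms: "(%q. real (length q) * wt (len G l) q) summable_on hit e0"
  "infsum (%q. real (length q) * wt (len G l) q) (hit e0) <= mean_const N m"
  using ml[OF one] unfolding mean_const_def by auto
 have "F (ev l) l <= infsum (%q. m*(real (length q) * wt (len G l) q)) (hit e0)"
  unfolding F_def
 proof (rule infsum_mono[OF s1 summable_on_cmult_right[OF ms(1)]])
  fix q assume "q:hit e0"
  then have q: "set q <= gE G" by (rule hit_set)
  show "ev l q * exp (- ev l q) <= m*(real (length q) * wt (len G l) q)"
   unfolding wt_ev[OF q] mult.assoc[symmetric] using pm[OF q] by (intro mult_right_mono) auto
 qed
 also have "... <= m * mean_const N m" unfolding infsum_cmult_right' using ms(2) m(1) by (rule mult_left_mono)
 finally have \<Lambda>: "F (ev l) l <= m * mean_const N m" .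
 have "cone l" using l i0 by (auto simp: cone_def less_imp_le)
 from F_cone_pos[OF this l(2)] have \<Lambda>0: "F (ev l) l > 0" using l i0 by force
 have pE: "set p <= gE G" by (rule hit_set[OF p(1)])
 have "(ev v p)\<^sup>2 * exp (- ev l p) <= F (%q. (ev v q)\<^sup>2) l"
  unfolding F_def using finite_sum_le_infsum[OF s2, of "{p}"] p(1) by simp
 also have "... = hess_form G l v * F (ev l) l" using \<Lambda>0 by (simp add: hess_form_eq[OF l v])
 also have "... <= hess_form G l v * (m * mean_const N m)"
  using \<Lambda> hess_form_nonneg[OF l v] by (intro mult_left_mono)
 finally have "(ev v p)\<^sup>2 <= hess_form G l v * (m * mean_const N m) * exp (ev l p)"
  by (simp add: exp_minus field_simps)
 also have "... <= hess_form G l v * (m * mean_const N m) * exp (real (2 * N+1) * m)"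
 proof (rule mult_left_mono)
  have "ev l p <= m * real (length p)" by (rule pm[OF pE])
  also have "... <= m * real (2 * N+1)" using p(2) m(1) by (intro mult_left_mono) (simp_all only: of_nat_le_iff)
  finally show "exp (ev l p) <= exp (real (2 * N+1) * m)" by (simp add: mult.commute)
  show "0 <= hess_form G l v * (m * mean_const N m)"
   using mult_nonneg_nonneg[OF hess_form_nonneg[OF l v], of "m * mean_const N m"] \<Lambda> \<Lambda>0 by linarith
 qed
 finally have "sqrt ((ev v p)\<^sup>2) <= sqrt ((m * mean_const N m * exp (real (2 * N+1) * m)) * hess_form G l v)"
  by (intro real_sqrt_le_mono) (simp add: mult_ac)
 then show ?thesis by (simp add: lower_const_def real_sqrt_mult)
qed

lemma len_bar: "e:gE G ==> len G v (gbar G e) = len G v e"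
 using serre_Ep[OF sg, of e] serreD(4)[OF sg, of e] by (auto simp: len_def)

text \<open>Let \<open>\<phi> e\<close> be the value of \<open>v\<close> along a short path from
  \<open>e0\<close> to \<open>e\<close>. Closing up by short return paths shows that a
  nonbacktracking step to \<open>f\<close> changes \<phi> by the value of \<open>v\<close> at
  \<open>f\<close> up to \<open>2*\<beta>\<close>, and that edges with a common end vertex have
  \<phi> within \<open>4*\<beta>\<close>. So the value of \<open>v\<close> at \<open>d\<close> is
  within \<open>6*\<beta>\<close> of the difference of \<phi> at \<open>d\<close> and at its
  reversal. For the reversed edge this difference changes sign while the value of \<open>v\<close>
  does not, and combining the two estimates leaves \<open>6*\<beta>\<close>.\<close>

lemma edge_bound_from_loops:
 assumes \<beta>: "!!p. p:hit e0 ==> length p <= 2 * card (gE G)+1 ==> \<bar>ev v p\<bar> <= \<beta>" and b: "b:gE G"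
 shows "\<bar>len G v b\<bar> <= 6*\<beta>"
proof -
 let ?N = "card (gE G)"
 have "ALL e:gE G. EX p. successively (nb G) (e0#p) & last (e0#p) = e & e0 ~: set p & length p <= ?N"
 proof
  fix e assume e: "e:gE G"
  show "EX p. successively (nb G) (e0#p) & last (e0#p) = e & e0 ~: set p & length p <= ?N"
  proof (cases "e = e0")
   case True
   then show ?thesis by (intro exI[of _ "[]"]) auto
  next
   case False
   obtain p where p: "p ~= []" "successively (nb G) (e0#p)" "last p = e" "length p <= ?N" "e0 ~: set (butlast p)"
    using short_path[OF e0 e] by blast
   have "set p = insert e (set (butlast p))" using append_butlast_last_id[OF p(1)] p(3)
    by (metis Un_commute insert_is_Un list.simps(15) set_append empty_set)
   then show ?thesis using p False by (intro exI[of _ p]) auto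
  qed
 qed
 then obtain \<alpha> where al: "!!e. e:gE G ==> successively (nb G) (e0#\<alpha> e) & last (e0#\<alpha> e) = e & e0 ~: set (\<alpha> e) & length (\<alpha> e) <= ?N"
  by metis
 have "ALL e:gE G. EX q. q:hit e & length q <= ?N"
  using short_path[OF _ e0] unfolding hit_def by blast
 then obtain \<omega> where om: "!!e. e:gE G ==> \<omega> e:hit e & length (\<omega> e) <= ?N" by metis
 define V where "V p = sum_list (map (len G v) p)" for p
 have Vapp: "V (p@q) = V p+V q" "V [] = 0" "V (e#p) = len G v e+V p" for p q e by (auto simp: V_def)
 have Vb: "\<bar>V p\<bar> <= \<beta>" if "p:hit e0" "length p <= 2*?N+1" for p
  using \<beta>[OF that] ev_eq[OF hit_set[OF that(1)]] by (simp add: V_def)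
 have \<beta>0: "0 <= \<beta>"
 proof -
  have "\<omega> e0:hit e0" "length (\<omega> e0) <= 2*?N+1" using om[OF e0] by auto
  from Vb[OF this] show ?thesis by linarith
 qed
 define \<phi> where "\<phi> e = V (\<alpha> e)" for e
 have \<alpha>0: "\<alpha> e0 = []" using al[OF e0] by (metis last_ConsR last_in_set)
 have cat: "\<alpha> e@q:hit e0" if "e:gE G" "q:hit e" for e q
 proof -
  have q: "q ~= []" "successively (nb G) (e#q)" "last q = e0" "e0 ~: set (butlast q)" using that by (auto simp: hit_def)
  show ?thesis
  proof (cases "\<alpha> e = []")
   case True
   then show ?thesis using al[OF that(1)] that by auto
  next
   case False
   have "e0#\<alpha> e = (e0#butlast (\<alpha> e))@[e]" using al[OF that(1)] False append_butlast_last_id[OF False] by simp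
   then have "successively (nb G) ((e0#butlast (\<alpha> e))@e#q)" using successively_join al[OF that(1)] q(2) by metis
   also have "(e0#butlast (\<alpha> e))@e#q = e0#\<alpha> e@q" using \<open>e0 # \<alpha> e = _\<close> by simp
   finally show ?thesis using q al[OF that(1)] by (auto simp: hit_def butlast_append)
  qed
 qed
 have step: "\<bar>\<phi> e+len G v f-\<phi> f\<bar> <= 2*\<beta>" if ef: "nb G e f" for e f
 proof -
  have E: "e:gE G" "f:gE G" using ef by (auto simp: nb_def)
  show ?thesis
  proof (cases "f = e0")
   case True
   have "[e0]:hit e" using ef True by (auto simp: hit_def)
   then have "\<bar>V (\<alpha> e@[e0])\<bar> <= \<beta>" using cat[OF E(1)] al[OF E(1)] by (intro Vb) auto
   then show ?thesis using True \<alpha>0 \<beta>0 by (simp add: Vapp \<phi>_def)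
  next
   case False
   have "f#\<omega> f:hit e" using ef False om[OF E(2)] by (auto simp: hit_Cons) (auto simp: hit_def)
   then have 1: "\<bar>V (\<alpha> e@f#\<omega> f)\<bar> <= \<beta>" using cat[OF E(1)] al[OF E(1)] om[OF E(2)] by (intro Vb) auto
   have 2: "\<bar>V (\<alpha> f@\<omega> f)\<bar> <= \<beta>" using cat[OF E(2)] al[OF E(2)] om[OF E(2)] by (intro Vb) auto
   show ?thesis using 1 2 by (simp add: Vapp \<phi>_def)
  qed
 qed
 have same: "\<bar>\<phi> a-\<phi> a'\<bar> <= 4*\<beta>" if a: "a:gE G" "a':gE G" "tm G a = tm G a'" for a a'
 proof -
  obtain g where "nb G a g" "nb G a' g" using outer_out2[OF og a] by auto
  from step[OF this(1)] step[OF this(2)] show ?thesis by linarith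
 qed
 have half: "\<bar>len G v d-(\<phi> d-\<phi> (gbar G d))\<bar> <= 6*\<beta>" if d: "d:gE G" for d
 proof -
  have bd: "gbar G d:gE G" "tm G (gbar G d) = gorg G d" by (auto simp: serreD[OF sg d])
  obtain g where "nb G (gbar G d) g" "g ~= d"
  proof -
   have "nb G (gbar G d) g ==> g ~= d" for g using serreD(4)[OF sg d] by (auto simp: nb_def)
   then show ?thesis using that outer_out2[OF og bd(1) bd(1)] by blast
  qed
  then have gE: "g:gE G" "gorg G g = gorg G d" using bd by (auto simp: nb_def)
  have "nb G (gbar G g) d" using gE d \<open>g ~= d\<close> by (auto simp: nb_def serreD[OF sg])
  from step[OF this] have 1: "\<bar>\<phi> (gbar G g)+len G v d-\<phi> d\<bar> <= 2*\<beta>" .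
  have "\<bar>\<phi> (gbar G g)-\<phi> (gbar G d)\<bar> <= 4*\<beta>"
   by (rule same) (use gE d in \<open>auto simp: serreD[OF sg]\<close>)
  with 1 show ?thesis by linarith
 qed
 have "\<bar>len G v b-(\<phi> b-\<phi> (gbar G b))\<bar> <= 6*\<beta>" by (rule half[OF b])
 moreover have "\<bar>len G v b-(\<phi> (gbar G b)-\<phi> b)\<bar> <= 6*\<beta>"
  using half[OF serreD(2)[OF sg b]] by (simp add: serreD[OF sg b] len_bar[OF b])
 ultimately show ?thesis by linarith
qed

lemma hess_lower_bound:
 assumes l: "ALL i:gEp G. l i > 0" "root l" and v: "F (ev v) l = 0"
  and m: "m >= 0" "ALL i:gEp G. l i <= m" and N: "card (gE G) <= N" and b: "b:gEp G"
 shows "\<bar>v b\<bar> <= lower_const N m * sqrt (hess_form G l v)"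
proof -
 have bE: "b:gE G" using b serre_fin(3)[OF sg] by auto
 have "\<bar>len G v b\<bar> <= 6*(lower_const N m * sqrt (hess_form G l v)/6)"
 proof (rule edge_bound_from_loops[OF _ bE])
  fix p assume p: "p:hit e0" "length p <= 2 * card (gE G)+1"
  have "length p <= 2 * N+1" using p(2) N by linarith
  from loop_bound[OF l v m N p(1) this] show "\<bar>ev v p\<bar> <= lower_const N m * sqrt (hess_form G l v)/6" by linarith
 qed
 then show ?thesis using b by (simp add: len_def)
qed

end

section \<open>Collapses\<close>

text \<open>A connected subgraph with edges \<open>F\<close> on the vertices \<open>X\<close>. One
  descending edge \<open>\<epsilon> v\<close> for each vertex other than the root, together with the
  reversals, forms a spanning tree \<open>T\<close>. Comparison with \<open>T\<close> shows that the
  edge count of a tree is equivalent to the absence of nonempty reduced closed paths.\<close>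

locale subgr =
 fixes G :: sgraph and F X :: "nat set" and x0 :: nat
 assumes sg: "serre_graph G" and FE: "F <= gE G" and Fbar: "e:F ==> gbar G e:F"
  and FX: "e:F ==> gorg G e:X" and XV: "X <= gV G" and x0: "x0:X"
  and conn: "a:X ==> b:X ==> EX p. walk G F p a b"
begin

definition d :: "nat => nat" where "d v = (LEAST k. EX p. walk G F p v x0 & length p = k)"

lemma FE': "e:F ==> e:gE G" using FE by auto

lemma d_le: "walk G F p v x0 ==> d v <= length p"
 unfolding d_def by (rule Least_le) auto

lemma down_ex: "v:X ==> v ~= x0 ==> EX e:F. gorg G e = v & d (tm G e) < d v"
proof -
 assume v: "v:X" "v ~= x0"
 have "EX k p. walk G F p v x0 & length p = k" using conn[OF v(1) x0] by auto
 then have "EX p. walk G F p v x0 & length p = d v" unfolding d_def by (rule LeastI_ex)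
 then obtain p where p: "walk G F p v x0" "length p = d v" by auto
 then obtain e q where e: "p = e#q" using v by (cases p) auto
 then have "d (tm G e) <= length q" using p by (intro d_le) auto
 then show ?thesis using p e by auto
qed

definition \<epsilon> :: "nat => nat" where "\<epsilon> v = (SOME e. e:F & gorg G e = v & d (tm G e) < d v)"

lemma eps: "v:X ==> v ~= x0 ==> \<epsilon> v:F & gorg G (\<epsilon> v) = v & d (tm G (\<epsilon> v)) < d v"
 unfolding \<epsilon>_def by (rule someI_ex) (use down_ex in blast)

definition T :: "nat set" where "T = \<epsilon> ` (X-{x0}) \<union> gbar G ` \<epsilon> ` (X-{x0})"

lemma T_F: "T <= F" unfolding T_def using eps Fbar by auto

lemma T_bar: "e:T ==> gbar G e:T"
proof -
 assume e: "e:T"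
 show ?thesis
 proof (cases "e:\<epsilon> ` (X-{x0})")
  case False
  then obtain v where v: "v:X-{x0}" "e = gbar G (\<epsilon> v)" using e by (auto simp: T_def)
  then have "gbar G e = \<epsilon> v" using eps FE' serreD(4)[OF sg] by auto
  then show ?thesis using v by (auto simp: T_def)
 qed (auto simp: T_def)
qed

lemma finX: "finite X" using XV serre_fin(1)[OF sg] finite_subset by blast
lemma finF: "finite F" using FE serre_fin(2)[OF sg] finite_subset by blast

lemma card_T: "card T = 2*(card X-1)"
proof -
 have i1: "inj_on \<epsilon> (X-{x0})" by (rule inj_on_inverseI[of _ "gorg G"]) (use eps in auto)
 have i2: "inj_on (gbar G) (\<epsilon> ` (X-{x0}))"
  by (rule inj_on_inverseI[of _ "gbar G"]) (use eps FE' serreD(4)[OF sg] in auto)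
 have "\<epsilon> ` (X-{x0}) \<inter> gbar G ` \<epsilon> ` (X-{x0}) = {}"
 proof (rule ccontr)
  assume "~ ?thesis"
  then obtain v w where v: "v:X" "v ~= x0" and w: "w:X" "w ~= x0" and eq: "\<epsilon> v = gbar G (\<epsilon> w)" by auto
  have "tm G (\<epsilon> v) = w" using eps[OF w] eq serreD(6)[OF sg] FE' by auto
  moreover have "tm G (\<epsilon> w) = v" using eps[OF v] eps[OF w] eq serreD(7)[OF sg] FE' by metis
  ultimately show False using eps[OF v] eps[OF w] by simp
 qed
 then have "card T = card (\<epsilon> ` (X-{x0}))+card (gbar G ` \<epsilon> ` (X-{x0}))"
  unfolding T_def using finX by (intro card_Un_disjoint) auto
 then show ?thesis using x0 finX by (simp add: card_image[OF i1] card_image[OF i2])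
qed

lemma T_to_root: "v:X ==> EX p. walk G T p v x0"
proof (induction "d v" arbitrary: v rule: less_induct)
 case less
 show ?case
 proof (cases "v = x0")
  case True
  then show ?thesis using XV x0 by (intro exI[of _ "[]"]) auto
 next
  case False
  note e = eps[OF less.prems False]
  have "tm G (\<epsilon> v):X" using e Fbar FX unfolding tm_def by auto
  then obtain p where "walk G T p (tm G (\<epsilon> v)) x0" using less.hyps e by blast
  then show ?thesis using e False less.prems by (intro exI[of _ "\<epsilon> v#p"]) (auto simp: T_def)
 qed
qed

lemma T_conn: "a:X ==> b:X ==> EX p. walk G T p a b"
proof -
 assume ab: "a:X" "b:X"
 obtain p q where "walk G T p a x0" "walk G T q b x0" using T_to_root ab by blast
 moreover have TE: "T <= gE G" using T_F FE by auto
 ultimately show ?thesis using walk_rev[OF sg TE T_bar] walk_append[OF sg TE] by blast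
qed

text \<open>An edge outside \<open>T\<close>, closed up by a reduced path inside \<open>T\<close>,
  would be a nonempty reduced closed path.\<close>

lemma acyclic_card:
 assumes acyc: "!!p a. walk G F p a a ==> reduced G p ==> p = []"
 shows "card F = 2*(card X-1)"
proof -
 have "F <= T"
 proof
  fix e assume e: "e:F"
  show "e:T"
  proof (rule ccontr)
   assume nT: "e ~: T"
   have "tm G e:X" using Fbar[OF e] FX unfolding tm_def by auto
   then obtain p where p: "walk G T p (tm G e) (gorg G e)" using T_conn FX[OF e] by blast
   have TE: "T <= gE G" using T_F FE by auto
   have rp: "walk G T (red G p) (tm G e) (gorg G e)" by (rule walk_red[OF sg TE p])
   have "gbar G e ~: T" using nT T_bar[of "gbar G e"] serreD(4)[OF sg FE'[OF e]] by auto
   then have "red G p = [] | hd (red G p) ~= gbar G e"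
    using walk_ends(3)[OF sg TE rp] hd_in_set[of "red G p"] by (metis subsetD)
   then have "reduced G (e#red G p)" by (simp add: reduced_Cons)
   moreover have "walk G F (e#red G p) (gorg G e) (gorg G e)" using e walk_mono[OF T_F rp] by auto
   ultimately show False using acyc by blast
  qed
 qed
 then show ?thesis using T_F card_T by (simp add: subset_antisym)
qed

text \<open>A vertex has just one descending edge in \<open>T\<close>, so after an ascending step
  the only descending continuation is a backtrack.\<close>

lemma up_walk:
 assumes "walk G T (e#p) a b" "reduced G (e#p)" "gbar G e:\<epsilon> ` (X-{x0})"
 shows "d a < d b"
 using assms
proof (induction p arbitrary: e a)
 case Nil
 then obtain v where v: "v:X" "v ~= x0" "gbar G e = \<epsilon> v" by auto
 have eE: "e:gE G" using Nil T_F FE by auto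
 have "v = b" using v eps[of v] Nil serreD(7)[OF sg eE] by auto
 moreover have "tm G (\<epsilon> v) = a" using v(3)[symmetric] Nil serreD(6)[OF sg eE] by auto
 ultimately show ?case using eps[of v] v by auto
next
 case (Cons f p)
 then obtain v where v: "v:X" "v ~= x0" "gbar G e = \<epsilon> v" by auto
 have eE: "e:gE G" and fE: "f:gE G" using Cons T_F FE by auto
 have vt: "v = tm G e" using v eps[of v] serreD(7)[OF sg eE] by auto
 have "d a < d (tm G e)" using eps[of v] v vt serreD(6)[OF sg eE] Cons.prems(1) by auto
 moreover have "gbar G f:\<epsilon> ` (X-{x0})"
 proof -
  have "f:T" using Cons.prems by auto
  moreover have "f ~: \<epsilon> ` (X-{x0})"
  proof
   assume "f:\<epsilon> ` (X-{x0})"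
   then obtain w where w: "w:X" "w ~= x0" "f = \<epsilon> w" by auto
   then have "w = tm G e" using eps[of w] Cons.prems(1) by auto
   then have "f = gbar G e" using w v vt by simp
   then show False using Cons.prems(2) by (simp add: reduced_Cons)
  qed
  ultimately obtain w where "w:X-{x0}" "f = gbar G (\<epsilon> w)" by (auto simp: T_def)
  then have "gbar G f = \<epsilon> w" using eps FE' serreD(4)[OF sg] by auto
  then show ?thesis using \<open>w : X - {x0}\<close> by auto
 qed
 then have "d (tm G e) < d b" using Cons.prems by (intro Cons.IH[of f]) (auto simp: reduced_Cons)
 ultimately show ?case by simp
qed

text \<open>By \<open>up_walk\<close>, applied to the path and to its reversal, a nonempty reduced
  closed path descends first and ascends last. Both steps use the unique descending edge at the base
  vertex, so they are inverse to each other, and removing them leaves a shorter closed path.\<close>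

lemma T_acyclic: "walk G T p a a ==> reduced G p ==> p = []"
proof (induction "length p" arbitrary: p a rule: less_induct)
 case less
 have TE: "T <= gE G" using T_F FE by auto
 show ?case
 proof (rule ccontr)
  assume ne: "p ~= []"
  obtain e q where p: "p = e#q" using ne by (cases p) auto
  have pT: "set p <= T" by (rule walk_ends(3)[OF sg TE less.prems(1)])
  have eT: "e:T" using pT p by auto
  have ne': "gbar G e ~: \<epsilon> ` (X-{x0})" using up_walk[of e q a a] less.prems p by auto
  then obtain v where v: "v:X-{x0}" "e = \<epsilon> v"
   using eT eps FE' serreD(4)[OF sg] unfolding T_def by fastforce
  define f where "f = last p"
  have fT: "f:T" using pT ne last_in_set by (auto simp: f_def)
  have rv: "walk G T (rev_path G p) a a" by (rule walk_rev[OF sg TE T_bar less.prems(1)])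
  have rr: "reduced G (rev_path G p)" by (rule reduced_rev_path[OF sg _ less.prems(2)]) (use pT TE in auto)
  have pf: "p = butlast p@[f]" using ne by (simp add: f_def)
  have rp: "rev_path G p = gbar G f#rev_path G (butlast p)" by (subst pf) simp
  have fbb: "gbar G (gbar G f) = f" using fT TE serreD(4)[OF sg] by auto
  have "f ~: \<epsilon> ` (X-{x0})" using up_walk[of "gbar G f" "rev_path G (butlast p)" a a] rv rr rp fbb by auto
  then obtain w where w: "w:X-{x0}" "f = gbar G (\<epsilon> w)" using fT unfolding T_def by auto
  have "v = a" using v eps less.prems(1) p by auto
  have "tm G f = w" using w eps[of w] FE' serreD(6)[OF sg, of "\<epsilon> w"] by auto
  then have "w = a" using walk_hd_last(2)[OF less.prems(1) ne] by (simp add: f_def)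
  have fe: "f = gbar G e" using v w \<open>v = a\<close> \<open>w = a\<close> by simp
  show False
  proof (cases "q = []")
   case True
   then show False using fe p f_def serreD(3)[OF sg, of e] eT TE by auto
  next
   case False
   then have q: "q = butlast q@[f]" using p f_def append_butlast_last_id[OF False] by simp
   have w1: "walk G T (butlast q@[f]) (tm G e) a" using less.prems(1) p q by auto
   then have "walk G T (butlast q) (tm G e) (gorg G f)" using walk_append[OF sg TE] by auto
   moreover have "gorg G f = tm G e" using fe eT TE serreD(7)[OF sg] by auto
   moreover have "reduced G (butlast q)" using less.prems(2) p q reduced_append[of G "butlast q" "[f]"] by (simp add: reduced_Cons)
   ultimately have "butlast q = []" using less.hyps[of "butlast q" "tm G e"] p by simp
   then have "p = [e,f]" using p q by simp
   then show False using less.prems(2) fe by (simp add: reduced_Cons)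
  qed
 qed
qed

lemma card_acyclic:
 assumes "card F = 2*(card X-1)" "walk G F p a a" "reduced G p"
 shows "p = []"
proof -
 have "F = T" using card_subset_eq[OF finF T_F] card_T assms(1) by simp
 then show ?thesis using T_acyclic assms(2,3) by simp
qed

end

definition nset :: "sgraph => (nat => nat option) => nat set" where
 "nset G cE = {e:gE G. cE e = None}"

text \<open>Equivalent to \<open>collapse\<close> by \<open>collapse_iff_coll\<close>. The edge
  count of the fibres is replaced by the absence of reduced closed paths among collapsed edges, a
  condition that behaves well under composition, factorization and path lifting.\<close>

definition coll :: "sgraph => sgraph => (nat => nat) => (nat => nat option) => bool" where
 "coll G H cV cE \<longleftrightarrow> cV ` gV G = gV H &
   (ALL e:gE G. case cE e of
     Some f => f:gE H & gorg H f = cV (gorg G e) & cE (gbar G e) = Some (gbar H f)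
    | None => cV (gorg G e) = cV (tm G e) & cE (gbar G e) = None) &
   (ALL f:gE H. EX! e. e:gE G & cE e = Some f) &
   (ALL a:gV G. ALL b:gV G. cV a = cV b --> (EX p. walk G (nset G cE) p a b)) &
   (ALL p a. walk G (nset G cE) p a a & reduced G p --> p = [])"

lemma None_walk_fiber:
 assumes ed: "ALL e:gE G. case cE e of
     Some f => f:gE H & gorg H f = cV (gorg G e) & cE (gbar G e) = Some (gbar H f)
    | None => cV (gorg G e) = cV (tm G e) & cE (gbar G e) = None"
  and "walk G (nset G cE) p a b" "cV a = w"
 shows "walk G {e:gE G. cE e = None & cV (gorg G e) = w} p a b"
 using assms(2,3)
proof (induction p arbitrary: a)
 case (Cons e p)
 then have "e:gE G" "cE e = None" "gorg G e = a" by (auto simp: nset_def)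
 moreover have "cV (tm G e) = w" using bspec[OF ed \<open>e : gE G\<close>] Cons.prems calculation by auto
 ultimately show ?case using Cons by auto
qed auto

text \<open>The fibre over each vertex is a \<open>subgr\<close>, to which
  \<open>card_acyclic\<close> and \<open>acyclic_card\<close> apply in the two directions.\<close>

lemma collapse_iff_coll:
 assumes "serre_graph G"
 shows "collapse G H cV cE \<longleftrightarrow> coll G H cV cE"
proof -
 have key: "(ALL w:gV H.
    (ALL a:{v:gV G. cV v = w}. ALL b:{v:gV G. cV v = w}.
      EX p. walk G {e:gE G. cE e = None & cV (gorg G e) = w} p a b) &
    card {e:gE G. cE e = None & cV (gorg G e) = w} = 2*(card {v:gV G. cV v = w}-1)) \<longleftrightarrow>
   (ALL a:gV G. ALL b:gV G. cV a = cV b --> (EX p. walk G (nset G cE) p a b)) &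
   (ALL p a. walk G (nset G cE) p a a & reduced G p --> p = [])" (is "?L \<longleftrightarrow> ?R")
  if im: "cV ` gV G = gV H" and ed: "ALL e:gE G. case cE e of
     Some f => f:gE H & gorg H f = cV (gorg G e) & cE (gbar G e) = Some (gbar H f)
    | None => cV (gorg G e) = cV (tm G e) & cE (gbar G e) = None"
 proof -
  have edN: "cV (gorg G e) = cV (tm G e) & cE (gbar G e) = None" if "e:gE G" "cE e = None" for e
   using bspec[OF ed that(1)] that(2) by simp
  have sub: "subgr G {e:gE G. cE e = None & cV (gorg G e) = w} {v:gV G. cV v = w} x"
   if "x:gV G" "cV x = w" and c: "!!a b. a:gV G ==> b:gV G ==> cV a = w ==> cV b = w ==>
    EX p. walk G {e:gE G. cE e = None & cV (gorg G e) = w} p a b" for x w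
  proof
   fix e assume e: "e:{e:gE G. cE e = None & cV (gorg G e) = w}"
   then show "gbar G e:{e:gE G. cE e = None & cV (gorg G e) = w}"
    using edN[of e] by (simp add: serreD[OF assms])
   show "gorg G e:{v:gV G. cV v = w}" using e by (simp add: serreD[OF assms])
  qed (use that assms c in auto)
  show ?thesis
  proof
   assume L: ?L
   have conn: "EX p. walk G {e:gE G. cE e = None & cV (gorg G e) = cV a} p a b"
    if "a:gV G" "b:gV G" "cV a = cV b" for a b
   proof -
    have "cV a:gV H" using im that by auto
    then show ?thesis using bspec[OF L] that by simp
   qed
   show ?R
   proof (intro conjI ballI impI allI)
    fix a b assume "a:gV G" "b:gV G" "cV a = cV b"
    then obtain p where "walk G {e:gE G. cE e = None & cV (gorg G e) = cV a} p a b" using conn by blast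
    then have "walk G (nset G cE) p a b" by (rule walk_mono[rotated]) (auto simp: nset_def)
    then show "EX p. walk G (nset G cE) p a b" by blast
   next
    fix p a assume p: "walk G (nset G cE) p a a & reduced G p"
    have nE: "nset G cE <= gE G" by (auto simp: nset_def)
    have a: "a:gV G" using walk_ends(1)[OF assms nE] p by blast
    interpret subgr G "{e:gE G. cE e = None & cV (gorg G e) = cV a}" "{v:gV G. cV v = cV a}" a
    proof (rule sub[OF a refl])
     fix x y assume "x:gV G" "y:gV G" "cV x = cV a" "cV y = cV a"
     then show "EX p. walk G {e:gE G. cE e = None & cV (gorg G e) = cV a} p x y" using conn[of x y] by simp
    qed
    have "cV a:gV H" using a im by auto
    then have "card {e:gE G. cE e = None & cV (gorg G e) = cV a} = 2*(card {v:gV G. cV v = cV a}-1)"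
     using bspec[OF L] by simp
    from card_acyclic[OF this None_walk_fiber[OF ed conjunct1[OF p] refl] conjunct2[OF p]] show "p = []" .
   qed
  next
   assume R: ?R
   show ?L
   proof (intro ballI conjI)
    fix w assume w: "w:gV H"
    have c: "EX p. walk G {e:gE G. cE e = None & cV (gorg G e) = w} p a b"
     if ab: "a:gV G" "b:gV G" "cV a = w" "cV b = w" for a b
    proof -
     have "cV a = cV b" using ab by simp
     then obtain p where "walk G (nset G cE) p a b" using conjunct1[OF R] ab(1,2) by blast
     from None_walk_fiber[OF ed this ab(3)] show ?thesis by blast
    qed
    show "EX p. walk G {e:gE G. cE e = None & cV (gorg G e) = w} p a b"
     if "a:{v:gV G. cV v = w}" "b:{v:gV G. cV v = w}" for a b using c that by simp
    have "w:cV ` gV G" using w im by simp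
    then obtain x where x: "x:gV G" "cV x = w" by blast
    interpret subgr G "{e:gE G. cE e = None & cV (gorg G e) = w}" "{v:gV G. cV v = w}" x
     by (rule sub[OF x c])
    show "card {e:gE G. cE e = None & cV (gorg G e) = w} = 2*(card {v:gV G. cV v = w}-1)"
    proof (rule acyclic_card)
     fix p a assume p: "walk G {e:gE G. cE e = None & cV (gorg G e) = w} p a a" "reduced G p"
     have "walk G (nset G cE) p a a" using p(1) by (rule walk_mono[rotated]) (auto simp: nset_def)
     then show "p = []" using R p(2) by blast
    qed
   qed
  qed
 qed
 show ?thesis unfolding collapse_def coll_def
  by (rule conj_cong[OF refl], rule conj_cong[OF refl], rule conj_cong[OF refl], rule key)
qed

definition cmap :: "(nat => nat option) => nat => nat list" where
 "cmap cE e = (case cE e of None => [] | Some f => [f])"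

lemma cmap_None: "cE e = None ==> cmap cE e = []" by (simp add: cmap_def)
lemma cmap_Some: "cE e = Some f ==> cmap cE e = [f]" by (simp add: cmap_def)

lemma collapse_path_subst: "collapse_path cE p = subst (cmap cE) p"
 by (simp add: collapse_path_def subst_def cmap_def[abs_def])

locale coll2 =
 fixes G H :: sgraph and cV :: "nat => nat" and cE :: "nat => nat option"
 assumes sG: "serre_graph G" and sH: "serre_graph H" and co: "coll G H cV cE"
begin

abbreviation cp :: "nat list => nat list" where "cp \<equiv> subst (cmap cE)"

lemma cV_im: "cV ` gV G = gV H" using co unfolding coll_def by blast
lemma cV_in: "v:gV G ==> cV v:gV H" using cV_im by auto

lemma edge_Some: "e:gE G ==> cE e = Some f ==> f:gE H & gorg H f = cV (gorg G e) & cE (gbar G e) = Some (gbar H f)"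
 using co unfolding coll_def by (auto split: option.splits)

lemma edge_None: "e:gE G ==> cE e = None ==> cV (gorg G e) = cV (tm G e) & cE (gbar G e) = None"
 using co unfolding coll_def by (auto split: option.splits)

lemma edge_Some_tm: "e:gE G ==> cE e = Some f ==> tm H f = cV (tm G e)"
 using edge_Some[of e f] edge_Some[of "gbar G e" "gbar H f"] serreD[OF sG, of e] serreD[OF sH, of f] by auto

lemma edge_ex: "f:gE H ==> EX e:gE G. cE e = Some f"
 using co unfolding coll_def by blast

lemma edge_uniq: "e:gE G ==> e':gE G ==> cE e = Some f ==> cE e' = Some f ==> e = e'"
proof -
 assume e: "e:gE G" "e':gE G" "cE e = Some f" "cE e' = Some f"
 then have "f:gE H" using edge_Some by blast
 then have "EX! e. e:gE G & cE e = Some f" using co unfolding coll_def by blast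
 then show ?thesis using e by blast
qed

lemma fib_conn: "a:gV G ==> b:gV G ==> cV a = cV b ==> EX p. walk G (nset G cE) p a b"
 using co unfolding coll_def by blast

lemma fib_acyc: "walk G (nset G cE) p a a ==> reduced G p ==> p = []"
 using co unfolding coll_def by blast

lemma nE: "nset G cE <= gE G" by (auto simp: nset_def)

lemma hom: "hom_map G H (cmap cE)"
 unfolding hom_map_def
proof (intro ballI conjI)
 fix e assume e: "e:gE G"
 show "set (cmap cE e) <= gE H" using edge_Some[OF e] by (auto simp: cmap_def split: option.splits)
 show "red H (cmap cE (gbar G e)) = red H (rev_path H (cmap cE e))"
 proof (cases "cE e")
  case None
  then show ?thesis using edge_None[OF e] by (simp add: cmap_def)
 next
  case (Some f)
  then show ?thesis using edge_Some[OF e] by (simp add: cmap_def)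
 qed
qed

lemma cwalk: "walk G (gE G) p a b ==> walk H (gE H) (cp p) (cV a) (cV b)"
proof (induction p arbitrary: a)
 case Nil
 then show ?case using cV_in by auto
next
 case (Cons e p)
 then have e: "e:gE G" "gorg G e = a" and p: "walk H (gE H) (cp p) (cV (tm G e)) (cV b)" by auto
 show ?case
 proof (cases "cE e")
  case None
  then show ?thesis using edge_None[OF e(1)] e p by (simp add: cmap_None cmap_Some)
 next
  case (Some f)
  then show ?thesis using edge_Some[OF e(1)] edge_Some_tm[OF e(1)] e p by (simp add: cmap_None cmap_Some)
 qed
qed

lemma cp_Nil: "set p <= gE G ==> cp p = [] \<longleftrightarrow> set p <= nset G cE"
 by (induction p) (auto simp: cmap_def nset_def split: option.splits)

lemma cp_Cons_split:
 assumes "set p <= gE G" "cp p = f#q"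
 shows "EX x e y. p = x@e#y & set x <= nset G cE & cE e = Some f & cp y = q"
 using assms
proof (induction p)
 case (Cons e p)
 show ?case
 proof (cases "cE e")
  case None
  then have "cp p = f#q" using Cons.prems by (simp add: cmap_None cmap_Some)
  then obtain x e' y where "p = x@e'#y" "set x <= nset G cE" "cE e' = Some f" "cp y = q" using Cons by auto
  then show ?thesis using None Cons.prems by (intro exI[of _ "e#x"]) (auto simp: nset_def)
 next
  case (Some f')
  then show ?thesis using Cons.prems by (intro exI[of _ "[]"]) (auto simp: cmap_None cmap_Some)
 qed
qed simp

text \<open>If the images of two edges of a reduced path cancelled, these edges would be mutually
  inverse, and the collapsed edges between them would form a reduced closed path, which is empty;
  then the path itself would backtrack.\<close>

lemma creduced:
 assumes "walk G (gE G) p a b" "reduced G p"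
 shows "reduced H (cp p)"
 using assms
proof (induction p arbitrary: a)
 case (Cons e p)
 then have e: "e:gE G" and w: "walk G (gE G) p (tm G e) b" and r: "reduced G p" by (auto simp: reduced_Cons)
 have pE: "set p <= gE G" by (rule walk_E[OF sG w])
 have IH: "reduced H (cp p)" using Cons.IH[OF w r] .
 show ?case
 proof (cases "cE e")
  case None
  then show ?thesis using IH by (simp add: cmap_None cmap_Some)
 next
  case (Some f)
  have "cp p = [] | hd (cp p) ~= gbar H f"
  proof (rule ccontr)
   assume "~ ?thesis"
   then obtain q where q: "cp p = gbar H f#q" by (cases "cp p") auto
   obtain x e' y where x: "p = x@e'#y" "set x <= nset G cE" "cE e' = Some (gbar H f)"
    using cp_Cons_split[OF pE q] by blast
   have e'E: "e':gE G" using pE x by auto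
   have e': "e' = gbar G e"
    using edge_uniq[OF e'E serreD(2)[OF sG e] x(3)] edge_Some[OF e Some] by simp
   have "walk G (gE G) x (tm G e) (gorg G e')" using w x(1) walk_append[OF sG order_refl] by auto
   then have "walk G (nset G cE) x (tm G e) (tm G e)" using walk_restrict[OF _ x(2)] e' serreD(7)[OF sG e] by simp
   moreover have "reduced G x" using r x(1) reduced_append by blast
   ultimately have "x = []" by (rule fib_acyc)
   then show False using Cons.prems(2) x(1) e' by (simp add: reduced_Cons)
  qed
  then show ?thesis using IH Some by (simp add: cmap_None cmap_Some reduced_Cons)
 qed
qed simp

lemma cp_red:
 assumes "walk G (gE G) p a b"
 shows "cp (red G p) = red H (cp p)"
proof -
 have pE: "set p <= gE G" by (rule walk_E[OF sG assms])
 have "reduced H (cp (red G p))" by (rule creduced[OF walk_red[OF sG order_refl assms] red_reduced])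
 then show ?thesis using red_subst_red[OF sG sH hom pE] by (simp add: red_id)
qed

text \<open>Edges lift uniquely, and the gaps are filled inside the connected fibres. Together with
  \<open>cp_inj\<close> this says that a collapse is bijective on homotopy classes of paths with
  fixed ends, the form in which its being a homotopy equivalence is used.\<close>

lemma lift:
 assumes "walk H (gE H) q (cV a) (cV b)" "a:gV G" "b:gV G"
 shows "EX p. walk G (gE G) p a b & cp p = q"
 using assms(1,2)
proof (induction q arbitrary: a)
 case Nil
 then obtain p where p: "walk G (nset G cE) p a b" using fib_conn assms(3) by auto
 then have "set p <= nset G cE" by (rule walk_ends(3)[OF sG nE])
 then have "cp p = []" using cp_Nil nE by blast
 then show ?case using walk_mono[OF nE p] by blast
next
 case (Cons f q)
 then have f: "f:gE H" "gorg H f = cV a" "walk H (gE H) q (tm H f) (cV b)" by auto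
 obtain e where e: "e:gE G" "cE e = Some f" using edge_ex[OF f(1)] by auto
 have tme: "tm H f = cV (tm G e)" using edge_Some_tm[OF e] .
 then obtain p where p: "walk G (gE G) p (tm G e) b" "cp p = q"
  using Cons.IH[of "tm G e"] f(3) serreD(5)[OF sG e(1)] by auto
 have "cV a = cV (gorg G e)" using edge_Some[OF e] f(2) by simp
 then obtain x where x: "walk G (nset G cE) x a (gorg G e)" using fib_conn[OF Cons.prems(2) serreD(1)[OF sG e(1)]] by blast
 then have "set x <= nset G cE" by (rule walk_ends(3)[OF sG nE])
 then have "cp x = []" using cp_Nil nE by blast
 moreover have "walk G (gE G) (x@e#p) a b"
  using walk_append[OF sG order_refl] walk_mono[OF nE x] p(1) e(1) by auto
 ultimately show ?case using p(2) e(2) by (intro exI[of _ "x@e#p"]) (auto simp: cmap_None cmap_Some)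
qed

lemma cp_inj_Nil:
 assumes "walk G (gE G) p a a" "red H (cp p) = []"
 shows "red G p = []"
proof -
 have w: "walk G (gE G) (red G p) a a" by (rule walk_red[OF sG order_refl assms(1)])
 have E: "set (red G p) <= gE G" by (rule walk_E[OF sG w])
 have "cp (red G p) = []" using cp_red[OF assms(1)] assms(2) by simp
 then have "walk G (nset G cE) (red G p) a a" using cp_Nil[OF E] walk_restrict[OF w] by blast
 then show ?thesis by (rule fib_acyc) simp
qed

lemma cp_inj:
 assumes p: "walk G (gE G) p a b" and q: "walk G (gE G) q a b" and eq: "red H (cp p) = red H (cp q)"
 shows "red G p = red G q"
proof -
 have E: "set p <= gE G" "set q <= gE G" using p q walk_E[OF sG] by blast+
 have E': "set (cp p) <= gE H" "set (cp q) <= gE H" using set_subst[OF hom] E by auto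
 have rq: "set (rev_path G q) <= gE G" by (rule set_rev_path[OF sG E(2)])
 have "walk G (gE G) (p@rev_path G q) a a" using p walk_rev_E[OF sG q] walk_append[OF sG order_refl] by blast
 moreover have "red H (cp (p@rev_path G q)) = []"
 proof -
  have "red H (cp p@cp (rev_path G q)) = red H (cp p@rev_path H (cp q))"
   using red_subst_rev_path[OF sG sH hom E(2)] by (metis red_append_right)
  also have "... = []" using red_eq_iff[OF sH E'] eq by simp
  finally show ?thesis by simp
 qed
 ultimately have "red G (p@rev_path G q) = []" by (rule cp_inj_Nil)
 then show ?thesis using red_eq_iff[OF sG E] by simp
qed

end

lemma coll_compose:
 assumes "serre_graph G" "serre_graph H" "serre_graph K" "coll G H cV cE" "coll H K bV bE"
 shows "coll G K (bV \<circ> cV) (%e. Option.bind (cE e) bE)"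
proof -
 interpret c: coll2 G H cV cE using assms by unfold_locales
 interpret b: coll2 H K bV bE using assms by unfold_locales
 let ?d = "%e. Option.bind (cE e) bE"
 have nd: "set p <= gE G ==> set p <= nset G ?d \<longleftrightarrow> set (c.cp p) <= nset H bE" for p
 proof (induction p)
  case (Cons e p)
  then show ?case using c.edge_Some[of e] by (cases "cE e") (auto simp: cmap_None cmap_Some nset_def)
 qed auto
 have 1: "(bV \<circ> cV) ` gV G = gV K" unfolding image_comp[symmetric] c.cV_im by (rule b.cV_im)
 have 2: "case ?d e of
     Some f => f:gE K & gorg K f = (bV \<circ> cV) (gorg G e) & ?d (gbar G e) = Some (gbar K f)
    | None => (bV \<circ> cV) (gorg G e) = (bV \<circ> cV) (tm G e) & ?d (gbar G e) = None" if e: "e:gE G" for e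
 proof (cases "cE e")
  case None
  then show ?thesis using c.edge_None[OF e] by simp
 next
  case (Some f)
  note f = c.edge_Some[OF e Some] c.edge_Some_tm[OF e Some]
  show ?thesis
  proof (cases "bE f")
   case None
   then show ?thesis using Some f b.edge_None[of f] by simp
  next
   case (Some g)
   then show ?thesis using \<open>cE e = Some f\<close> f b.edge_Some[of f g] by simp
  qed
 qed
 have 3: "EX! e. e:gE G & ?d e = Some f" if f: "f:gE K" for f
 proof -
  obtain g where g: "g:gE H" "bE g = Some f" using b.edge_ex[OF f] by auto
  obtain e where e: "e:gE G" "cE e = Some g" using c.edge_ex[OF g(1)] by auto
  show ?thesis
  proof (rule ex1I[of _ e])
   show "e:gE G & ?d e = Some f" using e g by simp
   fix e' assume e': "e':gE G & ?d e' = Some f"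
   then obtain g' where g': "cE e' = Some g'" "bE g' = Some f" by (cases "cE e'") auto
   then have "g' = g" using b.edge_uniq[of g' g f] c.edge_Some[of e' g'] e' g by simp
   then show "e' = e" using c.edge_uniq[of e' e g] e' e g' by simp
  qed
 qed
 have 4: "EX p. walk G (nset G ?d) p x y" if xy: "x:gV G" "y:gV G" "(bV \<circ> cV) x = (bV \<circ> cV) y" for x y
 proof -
  obtain q where q: "walk H (nset H bE) q (cV x) (cV y)" using b.fib_conn[OF c.cV_in[OF xy(1)] c.cV_in[OF xy(2)]] xy(3) by auto
  obtain p where p: "walk G (gE G) p x y" "c.cp p = q" using c.lift[OF walk_mono[OF b.nE q] xy(1,2)] by blast
  have "set p <= gE G" by (rule walk_E[OF assms(1) p(1)])
  then have "set p <= nset G ?d" using nd[of p] p(2) walk_ends(3)[OF assms(2) b.nE q] by simp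
  then show ?thesis using walk_restrict[OF p(1)] by blast
 qed
 have 5: "p = []" if p: "walk G (nset G ?d) p x x" "reduced G p" for p x
 proof -
  have dE: "nset G ?d <= gE G" by (auto simp: nset_def)
  have w: "walk G (gE G) p x x" by (rule walk_mono[OF dE p(1)])
  have E: "set p <= gE G" by (rule walk_E[OF assms(1) w])
  have "walk H (nset H bE) (c.cp p) (cV x) (cV x)"
   using walk_restrict[OF c.cwalk[OF w]] nd[OF E] walk_ends(3)[OF assms(1) dE p(1)] by blast
  then have "c.cp p = []" by (rule b.fib_acyc[OF _ c.creduced[OF w p(2)]])
  then have "walk G (nset G cE) p x x" using c.cp_Nil[OF E] walk_restrict[OF w] by blast
  then show ?thesis by (rule c.fib_acyc[OF _ p(2)])
 qed
 show ?thesis unfolding coll_def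
  by (intro conjI ballI allI impI)
   (rule 1, rule 2, assumption, rule 3, assumption, rule 4, assumption, assumption, assumption,
    elim conjE, rule 5, assumption, assumption)
qed

text \<open>Whatever \<open>cE\<close> collapses is collapsed by \<open>dE\<close>, so
  \<open>dV\<close> is constant on the fibres of \<open>cV\<close> and the second collapse descends
  to \<open>H\<close>. Applied to the identity this inverts isomorphisms; applied in a closed cell
  it compares faces.\<close>

lemma coll_factor:
 assumes "serre_graph G" "serre_graph H" "serre_graph K" "coll G H cV cE" "coll G K dV dE"
  and sub: "!!e. e:gE G ==> cE e = None ==> dE e = None"
 shows "EX bV bE. coll H K bV bE & (ALL v:gV G. bV (cV v) = dV v) & (ALL e:gE G. dE e = Option.bind (cE e) bE)"
proof -
 interpret c: coll2 G H cV cE using assms by unfold_locales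
 interpret d: coll2 G K dV dE using assms by unfold_locales
 have ns: "nset G cE <= nset G dE" using sub by (auto simp: nset_def)
 have dconst: "dV a = dV b" if "walk G (nset G dE) p a b" for p a b
  using that by (induction p arbitrary: a) (use d.edge_None in \<open>auto simp: nset_def\<close>)
 have wd: "dV a = dV b" if "a:gV G" "b:gV G" "cV a = cV b" for a b
 proof -
  have "EX p. walk G (nset G cE) p a b" using c.fib_conn that by blast
  then obtain p where "walk G (nset G cE) p a b" by blast
  from dconst[OF walk_mono[OF ns this]] show ?thesis .
 qed
 define bV where "bV w = dV (SOME v. v:gV G & cV v = w)" for w
 define bE where "bE f = dE (SOME e. e:gE G & cE e = Some f)" for f
 have bV: "bV (cV v) = dV v" if v: "v:gV G" for v
 proof -
  have "(SOME u. u:gV G & cV u = cV v):gV G & cV (SOME u. u:gV G & cV u = cV v) = cV v"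
   by (rule someI[of "%u. u:gV G & cV u = cV v" v]) (use v in simp)
  then show ?thesis unfolding bV_def using wd v by metis
 qed
 have bE: "bE f = dE e" if e: "e:gE G" "cE e = Some f" for e f
 proof -
  have "(SOME e. e:gE G & cE e = Some f) = e"
   by (rule some_equality) (use e c.edge_uniq in auto)
  then show ?thesis by (simp add: bE_def)
 qed
 have nd: "set p <= gE G ==> set p <= nset G dE \<longleftrightarrow> set (c.cp p) <= nset H bE" for p
 proof (induction p)
  case (Cons e p)
  then show ?case using c.edge_Some[of e] sub[of e] bE[of e] by (cases "cE e") (auto simp: cmap_None cmap_Some nset_def)
 qed auto
 have 1: "bV ` gV H = gV K"
 proof -
  have "bV ` gV H = (%v. bV (cV v)) ` gV G" unfolding c.cV_im[symmetric] image_comp comp_def ..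
  also have "... = dV ` gV G" using bV by (rule image_cong[OF refl])
  finally show ?thesis using d.cV_im by simp
 qed
 have 2: "case bE f of
     Some g => g:gE K & gorg K g = bV (gorg H f) & bE (gbar H f) = Some (gbar K g)
    | None => bV (gorg H f) = bV (tm H f) & bE (gbar H f) = None" if f: "f:gE H" for f
 proof -
  obtain e where e: "e:gE G" "cE e = Some f" using c.edge_ex[OF f] by auto
  have eb: "gbar G e:gE G" "cE (gbar G e) = Some (gbar H f)" using e c.edge_Some serreD(2)[OF assms(1)] by auto
  have o: "gorg H f = cV (gorg G e)" "tm H f = cV (tm G e)" using c.edge_Some[OF e] c.edge_Some_tm[OF e] by auto
  note V = bV[OF serreD(1)[OF assms(1) e(1)]] bV[OF serreD(5)[OF assms(1) e(1)]]
  show ?thesis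
  proof (cases "dE e")
   case None
   then show ?thesis using d.edge_None[OF e(1) None] bE[OF e] bE[OF eb] o V by simp
  next
   case (Some g)
   then show ?thesis using d.edge_Some[OF e(1) Some] bE[OF e] bE[OF eb] o V by simp
  qed
 qed
 have 3: "EX! f. f:gE H & bE f = Some g" if g: "g:gE K" for g
 proof -
  obtain e where e: "e:gE G" "dE e = Some g" using d.edge_ex[OF g] by auto
  obtain f where f: "cE e = Some f" using sub[OF e(1)] e(2) by (cases "cE e") auto
  show ?thesis
  proof (rule ex1I[of _ f])
   show "f:gE H & bE f = Some g" using bE[OF e(1) f] c.edge_Some[OF e(1) f] e by simp
   fix f' assume f': "f':gE H & bE f' = Some g"
   then obtain e' where e': "e':gE G" "cE e' = Some f'" using c.edge_ex by blast
   then have "e' = e" using d.edge_uniq[of e' e g] bE[OF e'] f' e by simp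
   then show "f' = f" using e' f by simp
  qed
 qed
 have 4: "EX p. walk H (nset H bE) p x y" if xy: "x:gV H" "y:gV H" "bV x = bV y" for x y
 proof -
  have "x:cV ` gV G" "y:cV ` gV G" using xy c.cV_im by simp_all
  then obtain u v where uv: "u:gV G" "v:gV G" "x = cV u" "y = cV v" by blast
  then have "dV u = dV v" using xy bV by simp
  then obtain p where p: "walk G (nset G dE) p u v" using d.fib_conn uv by blast
  have w: "walk G (gE G) p u v" by (rule walk_mono[OF d.nE p])
  have "set p <= gE G" by (rule walk_E[OF assms(1) w])
  then have "set (c.cp p) <= nset H bE" using nd walk_ends(3)[OF assms(1) d.nE p] by blast
  then show ?thesis using walk_restrict[OF c.cwalk[OF w]] uv by blast
 qed
 have 5: "q = []" if q: "walk H (nset H bE) q x x" "reduced H q" for q x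
 proof -
  have bE': "nset H bE <= gE H" by (auto simp: nset_def)
  have x: "x:gV H" by (rule walk_ends(1)[OF assms(2) bE' q(1)])
  then obtain u where u: "u:gV G" "x = cV u" using c.cV_im by auto
  obtain p where p: "walk G (gE G) p u u" "c.cp p = q" using c.lift[of q u u] walk_mono[OF bE' q(1)] u by blast
  have rw: "walk G (gE G) (red G p) u u" by (rule walk_red[OF assms(1) order_refl p(1)])
  have cr: "c.cp (red G p) = q" using c.cp_red[OF p(1)] p(2) red_id[OF q(2)] by simp
  have E: "set (red G p) <= gE G" by (rule walk_E[OF assms(1) rw])
  have "walk G (nset G dE) (red G p) u u"
   using walk_restrict[OF rw] nd[OF E] cr walk_ends(3)[OF assms(2) bE' q(1)] by blast
  then have "red G p = []" by (rule d.fib_acyc) simp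
  then show ?thesis using cr by simp
 qed
 have "coll H K bV bE" unfolding coll_def
  by (intro conjI ballI allI impI)
   (rule 1, rule 2, assumption, rule 3, assumption, rule 4, assumption, assumption, assumption,
    elim conjE, rule 5, assumption, assumption)
 moreover have "dE e = Option.bind (cE e) bE" if "e:gE G" for e
  using sub[OF that] bE[OF that] by (cases "cE e") auto
 ultimately show ?thesis using bV by blast
qed

section \<open>Markings\<close>

text \<open>Petal \<open>i\<close> is the edge \<open>2 * i\<close> with reversal
  \<open>2 * i + 1\<close>. Words in the free group thereby become edge paths, and
  \<open>red\<close> serves for words as well.\<close>

definition rose :: "nat => sgraph" where
 "rose r = \<lparr>gV = {0},gE = {..<2 * r},gorg = (%_. 0),gbar = (%e. if even e then e+1 else e-1),
   gEp = {e. e < 2 * r & even e}\<rparr>"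

lemma rose_sel [simp]:
 "gV (rose r) = {0}" "gE (rose r) = {..<2 * r}" "gorg (rose r) e = 0" "tm (rose r) e = 0"
 "gbar (rose r) e = (if even e then e+1 else e-1)" "gEp (rose r) = {e. e < 2 * r & even e}"
 by (auto simp: rose_def tm_def)

lemma rose_serre: "serre_graph (rose r)"
proof -
 have "gbar (rose r) e:gE (rose r) & gbar (rose r) e ~= e & gbar (rose r) (gbar (rose r) e) = e &
   (e:gEp (rose r) \<longleftrightarrow> gbar (rose r) e ~: gEp (rose r))" if e: "e < 2 * r" for e
 proof (cases "even e")
  case True
  then obtain k where "e = 2 * k" by (rule evenE)
  then show ?thesis using e by simp
 next
  case False
  then obtain k where "e = 2 * k+1" by (rule oddE)
  then show ?thesis using e by simp
 qed
 moreover have "gEp (rose r) <= gE (rose r)" by auto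
 ultimately show ?thesis unfolding serre_graph_def by simp
qed

definition enc :: "nat \<times> bool => nat" where "enc x = (if snd x then 2 * fst x else 2 * fst x+1)"
definition petal :: "sgraph => nat list list => nat => nat list" where
 "petal G ws e = (if even e then ws ! (e div 2) else rev_path G (ws ! (e div 2)))"

lemma petal_enc: "petal G ws (enc x) = letter_img G ws x"
 by (auto simp: petal_def enc_def letter_img_def)

lemma eval_subst: "eval_word G ws u = red G (subst (petal G ws) (map enc u))"
 by (simp add: eval_word_def subst_def petal_enc comp_def)

lemma enc_dec: "enc (e div 2,even e) = e" by (auto simp: enc_def)

lemma enc_range: "enc x < 2 * r \<longleftrightarrow> fst x < r" by (auto simp: enc_def)

lemma enc_surj:
 assumes "set q <= gE (rose r)"
 shows "EX u. set (map fst u) <= {..<r} & map enc u = q"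
proof (intro exI conjI)
 show "map enc (map (%e. (e div 2,even e)) q) = q" by (simp add: comp_def enc_dec)
 show "set (map fst (map (%e. (e div 2,even e)) q)) <= {..<r}" using assms by auto
qed

lemma freely_reduced_iff: "freely_reduced u \<longleftrightarrow> reduced (rose r) (map enc u)"
proof -
 have "enc y = gbar (rose r) (enc x) \<longleftrightarrow> fst y = fst x & snd y ~= snd x" for x y
  by (cases "snd x"; cases "snd y") (auto simp: enc_def, presburger+)
 then show ?thesis by (auto simp: freely_reduced_def reduced_def)
qed

lemma valid_marking_iff:
 "valid_marking r G (v,ws) \<longleftrightarrow> v:gV G & length ws = r &
   (ALL i<r. walk G (gE G) (ws ! i) v v & reduced G (ws ! i)) &
   (ALL c. walk G (gE G) c v v & reduced G c --> (EX q. set q <= gE (rose r) & red G (subst (petal G ws) q) = c)) &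
   (ALL q. set q <= gE (rose r) & reduced (rose r) q & red G (subst (petal G ws) q) = [] --> q = [])"
proof -
 have A: "(EX u. set (map fst u) <= {..<r} & eval_word G ws u = c) \<longleftrightarrow>
  (EX q. set q <= gE (rose r) & red G (subst (petal G ws) q) = c)" for c
 proof
  assume "EX u. set (map fst u) <= {..<r} & eval_word G ws u = c"
  then obtain u where u: "set (map fst u) <= {..<r}" "eval_word G ws u = c" by auto
  then show "EX q. set q <= gE (rose r) & red G (subst (petal G ws) q) = c"
   by (intro exI[of _ "map enc u"]) (auto simp: eval_subst enc_range)
 next
  assume "EX q. set q <= gE (rose r) & red G (subst (petal G ws) q) = c"
  then obtain q where q: "set q <= gE (rose r)" "red G (subst (petal G ws) q) = c" by auto
  obtain u where "set (map fst u) <= {..<r}" "map enc u = q" using enc_surj[OF q(1)] by blast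
  then show "EX u. set (map fst u) <= {..<r} & eval_word G ws u = c" using q by (auto simp: eval_subst)
 qed
 have B: "(ALL u. set (map fst u) <= {..<r} & freely_reduced u & eval_word G ws u = [] --> u = []) \<longleftrightarrow>
   (ALL q. set q <= gE (rose r) & reduced (rose r) q & red G (subst (petal G ws) q) = [] --> q = [])" (is "?L \<longleftrightarrow> ?R")
 proof
  assume L: ?L
  show ?R
  proof (intro allI impI, elim conjE)
   fix q assume q: "set q <= gE (rose r)" "reduced (rose r) q" "red G (subst (petal G ws) q) = []"
   obtain u where u: "set (map fst u) <= {..<r}" "map enc u = q" using enc_surj[OF q(1)] by blast
   then have "u = []" using L q freely_reduced_iff[of u r] by (simp add: eval_subst)
   then show "q = []" using u by simp
  qed
 next
  assume R: ?R
  show ?L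
  proof (intro allI impI, elim conjE)
   fix u assume u: "set (map fst u) <= {..<r}" "freely_reduced u" "eval_word G ws u = []"
   have "set (map enc u) <= gE (rose r)" using u(1) by (auto simp: enc_range)
   then have "map enc u = []" using spec[OF R, of "map enc u"] u(2,3) freely_reduced_iff[of u r] by (simp only: eval_subst simp_thms)
   then show "u = []" by simp
  qed
 qed
 show ?thesis unfolding valid_marking_def prod.case A B ..
qed

lemma valid_markingD:
 assumes "valid_marking r G (v,ws)"
 shows "v:gV G" "length ws = r" "i < r ==> walk G (gE G) (ws ! i) v v" "i < r ==> reduced G (ws ! i)"
 using assms unfolding valid_marking_iff by blast+

lemma petal_walk:
 assumes "serre_graph G" "!!i. i < r ==> walk G (gE G) (ws ! i) v v" "e:gE (rose r)"
 shows "walk G (gE G) (petal G ws e) v v"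
proof -
 have "e div 2 < r" using assms(3) by auto
 then show ?thesis using assms(2) walk_rev_E[OF assms(1)] by (auto simp: petal_def)
qed

lemma petal_hom:
 assumes "serre_graph G" "!!i. i < r ==> walk G (gE G) (ws ! i) v v"
 shows "hom_map (rose r) G (petal G ws)"
 unfolding hom_map_def
proof (intro ballI conjI)
 fix e assume e: "e:gE (rose r)"
 show "set (petal G ws e) <= gE G" by (rule walk_E[OF assms(1) petal_walk[OF assms e]])
 have i: "e div 2 < r" using e by auto
 have s: "set (ws ! (e div 2)) <= gE G" by (rule walk_E[OF assms(1) assms(2)[OF i]])
 have "(e-1) div 2 = e div 2" if "odd e" using that by (metis odd_two_times_div_two_nat nonzero_mult_div_cancel_left zero_neq_numeral)
 then show "red G (petal G ws (gbar (rose r) e)) = red G (rev_path G (petal G ws e))"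
  using rev_path_rev_path[OF assms(1) s] by (auto simp: petal_def)
qed

lemma subst_walk:
 assumes "v:gV G" "serre_graph G" "!!e. e:set q ==> walk G (gE G) (\<phi> e) v v"
 shows "walk G (gE G) (subst \<phi> q) v v"
 using assms(3)
proof (induction q)
 case (Cons e q)
 then show ?case using walk_append[OF assms(2) order_refl, of "\<phi> e" "subst \<phi> q" v v] by auto
qed (use assms in auto)

lemma set_petal_subst:
 assumes "serre_graph G" "valid_marking r G (v,ws)" "set q <= gE (rose r)"
 shows "walk G (gE G) (subst (petal G ws) q) v v"
 by (rule subst_walk[OF valid_markingD(1)[OF assms(2)] assms(1)], rule petal_walk[OF assms(1) valid_markingD(3)[OF assms(2)]])
   (use assms(3) in auto)

lemma mequiv_iff:
 "marking_equiv G (v,ws) (v',ws') \<longleftrightarrow> length ws = length ws' &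
   (EX p. walk G (gE G) p v v' & (ALL i<length ws. ws' ! i = red G (rev_path G p@ws ! i@p)))"
 by (simp add: marking_equiv_def)

text \<open>The part of \<open>valid_marking\<close> that says nothing about bijectivity on the
  fundamental group; it is enough for the calculus of marking equivalence.\<close>

definition wfm :: "nat => sgraph => nat \<times> nat list list => bool" where
 "wfm r G M \<longleftrightarrow> fst M:gV G & length (snd M) = r &
  (ALL i<r. walk G (gE G) (snd M ! i) (fst M) (fst M) & reduced G (snd M ! i))"

lemma valid_wfm: "valid_marking r G M ==> wfm r G M"
 by (cases M) (simp add: valid_marking_iff wfm_def)

lemma mequiv_refl: "serre_graph G ==> wfm r G M ==> marking_equiv G M M"
 by (cases M) (auto simp: mequiv_iff wfm_def red_id intro!: exI[of _ "[]"])

lemma mequiv_trans: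
 assumes sg: "serre_graph G" and w: "wfm r G M1" and 12: "marking_equiv G M1 M2" and 23: "marking_equiv G M2 M3"
 shows "marking_equiv G M1 M3"
proof -
 obtain v1 ws1 v2 ws2 v3 ws3 where M: "M1 = (v1,ws1)" "M2 = (v2,ws2)" "M3 = (v3,ws3)" by (metis surj_pair)
 obtain p where p: "length ws1 = length ws2" "walk G (gE G) p v1 v2" "!!i. i < length ws1 ==> ws2 ! i = red G (rev_path G p@ws1 ! i@p)"
  using 12 unfolding M mequiv_iff by blast
 obtain q where q: "length ws2 = length ws3" "walk G (gE G) q v2 v3" "!!i. i < length ws2 ==> ws3 ! i = red G (rev_path G q@ws2 ! i@q)"
  using 23 unfolding M mequiv_iff by blast
 have pE: "set p <= gE G" "set (rev_path G p) <= gE G"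
  using walk_E[OF sg p(2)] set_rev_path[OF sg] by auto
 have "ws3 ! i = red G (rev_path G (p@q)@ws1 ! i@p@q)" if i: "i < length ws1" for i
 proof -
  have wE: "set (ws1 ! i) <= gE G" using w i walk_E[OF sg] unfolding M wfm_def by auto
  have "red G (red G (rev_path G p@ws1 ! i@p)@q) = red G ((rev_path G p@ws1 ! i@p)@q)"
   by (rule red_append_left[OF sg]) (use pE wE in auto)
  then have "red G (rev_path G q@red G (rev_path G p@ws1 ! i@p)@q) = red G (rev_path G q@(rev_path G p@ws1 ! i@p)@q)"
   by (metis red_append_right)
  then show ?thesis using p(1,3) q(3) i by simp
 qed
 moreover have "walk G (gE G) (p@q) v1 v3" using p q walk_append[OF sg order_refl] by blast
 ultimately show ?thesis using p(1) q(1) unfolding M mequiv_iff by (intro conjI exI[of _ "p@q"]) auto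
qed

lemma mequiv_sym:
 assumes sg: "serre_graph G" and w: "wfm r G M" and e: "marking_equiv G M M'"
 shows "marking_equiv G M' M"
proof -
 obtain v ws v' ws' where M: "M = (v,ws)" "M' = (v',ws')" by (metis surj_pair)
 obtain p where p: "length ws = length ws'" "walk G (gE G) p v v'" "!!i. i < length ws ==> ws' ! i = red G (rev_path G p@ws ! i@p)"
  using e unfolding M mequiv_iff by blast
 have pE: "set p <= gE G" "set (rev_path G p) <= gE G"
  using walk_E[OF sg p(2)] set_rev_path[OF sg] by auto
 have "ws ! i = red G (rev_path G (rev_path G p)@ws' ! i@rev_path G p)" if i: "i < length ws" for i
 proof -
  have wE: "set (ws ! i) <= gE G" "reduced G (ws ! i)" using w i walk_E[OF sg] unfolding M wfm_def by auto
  have "red G (red G (rev_path G p@ws ! i@p)@rev_path G p) = red G ((rev_path G p@ws ! i@p)@rev_path G p)"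
   by (rule red_append_left[OF sg]) (use pE wE in auto)
  then have "red G (p@ws' ! i@rev_path G p) = red G (p@rev_path G p@ws ! i@p@rev_path G p)"
   unfolding p(3)[OF i] by (metis red_append_right append.assoc)
  also have "... = red G (ws ! i@p@rev_path G p)" by (rule red_rev_path_right[OF sg pE(1)])
  also have "... = red G (ws ! i)" using red_rev_path_right[OF sg pE(1), of "[]"] by (metis append_Nil2 red_append_right red.simps(1))
  finally show ?thesis using rev_path_rev_path[OF sg pE(1)] red_id[OF wE(2)] by simp
 qed
 moreover have "walk G (gE G) (rev_path G p) v' v" by (rule walk_rev_E[OF sg p(2)])
 ultimately show ?thesis using p(1) unfolding M mequiv_iff by (intro conjI exI[of _ "rev_path G p"]) auto
qed


context coll2
begin

lemma comp_marking_eq: "comp_marking H cV cE (v,ws) = (cV v,map (%w. red H (cp w)) ws)"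
 by (simp add: comp_marking_def collapse_path_subst)

lemma comp_wfm: "wfm r G M ==> wfm r H (comp_marking H cV cE M)"
 by (cases M) (auto simp: comp_marking_eq wfm_def cV_in intro!: walk_red[OF sH order_refl] cwalk)

lemma comp_mequiv:
 assumes w: "wfm r G M" and e: "marking_equiv G M M'"
 shows "marking_equiv H (comp_marking H cV cE M) (comp_marking H cV cE M')"
proof -
 obtain v ws v' ws' where M: "M = (v,ws)" "M' = (v',ws')" by (metis surj_pair)
 obtain p where p: "length ws = length ws'" "walk G (gE G) p v v'" "!!i. i < length ws ==> ws' ! i = red G (rev_path G p@ws ! i@p)"
  using e unfolding M mequiv_iff by blast
 have pE: "set p <= gE G" "set (rev_path G p) <= gE G"
  using walk_E[OF sG p(2)] set_rev_path[OF sG] by auto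
 note sub = set_subst[OF hom]
 have "red H (cp (ws' ! i)) = red H (rev_path H (cp p)@red H (cp (ws ! i))@cp p)" if i: "i < length ws" for i
 proof -
  have wE: "set (ws ! i) <= gE G" using w i walk_E[OF sG] unfolding M wfm_def by auto
  have "red H (cp (ws' ! i)) = red H (cp (rev_path G p@ws ! i@p))"
   unfolding p(3)[OF i] by (rule red_subst_red[OF sG sH hom]) (use pE wE in auto)
  also have "... = red H (rev_path H (cp p)@red H (cp (ws ! i))@cp p)"
   unfolding subst_simps
   by (intro red_append_cong[OF sH] sub pE wE set_rev_path[OF sH] order_trans[OF set_red] red_subst_rev_path[OF sG sH hom] refl red_red[symmetric])
  finally show ?thesis .
 qed
 then show ?thesis unfolding M comp_marking_eq mequiv_iff
  using p(1) cwalk[OF p(2)] by (intro conjI exI[of _ "cp p"]) auto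
qed

lemma petal_comp:
 assumes w: "!!i. i < r ==> walk G (gE G) (ws ! i) v v" and l: "length ws = r" and q: "set q <= gE (rose r)"
 shows "red H (subst (petal H (map (%w. red H (cp w)) ws)) q) = red H (cp (subst (petal G ws) q))"
proof -
 have "cp (subst (petal G ws) q) = subst (%e. cp (petal G ws e)) q" by (induction q) auto
 moreover have "red H (subst (petal H (map (%w. red H (cp w)) ws)) q) = red H (subst (%e. cp (petal G ws e)) q)"
 proof (rule red_subst_letterwise[OF sH])
  fix e assume "e:set q"
  then have i: "e div 2 < r" using q by auto
  have E: "set (ws ! (e div 2)) <= gE G" by (rule walk_E[OF sG w[OF i]])
  have E': "set (cp (ws ! (e div 2))) <= gE H" by (rule set_subst[OF hom E])
  have E'': "set (red H (cp (ws ! (e div 2)))) <= gE H" using E' set_red by blast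
  have pE: "set (petal G ws e) <= gE G" using E set_rev_path[OF sG E] by (auto simp: petal_def)
  have 1: "red H (rev_path H (red H (cp (ws ! (e div 2))))) = red H (cp (rev_path G (ws ! (e div 2))))"
   using red_rev_path[OF sH E''] red_rev_path[OF sH E'] red_subst_rev_path[OF sG sH hom E] by simp
  show "set (petal H (map (%w. red H (cp w)) ws) e) <= gE H & set (cp (petal G ws e)) <= gE H &
   red H (petal H (map (%w. red H (cp w)) ws) e) = red H (cp (petal G ws e))"
   using i l E'' set_rev_path[OF sH E''] set_subst[OF hom pE] 1 by (auto simp: petal_def)
 qed
 ultimately show ?thesis by simp
qed

text \<open>Surjectivity on the fundamental group is transported by \<open>lift\<close>, injectivity
  by \<open>cp_inj_Nil\<close>.\<close>

lemma comp_valid: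
 assumes "valid_marking r G M"
 shows "valid_marking r H (comp_marking H cV cE M)"
proof -
 obtain v ws where M: "M = (v,ws)" by (metis surj_pair)
 note vm = assms[unfolded M]
 note D = valid_markingD[OF vm]
 have wf: "wfm r H (cV v,map (%w. red H (cp w)) ws)" using comp_wfm[OF valid_wfm[OF vm]] by (simp add: comp_marking_eq)
 have pc: "red H (subst (petal H (map (%w. red H (cp w)) ws)) q) = red H (cp (subst (petal G ws) q))"
  if "set q <= gE (rose r)" for q by (rule petal_comp[of r ws v, OF _ D(2) that]) (rule D(3))
 have surj: "EX q. set q <= gE (rose r) & red H (subst (petal H (map (%w. red H (cp w)) ws)) q) = c"
  if c: "walk H (gE H) c (cV v) (cV v)" "reduced H c" for c
 proof -
  obtain p where p: "walk G (gE G) p v v" "cp p = c" using lift[OF c(1) D(1) D(1)] by blast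
  have "walk G (gE G) (red G p) v v" by (rule walk_red[OF sG order_refl p(1)])
  then obtain q where q: "set q <= gE (rose r)" "red G (subst (petal G ws) q) = red G p"
   using vm unfolding valid_marking_iff by (meson red_reduced)
  have E: "set (subst (petal G ws) q) <= gE G" "set p <= gE G"
   using walk_E[OF sG] set_petal_subst[OF sG vm q(1)] p(1) by blast+
  have "red H (cp (subst (petal G ws) q)) = red H (cp p)" by (rule red_subst_cong[OF sG sH hom E q(2)])
  then show ?thesis using q(1) pc[OF q(1)] p(2) red_id[OF c(2)] by auto
 qed
 have inj: "q = []" if q: "set q <= gE (rose r)" "reduced (rose r) q" "red H (subst (petal H (map (%w. red H (cp w)) ws)) q) = []" for q
 proof -
  have "red H (cp (subst (petal G ws) q)) = []" using pc[OF q(1)] q(3) by simp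
  then have "red G (subst (petal G ws) q) = []" by (rule cp_inj_Nil[OF set_petal_subst[OF sG vm q(1)]])
  then show ?thesis using vm q(1,2) unfolding valid_marking_iff by blast
 qed
 show ?thesis unfolding M comp_marking_eq valid_marking_iff
  using wf[unfolded wfm_def fst_conv snd_conv] surj inj by blast
qed

text \<open>A blow-up of a marked graph is first built as a bare graph; this lemma then provides its
  marking.\<close>

lemma marking_lift:
 assumes "valid_marking r H N"
 shows "EX M. valid_marking r G M & comp_marking H cV cE M = N"
proof -
 obtain w us where N: "N = (w,us)" by (metis surj_pair)
 note vm = assms[unfolded N]
 note D = valid_markingD[OF vm]
 have "w:cV ` gV G" using D(1) cV_im by simp
 then obtain v where v: "v:gV G" "cV v = w" by blast
 have "ALL i<r. EX p. walk G (gE G) p v v & cp p = us ! i" using lift[OF _ v(1) v(1)] D(3) v(2) by simp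
 then obtain P where P: "!!i. i < r ==> walk G (gE G) (P i) v v & cp (P i) = us ! i" by metis
 define ws where "ws = map (%i. red G (P i)) [0..<r]"
 have ws: "length ws = r" "!!i. i < r ==> ws ! i = red G (P i)" by (auto simp: ws_def)
 have wl: "walk G (gE G) (ws ! i) v v" if "i < r" for i using walk_red[OF sG order_refl] P[OF that] ws(2)[OF that] by simp
 have eq: "map (%w. red H (cp w)) ws = us"
 proof (rule nth_equalityI)
  fix i assume i: "i < length (map (%w. red H (cp w)) ws)"
  then have i: "i < r" using ws by simp
  have "red H (cp (red G (P i))) = red H (cp (P i))" using cp_red[of "P i"] P[OF i] by auto
  then show "map (%w. red H (cp w)) ws ! i = us ! i" using i ws P[OF i] D(4)[OF i] by (simp add: red_id)
 qed (use ws D in simp)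
 have pc: "red H (subst (petal H us) q) = red H (cp (subst (petal G ws) q))"
  if "set q <= gE (rose r)" for q using petal_comp[of r ws v, OF _ ws(1) that] wl eq by simp
 have psub: "walk G (gE G) (subst (petal G ws) q) v v" if "set q <= gE (rose r)" for q
  by (rule subst_walk[OF v(1) sG], rule petal_walk[OF sG wl]) (use that in auto)
 have "valid_marking r G (v,ws)" unfolding valid_marking_iff
 proof (intro conjI allI impI)
  fix c assume c: "walk G (gE G) c v v & reduced G c"
  have "walk H (gE H) (cp c) w w" "reduced H (cp c)" using cwalk[of c v v] creduced[of c v v] c v(2) by auto
  then obtain q where q: "set q <= gE (rose r)" "red H (subst (petal H us) q) = cp c"
   using vm unfolding valid_marking_iff by blast
  have "red G (subst (petal G ws) q) = red G c"
   by (rule cp_inj[OF psub[OF q(1)] conjunct1[OF c]]) (use pc[OF q(1)] q(2) in \<open>metis red_red\<close>)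
  then show "EX q. set q <= gE (rose r) & red G (subst (petal G ws) q) = c" using q(1) c red_id by auto
 next
  fix q assume q: "set q <= gE (rose r) & reduced (rose r) q & red G (subst (petal G ws) q) = []"
  have E: "set (subst (petal G ws) q) <= gE G" using walk_E[OF sG psub] q by blast
  have "red H (cp (subst (petal G ws) q)) = red H (cp [])"
   by (rule red_subst_cong[OF sG sH hom E]) (use q in auto)
  then have "red H (subst (petal H us) q) = []" using pc q by simp
  then show "q = []" using vm q unfolding valid_marking_iff by blast
 qed (use v ws wl in auto)
 then show ?thesis using v eq unfolding N by (intro exI[of _ "(v,ws)"]) (simp add: comp_marking_eq)
qed

text \<open>Once the collapse is fixed, the marking upstairs is determined up to equivalence by the
  marking below. The many markings of a graph in the star of a point thus reduce to one for each
  collapse, and local finiteness rests on this.\<close>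

lemma comp_mequiv_inj:
 assumes w: "wfm r G M" "wfm r G M'" and e: "marking_equiv H (comp_marking H cV cE M) (comp_marking H cV cE M')"
 shows "marking_equiv G M M'"
proof -
 obtain v ws v' ws' where M: "M = (v,ws)" "M' = (v',ws')" by (metis surj_pair)
 have len: "length ws = r" "length ws' = r" "v:gV G" "v':gV G" using w unfolding M wfm_def by auto
 obtain q where q: "walk H (gE H) q (cV v) (cV v')"
  "!!i. i < r ==> red H (cp (ws' ! i)) = red H (rev_path H q@red H (cp (ws ! i))@q)"
  using e len unfolding M comp_marking_eq mequiv_iff by auto
 obtain p where p: "walk G (gE G) p v v'" "cp p = q" using lift[OF q(1)] len by blast
 have pE: "set p <= gE G" "set (rev_path G p) <= gE G"
  using walk_E[OF sG p(1)] set_rev_path[OF sG] by auto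
 note sub = set_subst[OF hom]
 have "ws' ! i = red G (rev_path G p@ws ! i@p)" if i: "i < r" for i
 proof -
  have wi: "walk G (gE G) (ws ! i) v v" "walk G (gE G) (ws' ! i) v' v'" "reduced G (ws' ! i)" using w i unfolding M wfm_def by auto
  have wE: "set (ws ! i) <= gE G" by (rule walk_E[OF sG wi(1)])
  have wk: "walk G (gE G) (rev_path G p@ws ! i@p) v' v'"
   using walk_rev_E[OF sG p(1)] p(1) wi(1) walk_append[OF sG order_refl] by blast
  have "red H (cp (rev_path G p@ws ! i@p)) = red H (rev_path H (cp p)@red H (cp (ws ! i))@cp p)"
   unfolding subst_simps
   by (intro red_append_cong[OF sH] sub pE wE set_rev_path[OF sH] order_trans[OF set_red] red_subst_rev_path[OF sG sH hom] refl red_red[symmetric])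
  then have "red H (cp (ws' ! i)) = red H (cp (rev_path G p@ws ! i@p))" using q(2)[OF i] p(2) by simp
  from cp_inj[OF wi(2) wk this] show ?thesis using red_id[OF wi(3)] by simp
 qed
 then show ?thesis unfolding M mequiv_iff using p(1) len by auto
qed

end

text \<open>The order of marked graphs with the collapse made explicit; \<open>(G,M)\<close> is the
  larger side.\<close>

definition mdom :: "sgraph => nat \<times> nat list list => sgraph => nat \<times> nat list list => (nat => nat) => (nat => nat option) => bool" where
 "mdom G M H N cV cE \<longleftrightarrow> coll G H cV cE & marking_equiv H N (comp_marking H cV cE M)"

lemma cmap_bind: "subst (cmap (%e. Option.bind (cE e) bE)) p = subst (cmap bE) (subst (cmap cE) p)"
proof (induction p)
 case (Cons e p)
 then show ?case by (cases "cE e") (simp_all add: cmap_def[of _ e] cmap_def[of bE])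
qed simp

lemma comp_compose:
 assumes sg: "serre_graph G" "serre_graph H" "serre_graph K" and c: "coll G H cV cE" and b: "coll H K bV bE" and w: "wfm r G M"
 shows "comp_marking K (bV \<circ> cV) (%e. Option.bind (cE e) bE) M = comp_marking K bV bE (comp_marking H cV cE M)"
proof -
 interpret c: coll2 G H cV cE using sg c by unfold_locales
 interpret b: coll2 H K bV bE using sg b by unfold_locales
 obtain v ws where M: "M = (v,ws)" by (metis surj_pair)
 have "red K (subst (cmap (%e. Option.bind (cE e) bE)) u) = red K (b.cp (red H (c.cp u)))" if u: "u:set ws" for u
 proof -
  have "set u <= gE G" using w u walk_E[OF sg(1)] unfolding M wfm_def in_set_conv_nth by fastforce
  then have "set (c.cp u) <= gE H" by (rule set_subst[OF c.hom])
  from red_subst_red[OF sg(2,3) b.hom this] show ?thesis by (simp add: cmap_bind)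
 qed
 then show ?thesis unfolding M by (simp add: comp_marking_def collapse_path_subst)
qed

lemma mdom_compose:
 assumes sg: "serre_graph G" "serre_graph H" "serre_graph K" and w: "wfm r G M" "wfm r H N" "wfm r K J"
  and c: "mdom G M H N cV cE" and b: "mdom H N K J bV bE"
 shows "mdom G M K J (bV \<circ> cV) (%e. Option.bind (cE e) bE)"
proof -
 interpret c: coll2 G H cV cE using sg c by unfold_locales (auto simp: mdom_def)
 interpret b: coll2 H K bV bE using sg b by unfold_locales (auto simp: mdom_def)
 have "marking_equiv K J (comp_marking K bV bE N)" using b by (simp add: mdom_def)
 moreover have "marking_equiv K (comp_marking K bV bE N) (comp_marking K bV bE (comp_marking H cV cE M))"
  by (rule b.comp_mequiv[OF w(2)]) (use c in \<open>simp add: mdom_def\<close>)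
 ultimately have "marking_equiv K J (comp_marking K bV bE (comp_marking H cV cE M))" by (rule mequiv_trans[OF sg(3) w(3)])
 then show ?thesis unfolding mdom_def
  using coll_compose[OF sg c.co b.co] comp_compose[OF sg c.co b.co w(1)] by simp
qed

lemma comp_cong:
 assumes "cV (fst M) = dV (fst M)" "!!e w. w:set (snd M) ==> e:set w ==> cE e = dE e"
 shows "comp_marking H cV cE M = comp_marking H dV dE M"
proof -
 have "subst (cmap cE) p = subst (cmap dE) p" if "!!e. e:set p ==> cE e = dE e" for p
  using that by (induction p) (auto simp: cmap_def)
 then show ?thesis using assms by (simp add: comp_marking_def collapse_path_subst)
qed

lemma mdom_factor:
 assumes sg: "serre_graph G" "serre_graph H" "serre_graph K" and w: "wfm r G M" "wfm r H N" "wfm r K J"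
  and c: "mdom G M H N cV cE" and d: "mdom G M K J dV dE"
  and sub: "!!e. e:gE G ==> cE e = None ==> dE e = None"
 shows "EX bV bE. mdom H N K J bV bE & (ALL e:gE G. dE e = Option.bind (cE e) bE)"
proof -
 have cc: "coll G H cV cE" and dd: "coll G K dV dE" using c d by (auto simp: mdom_def)
 obtain bV bE where b: "coll H K bV bE" "!!v. v:gV G ==> bV (cV v) = dV v" "!!e. e:gE G ==> dE e = Option.bind (cE e) bE"
  using coll_factor[OF sg cc dd sub] by blast
 interpret c: coll2 G H cV cE using sg cc by unfold_locales
 interpret b: coll2 H K bV bE using sg b(1) by unfold_locales
 have "comp_marking K dV dE M = comp_marking K (bV \<circ> cV) (%e. Option.bind (cE e) bE) M"
 proof (rule comp_cong)
  show "dV (fst M) = (bV \<circ> cV) (fst M)" using b(2) w(1) by (simp add: wfm_def)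
  fix e u assume u: "u:set (snd M)" "e:set u"
  then obtain i where "i < r" "u = snd M ! i" using w(1) by (auto simp: in_set_conv_nth wfm_def)
  then have "walk G (gE G) u (fst M) (fst M)" using w(1) by (simp add: wfm_def)
  then have "e:gE G" using walk_E[OF sg(1)] u(2) by blast
  then show "dE e = Option.bind (cE e) bE" by (rule b(3))
 qed
 also have "... = comp_marking K bV bE (comp_marking H cV cE M)" by (rule comp_compose[OF sg cc b(1) w(1)])
 finally have eq: "comp_marking K dV dE M = comp_marking K bV bE (comp_marking H cV cE M)" .
 have "marking_equiv K (comp_marking K bV bE N) (comp_marking K dV dE M)"
  unfolding eq by (rule b.comp_mequiv[OF w(2)]) (use c in \<open>simp add: mdom_def\<close>)
 then have "marking_equiv K (comp_marking K dV dE M) (comp_marking K bV bE N)"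
  by (rule mequiv_sym[OF sg(3) b.comp_wfm[OF w(2)]])
 moreover have "marking_equiv K J (comp_marking K dV dE M)" using d by (simp add: mdom_def)
 ultimately have "marking_equiv K J (comp_marking K bV bE N)" using mequiv_trans[OF sg(3) w(3)] by blast
 then have "mdom H N K J bV bE" using b(1) by (simp add: mdom_def)
 then show ?thesis using b(3) by blast
qed

lemma coll_id: "serre_graph G ==> coll G G id Some"
 unfolding coll_def by (auto simp: serreD nset_def intro!: exI[of _ "[]"]) (case_tac p; simp)

lemma cp_Some: "subst (cmap (%e. Some (f e))) p = map f p"
 by (induction p) (auto simp: cmap_def)

lemma mdom_id:
 assumes "serre_graph G" "wfm r G M"
 shows "mdom G M G M id Some"
proof -
 obtain v ws where M: "M = (v,ws)" by (metis surj_pair)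
 have "map (%w. red G (subst (cmap Some) w)) ws = ws"
  using assms(2) cp_Some[of "%e. e"] unfolding M wfm_def by (intro nth_equalityI) (auto simp: red_id)
 then have "comp_marking G id Some M = M" unfolding M by (simp add: comp_marking_def collapse_path_subst)
 then show ?thesis using coll_id[OF assms(1)] mequiv_refl[OF assms] by (simp add: mdom_def)
qed

lemma len_pull:
 assumes "serre_graph G" "serre_graph H" "coll G H cV cE" "e:gE G"
 shows "len G (pullback G cE H l) e = (case cE e of Some f => len H l f | None => 0)"
proof -
 interpret coll2 G H cV cE using assms by unfold_locales
 show ?thesis
 proof (cases "e:gEp G")
  case True
  then show ?thesis by (simp add: len_def pullback_def)
 next
  case False
  have be: "gbar G e:gEp G" using serre_Ep[OF assms(1,4)] False by simp
  show ?thesis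
  proof (cases "cE e")
   case None
   then show ?thesis using edge_None[OF assms(4) None] False be by (simp add: len_def pullback_def)
  next
   case (Some f)
   have f: "f:gE H" "cE (gbar G e) = Some (gbar H f)" using edge_Some[OF assms(4) Some] by auto
   have "len H l (gbar H f) = len H l f"
    using serre_Ep[OF assms(2) f(1)] serreD(4)[OF assms(2) f(1)] by (auto simp: len_def)
   then show ?thesis using Some f False be by (simp add: len_def[of G] pullback_def)
  qed
 qed
qed

lemma pull_eqI:
 assumes "serre_graph G" "serre_graph H" "coll G H cV cE" "!!e. e ~: gEp G ==> lam e = 0"
  "!!e. e:gE G ==> len G lam e = (case cE e of Some f => len H l f | None => 0)"
 shows "lam = pullback G cE H l"
proof
 fix e show "lam e = pullback G cE H l e"
  using assms(4)[of e] assms(5)[of e] serre_fin(3)[OF assms(1)] by (auto simp: pullback_def len_def)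
qed

text \<open>Isomorphisms regarded as collapses that collapse nothing. Transitivity and symmetry then
  come from \<open>mdom_compose\<close> and \<open>mdom_factor\<close>.\<close>

definition meq :: "mmg => mmg => bool" where
 "meq t t' \<longleftrightarrow> (case t of (G,M,l) => case t' of (G',M',l') =>
   EX cV cE. mdom G M G' M' cV cE & (ALL e:gE G. cE e ~= None) & (ALL e:gE G. len G' l' (the (cE e)) = len G l e))"

lemma iso_coll:
 assumes "serre_graph G" "serre_graph G'" "graph_iso G G' fV fE"
 shows "coll G G' fV (%e. Some (fE e))"
proof -
 have V: "bij_betw fV (gV G) (gV G')" and E: "bij_betw fE (gE G) (gE G')"
  and ed: "!!e. e:gE G ==> gorg G' (fE e) = fV (gorg G e) & fE (gbar G e) = gbar G' (fE e)"
  using assms(3) by (auto simp: graph_iso_def)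
 have ns: "nset G (%e. Some (fE e)) = {}" by (auto simp: nset_def)
 have 1: "fV ` gV G = gV G'" using V by (simp add: bij_betw_def)
 have 2: "fE e:gE G'" if "e:gE G" for e using E that by (auto simp: bij_betw_def)
 have 3: "EX! e. e:gE G & Some (fE e) = Some f" if f: "f:gE G'" for f
 proof -
  have "f:fE ` gE G" using f E by (simp add: bij_betw_def)
  then obtain e where "e:gE G" "fE e = f" by blast
  moreover have "inj_on fE (gE G)" using E by (simp add: bij_betw_def)
  ultimately show ?thesis by (auto dest: inj_onD)
 qed
 have 4: "EX p. walk G (nset G (%e. Some (fE e))) p a b" if "a:gV G" "b:gV G" "fV a = fV b" for a b
 proof -
  have "a = b" using that V by (auto simp: bij_betw_def dest: inj_onD)
  then show ?thesis using that by (intro exI[of _ "[]"]) simp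
 qed
 have 5: "p = []" if "walk G (nset G (%e. Some (fE e))) p a a" for p a using that by (cases p) (auto simp: ns)
 show ?thesis unfolding coll_def using 1 2 3 4 5 ed by auto
qed

lemma iso_comp:
 assumes "serre_graph G" "serre_graph G'" "graph_iso G G' fV fE" "wfm r G M"
 shows "comp_marking G' fV (%e. Some (fE e)) M = (fV (fst M),map (map fE) (snd M))"
proof -
 interpret coll2 G G' fV "%e. Some (fE e)" using assms iso_coll[OF assms(1-3)] by unfold_locales
 obtain v ws where M: "M = (v,ws)" by (metis surj_pair)
 have "red G' (cp w) = map fE w" if w: "w:set ws" for w
 proof -
  obtain i where "i < r" "w = ws ! i" using w assms(4) unfolding M by (auto simp: in_set_conv_nth wfm_def)
  then have "walk G (gE G) w v v" "reduced G w" using assms(4) unfolding M by (auto simp: wfm_def)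
  from creduced[OF this] show ?thesis by (simp add: red_id cp_Some)
 qed
 then show ?thesis unfolding M by (simp add: comp_marking_eq)
qed

lemma mmg_equiv_iff:
 assumes sg: "serre_graph G" "serre_graph G'" and w: "wfm r G M" "wfm r G' M'"
 shows "mmg_equiv (G,M,l) (G',M',l') \<longleftrightarrow> meq (G,M,l) (G',M',l')"
proof
 assume "mmg_equiv (G,M,l) (G',M',l')"
 then obtain fV fE where f: "graph_iso G G' fV fE" "ALL e:gE G. len G' l' (fE e) = len G l e"
  "marking_equiv G' (fV (fst M),map (map fE) (snd M)) M'" by (auto simp: mmg_equiv_def)
 interpret coll2 G G' fV "%e. Some (fE e)" using sg iso_coll[OF sg f(1)] by unfold_locales
 have "marking_equiv G' M' (comp_marking G' fV (%e. Some (fE e)) M)"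
  using mequiv_sym[OF sg(2) comp_wfm[OF w(1)]] f(3) iso_comp[OF sg f(1) w(1)] by simp
 then show "meq (G,M,l) (G',M',l')" unfolding meq_def mdom_def prod.case using co f(2)
  by (intro exI[of _ fV] exI[of _ "%e. Some (fE e)"]) auto
next
 assume "meq (G,M,l) (G',M',l')"
 then obtain cV cE where c: "mdom G M G' M' cV cE" "!!e. e:gE G ==> cE e ~= None"
  "!!e. e:gE G ==> len G' l' (the (cE e)) = len G l e" by (auto simp: meq_def)
 interpret coll2 G G' cV cE using sg c(1) by unfold_locales (auto simp: mdom_def)
 have ns: "nset G cE = {}" using c(2) by (auto simp: nset_def)
 define fE where "fE e = the (cE e)" for e
 have fE: "cE e = Some (fE e)" if "e:gE G" for e using c(2)[OF that] by (auto simp: fE_def)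
 have "inj_on cV (gV G)"
 proof (rule inj_onI)
  fix a b assume "a:gV G" "b:gV G" "cV a = cV b"
  from fib_conn[OF this] obtain p where "walk G (nset G cE) p a b" by blast
  then show "a = b" by (cases p) (auto simp: ns)
 qed
 then have V: "bij_betw cV (gV G) (gV G')" using cV_im by (simp add: bij_betw_def)
 have E: "bij_betw fE (gE G) (gE G')" unfolding bij_betw_def
 proof
  show "inj_on fE (gE G)" by (rule inj_onI) (metis fE edge_uniq)
  show "fE ` gE G = gE G'"
  proof
   show "fE ` gE G <= gE G'" using edge_Some fE by blast
   show "gE G' <= fE ` gE G"
   proof
    fix f assume "f:gE G'"
    then obtain e where "e:gE G" "cE e = Some f" using edge_ex by blast
    then show "f:fE ` gE G" using fE by force
   qed
  qed
 qed
 have iso: "graph_iso G G' cV fE" unfolding graph_iso_def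
  using V E edge_Some[OF _ fE] serreD(2)[OF sg(1)] fE by (metis option.inject)
 have "comp_marking G' cV cE M = comp_marking G' cV (%e. Some (fE e)) M"
 proof (rule comp_cong)
  fix e u assume u: "u:set (snd M)" "e:set u"
  then obtain i where "i < r" "u = snd M ! i" using w(1) by (auto simp: in_set_conv_nth wfm_def)
  then have "walk G (gE G) u (fst M) (fst M)" using w(1) by (simp add: wfm_def)
  then have "e:gE G" using walk_E[OF sg(1)] u(2) by blast
  then show "cE e = Some (fE e)" by (rule fE)
 qed simp
 moreover have "marking_equiv G' (comp_marking G' cV cE M) M'"
  by (rule mequiv_sym[OF sg(2) w(2)]) (use c(1) in \<open>simp add: mdom_def\<close>)
 ultimately have "marking_equiv G' (cV (fst M),map (map fE) (snd M)) M'" using iso_comp[OF sg iso w(1)] by simp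
 then show "mmg_equiv (G,M,l) (G',M',l')"
  unfolding mmg_equiv_def prod.case using iso c(3) by (intro exI[of _ cV] exI[of _ fE]) (simp add: fE_def)
qed

lemma valid_mmgD:
 assumes "valid_mmg r (G,M,l)"
 shows "outer_graph G" "serre_graph G" "valid_marking r G M" "wfm r G M" "l:lengths G"
 using assms outerD(1) valid_wfm by (auto simp: valid_mmg_def)

lemma meq_refl: "valid_mmg r t ==> meq t t"
proof -
 assume v: "valid_mmg r t"
 obtain G M l where t: "t = (G,M,l)" by (metis surj_pair)
 show ?thesis unfolding t meq_def using mdom_id[OF valid_mmgD(2,4)[OF v[unfolded t]]] by force
qed

lemma meq_trans:
 assumes v: "valid_mmg r t1" "valid_mmg r t2" "valid_mmg r t3" and "meq t1 t2" "meq t2 t3"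
 shows "meq t1 t3"
proof -
 obtain G1 M1 l1 G2 M2 l2 G3 M3 l3 where t: "t1 = (G1,M1,l1)" "t2 = (G2,M2,l2)" "t3 = (G3,M3,l3)" by (metis surj_pair)
 note D1 = valid_mmgD[OF v(1)[unfolded t]] note D2 = valid_mmgD[OF v(2)[unfolded t]] note D3 = valid_mmgD[OF v(3)[unfolded t]]
 obtain cV cE where c: "mdom G1 M1 G2 M2 cV cE" "!!e. e:gE G1 ==> cE e ~= None" "!!e. e:gE G1 ==> len G2 l2 (the (cE e)) = len G1 l1 e"
  using assms(4) unfolding t meq_def by auto
 obtain bV bE where b: "mdom G2 M2 G3 M3 bV bE" "!!e. e:gE G2 ==> bE e ~= None" "!!e. e:gE G2 ==> len G3 l3 (the (bE e)) = len G2 l2 e"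
  using assms(5) unfolding t meq_def by auto
 interpret coll2 G1 G2 cV cE using D1 D2 c by unfold_locales (auto simp: mdom_def)
 have "mdom G1 M1 G3 M3 (bV \<circ> cV) (%e. Option.bind (cE e) bE)"
  by (rule mdom_compose[OF D1(2) D2(2) D3(2) D1(4) D2(4) D3(4) c(1) b(1)])
 moreover have "Option.bind (cE e) bE ~= None & len G3 l3 (the (Option.bind (cE e) bE)) = len G1 l1 e" if e: "e:gE G1" for e
 proof -
  obtain f where f: "cE e = Some f" using c(2)[OF e] by auto
  have "f:gE G2" using edge_Some[OF e f] by simp
  then show ?thesis using b(2,3)[of f] c(3)[OF e] f by simp
 qed
 ultimately show ?thesis unfolding t meq_def prod.case by (intro exI[of _ "bV \<circ> cV"] exI[of _ "%e. Option.bind (cE e) bE"]) auto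
qed

lemma meq_sym:
 assumes v: "valid_mmg r t1" "valid_mmg r t2" and "meq t1 t2"
 shows "meq t2 t1"
proof -
 obtain G1 M1 l1 G2 M2 l2 where t: "t1 = (G1,M1,l1)" "t2 = (G2,M2,l2)" by (metis surj_pair)
 note D1 = valid_mmgD[OF v(1)[unfolded t]] note D2 = valid_mmgD[OF v(2)[unfolded t]]
 obtain cV cE where c: "mdom G1 M1 G2 M2 cV cE" "!!e. e:gE G1 ==> cE e ~= None" "!!e. e:gE G1 ==> len G2 l2 (the (cE e)) = len G1 l1 e"
  using assms(3) unfolding t meq_def by auto
 interpret coll2 G1 G2 cV cE using D1 D2 c by unfold_locales (auto simp: mdom_def)
 \<comment> \<open>The inverse isomorphism arises by factoring the identity of \<open>G1\<close>
   through the given one.\<close>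
 have "EX bV bE. mdom G2 M2 G1 M1 bV bE & (ALL e:gE G1. Some e = Option.bind (cE e) bE)"
  by (rule mdom_factor[OF D1(2) D2(2) D1(2) D1(4) D2(4) D1(4) c(1) mdom_id[OF D1(2,4)]]) (use c(2) in blast)
 then obtain bV bE where b: "mdom G2 M2 G1 M1 bV bE" "!!e. e:gE G1 ==> Some e = Option.bind (cE e) bE" by blast
 have "bE f ~= None & len G1 l1 (the (bE f)) = len G2 l2 f" if f: "f:gE G2" for f
 proof -
  obtain e where e: "e:gE G1" "cE e = Some f" using edge_ex[OF f] by auto
  then have "bE f = Some e" using b(2)[OF e(1)] by simp
  then show ?thesis using c(3)[OF e(1)] e by simp
 qed
 then show ?thesis unfolding t meq_def prod.case using b(1) by blast
qed

lemma cls_meq: "valid_mmg r t ==> cls r t = {t'. valid_mmg r t' & meq t t'}"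
proof -
 assume v: "valid_mmg r t"
 obtain G M l where t: "t = (G,M,l)" by (metis surj_pair)
 have "mmg_equiv t t' \<longleftrightarrow> meq t t'" if v': "valid_mmg r t'" for t'
 proof -
  obtain G' M' l' where t': "t' = (G',M',l')" by (metis surj_pair)
  show ?thesis unfolding t t' using mmg_equiv_iff[of G G' r M M'] valid_mmgD[OF v[unfolded t]] valid_mmgD[OF v'[unfolded t']] by blast
 qed
 then show ?thesis by (auto simp: cls_def)
qed

lemma cls_eq_iff:
 assumes "valid_mmg r t" "valid_mmg r t'"
 shows "cls r t = cls r t' \<longleftrightarrow> meq t t'"
proof
 assume "cls r t = cls r t'"
 moreover have "t':cls r t'" using assms(2) meq_refl by (simp add: cls_meq[OF assms(2)])
 ultimately have "t':cls r t" by (simp only:)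
 then show "meq t t'" by (simp add: cls_meq[OF assms(1)])
next
 assume m: "meq t t'"
 have "meq t s \<longleftrightarrow> meq t' s" if s: "valid_mmg r s" for s
  using meq_trans[OF assms(1,2) s m] meq_trans[OF assms(2,1) s meq_sym[OF assms m]] by blast
 then show "cls r t = cls r t'" by (auto simp: cls_meq assms)
qed

lemma cell_rel_iff:
 assumes "serre_graph G"
 shows "cell_rel r G M lam x \<longleftrightarrow> (EX G0 M0 l0 cV cE. valid_mmg r (G0,M0,l0) & mdom G M G0 M0 cV cE &
  lam = pullback G cE G0 l0 & x = cls r (G0,M0,l0))"
 unfolding cell_rel_def mdom_def collapse_iff_coll[OF assms] by blast

lemma len_lengths_pos: "serre_graph G ==> l:lengths G ==> e:gE G ==> len G l e > 0"
 using serre_Ep[of G e] by (auto simp: len_def lengths_def)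

lemma pull_zero_iff:
 assumes "serre_graph G" "serre_graph H" "coll G H cV cE" "l:lengths H" "e:gE G"
 shows "len G (pullback G cE H l) e = 0 \<longleftrightarrow> cE e = None"
proof -
 interpret coll2 G H cV cE using assms by unfold_locales
 show ?thesis
 proof (cases "cE e")
  case None
  then show ?thesis by (simp add: len_pull[OF assms(1,2,3,5)])
 next
  case (Some f)
  then have "f:gE H" using edge_Some[OF assms(5)] by simp
  then show ?thesis using Some len_lengths_pos[OF assms(2,4), of f] by (simp add: len_pull[OF assms(1,2,3,5)])
 qed
qed

text \<open>The zero coordinates are precisely the collapsed edges. Two collapses with equal
  coordinates therefore kill the same edges, and one factors through the other by an isomorphism
  that preserves lengths.\<close>

lemma cell_rel_fun:
 assumes "outer_graph G" "valid_marking r G M" "cell_rel r G M lam x" "cell_rel r G M lam y"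
 shows "x = y"
proof -
 note sg = outerD(1)[OF assms(1)] note w = valid_wfm[OF assms(2)]
 obtain G1 M1 l1 cV cE where 1: "valid_mmg r (G1,M1,l1)" "mdom G M G1 M1 cV cE" "lam = pullback G cE G1 l1" "x = cls r (G1,M1,l1)"
  using iffD1[OF cell_rel_iff[OF sg] assms(3)] by blast
 obtain G2 M2 l2 dV dE where 2: "valid_mmg r (G2,M2,l2)" "mdom G M G2 M2 dV dE" "lam = pullback G dE G2 l2" "y = cls r (G2,M2,l2)"
  using iffD1[OF cell_rel_iff[OF sg] assms(4)] by blast
 note D1 = valid_mmgD[OF 1(1)] note D2 = valid_mmgD[OF 2(1)]
 have c: "coll G G1 cV cE" and d: "coll G G2 dV dE" using 1 2 by (auto simp: mdom_def)
 interpret coll2 G G1 cV cE using sg D1 c by unfold_locales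
 have N: "cE e = None \<longleftrightarrow> dE e = None" if "e:gE G" for e
  using pull_zero_iff[OF sg D1(2) c D1(5) that] pull_zero_iff[OF sg D2(2) d D2(5) that] 1(3) 2(3) by simp
 have "EX bV bE. mdom G1 M1 G2 M2 bV bE & (ALL e:gE G. dE e = Option.bind (cE e) bE)"
  by (rule mdom_factor[OF sg D1(2) D2(2) w D1(4) D2(4) 1(2) 2(2)]) (simp add: N)
 then obtain bV bE where b: "mdom G1 M1 G2 M2 bV bE" "!!e. e:gE G ==> dE e = Option.bind (cE e) bE" by blast
 have "bE f ~= None & len G2 l2 (the (bE f)) = len G1 l1 f" if f: "f:gE G1" for f
 proof -
  obtain e where e: "e:gE G" "cE e = Some f" using edge_ex[OF f] by auto
  then have be: "dE e = bE f" using b(2)[OF e(1)] by simp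
  then have "bE f ~= None" using N[OF e(1)] e by auto
  moreover have "len G lam e = len G1 l1 f" using len_pull[OF sg D1(2) c e(1)] e 1(3) by simp
  moreover have "len G lam e = len G2 l2 (the (bE f))" using len_pull[OF sg D2(2) d e(1)] be 2(3) \<open>bE f ~= None\<close> by auto
  ultimately show ?thesis by simp
 qed
 then have "meq (G1,M1,l1) (G2,M2,l2)" unfolding meq_def prod.case using b(1) by blast
 then show ?thesis unfolding 1(4) 2(4) by (rule iffD2[OF cls_eq_iff[OF 1(1) 2(1)]])
qed

section \<open>Normalized segments in a closed cell\<close>

context loop_sums
begin

text \<open>Uniform bounds for all normalized vectors near a possibly degenerate vector
  \<open>a\<close>. They are obtained from limits along a filter, by \<open>root_tendsto\<close> and
  \<open>F_tendsto\<close>.\<close>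

lemma near_bound:
 assumes a: "cone a" "root (%i. k0 * a i)" "k0 > 0"
 shows "EX \<delta>>0. EX C>0. ALL c k. (ALL i:I. \<bar>c i-a i\<bar> < \<delta>) & cone c & root (%i. k * c i) -->
   1/C <= k & k <= C & 1/C <= c i0 & (ALL i:I. c i <= C) &
   F sz (%i. k * c i) <= C & F (%p. sz p * sz p) (%i. k * c i) <= C"
proof -
 define S where "S \<delta> = {z::real \<times> (nat => real). (ALL i:I. \<bar>snd z i-a i\<bar> < \<delta>) & cone (snd z) & root (%i. fst z * snd z i)}" for \<delta>
 \<comment> \<open>The filter of pairs of a factor and a vector in which the vector tends to
   \<open>a\<close> while the root equation keeps holding.\<close>
 define net where "net = (INF \<delta>\<in>{0<..}. principal (S \<delta>))"
 have ev_net: "eventually P net \<longleftrightarrow> (EX \<delta>>0. ALL z:S \<delta>. P z)" for P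
  unfolding net_def
 proof (subst eventually_INF_base)
  show "EX x:{0<..}. principal (S x) <= inf (principal (S d)) (principal (S e))" if "d:{0<..}" "e:{0<..}" for d e
   using that by (intro bexI[of _ "min d e"]) (auto simp: S_def)
 qed (auto simp: eventually_principal)
 have c: "((%z. snd z i) \<longlongrightarrow> a i) net" if "i:I" for i
  by (rule tendstoI, unfold ev_net dist_real_def) (use that in \<open>auto simp: S_def\<close>)
 have inS: "eventually (%z. cone (snd z) & root (%i. fst z * snd z i)) net"
  unfolding ev_net by (rule exI[of _ 1]) (auto simp: S_def)
 have k: "(fst \<longlongrightarrow> k0) net" by (rule root_tendsto[OF c a(1,2) inS])
 have kc: "((%z. fst z * snd z i) \<longlongrightarrow> k0 * a i) net" if "i:I" for i
  by (intro tendsto_mult k c that)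
 note g = root_good[OF a(2)]
 have F1: "((%z. F sz (%i. fst z * snd z i)) \<longlongrightarrow> F sz (%i. k0 * a i)) net" by (rule F_tendsto(1)[OF kc g pol_sz])
 have F2: "((%z. F (%p. sz p * sz p) (%i. fst z * snd z i)) \<longlongrightarrow> F (%p. sz p * sz p) (%i. k0 * a i)) net"
  by (rule F_tendsto(1)[OF kc g pol_mult[OF pol_sz pol_sz]])
 \<comment> \<open>One constant above all the limits; the summands \<open>2/k0\<close> and
   \<open>2/a i0\<close> make \<open>1/C\<close> lie below \<open>k0\<close> and
   \<open>a i0\<close>.\<close>
 define C where "C = 1+\<bar>F sz (%i. k0 * a i)\<bar>+\<bar>F (%p. sz p * sz p) (%i. k0 * a i)\<bar>+(\<Sum>i\<in>I. \<bar>a i\<bar>)+k0+2/k0+2/a i0"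
 have ai0: "a i0 > 0" using a(1) by (simp add: cone_def)
 have nn: "0 <= (\<Sum>i\<in>I. \<bar>a i\<bar>)" by (intro sum_nonneg) auto
 have nn': "0 < 2/k0" "0 < 2/a i0" using a(3) ai0 by auto
 have C0: "C > 0" unfolding C_def using nn nn' a(3) by linarith
 have C1: "2/k0 <= C" "2/a i0 <= C" "k0 < C" "F sz (%i. k0 * a i) < C" "F (%p. sz p * sz p) (%i. k0 * a i) < C"
  unfolding C_def using nn nn' a(3) by linarith+
 have C2: "1/C < k0" "1/C < a i0"
 proof -
  have "2 <= C * k0" "2 <= C * a i0" using C1(1,2) a(3) ai0 by (simp_all add: pos_divide_le_eq)
  then show "1/C < k0" "1/C < a i0" using C0 by (simp_all add: pos_divide_less_eq mult.commute)
 qed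
 have C3: "a i < C" if "i:I" for i
 proof -
  have "\<bar>a i\<bar> <= (\<Sum>i\<in>I. \<bar>a i\<bar>)" by (rule member_le_sum) (use that finI in auto)
  then show ?thesis unfolding C_def using nn' a(3) by linarith
 qed
 have evI: "eventually (%z. ALL i:I. snd z i < C) net"
  by (rule eventually_ball_finite[OF finI]) (use order_tendstoD(2)[OF c C3] in blast)
 have "eventually (%z. 1/C < fst z & fst z < C & 1/C < snd z i0 & (ALL i:I. snd z i < C) &
   F sz (%i. fst z * snd z i) < C & F (%p. sz p * sz p) (%i. fst z * snd z i) < C) net"
  using order_tendstoD(1)[OF k C2(1)] order_tendstoD(2)[OF k C1(3)] order_tendstoD(1)[OF c[OF i0] C2(2)] evI
   order_tendstoD(2)[OF F1 C1(4)] order_tendstoD(2)[OF F2 C1(5)] by eventually_elim simp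
 then obtain \<delta> where d: "\<delta> > 0" "!!z. z:S \<delta> ==> 1/C < fst z & fst z < C & 1/C < snd z i0 & (ALL i:I. snd z i < C) &
   F sz (%i. fst z * snd z i) < C & F (%p. sz p * sz p) (%i. fst z * snd z i) < C" unfolding ev_net by blast
 have "1/C <= k & k <= C & 1/C <= c i0 & (ALL i:I. c i <= C) &
   F sz (%i. k * c i) <= C & F (%p. sz p * sz p) (%i. k * c i) <= C"
  if "(ALL i:I. \<bar>c i-a i\<bar> < \<delta>) & cone c & root (%i. k * c i)" for c k
  using d(2)[of "(k,c)"] that by (auto simp: S_def less_imp_le)
 then show ?thesis using d(1) C0 by blast
qed

text \<open>The velocity of the normalized vector when \<open>c\<close> moves with velocity
  \<open>u\<close>. The first summand contains the derivative of the factor from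
  \<open>root_DERIV\<close> and makes the motion tangent (\<open>vel_tangent\<close>).\<close>

definition vel :: "(nat => real) => (nat => real) => real => nat => real" where
 "vel c u k = (%i. (- (k * F (ev u) (%i. k * c i))/F (ev c) (%i. k * c i)) * c i+k * u i)"

text \<open>The entropy speed of this motion, in view of \<open>hess_form_eq\<close>. The formula
  stays meaningful at degenerate vectors.\<close>

definition spd :: "(nat => real) => (nat => real) => real => real" where
 "spd c u k = sqrt (F (%p. (ev (vel c u k) p)\<^sup>2) (%i. k * c i)/F (ev (%i. k * c i)) (%i. k * c i))"

lemma vel_tangent:
 assumes "cone c" "root (%i. k * c i)"
 shows "F (ev (vel c u k)) (%i. k * c i) = 0"
proof -
 let ?L = "%i. k * c i"
 have g: "good ?L" by (rule root_good[OF assms(2)])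
 have pos: "F (ev c) ?L ~= 0" using F_cone_pos[OF assms] assms(1) by (auto simp: cone_def)
 define \<kappa> where "\<kappa> = - (k * F (ev u) ?L)/F (ev c) ?L"
 have "F (ev (vel c u k)) ?L = (\<Sum>i\<in>I. (\<kappa> * c i+k * u i) * F (%p. n p i) ?L)"
  unfolding F_linear1[OF g] vel_def \<kappa>_def ..
 also have "... = \<kappa>*(\<Sum>i\<in>I. c i * F (%p. n p i) ?L)+k*(\<Sum>i\<in>I. u i * F (%p. n p i) ?L)"
  by (simp add: algebra_simps sum.distrib sum_distrib_left)
 also have "... = \<kappa> * F (ev c) ?L+k * F (ev u) ?L" unfolding F_linear1[OF g] ..
 also have "... = 0" using pos by (simp add: \<kappa>_def)
 finally show ?thesis .
qed

lemma F_ev_bound: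
 assumes "good L" "!!i. i:I ==> \<bar>u i\<bar> <= D"
 shows "\<bar>F (ev u) L\<bar> <= D * F sz L" "F (%p. (ev u p)\<^sup>2) L <= D\<^sup>2 * F (%p. sz p * sz p) L"
proof -
 have s1: "(%p. D*(sz p * exp (- ev L p))) summable_on P"
  by (intro summable_on_cmult_right good_summable[OF assms(1)] pol_sz)
 have s2: "(%p. norm (ev u p * exp (- ev L p))) summable_on P"
  using good_abs_summable[OF assms(1) pol_ev[of u]] by (simp add: abs_mult)
 have b: "norm (ev u p * exp (- ev L p)) <= D*(sz p * exp (- ev L p))" for p
  using ev_bound[of u D p] assms(2) by (simp add: abs_mult mult.assoc[symmetric] mult_right_mono)
 have "\<bar>F (ev u) L\<bar> <= infsum (%p. norm (ev u p * exp (- ev L p))) P" unfolding F_def using norm_infsum_bound[OF s2] by simp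
 also have "... <= infsum (%p. D*(sz p * exp (- ev L p))) P" by (rule infsum_mono[OF s2 s1 b])
 finally show "\<bar>F (ev u) L\<bar> <= D * F sz L" by (simp add: F_def infsum_cmult_right')
 have s3: "(%p. D\<^sup>2*(sz p * sz p * exp (- ev L p))) summable_on P"
  by (intro summable_on_cmult_right good_summable[OF assms(1)] pol_mult pol_sz)
 have s4: "(%p. (ev u p)\<^sup>2 * exp (- ev L p)) summable_on P"
  using good_summable[OF assms(1) pol_mult[OF pol_ev pol_ev], of u u] by (simp add: power2_eq_square)
 have b2: "(ev u p)\<^sup>2 * exp (- ev L p) <= D\<^sup>2*(sz p * sz p * exp (- ev L p))" for p
 proof -
  have "\<bar>ev u p\<bar>\<^sup>2 <= (D * sz p)\<^sup>2" using ev_bound[of u D p] assms(2) by (intro power_mono) auto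
  then have "(ev u p)\<^sup>2 * exp (- ev L p) <= (D * sz p)\<^sup>2 * exp (- ev L p)" by (intro mult_right_mono) auto
  then show ?thesis by (simp add: power2_eq_square mult_ac)
 qed
 show "F (%p. (ev u p)\<^sup>2) L <= D\<^sup>2 * F (%p. sz p * sz p) L"
  using infsum_mono[OF s4 s3 b2] by (simp add: F_def infsum_cmult_right')
qed

text \<open>The speed is at most linear in the size of \<open>u\<close>. In the constant,
  \<open>C * C * C * C + C\<close> bounds the velocity, the fourth power coming from the change of
  the factor; under the root, \<open>C\<close> bounds the second moment and \<open>C * C\<close> the
  reciprocal of the mean length.\<close>

lemma spd_bound:
 assumes c: "cone c" "root (%i. k * c i)" and C: "C > 0" "1/C <= k" "k <= C" "1/C <= c i0" "!!i. i:I ==> c i <= C"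
  "F sz (%i. k * c i) <= C" "F (%p. sz p * sz p) (%i. k * c i) <= C"
  and u: "!!i. i:I ==> \<bar>u i\<bar> <= D" and D: "D >= 0"
 shows "spd c u k <= (C * C * C * C+C) * sqrt (C * C * C) * D"
proof -
 let ?L = "%i. k * c i"
 have g: "good ?L" by (rule root_good[OF c(2)])
 have k0: "k > 0" using C(1,2) by (meson less_le_trans zero_less_divide_1_iff)
 have c0: "c i0 > 0" using c(1) by (simp add: cone_def)
 have Fc: "F (ev c) ?L >= 1/C" using F_cone_pos[OF c] C(4) by linarith
 have Cp: "1/C > 0" using C(1) by simp
 have Fu: "\<bar>F (ev u) ?L\<bar> <= D * C" using F_ev_bound(1)[OF g, of u D] u mult_left_mono[OF C(6) D] by fastforce
 define \<kappa> where "\<kappa> = - (k * F (ev u) ?L)/F (ev c) ?L"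
 have Fcp: "F (ev c) ?L > 0" by (rule less_le_trans[OF Cp Fc])
 have "\<bar>\<kappa>\<bar> = k*\<bar>F (ev u) ?L\<bar>/F (ev c) ?L" using k0 Fcp by (simp add: \<kappa>_def abs_mult)
 also have "... <= (C*(D * C))/(1/C)"
  using k0 C Fu Fc Cp D by (intro frac_le mult_mono) auto
 finally have kap: "\<bar>\<kappa>\<bar> <= C * C * C * D" by (simp add: mult_ac)
 have v: "\<bar>vel c u k i\<bar> <= (C * C * C * C+C) * D" if i: "i:I" for i
 proof -
  have "\<bar>vel c u k i\<bar> <= \<bar>\<kappa> * c i\<bar>+\<bar>k * u i\<bar>" unfolding vel_def \<kappa>_def by (rule abs_triangle_ineq)
  also have "\<bar>\<kappa> * c i\<bar> <= (C * C * C * D) * C" unfolding abs_mult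
   using kap C(5)[OF i] c(1) i by (intro mult_mono) (auto simp: cone_def intro: order_trans[OF abs_ge_zero])
  also have "\<bar>k * u i\<bar> <= C * D" unfolding abs_mult using k0 C(1,3) u[OF i] by (intro mult_mono) auto
  finally show ?thesis by (simp add: algebra_simps)
 qed
 have "F (%p. (ev (vel c u k) p)\<^sup>2) ?L <= ((C * C * C * C+C) * D)\<^sup>2 * F (%p. sz p * sz p) ?L"
  by (rule F_ev_bound(2)[OF g v])
 also have "... <= ((C * C * C * C+C) * D)\<^sup>2 * C" using C(7) by (intro mult_left_mono) auto
 finally have num: "F (%p. (ev (vel c u k) p)\<^sup>2) ?L <= ((C * C * C * C+C) * D)\<^sup>2 * C" .
 have "F (ev ?L) ?L = k * F (ev c) ?L"
  unfolding F_linear1[OF g] by (simp add: sum_distrib_left mult_ac)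
 moreover have "1/C*(1/C) <= k * F (ev c) ?L" using C(2) Fc Cp k0 by (intro mult_mono) auto
 ultimately have den: "1/(C * C) <= F (ev ?L) ?L" by simp
 have "F (%p. (ev (vel c u k) p)\<^sup>2) ?L/F (ev ?L) ?L <= (((C * C * C * C+C) * D)\<^sup>2 * C)/(1/(C * C))"
  using num den C(1) by (intro frac_le) auto
 also have "... = ((C * C * C * C+C) * D)\<^sup>2*(C * C * C)" by simp
 finally have "spd c u k <= sqrt (((C * C * C * C+C) * D)\<^sup>2*(C * C * C))" unfolding spd_def by (rule real_sqrt_le_mono)
 also have "... = (C * C * C * C+C) * D * sqrt (C * C * C)" using C(1) D by (simp add: real_sqrt_mult)
 finally show ?thesis by (simp add: mult_ac)
qed

text \<open>Continuity reaches up to the ends of the segment, where coordinates may vanish; this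
  makes the length an integral of a continuous function on a compact interval.\<close>

lemma spd_cont:
 fixes k :: "real => real"
 assumes seg: "!!t. t:{0..1} ==> cone (%i. a i+t*(b i-a i)) & root (%i. k t*(a i+t*(b i-a i)))"
  and kp: "!!t. t:{0..1} ==> k t > 0"
 shows "continuous_on {0..1} k" "continuous_on {0..1} (%t. spd (%i. a i+t*(b i-a i)) (%i. b i-a i) (k t))"
proof -
 let ?s = "%t i. a i+t*(b i-a i)"
 show kc: "continuous_on {0..1} k" unfolding continuous_on_def
 proof
  fix t :: real assume t: "t:{0..1}"
  show "(k \<longlongrightarrow> k t) (at t within {0..1})"
  proof (rule root_tendsto[where c = ?s and ?c0.0 = "?s t"])
   show "((%y. ?s y i) \<longlongrightarrow> ?s t i) (at t within {0..1})" for i by (intro tendsto_intros)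
   show "eventually (%y. cone (?s y) & root (%i. k y*?s y i)) (at t within {0..1})"
    unfolding eventually_at_filter using seg by (intro always_eventually) blast
  qed (use seg[OF t] in auto)
 qed
 have Fc: "continuous_on {0..1} (%t. F w (%i. k t*?s t i))" if w: "pol w" for w
  unfolding continuous_on_def
 proof
  fix t :: real assume t: "t:{0..1}"
  have "(k \<longlongrightarrow> k t) (at t within {0..1})" using kc t by (simp add: continuous_on_def)
  then have "((%y. k y*?s y i) \<longlongrightarrow> k t*?s t i) (at t within {0..1})" for i by (intro tendsto_intros)
  then show "((%t. F w (%i. k t*?s t i)) \<longlongrightarrow> F w (%i. k t*?s t i)) (at t within {0..1})"
   by (rule F_tendsto(1)) (use seg[OF t] root_good w in auto)
 qed
 have g: "good (%i. k t*?s t i)" if "t:{0..1}" for t using seg[OF that] root_good by blast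
 have pos: "F (ev (?s t)) (%i. k t*?s t i) > 0" if t: "t:{0..1}" for t
  using F_cone_pos[of "?s t" "%i. k t*?s t i"] seg[OF t] by (auto simp: cone_def)
 define N where "N i t = F (%p. n p i) (%i. k t*?s t i)" for i t
 have Nc: "continuous_on {0..1} (N i)" if "i:I" for i unfolding N_def by (rule Fc[OF pol_n[OF that]])
 define A where "A t = (\<Sum>i\<in>I. (b i-a i) * N i t)" for t
 define B where "B t = (\<Sum>i\<in>I. ?s t i * N i t)" for t
 have Ac: "continuous_on {0..1} A" and Bc: "continuous_on {0..1} B"
  unfolding A_def B_def by (intro continuous_intros Nc; assumption)+
 have B: "F (ev (?s t)) (%i. k t*?s t i) = B t" "F (ev (%i. b i-a i)) (%i. k t*?s t i) = A t" if "t:{0..1}" for t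
  unfolding A_def B_def N_def by (rule F_linear1[OF g[OF that]])+
 define V where "V i t = (- (k t * A t)/B t)*?s t i+k t*(b i-a i)" for i t
 have Bnz: "B t ~= 0" if "t:{0..1}" for t using pos[OF that] B(1)[OF that] by simp
 have Vc: "continuous_on {0..1} (V i)" for i
  unfolding V_def using Bnz by (intro continuous_intros kc Ac Bc) auto
 have Vv: "vel (?s t) (%i. b i-a i) (k t) = (%i. V i t)" if "t:{0..1}" for t
  unfolding vel_def V_def B[OF that] ..
 let ?Q = "%t. \<Sum>e\<in>I. \<Sum>f\<in>I. V e t * V f t * F (%p. n p f * n p e) (%i. k t*?s t i)"
 have Qc: "continuous_on {0..1} ?Q" by (intro continuous_on_sum continuous_on_mult Vc Fc pol_mult pol_n)
 have eq: "spd (?s t) (%i. b i-a i) (k t) = sqrt (?Q t/(k t * B t))" if t: "t:{0..1}" for t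
 proof -
  have "F (ev (%i. k t*?s t i)) (%i. k t*?s t i) = k t * B t"
   unfolding F_linear1[OF g[OF t]] B_def N_def by (simp add: sum_distrib_left mult.assoc)
  then show ?thesis unfolding spd_def Vv[OF t] F_vv[OF g[OF t], symmetric] by simp
 qed
 have "continuous_on {0..1} (%t. sqrt (?Q t/(k t * B t)))"
  using Bnz kp by (intro continuous_on_real_sqrt continuous_on_divide Qc continuous_on_mult kc Bc) fastforce
 then show "continuous_on {0..1} (%t. spd (?s t) (%i. b i-a i) (k t))"
  by (subst continuous_on_cong[OF refl eq])
qed

end

section \<open>First-return loops under collapses\<close>

lemma append_first_unique:
 "x ~: set a ==> x ~: set b ==> a@x#q = b@x#q' ==> a = b & q = q'"
proof (induction a arbitrary: b)
 case Nil
 then show ?case by (cases b) auto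
next
 case (Cons y a)
 then show ?case by (cases b) auto
qed

locale coll_loops = coll2 +
 fixes e0 f0 :: nat
 assumes oG: "outer_graph G" and oH: "outer_graph H" and e0: "e0:gE G" and ce0: "cE e0 = Some f0"
begin

lemma f0: "f0:gE H" using edge_Some[OF e0 ce0] by simp

sublocale g: outer_loops G e0 by unfold_locales (rule oG, rule e0)
sublocale h: outer_loops H f0 by unfold_locales (rule oH, rule f0)

lemma hit_iff:
 assumes "outer_graph K" "x:gE K"
 shows "p:strong_digraph.hit (nb K) x x \<longleftrightarrow> p ~= [] & walk K (gE K) p (tm K x) (tm K x) & reduced K p &
  hd p ~= gbar K x & last p = x & x ~: set (butlast p)"
proof (cases "p = []")
 case False
 interpret k: outer_loops K x using assms by unfold_locales
 have "p:k.hit x \<longleftrightarrow> (set p <= gE K & successively (nb K) p & gorg K (hd p) = tm K x & tm K (last p) = tm K x) &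
  hd p ~= gbar K x & last p = x & x ~: set (butlast p)" (is "_ \<longleftrightarrow> ?R")
 proof
  assume p: "p:k.hit x"
  then have "successively (nb K) (x#p)" "last p = x" "x ~: set (butlast p)" by (auto simp: k.hit_def)
  then show ?R using k.hit_set[OF p] False by (auto simp: successively_Cons nb_def)
 next
  assume R: ?R
  then have "hd p:gE K" using hd_in_set[OF False] by blast
  then show "p:k.hit x" using R False assms(2) by (auto simp: k.hit_def successively_Cons nb_def)
 qed
 also have "... \<longleftrightarrow> (walk K (gE K) p (tm K x) (tm K x) & reduced K p) & hd p ~= gbar K x & last p = x & x ~: set (butlast p)"
  unfolding walk_reduced_iff[OF outerD(1)[OF assms(1)] False] ..
 finally show ?thesis using False by blast
next
 case True
 interpret k: outer_loops K x using assms by unfold_locales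
 show ?thesis using True by (simp add: k.hit_def)
qed

lemma set_cp_iff: "set p <= gE G ==> f0:set (cp p) \<longleftrightarrow> e0:set p"
proof (induction p)
 case (Cons e p)
 have "f0:set (cmap cE e) \<longleftrightarrow> e0 = e" using Cons.prems edge_uniq[OF _ e0 _ ce0, of e] ce0
  by (cases "cE e") (auto simp: cmap_None cmap_Some)
 then show ?case using Cons by auto
qed simp

lemma tm_f0: "tm H f0 = cV (tm G e0)" by (rule edge_Some_tm[OF e0 ce0])

lemma cp_hit:
 assumes p: "p:g.hit e0"
 shows "cp p:h.hit f0"
proof -
 note P = p[unfolded hit_iff[OF oG e0]]
 have w: "walk G (gE G) p (tm G e0) (tm G e0)" and r: "reduced G p" using P by auto
 obtain q where q: "p = q@[e0]" "e0 ~: set q" using g.hitE[OF p] by blast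
 have pE: "set p <= gE G" by (rule g.hit_set[OF p])
 have cq: "cp p = cp q@[f0]" using q(1) ce0 by (simp add: cmap_Some)
 have nq: "f0 ~: set (cp q)" using set_cp_iff[of q] q pE by auto
 have w': "walk H (gE H) (cp p) (tm H f0) (tm H f0)" using cwalk[OF w] tm_f0 by simp
 have "walk G (gE G) (e0#p) (gorg G e0) (tm G e0)" "reduced G (e0#p)" using w e0 P by (auto simp: reduced_Cons)
 from creduced[OF this] have r': "reduced H (f0#cp p)" using ce0 by (simp add: cmap_Some)
 have "hd (cp p) ~= gbar H f0" using r' cq by (auto simp: reduced_Cons)
 then show ?thesis unfolding hit_iff[OF oH f0] using w' r' cq nq by (auto simp: reduced_Cons)
qed

text \<open>Injectivity is \<open>cp_inj\<close>. For surjectivity a loop is lifted and reduced;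
  what follows the first visit of \<open>e0\<close> in the lift maps to the empty path, hence is a
  reduced closed path of collapsed edges and so empty. As a consequence the series of a face equals
  the series of \<open>G\<close> at pulled-back lengths (\<open>F_pull\<close>).\<close>

lemma cp_bij: "bij_betw cp (g.hit e0) (h.hit f0)"
 unfolding bij_betw_def
proof
 show "inj_on cp (g.hit e0)"
 proof (rule inj_onI)
  fix p q assume p: "p:g.hit e0" and q: "q:g.hit e0" and eq: "cp p = cp q"
  note P = p[unfolded hit_iff[OF oG e0]] q[unfolded hit_iff[OF oG e0]]
  have "red G p = red G q" by (rule cp_inj[of p "tm G e0" "tm G e0"]) (use P eq in auto)
  then show "p = q" using P red_id by metis
 qed
 show "cp ` g.hit e0 = h.hit f0"
 proof
  show "cp ` g.hit e0 <= h.hit f0" using cp_hit by blast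
  show "h.hit f0 <= cp ` g.hit e0"
  proof
   fix q assume q: "q:h.hit f0"
   note Q = q[unfolded hit_iff[OF oH f0]]
   have tV: "tm G e0:gV G" by (rule serreD(5)[OF sG e0])
   obtain p1 where p1: "walk G (gE G) p1 (tm G e0) (tm G e0)" "cp p1 = q"
    using lift[OF _ tV tV, of q] Q tm_f0 by auto
   define p where "p = red G p1"
   have w: "walk G (gE G) p (tm G e0) (tm G e0)" unfolding p_def by (rule walk_red[OF sG order_refl p1(1)])
   have r: "reduced G p" by (simp add: p_def)
   have cq: "cp p = q" using cp_red[OF p1(1)] p1(2) Q red_id unfolding p_def by metis
   have pE: "set p <= gE G" by (rule walk_E[OF sG w])
   have ne: "p ~= []" using cq Q by auto
   have hd: "hd p ~= gbar G e0"
   proof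
    assume h: "hd p = gbar G e0"
    have "cE (gbar G e0) = Some (gbar H f0)" using edge_Some[OF e0 ce0] by simp
    then have "hd (cp p) = gbar H f0" using h ne by (cases p) (auto simp: cmap_Some)
    then show False using cq Q by simp
   qed
   obtain b where b: "q = b@[f0]" "f0 ~: set b" using h.hitE[OF q] by blast
   have "e0:set p" using set_cp_iff[OF pE] cq b by auto
   then obtain x y where xy: "p = x@e0#y" "e0 ~: set x" by (meson split_list_first)
   have "cp x@f0#cp y = b@[f0]" using cq b xy ce0 by (simp add: cmap_Some)
   moreover have "f0 ~: set (cp x)" using set_cp_iff[of x] xy pE by auto
   ultimately have cy: "cp y = []" using append_first_unique[of f0 "cp x" b "cp y" "[]"] b(2) by simp
   have wy: "walk G (gE G) y (tm G e0) (tm G e0)" using w xy(1) walk_append[OF sG order_refl, of x "e0#y"] by auto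
   have yE: "set y <= gE G" using pE xy by auto
   have "walk G (nset G cE) y (tm G e0) (tm G e0)" using cp_Nil[OF yE] cy walk_restrict[OF wy] by blast
   moreover have "reduced G y" using r xy(1) by (simp add: reduced_append reduced_Cons)
   ultimately have "y = []" by (rule fib_acyc)
   then have "p:g.hit e0" unfolding hit_iff[OF oG e0] using w r ne hd xy by auto
   then show "q:cp ` g.hit e0" using cq by blast
  qed
 qed
qed

lemma ev_pull: "set p <= gE G ==> g.ev (pullback G cE H l) p = h.ev l (cp p)"
proof -
 assume p: "set p <= gE G"
 have "sum_list (map (len G (pullback G cE H l)) p) = sum_list (map (len H l) (cp p))"
  using p
 proof (induction p)
  case (Cons e p)
  then show ?case using len_pull[OF sG sH co, of e l] by (cases "cE e") (auto simp: cmap_None cmap_Some)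
 qed simp
 then show ?thesis using g.ev_eq[OF p] h.ev_eq[OF set_subst[OF hom p]] by simp
qed

lemma F_pull: "h.F w l = g.F (%p. w (cp p)) (pullback G cE H l)"
proof -
 have "h.F w l = infsum (%p. w (cp p) * exp (- h.ev l (cp p))) (g.hit e0)"
  unfolding h.F_def using infsum_reindex_bij_betw[OF cp_bij, of "%q. w q * exp (- h.ev l q)"] by simp
 also have "... = g.F (%p. w (cp p)) (pullback G cE H l)"
  unfolding g.F_def by (rule infsum_cong) (simp add: ev_pull g.hit_set)
 finally show ?thesis .
qed

lemma root_pull: "h.root l \<longleftrightarrow> g.root (pullback G cE H l)"
 unfolding h.root_def g.root_def F_pull ..

text \<open>Collapsing shortens loops, so moment bounds established once on \<open>G\<close> hold
  for every face.\<close>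

lemma F_sz_pull:
 assumes "h.root l"
 shows "h.F h.sz l <= g.F g.sz (pullback G cE H l)"
  "h.F (%p. h.sz p * h.sz p) l <= g.F (%p. g.sz p * g.sz p) (pullback G cE H l)"
proof -
 let ?L = "pullback G cE H l"
 have gd: "g.good ?L" using assms root_pull g.root_good by blast
 have le: "h.sz (cp p) <= g.sz p" "0 <= h.sz (cp p)" if "p:g.hit e0" for p
 proof -
  have pE: "set p <= gE G" by (rule g.hit_set[OF that])
  have "length (cp q) <= length q" for q by (induction q) (auto simp: cmap_def split: option.splits)
  then show "h.sz (cp p) <= g.sz p" using g.sz_eq[OF pE] h.sz_eq[OF set_subst[OF hom pE]] by simp
 qed (rule h.sz_nonneg)
 have gs: "(%p. g.sz p * exp (- g.ev ?L p)) summable_on g.hit e0" "(%p. g.sz p * g.sz p * exp (- g.ev ?L p)) summable_on g.hit e0"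
  by (intro g.good_summable[OF gd] g.pol_mult g.pol_sz)+
 have hs1: "(%p. h.sz (cp p) * exp (- g.ev ?L p)) summable_on g.hit e0"
  by (rule summable_on_comparison_test[OF gs(1)]) (use le in \<open>auto intro!: mult_right_mono\<close>)
 have hs2: "(%p. h.sz (cp p) * h.sz (cp p) * exp (- g.ev ?L p)) summable_on g.hit e0"
  by (rule summable_on_comparison_test[OF gs(2)]) (use le g.sz_nonneg in \<open>auto intro!: mult_right_mono mult_mono\<close>)
 show "h.F h.sz l <= g.F g.sz ?L" unfolding F_pull unfolding g.F_def
  by (rule infsum_mono[OF hs1 gs(1)]) (use le in \<open>auto intro!: mult_right_mono\<close>)
 show "h.F (%p. h.sz p * h.sz p) l <= g.F (%p. g.sz p * g.sz p) ?L" unfolding F_pull unfolding g.F_def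
  by (rule infsum_mono[OF hs2 gs(2)]) (use le g.sz_nonneg in \<open>auto intro!: mult_right_mono mult_mono\<close>)
qed

end

lemma pull_seg:
 "pullback G cE H (%f. k*(x f+t*(y f-x f))) =
  (%i. k*(pullback G cE H x i+t*(pullback G cE H y i-pullback G cE H x i)))"
 by (auto simp: pullback_def len_def split: option.splits)

lemma pull_scale: "pullback G cE H (%f. k * x f) = (%i. k * pullback G cE H x i)"
 by (auto simp: pullback_def len_def split: option.splits)

lemma hess_form_cong: "(!!e. e:gEp G ==> v e = w e) ==> hess_form G l v = hess_form G l w"
 unfolding hess_form_def by (intro sum.cong refl) auto

text \<open>Segments are straight in the coordinates of a closed cell and are then projected along
  rays to unit entropy; \<open>nrm\<close> is this projection.\<close>

definition nrm :: "nat => mmg => mmg set" where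
 "nrm r t = (case t of (G,M,l) => cls r (G,M,%i. entropy G l * l i))"

lemma outer_edge: "outer_graph G ==> EX e. e:gE G"
proof -
 assume o: "outer_graph G"
 obtain v where "v:gV G" using serre_fin(4)[OF outerD(1)[OF o]] by auto
 then have "card {e:gE G. gorg G e = v} >= 3" by (rule outerD(3)[OF o])
 then have "{e:gE G. gorg G e = v} ~= {}" by (metis card.empty not_numeral_le_zero)
 then show ?thesis by blast
qed

lemma entropy_scale:
 assumes "outer_graph G" "ALL i:gEp G. l i > 0"
 shows "entropy G l > 0" "entropy G (%i. entropy G l * l i) = 1"
proof -
 obtain e where "e:gE G" using outer_edge[OF assms(1)] by auto
 then interpret outer_loops G e using assms(1) by unfold_locales
 show p: "entropy G l > 0" by (rule entropy_root(2)[OF assms(2)])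
 show "entropy G (%i. entropy G l * l i) = 1"
  using entropy_1_iff[of "%i. entropy G l * l i"] entropy_root(1)[OF assms(2)] assms(2) p by simp
qed

lemma nrm_in:
 assumes "valid_mmg r (G,M,l)"
 shows "valid_mmg r (G,M,%i. entropy G l * l i)" "nrm r (G,M,l):outer_space1 r"
proof -
 note D = valid_mmgD[OF assms]
 have pos: "ALL i:gEp G. l i > 0" using D(5) by (simp add: lengths_def)
 note s = entropy_scale[OF D(1) pos]
 show v: "valid_mmg r (G,M,%i. entropy G l * l i)" using assms s(1) by (auto simp: valid_mmg_def lengths_def)
 show "nrm r (G,M,l):outer_space1 r" unfolding nrm_def outer_space1_def prod.case
  by (rule imageI) (use v s(2) in simp)
qed

lemma cell_relI:
 "serre_graph G ==> valid_mmg r (G0,M0,l0) ==> mdom G M G0 M0 cV cE ==>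
  cell_rel r G M (pullback G cE G0 l0) (cls r (G0,M0,l0))"
 unfolding cell_rel_iff by blast

text \<open>A segment in the closed cell of \<open>(G,M)\<close> from a point of the face
  \<open>G0\<close> to a point of the face \<open>G1\<close>, where \<open>G1\<close> keeps every
  edge that \<open>G0\<close> keeps. The cutting edge \<open>e0\<close> survives in
  \<open>G0\<close>, hence in both. After time 0 the segment runs in the open cell of
  \<open>G1\<close>.\<close>

locale cell_seg =
 fixes r :: nat and G :: sgraph and M :: "nat \<times> nat list list" and G0 M0 l0 cV cE G1 M1 l1 dV dE e0
 assumes og: "outer_graph G" and vM: "valid_marking r G M"
  and v0: "valid_mmg r (G0,M0,l0)" and c: "mdom G M G0 M0 cV cE"
  and v1: "valid_mmg r (G1,M1,l1)" and d: "mdom G M G1 M1 dV dE"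
  and sub: "!!e. e:gE G ==> dE e = None ==> cE e = None"
  and e0: "e0:gE G" and ce0: "cE e0 ~= None"
begin

definition g0 where "g0 = the (cE e0)"
definition f0 where "f0 = the (dE e0)"
lemma de0: "dE e0 = Some f0" using sub[OF e0] ce0 by (cases "dE e0") (auto simp: f0_def)
lemma ce0': "cE e0 = Some g0" using ce0 by (auto simp: g0_def)

lemma sg: "serre_graph G" by (rule outerD(1)[OF og])
lemmas D0 = valid_mmgD[OF v0]
lemmas D1 = valid_mmgD[OF v1]
lemma cc: "coll G G0 cV cE" using c by (simp add: mdom_def)
lemma cd: "coll G G1 dV dE" using d by (simp add: mdom_def)

sublocale z: coll_loops G G0 cV cE e0 g0
 by unfold_locales (use sg D0 D1 cc og e0 ce0' in auto)
sublocale y: coll_loops G G1 dV dE e0 f0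
 by unfold_locales (use sg D0 D1 cd og e0 de0 in auto)

abbreviation a where "a \<equiv> pullback G cE G0 l0"
abbreviation b where "b \<equiv> pullback G dE G1 l1"

definition pre :: "nat => nat" where "pre f = (SOME e. e:gE G & dE e = Some f)"
lemma pre: "e:gE G ==> dE e = Some f ==> pre f = e"
 unfolding pre_def by (rule some_equality) (use y.edge_uniq in auto)

text \<open>The starting point in the coordinates of \<open>G1\<close>, with zeros at the edges that
  only \<open>G0\<close> collapses. It allows the whole segment to be studied on the single graph
  \<open>G1\<close>.\<close>

definition a1 :: "nat => real" where "a1 f = (if f:gEp G1 then len G a (pre f) else 0)"

lemma len_a_nonneg: "e:gE G ==> len G a e >= 0"
proof -
 assume e: "e:gE G"
 show ?thesis
 proof (cases "cE e")
  case (Some f)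
  then have "f:gE G0" using z.edge_Some[OF e] by simp
  then show ?thesis using Some len_lengths_pos[OF D0(2,5), of f] by (simp add: len_pull[OF sg D0(2) cc e])
 qed (simp add: len_pull[OF sg D0(2) cc e])
qed

lemma len_a1: "e:gE G ==> dE e = Some f ==> len G1 a1 f = len G a e"
proof -
 assume e: "e:gE G" "dE e = Some f"
 have f: "f:gE G1" "dE (gbar G e) = Some (gbar G1 f)" using y.edge_Some[OF e] by auto
 show ?thesis
 proof (cases "f:gEp G1")
  case True
  then show ?thesis using pre[OF e] by (simp add: len_def a1_def)
 next
  case False
  then have "gbar G1 f:gEp G1" using serre_Ep[OF D1(2) f(1)] by simp
  moreover have "pre (gbar G1 f) = gbar G e" using pre[OF serreD(2)[OF sg e(1)] f(2)] .
  ultimately have "len G1 a1 f = len G a (gbar G e)" using False by (simp add: len_def[of G1] a1_def)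
  then show ?thesis using z.g.len_bar[OF e(1)] by simp
 qed
qed

lemma pull_a1: "pullback G dE G1 a1 = a"
proof (rule pull_eqI[OF sg D1(2) cd, symmetric])
 show "a e = 0" if "e ~: gEp G" for e using that by (simp add: pullback_def)
 fix e assume e: "e:gE G"
 show "len G a e = (case dE e of Some f => len G1 a1 f | None => 0)"
  using len_a1[OF e] sub[OF e] len_pull[OF sg D0(2) cc e] by (cases "dE e") auto
qed

lemma a1_nonneg: "a1 f >= 0"
proof (cases "f:gEp G1")
 case True
 then have "f:gE G1" using serre_fin(3)[OF D1(2)] by auto
 then obtain e where "e:gE G" "dE e = Some f" using y.edge_ex by blast
 then show ?thesis using pre len_a_nonneg True by (simp add: a1_def)
qed (simp add: a1_def)

abbreviation s1 :: "real => nat => real" where "s1 t \<equiv> (%i. a1 i+t*(l1 i-a1 i))"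
abbreviation u1 :: "nat => real" where "u1 \<equiv> (%i. l1 i-a1 i)"

lemma l1_pos: "i:gEp G1 ==> l1 i > 0" using D1(5) by (simp add: lengths_def)

lemma s1_pos: "0 < t ==> t <= 1 ==> i:gEp G1 ==> s1 t i > 0"
proof -
 assume t: "0 < t" "t <= 1" and i: "i:gEp G1"
 have "s1 t i = (1-t) * a1 i+t * l1 i" by (simp add: algebra_simps)
 moreover have "(1-t) * a1 i >= 0" using t a1_nonneg by simp
 moreover have "t * l1 i > 0" using t l1_pos[OF i] by simp
 ultimately show ?thesis by linarith
qed

lemma a1_i0: "a1 y.h.i0 > 0"
proof -
 have "a1 y.h.i0 = len G1 a1 f0" by (rule y.h.len_i0[symmetric])
 also have "... = len G a e0" by (rule len_a1[OF e0 de0])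
 also have "... = len G0 l0 g0" by (simp add: len_pull[OF sg D0(2) cc e0] ce0')
 finally show ?thesis using len_lengths_pos[OF D0(2,5) z.f0] by simp
qed

lemma s1_cone: "0 <= t ==> t <= 1 ==> y.h.cone (s1 t)"
proof (cases "t = 0")
 case True
 then show ?thesis using a1_nonneg a1_i0 by (simp add: y.h.cone_def)
next
 case False
 assume "0 <= t" "t <= 1"
 then show ?thesis using s1_pos[of t] y.h.i0 False by (auto simp: y.h.cone_def less_imp_le)
qed

lemma root_0: "y.h.root (%i. entropy G0 l0 * a1 i)"
proof -
 have "ALL i:gEp G0. l0 i > 0" using D0(5) by (simp add: lengths_def)
 from z.h.entropy_root(1)[OF this] have "z.g.root (pullback G cE G0 (%i. entropy G0 l0 * l0 i))"
  using z.root_pull by blast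
 then have "z.g.root (pullback G dE G1 (%i. entropy G0 l0 * a1 i))" by (simp add: pull_scale pull_a1)
 then show ?thesis using y.root_pull by blast
qed

lemma k_ex: "EX k. ALL t:{0..1}. k t > 0 & y.h.root (%i. k t * s1 t i)"
proof (rule bchoice, rule ballI)
 fix t :: real assume t: "t:{0..1}"
 show "EX k. k > 0 & y.h.root (%i. k * s1 t i)"
 proof (cases "t = 0")
  case True
  have "ALL i:gEp G0. l0 i > 0" using D0(5) by (simp add: lengths_def)
  then show ?thesis using root_0 entropy_scale(1)[OF D0(1)] True by (intro exI[of _ "entropy G0 l0"]) simp
 next
  case False
  then have "ALL i:gEp G1. s1 t i > 0" using s1_pos[of t] t by auto
  from y.h.root_ex[OF this] show ?thesis by blast
 qed
qed

definition k :: "real => real" where "k = (SOME k. ALL t:{0..1}. k t > 0 & y.h.root (%i. k t * s1 t i))"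

lemma k: "t:{0..1} ==> k t > 0" "t:{0..1} ==> y.h.root (%i. k t * s1 t i)"
 using someI_ex[OF k_ex] unfolding k_def by blast+

lemma k0: "k 0 = entropy G0 l0"
proof -
 have "y.h.cone a1" using s1_cone[of 0] by simp
 moreover have "y.h.root (%i. k 0 * a1 i)" using k(2)[of 0] by simp
 ultimately show ?thesis using root_0 by (rule y.h.root_unique)
qed

lemma k1: "k 1 = entropy G1 l1"
proof -
 have p: "ALL i:gEp G1. l1 i > 0" using l1_pos by blast
 have "y.h.cone l1" using s1_cone[of 1] by simp
 moreover have "y.h.root (%i. k 1 * l1 i)" using k(2)[of 1] by simp
 ultimately show ?thesis using y.h.entropy_root(1)[OF p] by (rule y.h.root_unique)
qed

definition L :: "real => nat => real" where "L t = (%i. k t * s1 t i)"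

lemma L_lengths: "0 < t ==> t <= 1 ==> L t:lengths G1"
 using s1_pos[of t] k(1)[of t] D1(5) by (auto simp: lengths_def L_def a1_def)

lemma L_entropy: "0 < t ==> t <= 1 ==> entropy G1 (L t) = 1"
 using y.h.entropy_1_iff[of "L t"] L_lengths[of t] k(2)[of t] by (simp add: lengths_def L_def)

lemma L_valid: "0 < t ==> t <= 1 ==> valid_mmg r (G1,M1,L t)"
 using L_lengths D1 by (simp add: valid_mmg_def)

text \<open>At time 0 the point may lie in a smaller cell, so it needs the representative on
  \<open>G0\<close>.\<close>

definition \<gamma> :: "real => mmg set" where
 "\<gamma> t = (if t = 0 then nrm r (G0,M0,l0) else cls r (G1,M1,L t))"

lemma gamma_1: "\<gamma> 1 = nrm r (G1,M1,l1)" by (simp add: \<gamma>_def nrm_def L_def k1)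

definition K :: "real => nat => real" where "K t = pullback G dE G1 (L t)"

lemma K_eq: "K t = (%i. k t*(a i+t*(b i-a i)))"
 unfolding K_def L_def pull_seg pull_a1 ..

lemma K_cell: "t:{0..1} ==> cell_rel r G M (K t) (\<gamma> t)"
proof (cases "t = 0")
 case True
 have "K t = pullback G cE G0 (%i. entropy G0 l0 * l0 i)" using True by (simp add: K_eq pull_scale k0)
 then show ?thesis using cell_relI[OF sg nrm_in(1)[OF v0] c] True by (simp add: \<gamma>_def nrm_def)
next
 case False
 assume "t:{0..1}"
 then have "valid_mmg r (G1,M1,L t)" using L_valid False by simp
 then show ?thesis using cell_relI[OF sg _ d, of r "L t"] False by (simp add: \<gamma>_def K_def)
qed

lemma gamma_in: "t:{0..1} ==> \<gamma> t:outer_space1 r"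
proof (cases "t = 0")
 case True
 then show ?thesis using nrm_in(2)[OF v0] by (simp add: \<gamma>_def)
next
 case False
 assume "t:{0..1}"
 then have "0 < t" "t <= 1" using False by auto
 then show ?thesis using False L_valid[of t] L_entropy[of t] unfolding \<gamma>_def outer_space1_def by auto
qed

lemma seg_h: "t:{0..1} ==> y.h.cone (s1 t) & y.h.root (%i. k t * s1 t i)"
 using s1_cone[of t] k(2) by simp

lemma K_cont: "continuous_on {0..1} K"
proof (rule continuous_on_coordinatewise_then_product)
 fix i
 have "continuous_on {0..1} k" by (rule y.h.spd_cont(1)[OF seg_h k(1)])
 then show "continuous_on {0..1} (%t. K t i)" unfolding K_eq by (intro continuous_intros)
qed

text \<open>All points of the path have coordinates \<open>K\<close> in one closed cell, where
  continuity is plain; \<open>cell_rel_fun\<close> turns it into continuity for the weak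
  topology.\<close>

lemma gamma_cont: "weak_cont r \<gamma>"
 unfolding weak_cont_def
proof (intro allI impI)
 fix V assume V: "weak_open r V"
 let ?C = "{lam. EX x. cell_rel r G M lam x}" and ?W = "{lam. EX x:V. cell_rel r G M lam x}"
 have o: "openin (top_of_set ?C) ?W" using V og vM unfolding weak_open_def by blast
 have im: "K:{0..1} \<rightarrow> ?C" using K_cell by blast
 have "openin (top_of_set {0..1}) ({0..1} \<inter> K -` ?W)" by (rule continuous_openin_preimage[OF K_cont im o])
 moreover have "{0..1} \<inter> K -` ?W = {t:{0..1}. \<gamma> t:V}"
  using K_cell cell_rel_fun[OF og vM] by blast
 ultimately show "openin (top_of_set {0..1}) {t:{0..1}. \<gamma> t:V}" by simp
qed

definition sp :: "real => real" where "sp t = y.h.spd (s1 t) u1 (k t)"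

lemma sp_cont: "continuous_on {0..1} sp"
 unfolding sp_def[abs_def] by (rule y.h.spd_cont(2)[OF seg_h k(1)])

lemma hess_sp:
 assumes t: "t:{0<..<1}"
 shows "sqrt (hess_form G1 (L t) (%e. deriv (%s. L s e) t)) = sp t"
proof -
 have t': "t:{0..1}" and t'': "0 < t" "t <= 1" using t by auto
 have D: "deriv (%s. L s e) t = y.h.vel (s1 t) u1 (k t) e" for e
  unfolding L_def y.h.vel_def
  by (rule DERIV_imp_deriv, rule y.h.seg_DERIV[of a1 l1 k t e, OF _ t]) (rule seg_h, auto)
 have pos: "ALL i:gEp G1. L t i > 0" using L_lengths[OF t''] by (simp add: lengths_def)
 have root: "y.h.root (L t)" using k(2)[OF t'] by (simp add: L_def)
 have "hess_form G1 (L t) (%e. deriv (%s. L s e) t) = hess_form G1 (L t) (y.h.vel (s1 t) u1 (k t))"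
  by (simp add: D)
 also have "... = y.h.F (%p. (y.h.ev (y.h.vel (s1 t) u1 (k t)) p)\<^sup>2) (L t)/y.h.F (y.h.ev (L t)) (L t)"
  by (rule y.h.hess_form_eq[OF pos root]) (use y.h.vel_tangent[of "s1 t" "k t" u1] seg_h[OF t'] in \<open>simp add: L_def\<close>)
 finally show ?thesis by (simp add: sp_def y.h.spd_def L_def)
qed

lemma piece: "smooth_piece r 0 1 \<gamma> (integral {0..1} sp)"
 unfolding smooth_piece_def
proof (intro exI[of _ G1] exI[of _ M1] exI[of _ L] conjI ballI)
 show "outer_graph G1" "valid_marking r G1 M1" by (rule D1)+
 fix t :: real assume t: "t:{0<..<1}"
 show "L t:lengths G1" "entropy G1 (L t) = 1" using L_lengths L_entropy t by auto
 show "\<gamma> t = cls r (G1,M1,L t)" using t by (simp add: \<gamma>_def)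
next
 fix e show "smooth_on {0<..<1} (%t. L t e)"
  unfolding L_def by (rule y.h.seg_smooth) (rule seg_h, auto)
next
 have "(sp has_integral integral {0..1} sp) {0..1}"
  by (rule integrable_integral[OF integrable_continuous_real[OF sp_cont]])
 then show "((%t. sqrt (hess_form G1 (L t) (%e. deriv (%s. L s e) t))) has_integral integral {0..1} sp) {0..1}"
  by (rule has_integral_spike_finite[of "{0,1}", rotated 2]) (use hess_sp in auto)
qed

lemma seg_path: "integral {0..1} sp:path_lengths r (nrm r (G0,M0,l0)) (nrm r (G1,M1,l1))"
 unfolding path_lengths_def
proof (rule CollectI, intro exI[of _ \<gamma>] exI[of _ "[0,1::real]"] exI[of _ "%_::nat. integral {0..1} sp"] conjI)
 show "\<gamma> 0 = nrm r (G0,M0,l0)" by (simp add: \<gamma>_def)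
 show "ALL n. Suc n < length [0,1::real] --> smooth_piece r ([0,1::real] ! n) ([0,1] ! Suc n) \<gamma> (integral {0..1} sp)"
  using piece by (auto simp: less_Suc_eq)
qed (use gamma_1 gamma_in gamma_cont in auto)


text \<open>The assumption \<open>nb\<close> concerns \<open>G\<close> and the starting point only.
  Coordinates on \<open>G1\<close> occur among those on \<open>G\<close>, and moments on
  \<open>G1\<close> are dominated by those on \<open>G\<close>, so one \<open>C\<close> serves for
  all faces and all end points near the start.\<close>

lemma sp_bound:
 assumes C: "C > 0" and D: "D >= 0" "!!i. i:gEp G ==> \<bar>b i-a i\<bar> <= D"
  and nb: "!!c k. (ALL i:gEp G. \<bar>c i-a i\<bar> <= D) & z.g.cone c & z.g.root (%i. k * c i) ==>
   1/C <= k & k <= C & 1/C <= c z.g.i0 & (ALL i:gEp G. c i <= C) &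
   z.g.F z.g.sz (%i. k * c i) <= C & z.g.F (%p. z.g.sz p * z.g.sz p) (%i. k * c i) <= C"
 shows "integral {0..1} sp <= (C * C * C * C+C) * sqrt (C * C * C) * D"
proof -
 have "sp t <= (C * C * C * C+C) * sqrt (C * C * C) * D" if t: "t:{0..1}" for t
 proof -
  define cc where "cc = (%i. a i+t*(b i-a i))"
  have cp: "cc = pullback G dE G1 (s1 t)" using pull_seg[of G dE G1 1 a1 t l1] by (simp add: cc_def pull_a1)
  have lc: "len G cc e = (case dE e of Some f => len G1 (s1 t) f | None => 0)" if "e:gE G" for e
   unfolding cp by (rule len_pull[OF sg D1(2) cd that])
  have s1n: "s1 t i >= 0" if "i:gEp G1" for i using s1_cone[of t] t that by (auto simp: y.h.cone_def)
  have lenn: "len G1 (s1 t) f >= 0" if "f:gE G1" for f using s1n serre_Ep[OF D1(2) that] by (auto simp: len_def)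
  have i0eq: "cc z.g.i0 = s1 t y.h.i0"
   using lc[OF e0] de0 z.g.len_i0[of cc] y.h.len_i0[of "s1 t"] by simp
  have cn: "cc i >= 0" if i: "i:gEp G" for i
  proof -
   have iE: "i:gE G" using i serre_fin(3)[OF sg] by auto
   have "cc i = len G cc i" using i by (simp add: len_def)
   then show ?thesis using lc[OF iE] lenn y.edge_Some[OF iE] by (cases "dE i") auto
  qed
  have cone: "z.g.cone cc" using cn i0eq s1_cone[of t] t by (auto simp: z.g.cone_def y.h.cone_def)
  have "pullback G dE G1 (%i. k t * s1 t i) = (%i. k t * cc i)" unfolding cp by (rule pull_scale)
  then have root: "z.g.root (%i. k t * cc i)" and Fs:
   "y.h.F y.h.sz (%i. k t * s1 t i) <= z.g.F z.g.sz (%i. k t * cc i)"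
   "y.h.F (%p. y.h.sz p * y.h.sz p) (%i. k t * s1 t i) <= z.g.F (%p. z.g.sz p * z.g.sz p) (%i. k t * cc i)"
   using y.root_pull k(2)[OF t] y.F_sz_pull[OF k(2)[OF t]] by auto
  have near: "\<bar>cc i-a i\<bar> <= D" if "i:gEp G" for i
  proof -
   have "\<bar>cc i-a i\<bar> = t*\<bar>b i-a i\<bar>" using t by (simp add: cc_def abs_mult)
   also have "... <= 1 * D" using t D(2)[OF that] D(1) by (intro mult_mono) auto
   finally show ?thesis by simp
  qed
  note n = nb[of cc "k t"]
  have n1: "1/C <= k t & k t <= C & 1/C <= cc z.g.i0 & (ALL i:gEp G. cc i <= C) &
   z.g.F z.g.sz (%i. k t * cc i) <= C & z.g.F (%p. z.g.sz p * z.g.sz p) (%i. k t * cc i) <= C"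
   by (rule n) (use near cone root in blast)
  have ex: "EX e. e:gE G & dE e = Some i" if "i:gEp G1" for i
   using y.edge_ex[of i] that serre_fin(3)[OF D1(2)] by blast
  have lenb: "\<bar>len G b e-len G a e\<bar> <= D" "len G cc e <= C" if "e:gE G" for e
   using D(2) n1 serre_Ep[OF sg that] that by (auto simp: len_def)
  have sC: "s1 t i <= C" if i: "i:gEp G1" for i
  proof -
   obtain e where e: "e:gE G" "dE e = Some i" using ex[OF i] by blast
   have "s1 t i = len G1 (s1 t) i" using i by (simp add: len_def)
   then show ?thesis using lc[OF e(1)] e(2) lenb(2)[OF e(1)] by simp
  qed
  have uD: "\<bar>u1 i\<bar> <= D" if i: "i:gEp G1" for i
  proof -
   obtain e where e: "e:gE G" "dE e = Some i" using ex[OF i] by blast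
   have "len G b e = l1 i" using len_pull[OF sg D1(2) cd e(1), of l1] e(2) i by (simp add: len_def[of G1])
   moreover have "len G a e = a1 i" using len_a1[OF e] i by (simp add: len_def[of G1])
   ultimately show ?thesis using lenb(1)[OF e(1)] by simp
  qed
  show ?thesis unfolding sp_def
   by (rule y.h.spd_bound) (use seg_h[OF t] n1 i0eq sC uD C D(1) Fs in auto)
 qed
 then have "integral {0..1} sp <= integral {0..1} (%t::real. (C * C * C * C+C) * sqrt (C * C * C) * D)"
  by (intro integral_le integrable_continuous_real sp_cont continuous_on_const)
 then show ?thesis by simp
qed

end

section \<open>Concatenation of paths\<close>

lemma deriv_affine:
 fixes f :: "real => real"
 assumes "f differentiable (at (c+d * t))"
 shows "deriv (%t. f (c+d * t)) t = d * deriv f (c+d * t)"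
proof -
 have D: "(f has_real_derivative deriv f (c+d * t)) (at (c+d * t))"
  using assms DERIV_imp_deriv by (auto simp: real_differentiable_def)
 have "((%t. c+d * t) has_real_derivative d) (at t)" by (auto intro!: derivative_eq_intros)
 from DERIV_chain2[OF D this] show ?thesis using DERIV_imp_deriv by (simp add: mult.commute)
qed

lemma smooth_on_affine:
 assumes f: "smooth_on {a<..<b} f" and A: "!!t. t:{a'<..<b'} ==> c+d * t:{a<..<b}"
 shows "smooth_on {a'<..<b'} (%t. f (c+d * t))"
proof -
 have df: "(deriv ^^ n) f differentiable (at (c+d * t))" if "t:{a'<..<b'}" for n t
  using f A[OF that] by (simp add: smooth_on_def)
 have eq: "ALL t:{a'<..<b'}. (deriv ^^ n) (%t. f (c+d * t)) t = d^n*(deriv ^^ n) f (c+d * t)" for n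
 proof (induction n)
  case (Suc n)
  show ?case
  proof
   fix t assume t: "t:{a'<..<b'}"
   have ev: "eventually (%s. (deriv ^^ n) (%t. f (c+d * t)) s = d^n*(deriv ^^ n) f (c+d * s)) (nhds t)"
    using eventually_nhds_in_open[OF open_greaterThanLessThan t] by eventually_elim (use Suc in blast)
   have dd: "(%s. (deriv ^^ n) f (c+d * s)) differentiable (at t)"
   proof -
    obtain D where D: "((deriv ^^ n) f has_real_derivative D) (at (c+d * t))" using df[OF t, of n] by (auto simp: real_differentiable_def)
    have "((%t. c+d * t) has_real_derivative d) (at t)" by (auto intro!: derivative_eq_intros)
    from DERIV_chain2[OF D this] show ?thesis by (auto simp: real_differentiable_def)
   qed
   have "(deriv ^^ Suc n) (%t. f (c+d * t)) t = deriv (%s. d^n*(deriv ^^ n) f (c+d * s)) t"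
    using deriv_cong_ev[OF ev refl] by simp
   also have "... = d^n * deriv (%s. (deriv ^^ n) f (c+d * s)) t"
    using dd by (intro deriv_cmult) (auto simp: field_differentiable_def real_differentiable_def)
   also have "... = d^Suc n*(deriv ^^ Suc n) f (c+d * t)" using deriv_affine[OF df[OF t, of n]] by simp
   finally show "(deriv ^^ Suc n) (%t. f (c+d * t)) t = d^Suc n*(deriv ^^ Suc n) f (c+d * t)" .
  qed
 qed simp
 show ?thesis unfolding smooth_on_def
 proof (intro allI ballI)
  fix n t assume t: "t:{a'<..<b'}"
  obtain D where D: "((deriv ^^ n) f has_real_derivative D) (at (c+d * t))" using df[OF t, of n] by (auto simp: real_differentiable_def)
  have "((%t. c+d * t) has_real_derivative d) (at t)" by (auto intro!: derivative_eq_intros)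
  from DERIV_cmult[OF DERIV_chain2[OF D this], of "d^n"]
  have D2: "((%s. d^n*(deriv ^^ n) f (c+d * s)) has_real_derivative d^n*(D * d)) (at t)" .
  have ev: "eventually (%s. (deriv ^^ n) (%t. f (c+d * t)) s = d^n*(deriv ^^ n) f (c+d * s)) (nhds t)"
   using eventually_nhds_in_open[OF open_greaterThanLessThan t] by eventually_elim (use eq in blast)
  have "((deriv ^^ n) (%t. f (c+d * t)) has_real_derivative d^n*(D * d)) (at t)"
   using iffD2[OF DERIV_cong_ev[OF refl ev refl] D2] .
  then show "(deriv ^^ n) (%t. f (c+d * t)) differentiable (at t)" by (auto simp: real_differentiable_def)
 qed
qed

lemma hess_form_scale: "hess_form G l (%e. d * v e) = d\<^sup>2 * hess_form G l v"
 unfolding hess_form_def by (simp add: sum_distrib_left power2_eq_square mult_ac)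

text \<open>The substitution contributes the factor \<open>1/\<bar>d\<bar>\<close>, which cancels
  against the speed, homogeneous of degree 1 in the velocity. Negative \<open>d\<close> covers
  reversed paths.\<close>

lemma smooth_piece_affine:
 assumes p: "smooth_piece r a b \<gamma> I" and d: "d ~= 0" and ab: "a' < b'"
  and im: "d > 0 & c+d * a' = a & c+d * b' = b | d < 0 & c+d * a' = b & c+d * b' = a"
  and \<gamma>': "!!t. t:{a'<..<b'} ==> \<gamma>' t = \<gamma> (c+d * t)"
 shows "smooth_piece r a' b' \<gamma>' I"
proof -
 obtain G M L where L: "outer_graph G" "valid_marking r G M"
   "!!t. t:{a<..<b} ==> L t:lengths G & entropy G (L t) = 1 & \<gamma> t = cls r (G,M,L t)"
   "!!e. e:gEp G ==> smooth_on {a<..<b} (%t. L t e)"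
   "((%t. sqrt (hess_form G (L t) (%e. deriv (%s. L s e) t))) has_integral I) {a..b}"
  using p unfolding smooth_piece_def by blast
 have A: "c+d * t:{a<..<b}" if t: "t:{a'<..<b'}" for t
 proof (cases "d > 0")
  case True
  then have "d * a' < d * t" "d * t < d * b'" using t by auto
  then show ?thesis using im True by auto
 next
  case False
  then have "d < 0" using d by simp
  then have "d * t < d * a'" "d * b' < d * t" using t by auto
  then show ?thesis using im False by auto
 qed
 let ?f = "%t. sqrt (hess_form G (L t) (%e. deriv (%s. L s e) t))"
 have "((%x. ?f (d *\<^sub>R x+c)) has_integral (1/\<bar>d\<bar>^DIM(real)) *\<^sub>R I) ((%x. (1/d) *\<^sub>R x + - ((1/d) *\<^sub>R c)) ` cbox a b)"
  by (rule has_integral_affinity) (use L(5) d in auto)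
 moreover have "(%x. (1/d) *\<^sub>R x + - ((1/d) *\<^sub>R c)) ` cbox a b = {a'..b'}"
 proof -
  have "a < b"
  proof (cases "d > 0")
   case True
   then have "d * a' < d * b'" using ab by simp
   then show ?thesis using im True by linarith
  next
   case False
   then have "d < 0" using d by simp
   then have "d * b' < d * a'" using ab by simp
   then show ?thesis using im False by linarith
  qed
  have "x:(%x. (1/d) *\<^sub>R x + - ((1/d) *\<^sub>R c)) ` cbox a b \<longleftrightarrow> c+d * x:{a..b}" for x
  proof
   assume "x:(%x. (1/d) *\<^sub>R x + - ((1/d) *\<^sub>R c)) ` cbox a b"
   then obtain y where y: "y:{a..b}" "x = y/d-c/d" by auto
   then have "c+d * x = y" using d by (simp add: field_simps)
   then show "c+d * x:{a..b}" using y by simp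
  next
   assume "c+d * x:{a..b}"
   then show "x:(%x. (1/d) *\<^sub>R x + - ((1/d) *\<^sub>R c)) ` cbox a b"
    using d by (intro image_eqI[of _ _ "c+d * x"]) (auto simp: field_simps)
  qed
  moreover have "c+d * x:{a..b} \<longleftrightarrow> x:{a'..b'}" for x
  proof (cases "d > 0")
   case True
   then have "a = c+d * a'" "b = c+d * b'" using im by auto
   then show ?thesis using True by simp
  next
   case False
   then have "d < 0" "b = c+d * a'" "a = c+d * b'" using im d by auto
   then show ?thesis by auto
  qed
  ultimately show ?thesis by blast
 qed
 ultimately have "((%x. ?f (d * x+c)) has_integral (1/\<bar>d\<bar>) * I) {a'..b'}" by simp
 from has_integral_mult_right[OF this, of "\<bar>d\<bar>"]
 have int: "((%x. \<bar>d\<bar>*?f (d * x+c)) has_integral I) {a'..b'}" using d by simp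
 have diff: "(%s. L s e) differentiable (at (c+d * t))" if "e:gEp G" "t:{a'<..<b'}" for e t
  using L(4)[OF that(1)] A[OF that(2)] unfolding smooth_on_def by (metis funpow_0)
 show ?thesis unfolding smooth_piece_def
 proof (intro exI[of _ G] exI[of _ M] exI[of _ "%t. L (c+d * t)"] conjI ballI L(1,2))
  fix t assume t: "t:{a'<..<b'}"
  show "L (c+d * t):lengths G" "entropy G (L (c+d * t)) = 1" "\<gamma>' t = cls r (G,M,L (c+d * t))"
   using L(3)[OF A[OF t]] \<gamma>'[OF t] by auto
 next
  fix e assume "e:gEp G"
  from smooth_on_affine[OF L(4)[OF this] A] show "smooth_on {a'<..<b'} (%t. L (c+d * t) e)" .
 next
  show "((%t. sqrt (hess_form G (L (c+d * t)) (%e. deriv (%s. L (c+d * s) e) t))) has_integral I) {a'..b'}"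
  proof (rule has_integral_spike_finite[of "{a',b'}", OF _ _ int])
   fix t assume "t:{a'..b'}-{a',b'}"
   then have t: "t:{a'<..<b'}" by auto
   have "hess_form G (L (c+d * t)) (%e. deriv (%s. L (c+d * s) e) t)
     = hess_form G (L (c+d * t)) (%e. d * deriv (%s. L s e) (c+d * t))"
    by (rule hess_form_cong) (rule deriv_affine[OF diff[OF _ t]])
   then show "sqrt (hess_form G (L (c+d * t)) (%e. deriv (%s. L (c+d * s) e) t)) = \<bar>d\<bar>*?f (d * t+c)"
    by (simp add: hess_form_scale real_sqrt_mult add.commute)
  qed simp
 qed
qed

text \<open>A connection by a single piece with its length forgotten: finiteness of the distance
  only asks for existence.\<close>

definition onep :: "nat => mmg set => mmg set => bool" where
 "onep r x y \<longleftrightarrow> (EX \<gamma> I. \<gamma> 0 = x & \<gamma> 1 = y & (ALL t:{0..1}. \<gamma> t:outer_space1 r) & weak_cont r \<gamma> & smooth_piece r 0 1 \<gamma> I)"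

lemma onep_sym: "onep r x y ==> onep r y x"
proof -
 assume "onep r x y"
 then obtain \<gamma> I where g: "\<gamma> 0 = x" "\<gamma> 1 = y" "!!t. t:{0..1} ==> \<gamma> t:outer_space1 r" "weak_cont r \<gamma>" "smooth_piece r 0 1 \<gamma> I"
  unfolding onep_def by blast
 have "weak_cont r (%t. \<gamma> (1-t))" unfolding weak_cont_def
 proof (intro allI impI)
  fix V assume "weak_open r V"
  then have "openin (top_of_set {0..1}) {t:{0..1}. \<gamma> t:V}" using g(4) by (simp add: weak_cont_def)
  moreover have "continuous_on {0..1} (%t::real. 1-t)" by (intro continuous_intros)
  moreover have "(%t::real. 1-t):{0..1} \<rightarrow> {0..1}" by auto
  ultimately have "openin (top_of_set {0..1}) ({0..1} \<inter> (%t::real. 1-t) -` {t:{0..1}. \<gamma> t:V})"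
   using continuous_openin_preimage by blast
  moreover have "{0..1} \<inter> (%t::real. 1-t) -` {t:{0..1}. \<gamma> t:V} = {t:{0..1}. \<gamma> (1-t):V}" by auto
  ultimately show "openin (top_of_set {0..1}) {t:{0..1}. \<gamma> (1-t):V}" by simp
 qed
 moreover have "smooth_piece r 0 1 (%t. \<gamma> (1-t)) I"
  by (rule smooth_piece_affine[OF g(5), of "-1" 0 1 1]) auto
 ultimately show ?thesis unfolding onep_def using g by (intro exI[of _ "%t. \<gamma> (1-t)"] exI[of _ I]) auto
qed

lemma weak_cont_join:
 assumes "weak_cont r \<gamma>1" "weak_cont r \<gamma>2" "\<gamma>1 1 = \<gamma>2 0"
 shows "weak_cont r (%t. if t <= 1/2 then \<gamma>1 (2 * t) else \<gamma>2 (2 * t-1))"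
 unfolding weak_cont_def
proof (intro allI impI)
 fix V assume V: "weak_open r V"
 obtain T1 where T1: "open T1" "{t:{0..1}. \<gamma>1 t:V} = {0..1} \<inter> T1" using assms(1) V unfolding weak_cont_def openin_open by blast
 obtain T2 where T2: "open T2" "{t:{0..1}. \<gamma>2 t:V} = {0..1} \<inter> T2" using assms(2) V unfolding weak_cont_def openin_open by blast
 have m1: "\<gamma>1 t:V \<longleftrightarrow> t:T1" if "t:{0..1}" for t using T1(2) that by blast
 have m2: "\<gamma>2 t:V \<longleftrightarrow> t:T2" if "t:{0..1}" for t using T2(2) that by blast
 define A1 where "A1 = (%t::real. 2 * t) -` T1"
 define A2 where "A2 = (%t::real. 2 * t-1) -` T2"
 have o: "open A1" "open A2" unfolding A1_def A2_def
  by (intro continuous_open_vimage T1 T2 continuous_intros)+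
 \<comment> \<open>Away from the midpoint only one half of the path matters; the third set supplies
   a neighbourhood of the midpoint when that point belongs to the preimage.\<close>
 define T where "T = ({..<1/2} \<inter> A1) \<union> ({1/2<..} \<inter> A2) \<union> (A1 \<inter> A2)"
 have "open T" unfolding T_def using o by (intro open_Un open_Int) auto
 moreover have "{t:{0..1}. (if t <= 1/2 then \<gamma>1 (2 * t) else \<gamma>2 (2 * t-1)):V} = {0..1} \<inter> T"
 proof (rule set_eqI)
  fix t :: real
  consider "t < 1/2" | "t = 1/2" | "t > 1/2" by linarith
  then show "t:{t:{0..1}. (if t <= 1/2 then \<gamma>1 (2 * t) else \<gamma>2 (2 * t-1)):V} \<longleftrightarrow> t:{0..1} \<inter> T"
  proof cases
   case 1
   then show ?thesis using m1[of "2 * t"] by (auto simp: T_def A1_def)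
  next
   case 2
   have "\<gamma>1 1:V \<longleftrightarrow> 1:T1" "\<gamma>2 0:V \<longleftrightarrow> 0:T2" using m1[of 1] m2[of 0] by auto
   then show ?thesis unfolding 2 using assms(3) by (simp add: T_def A1_def A2_def)
  next
   case 3
   then show ?thesis using m2[of "2 * t-1"] by (auto simp: T_def A2_def)
  qed
 qed
 ultimately show "openin (top_of_set {0..1}) {t:{0..1}. (if t <= 1/2 then \<gamma>1 (2 * t) else \<gamma>2 (2 * t-1)):V}"
  unfolding openin_open by blast
qed

lemma path_extend:
 assumes "path_lengths r x y ~= {}" "onep r y z"
 shows "path_lengths r x z ~= {}"
proof -
 obtain s where "s:path_lengths r x y" using assms(1) by blast
 then obtain \<gamma>1 ts I where g1: "\<gamma>1 0 = x" "\<gamma>1 1 = y" "!!t. t:{0..1} ==> \<gamma>1 t:outer_space1 r" "weak_cont r \<gamma>1"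
  "length ts >= 2" "hd ts = 0" "last ts = 1" "sorted_wrt (<) ts"
  "!!k. Suc k < length ts ==> smooth_piece r (ts ! k) (ts ! Suc k) \<gamma>1 (I k)"
  unfolding path_lengths_def by blast
 obtain \<gamma>2 J where g2: "\<gamma>2 0 = y" "\<gamma>2 1 = z" "!!t. t:{0..1} ==> \<gamma>2 t:outer_space1 r" "weak_cont r \<gamma>2" "smooth_piece r 0 1 \<gamma>2 J"
  using assms(2) unfolding onep_def by blast
 define \<gamma> where "\<gamma> = (%t::real. if t <= 1/2 then \<gamma>1 (2 * t) else \<gamma>2 (2 * t-1))"
 define us where "us = map (%t. t/2) ts@[1]"
 define K where "K k = (if Suc k < length ts then I k else J)" for k
 have ne: "ts ~= []" using g1(5) by auto
 have le1: "t <= 1" if tts: "t:set ts" for t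
 proof -
  obtain i where i: "i < length ts" "t = ts ! i" using tts by (metis in_set_conv_nth)
  show ?thesis
  proof (cases "i = length ts-1")
   case True
   then show ?thesis using i g1(7) last_conv_nth[OF ne] by simp
  next
   case False
   then have "ts ! i < ts ! (length ts-1)" using i by (intro sorted_wrt_nth_less[OF g1(8)]) auto
   then show ?thesis using i g1(7) last_conv_nth[OF ne] by simp
  qed
 qed
 have "sorted_wrt (<) us" unfolding us_def sorted_wrt_append
  using g1(8) le1 by (auto simp: sorted_wrt_map) (fastforce dest: le1)
 moreover have "smooth_piece r (us ! k) (us ! Suc k) \<gamma> (K k)" if k: "Suc k < length us" for k
 proof (cases "Suc k < length ts")
  case True
  have lt: "ts ! k < ts ! Suc k" using True by (intro sorted_wrt_nth_less[OF g1(8)]) auto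
  have u: "us ! k = ts ! k/2" "us ! Suc k = ts ! Suc k/2" using True by (auto simp: us_def nth_append)
  have b: "ts ! Suc k <= 1" using le1 True by simp
  have KI: "K k = I k" using True by (simp add: K_def)
  show ?thesis unfolding u KI
   by (rule smooth_piece_affine[OF g1(9)[OF True], of 2 _ _ 0]) (use lt b in \<open>auto simp: \<gamma>_def\<close>)
 next
  case False
  then have kk: "k = length ts-1" using k ne by (simp add: us_def)
  have u: "us ! k = 1/2" "us ! Suc k = 1"
   using kk ne g1(7) last_conv_nth[OF ne] by (auto simp: us_def nth_append)
  have "smooth_piece r (1/2) 1 \<gamma> J"
   by (rule smooth_piece_affine[OF g2(5), of 2 _ _ "-1"]) (auto simp: \<gamma>_def)
  then show ?thesis unfolding u using False by (simp add: K_def)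
 qed
 moreover have "\<gamma> 0 = x" "\<gamma> 1 = z" "ALL t:{0..1}. \<gamma> t:outer_space1 r" using g1(1,3) g2(2,3) by (auto simp: \<gamma>_def)
 moreover have "weak_cont r \<gamma>" unfolding \<gamma>_def using weak_cont_join[OF g1(4) g2(4)] g1(2) g2(1) by simp
 moreover have "length us >= 2" "hd us = 0" "last us = 1" using g1(5,6) ne by (auto simp: us_def hd_map)
 ultimately have "(\<Sum>k<length us-1. K k):path_lengths r x z"
  unfolding path_lengths_def by blast
 then show ?thesis by blast
qed

section \<open>Metrically open sets are weakly open\<close>

text \<open>The segment of \<open>cell_seg\<close> in the closed cell of the larger graph, with the
  identity as second collapse. Equal graphs are included, so the lemma also changes lengths within
  one cell.\<close>

lemma onep_dominated:
 assumes v0: "valid_mmg r (G0,M0,l0)" and v: "valid_mmg r (G,M,l)" and c: "mdom G M G0 M0 cV cE"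
 shows "onep r (nrm r (G0,M0,l0)) (nrm r (G,M,l))"
proof -
 note D0 = valid_mmgD[OF v0] note D = valid_mmgD[OF v]
 interpret coll2 G G0 cV cE using D D0 c by unfold_locales (auto simp: mdom_def)
 obtain g where "g:gE G0" using outer_edge[OF D0(1)] by auto
 then obtain e0 where e0: "e0:gE G" "cE e0 = Some g" using edge_ex by blast
 interpret s: cell_seg r G M G0 M0 l0 cV cE G M l id Some e0
  by unfold_locales (use D D0 v v0 c e0 mdom_id[OF D(2,4)] in auto)
 show ?thesis unfolding onep_def using s.gamma_1 s.gamma_in s.gamma_cont s.piece
  by (intro exI[of _ s.\<gamma>] exI[of _ "integral {0..1} s.sp"]) (simp add: s.\<gamma>_def)
qed

text \<open>Entropy is the root of the loop series, and the series is compatible with collapses; an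
  isomorphism is the special case in which nothing is collapsed.\<close>

lemma meq_entropy:
 assumes v: "valid_mmg r (G,M,l)" "valid_mmg r (G',M',l')" and m: "meq (G,M,l) (G',M',l')"
 shows "entropy G l = entropy G' l'"
proof -
 note D = valid_mmgD[OF v(1)] note D' = valid_mmgD[OF v(2)]
 obtain cV cE where c: "mdom G M G' M' cV cE" "!!e. e:gE G ==> cE e ~= None" "!!e. e:gE G ==> len G' l' (the (cE e)) = len G l e"
  using m unfolding meq_def by auto
 have cc: "coll G G' cV cE" using c(1) by (simp add: mdom_def)
 obtain e0 where e0: "e0:gE G" using outer_edge[OF D(1)] by auto
 then obtain f0 where f0: "cE e0 = Some f0" using c(2) by blast
 interpret coll_loops G G' cV cE e0 f0 by unfold_locales (use D D' cc e0 f0 in auto)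
 have pos: "ALL i:gEp G. l i > 0" "ALL i:gEp G'. l' i > 0" using D(5) D'(5) by (auto simp: lengths_def)
 have "l = pullback G cE G' l'"
 proof (rule pull_eqI[OF D(2) D'(2) cc])
  show "l e = 0" if "e ~: gEp G" for e using D(5) that by (simp add: lengths_def)
  fix e assume "e:gE G"
  then show "len G l e = (case cE e of Some f => len G' l' f | None => 0)" using c(2,3)[of e] by (cases "cE e") auto
 qed
 then have "g.root (%i. entropy G' l' * l i)"
  using h.entropy_root(1)[OF pos(2)] root_pull[of "%i. entropy G' l' * l' i"] by (simp add: pull_scale)
 then show ?thesis by (intro g.entropy_eq[OF pos(1)] h.entropy_root(2)[OF pos(2)])
qed

lemma nrm_cong:
 assumes v: "valid_mmg r t" "valid_mmg r t'" and m: "meq t t'"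
 shows "nrm r t = nrm r t'"
proof -
 obtain G M l G' M' l' where t: "t = (G,M,l)" "t' = (G',M',l')" by (metis surj_pair)
 have e: "entropy G l = entropy G' l'" by (rule meq_entropy[OF v[unfolded t] m[unfolded t]])
 have sc: "len K (%i. s * x i) f = s * len K x f" for K s x f by (simp add: len_def)
 have "meq (G,M,%i. entropy G l * l i) (G',M',%i. entropy G' l' * l' i)"
  using m unfolding t meq_def prod.case e sc by (metis (no_types, lifting))
 then show ?thesis unfolding t nrm_def prod.case
  using cls_eq_iff nrm_in(1) v[unfolded t] by blast
qed

lemma open_coords:
 assumes "finite I"
 shows "open {f :: nat => real. ALL i:I. \<bar>f i-c i\<bar> < \<delta>}"
proof -
 have "open {f :: nat => real. \<bar>f i-c i\<bar> < \<delta>}" for i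
  by (intro open_Collect_less continuous_intros continuous_on_product_coordinates)
 then have "open (\<Inter>i\<in>I. {f :: nat => real. \<bar>f i-c i\<bar> < \<delta>})" using assms by (intro open_INT) auto
 moreover have "(\<Inter>i\<in>I. {f :: nat => real. \<bar>f i-c i\<bar> < \<delta>}) = {f. ALL i:I. \<bar>f i-c i\<bar> < \<delta>}" by auto
 ultimately show ?thesis by simp
qed

text \<open>A point closer than this cannot have coordinate zero at an edge that survives at
  \<open>l0\<close>, so its face is at least as large.\<close>

lemma pull_gap:
 assumes "serre_graph G" "serre_graph G0" "coll G G0 cV cE" "l0:lengths G0"
 shows "EX \<delta>>0. ALL e:gE G. cE e ~= None --> len G (pullback G cE G0 l0) e >= \<delta>"
proof -
 let ?S = "(%e. len G (pullback G cE G0 l0) e) ` {e:gE G. cE e ~= None}"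
 interpret coll2 G G0 cV cE using assms by unfold_locales
 have fin: "finite ?S" using serre_fin(2)[OF assms(1)] by simp
 have pos: "x > 0" if xS: "x:?S" for x
 proof -
  obtain e where e: "e:gE G" "cE e ~= None" "x = len G (pullback G cE G0 l0) e" using xS by blast
  obtain f where f: "cE e = Some f" using e(2) by blast
  then have "f:gE G0" using edge_Some[OF e(1) f] by simp
  then show ?thesis using len_lengths_pos[OF assms(2,4), of f] len_pull[OF assms(1-3) e(1), of l0] f e(3) by simp
 qed
 show ?thesis
 proof (intro exI[of _ "Min (insert 1 ?S)"] conjI ballI impI)
  show "0 < Min (insert 1 ?S)" using fin pos by (subst Min_gr_iff) auto
  fix e assume "e:gE G" "cE e ~= None"
  then show "Min (insert 1 ?S) <= len G (pullback G cE G0 l0) e" using fin by (intro Min_le) auto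
 qed
qed

lemma len_near:
 assumes "serre_graph G" "ALL i:gEp G. \<bar>x i-y i\<bar> < \<delta>" "e:gE G"
 shows "\<bar>len G x e-len G y e\<bar> < \<delta>"
 using assms(2) serre_Ep[OF assms(1,3)] by (auto simp: len_def)

text \<open>Near a point of a closed cell each other point lies in a face that keeps the surviving
  edges, and the segment to it has length at most a constant times the coordinate distance. The
  constants may depend on the closed cell, as the weak topology is tested cell by cell.\<close>

lemma metric_open_weak_open:
 assumes U: "U <= outer_space1 r"
  and mo: "ALL x:U. EX \<epsilon>>0. ALL y:outer_space1 r. d_h r x y < ereal \<epsilon> --> y:U"
 shows "EX V. weak_open r V & U = V \<inter> outer_space1 r"
proof -
 \<comment> \<open>The points of the whole outer space whose normalization lies in \<open>U\<close>:
   a union of rays with trace \<open>U\<close> on unit entropy.\<close>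
 define V where "V = {x. EX t. valid_mmg r t & x = cls r t & nrm r t:U}"
 have Vmem: "cls r t:V \<longleftrightarrow> nrm r t:U" if t: "valid_mmg r t" for t
 proof
  assume "cls r t:V"
  then obtain t' where t': "valid_mmg r t'" "cls r t = cls r t'" "nrm r t':U" unfolding V_def by blast
  then have "meq t t'" using cls_eq_iff[OF t t'(1)] by simp
  then show "nrm r t:U" using nrm_cong[OF t t'(1)] t'(3) by simp
 qed (use t V_def in blast)
 have VO: "V <= outer_space r" unfolding V_def outer_space_def by blast
 have "U = V \<inter> outer_space1 r"
 proof -
  have "x:U \<longleftrightarrow> x:V" if x: "x:outer_space1 r" for x
  proof -
   obtain G M l where l: "valid_mmg r (G,M,l)" "entropy G l = 1" "x = cls r (G,M,l)"
    using x unfolding outer_space1_def by blast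
   then have "nrm r (G,M,l) = x" by (simp add: nrm_def)
   then show ?thesis using Vmem[OF l(1)] l(3) by simp
  qed
  then show ?thesis using U by blast
 qed
 moreover have "weak_open r V" unfolding weak_open_def
 proof (intro conjI VO allI impI, elim conjE)
  fix G M assume og: "outer_graph G" and vM: "valid_marking r G M"
  note sg = outerD(1)[OF og]
  let ?C = "{lam. EX x. cell_rel r G M lam x}" and ?W = "{lam. EX x:V. cell_rel r G M lam x}"
  have "EX T. open T & lam:T & ?C \<inter> T <= ?W" if lam: "lam:?W" for lam
  proof -
   obtain x where x: "x:V" "cell_rel r G M lam x" using lam by blast
   obtain G0 M0 l0 cV cE where 0: "valid_mmg r (G0,M0,l0)" "mdom G M G0 M0 cV cE" "lam = pullback G cE G0 l0" "x = cls r (G0,M0,l0)"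
    using iffD1[OF cell_rel_iff[OF sg] x(2)] by blast
   note D0 = valid_mmgD[OF 0(1)]
   have cc: "coll G G0 cV cE" using 0(2) by (simp add: mdom_def)
   have "nrm r (G0,M0,l0):U" using Vmem[OF 0(1)] x(1) 0(4) by simp
   then obtain \<epsilon> where e: "\<epsilon> > 0" "!!y. y:outer_space1 r ==> d_h r (nrm r (G0,M0,l0)) y < ereal \<epsilon> ==> y:U" using mo by blast
   interpret coll2 G G0 cV cE using sg D0 cc by unfold_locales
   obtain g where "g:gE G0" using outer_edge[OF D0(1)] by auto
   then obtain e0 where e0: "e0:gE G" "cE e0 = Some g" using edge_ex by blast
   interpret s0: cell_seg r G M G0 M0 l0 cV cE G0 M0 l0 cV cE e0
    by unfold_locales (use og vM 0 e0 in auto)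
   let ?a = "pullback G cE G0 l0"
   have pos0: "ALL i:gEp G0. l0 i > 0" using D0(5) by (simp add: lengths_def)
   have cone: "s0.z.g.cone ?a"
   proof -
    have "?a i >= 0" if i: "i:gEp G" for i
    proof -
     have "i:gE G" using i serre_fin(3)[OF sg] by auto
     from s0.len_a_nonneg[OF this] show ?thesis using i by (simp add: len_def)
    qed
    moreover have "?a s0.z.g.i0 > 0"
     using s0.z.g.len_i0[of ?a] len_pull[OF sg D0(2) cc e0(1), of l0] e0(2) len_lengths_pos[OF D0(2,5) \<open>g : gE G0\<close>] by simp
    ultimately show ?thesis by (simp add: s0.z.g.cone_def)
   qed
   have root: "s0.z.g.root (%i. entropy G0 l0*?a i)"
    using s0.z.h.entropy_root(1)[OF pos0] s0.z.root_pull[of "%i. entropy G0 l0 * l0 i"] by (simp add: pull_scale)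
   obtain \<delta>1 C where nb: "\<delta>1 > 0" "C > 0" "!!c k. (ALL i:gEp G. \<bar>c i-?a i\<bar> < \<delta>1) & s0.z.g.cone c & s0.z.g.root (%i. k * c i) ==>
     1/C <= k & k <= C & 1/C <= c s0.z.g.i0 & (ALL i:gEp G. c i <= C) &
     s0.z.g.F s0.z.g.sz (%i. k * c i) <= C & s0.z.g.F (%p. s0.z.g.sz p * s0.z.g.sz p) (%i. k * c i) <= C"
    using s0.z.g.near_bound[OF cone root entropy_scale(1)[OF D0(1) pos0]] by blast
   obtain \<delta>2 where d2: "\<delta>2 > 0" "!!e. e:gE G ==> cE e ~= None ==> len G ?a e >= \<delta>2"
    using pull_gap[OF sg D0(2) cc D0(5)] by blast
   define B where "B = (C * C * C * C+C) * sqrt (C * C * C)"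
   have B: "B > 0" unfolding B_def using nb(2) by (intro mult_pos_pos add_pos_pos) auto
   \<comment> \<open>\<open>\<delta>1\<close> secures the bounds of \<open>near_bound\<close>,
     halved because \<open>sp_bound\<close> works with a closed condition; \<open>\<delta>2\<close>
     prevents the collapse of surviving edges; the last entry keeps the length below
     \<epsilon>.\<close>
   define \<delta> where "\<delta> = min (\<delta>1/2) (min \<delta>2 (\<epsilon>/(2 * B)))"
   have d: "\<delta> > 0" "\<delta> < \<delta>1" "\<delta> <= \<delta>2" "B*\<delta> < \<epsilon>"
   proof -
    show "\<delta> > 0" "\<delta> < \<delta>1" "\<delta> <= \<delta>2" using nb(1) d2(1) e(1) B by (auto simp: \<delta>_def)
    have "B*\<delta> <= B*(\<epsilon>/(2 * B))" using B by (intro mult_left_mono) (auto simp: \<delta>_def)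
    also have "... < \<epsilon>" using B e(1) by simp
    finally show "B*\<delta> < \<epsilon>" .
   qed
   let ?T = "{f :: nat => real. ALL i:gEp G. \<bar>f i-?a i\<bar> < \<delta>}"
   have "?C \<inter> ?T <= ?W"
   proof
    fix lam' assume l': "lam':?C \<inter> ?T"
    then obtain x' where x': "cell_rel r G M lam' x'" by blast
    obtain G1 M1 l1 dV dE where 1: "valid_mmg r (G1,M1,l1)" "mdom G M G1 M1 dV dE" "lam' = pullback G dE G1 l1" "x' = cls r (G1,M1,l1)"
     using iffD1[OF cell_rel_iff[OF sg] x'] by blast
    note D1 = valid_mmgD[OF 1(1)]
    have cd: "coll G G1 dV dE" using 1(2) by (simp add: mdom_def)
    have near: "ALL i:gEp G. \<bar>lam' i-?a i\<bar> < \<delta>" using l' by blast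
    have sub: "cE e = None" if "e:gE G" "dE e = None" for e
    proof (rule ccontr)
     assume "cE e ~= None"
     then have "len G ?a e >= \<delta>2" by (rule d2(2)[OF that(1)])
     moreover have "len G lam' e = 0" using len_pull[OF sg D1(2) cd that(1), of l1] that(2) 1(3) by simp
     ultimately show False using len_near[OF sg near that(1)] d(3) by linarith
    qed
    interpret s: cell_seg r G M G0 M0 l0 cV cE G1 M1 l1 dV dE e0
     by unfold_locales (use og vM 0 1 sub e0 in auto)
    have "integral {0..1} s.sp <= B*\<delta>" unfolding B_def
    proof (rule s.sp_bound[OF nb(2)])
     show "0 <= \<delta>" using d(1) by simp
     show "\<bar>pullback G dE G1 l1 i-?a i\<bar> <= \<delta>" if "i:gEp G" for i using near that 1(3) by force
     show "1/C <= k & k <= C & 1/C <= c s0.z.g.i0 & (ALL i:gEp G. c i <= C) &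
      s0.z.g.F s0.z.g.sz (%i. k * c i) <= C & s0.z.g.F (%p. s0.z.g.sz p * s0.z.g.sz p) (%i. k * c i) <= C"
      if "(ALL i:gEp G. \<bar>c i-?a i\<bar> <= \<delta>) & s0.z.g.cone c & s0.z.g.root (%i. k * c i)" for c k
      by (rule nb(3)) (use that d(2) in force)
    qed
    also have "... < \<epsilon>" by (rule d(4))
    finally have "d_h r (nrm r (G0,M0,l0)) (nrm r (G1,M1,l1)) < ereal \<epsilon>"
     unfolding d_h_def using s.seg_path by (meson INF_lower ereal_less_eq(3) less_ereal.simps(1) order_le_less_trans)
    then have "nrm r (G1,M1,l1):U" using e(2) nrm_in(2)[OF 1(1)] by blast
    then have "x':V" using Vmem[OF 1(1)] 1(4) by simp
    then show "lam':?W" using x' by blast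
   qed
   moreover have "open ?T" by (rule open_coords[OF serre_fin(5)[OF sg]])
   moreover have "lam:?T" using d(1) 0(3) by simp
   ultimately show ?thesis by blast
  qed
  then have "openin (top_of_set ?C) ?W"
  proof -
   assume *: "!!lam. lam:?W ==> EX T. open T & lam:T & ?C \<inter> T <= ?W"
   show ?thesis
   proof (subst openin_subopen, rule ballI)
    fix lam assume lw: "lam:?W"
    obtain T where T: "open T" "lam:T" "?C \<inter> T <= ?W" using *[OF lw] by blast
    have "openin (top_of_set ?C) (?C \<inter> T)" using T(1) by (simp add: openin_open_Int)
    moreover have "lam:?C \<inter> T" using lw T(2) by blast
    ultimately show "EX T. openin (top_of_set ?C) T & lam:T & T <= ?W" using T(3) by blast
   qed
  qed
  then show "openin (top_of_set ?C) ?W" .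
 qed
 ultimately show ?thesis by blast
qed

section \<open>Star neighbourhoods\<close>

text \<open>Points in the open star of the cell of \<open>(G0,M0)\<close> whose lengths are close to
  \<open>l0\<close>, compared on the larger graph. By \<open>star_nbhd_mem\<close> membership can be
  tested on any representative.\<close>

definition star_nbhd :: "nat => sgraph => nat \<times> nat list list => (nat => real) => real => mmg set set" where
 "star_nbhd r G0 M0 l0 \<delta> = {y. EX G M l cV cE. valid_mmg r (G,M,l) & mdom G M G0 M0 cV cE &
   (ALL e:gE G. \<bar>len G l e-len G (pullback G cE G0 l0) e\<bar> < \<delta>) & y = cls r (G,M,l)}"

lemma mdom_len_pull:
 assumes "serre_graph G" "serre_graph H" "mdom G M H N cV cE" "e:gE G"
 shows "len G (pullback G cE H l) e = (case cE e of Some f => len H l f | None => 0)"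
 by (rule len_pull[OF assms(1,2) conjunct1[OF assms(3)[unfolded mdom_def]] assms(4)])

lemma star_nbhd_mem:
 assumes v: "valid_mmg r (G,M,l)" and v0: "valid_mmg r (G0,M0,l0)"
 shows "cls r (G,M,l):star_nbhd r G0 M0 l0 \<delta> \<longleftrightarrow> (EX cV cE. mdom G M G0 M0 cV cE &
   (ALL e:gE G. \<bar>len G l e-len G (pullback G cE G0 l0) e\<bar> < \<delta>))" (is "?L \<longleftrightarrow> ?R")
proof
 assume ?L
 then obtain G1 M1 l1 cV cE where 1: "valid_mmg r (G1,M1,l1)" "mdom G1 M1 G0 M0 cV cE"
  "!!e. e:gE G1 ==> \<bar>len G1 l1 e-len G1 (pullback G1 cE G0 l0) e\<bar> < \<delta>" "cls r (G,M,l) = cls r (G1,M1,l1)"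
  unfolding star_nbhd_def by blast
 note D = valid_mmgD[OF v] note D0 = valid_mmgD[OF v0] note D1 = valid_mmgD[OF 1(1)]
 have "meq (G,M,l) (G1,M1,l1)" using cls_eq_iff[OF v 1(1)] 1(4) by simp
 then obtain iV iE where i: "mdom G M G1 M1 iV iE" "!!e. e:gE G ==> iE e ~= None" "!!e. e:gE G ==> len G1 l1 (the (iE e)) = len G l e"
  unfolding meq_def by auto
 interpret coll2 G G1 iV iE using D D1 i by unfold_locales (auto simp: mdom_def)
 let ?hE = "%e. Option.bind (iE e) cE"
 have h: "mdom G M G0 M0 (cV \<circ> iV) ?hE" by (rule mdom_compose[OF D(2) D1(2) D0(2) D(4) D1(4) D0(4) i(1) 1(2)])
 have "\<bar>len G l e-len G (pullback G ?hE G0 l0) e\<bar> < \<delta>" if e: "e:gE G" for e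
 proof -
  obtain f where f: "iE e = Some f" using i(2)[OF e] by blast
  have fE: "f:gE G1" using edge_Some[OF e f] by simp
  have "len G (pullback G ?hE G0 l0) e = len G1 (pullback G1 cE G0 l0) f"
   using mdom_len_pull[OF D(2) D0(2) h e, of l0] mdom_len_pull[OF D1(2) D0(2) 1(2) fE, of l0] f by simp
  then show ?thesis using 1(3)[OF fE] i(3)[OF e] f by simp
 qed
 then show ?R using h by blast
next
 assume ?R
 then show ?L unfolding star_nbhd_def using v by blast
qed

text \<open>Passage from a large graph to one of its faces: as long as the face keeps the edges that
  \<open>G0\<close> keeps, it still lies in the star of \<open>G0\<close>, and closeness is
  inherited.\<close>

lemma star_nbhd_factor:
 assumes og: "outer_graph G" and vM: "valid_marking r G M"
  and vx: "valid_mmg r (Gx,Mx,lx)" and c: "mdom G M Gx Mx cV cE"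
  and v0: "valid_mmg r (G0,M0,l0)" and d: "mdom G M G0 M0 dV dE"
  and sub: "!!e. e:gE G ==> cE e = None ==> dE e = None"
  and near: "!!e. e:gE G ==> cE e ~= None ==> \<bar>len G (pullback G cE Gx lx) e-len G (pullback G dE G0 l0) e\<bar> < \<delta>"
 shows "cls r (Gx,Mx,lx):star_nbhd r G0 M0 l0 \<delta>"
proof -
 note sg = outerD(1)[OF og] note w = valid_wfm[OF vM]
 note Dx = valid_mmgD[OF vx] note D0 = valid_mmgD[OF v0]
 interpret coll2 G Gx cV cE using sg Dx c by unfold_locales (auto simp: mdom_def)
 have "EX bV bE. mdom Gx Mx G0 M0 bV bE & (ALL e:gE G. dE e = Option.bind (cE e) bE)"
  by (rule mdom_factor[OF sg Dx(2) D0(2) w Dx(4) D0(4) c d]) (rule sub)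
 then obtain bV bE where b: "mdom Gx Mx G0 M0 bV bE" "!!e. e:gE G ==> dE e = Option.bind (cE e) bE" by blast
 have "\<bar>len Gx lx f-len Gx (pullback Gx bE G0 l0) f\<bar> < \<delta>" if f: "f:gE Gx" for f
 proof -
  obtain e where e: "e:gE G" "cE e = Some f" using edge_ex[OF f] by blast
  have "len Gx (pullback Gx bE G0 l0) f = len G (pullback G dE G0 l0) e"
   using len_pull[OF Dx(2) D0(2) _ f, of bV bE l0] b(1) len_pull[OF sg D0(2) _ e(1), of dV dE l0] d b(2)[OF e(1)] e(2)
   by (simp add: mdom_def)
  moreover have "len Gx lx f = len G (pullback G cE Gx lx) e" using len_pull[OF sg Dx(2) co e(1), of lx] e(2) by simp
  ultimately show ?thesis using near[OF e(1)] e(2) by simp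
 qed
 then show ?thesis using star_nbhd_mem[OF vx v0] b(1) by blast
qed

lemma openin_coordsI:
 assumes "finite I" "!!lam. lam:W ==> EX \<delta>>0. ALL lam':C. (ALL i:I. \<bar>lam' i-lam i\<bar> < \<delta>) --> lam':W" and WC: "W <= C"
 shows "openin (top_of_set C) (W :: (nat => real) set)"
proof (subst openin_subopen, rule ballI)
 fix lam assume l: "lam:W"
 obtain \<delta> where d: "\<delta> > 0" "ALL lam':C. (ALL i:I. \<bar>lam' i-lam i\<bar> < \<delta>) --> lam':W" using assms(2)[OF l] by blast
 let ?T = "{f :: nat => real. ALL i:I. \<bar>f i-lam i\<bar> < \<delta>}"
 have "openin (top_of_set C) (C \<inter> ?T)" using open_coords[OF assms(1)] by (simp add: openin_open_Int)
 moreover have "lam:C \<inter> ?T" using l WC d(1) by auto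
 moreover have "C \<inter> ?T <= W" using d(2) by blast
 ultimately show "EX T. openin (top_of_set C) T & lam:T & T <= W" by blast
qed

lemma star_nbhd_open:
 assumes v0: "valid_mmg r (G0,M0,l0)"
 shows "weak_open r (star_nbhd r G0 M0 l0 \<delta>)"
 unfolding weak_open_def
proof (intro conjI allI impI)
 show "star_nbhd r G0 M0 l0 \<delta> <= outer_space r" unfolding star_nbhd_def outer_space_def by blast
 note D0 = valid_mmgD[OF v0]
 fix G M assume gm: "outer_graph G & valid_marking r G M"
 then have og: "outer_graph G" and vM: "valid_marking r G M" by auto
 note sg = outerD(1)[OF og] note w = valid_wfm[OF vM]
 let ?N = "star_nbhd r G0 M0 l0 \<delta>"
 show "openin (top_of_set {lam. EX x. cell_rel r G M lam x}) {lam. EX x:?N. cell_rel r G M lam x}"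
 proof (rule openin_coordsI[OF serre_fin(5)[OF sg]])
  fix lam assume "lam:{lam. EX x:?N. cell_rel r G M lam x}"
  then obtain x where x: "x:?N" "cell_rel r G M lam x" by blast
  obtain Gx Mx lx cV cE where X: "valid_mmg r (Gx,Mx,lx)" "mdom G M Gx Mx cV cE" "lam = pullback G cE Gx lx" "x = cls r (Gx,Mx,lx)"
   using iffD1[OF cell_rel_iff[OF sg] x(2)] by blast
  note Dx = valid_mmgD[OF X(1)]
  have cc: "coll G Gx cV cE" using X(2) by (simp add: mdom_def)
  interpret coll2 G Gx cV cE using sg Dx cc by unfold_locales
  obtain bV bE where b: "mdom Gx Mx G0 M0 bV bE" "!!e. e:gE Gx ==> \<bar>len Gx lx e-len Gx (pullback Gx bE G0 l0) e\<bar> < \<delta>"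
   using x(1) star_nbhd_mem[OF X(1) v0] X(4) by blast
  let ?S = "(%e. \<delta>-\<bar>len Gx lx e-len Gx (pullback Gx bE G0 l0) e\<bar>) ` gE Gx"
  have fS: "finite ?S" using serre_fin(2)[OF Dx(2)] by simp
  obtain g where gE: "g:gE Gx" using outer_edge[OF Dx(1)] by blast
  then have neS: "?S ~= {}" by blast
  \<comment> \<open>The slack left at \<open>x\<close> in the strict inequalities.\<close>
  define \<eta> where "\<eta> = Min ?S"
  have eta: "\<eta> > 0" unfolding \<eta>_def using fS neS b(2) by (subst Min_gr_iff) auto
  have eta_le: "\<eta> <= \<delta>-\<bar>len Gx lx e-len Gx (pullback Gx bE G0 l0) e\<bar>" if "e:gE Gx" for e
   unfolding \<eta>_def using fS that by (intro Min_le) auto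
  have eta_d: "\<eta> <= \<delta>" using eta_le[OF gE] by linarith
  obtain \<mu> where mu: "\<mu> > 0" "!!e. e:gE G ==> cE e ~= None ==> len G lam e >= \<mu>"
   using pull_gap[OF sg Dx(2) cc Dx(5)] X(3) by blast
  let ?hE = "%e. Option.bind (cE e) bE"
  have h: "mdom G M G0 M0 (bV \<circ> cV) ?hE" by (rule mdom_compose[OF sg Dx(2) D0(2) w Dx(4) D0(4) X(2) b(1)])
  have lh: "len G (pullback G ?hE G0 l0) e = (case cE e of Some f => len Gx (pullback Gx bE G0 l0) f | None => 0)"
   if e: "e:gE G" for e
  proof (cases "cE e")
   case None
   then show ?thesis using mdom_len_pull[OF sg D0(2) h e, of l0] by simp
  next
   case (Some f)
   have fE: "f:gE Gx" using edge_Some[OF e Some] by simp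
   then show ?thesis using mdom_len_pull[OF sg D0(2) h e, of l0] mdom_len_pull[OF Dx(2) D0(2) b(1) fE, of l0] Some by simp
  qed
  have lamh: "\<bar>len G lam e-len G (pullback G ?hE G0 l0) e\<bar> <= \<delta>-\<eta>" if e: "e:gE G" for e
  proof (cases "cE e")
   case None
   then show ?thesis using lh[OF e] len_pull[OF sg Dx(2) cc e, of lx] X(3) eta_d by simp
  next
   case (Some f)
   have "f:gE Gx" using edge_Some[OF e Some] by simp
   then show ?thesis using lh[OF e] len_pull[OF sg Dx(2) cc e, of lx] X(3) Some eta_le[of f] by simp
  qed
  show "EX d>0. ALL lam':{lam. EX x. cell_rel r G M lam x}. (ALL i:gEp G. \<bar>lam' i-lam i\<bar> < d) --> lam':{lam. EX x:?N. cell_rel r G M lam x}"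
  \<comment> \<open>Within \<mu> no edge that survives at \<open>x\<close> can be collapsed; within
    \<eta> the distance to \<open>l0\<close> stays below \<delta>.\<close>
  proof (intro exI[of _ "min \<mu> \<eta>"] conjI ballI impI)
   show "0 < min \<mu> \<eta>" using mu eta by simp
   fix lam' assume l': "lam':{lam. EX x. cell_rel r G M lam x}" and near: "ALL i:gEp G. \<bar>lam' i-lam i\<bar> < min \<mu> \<eta>"
   obtain y where y: "cell_rel r G M lam' y" using l' by blast
   obtain G1 M1 l1 dV dE where 1: "valid_mmg r (G1,M1,l1)" "mdom G M G1 M1 dV dE" "lam' = pullback G dE G1 l1" "y = cls r (G1,M1,l1)"
    using iffD1[OF cell_rel_iff[OF sg] y] by blast
   note D1 = valid_mmgD[OF 1(1)]
   have cd: "coll G G1 dV dE" using 1(2) by (simp add: mdom_def)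
   have "y:?N" unfolding 1(4)
   proof (rule star_nbhd_factor[OF og vM 1(1,2) v0 h])
    fix e assume e: "e:gE G"
    note nl = len_near[OF sg near e]
    show "?hE e = None" if dn: "dE e = None"
    proof -
     have "cE e = None"
     proof (rule ccontr)
      assume "cE e ~= None"
      then have "len G lam e >= \<mu>" by (rule mu(2)[OF e])
      moreover have "len G lam' e = 0" using len_pull[OF sg D1(2) cd e, of l1] dn 1(3) by simp
      ultimately show False using nl by linarith
     qed
     then show ?thesis by simp
    qed
    show "\<bar>len G (pullback G dE G1 l1) e-len G (pullback G ?hE G0 l0) e\<bar> < \<delta>"
     unfolding 1(3)[symmetric] using nl lamh[OF e] by (simp add: min_less_iff_conj) linarith
   qed
   then show "lam':{lam. EX x:?N. cell_rel r G M lam x}" using y by blast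
  qed
 qed blast
qed

subsection \<open>Local finiteness\<close>

text \<open>Fibres are trees, so a collapse preserves the Euler characteristic, and valence at least
  3 gives \<open>3 * card (gV H) <= card (gE H)\<close> for oriented edges. The two relations
  together bound the size of \<open>H\<close> by that of \<open>G0\<close>.\<close>

lemma coll_card_bound:
 assumes oH: "outer_graph H" and s0: "serre_graph G0" and c: "coll H G0 cV cE"
 shows "card (gE H) <= 3 * card (gE G0)" "card (gV H) <= card (gE G0)"
proof -
 note oHs = outerD(1)[OF oH]
 interpret coll2 H G0 cV cE using oHs s0 c by unfold_locales
 have fV: "finite (gV H)" "finite (gE H)" using serre_fin[OF oHs] by auto
 have f0: "finite (gV G0)" "finite (gE G0)" using serre_fin[OF s0] by auto
 have col: "collapse H G0 cV cE" using collapse_iff_coll[OF oHs] c by simp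
 have tree: "card {e:gE H. cE e = None & cV (gorg H e) = w} = 2*(card {v:gV H. cV v = w}-1)" if "w:gV G0" for w
  using col that unfolding collapse_def by blast
 have ne: "card {v:gV H. cV v = w} >= 1" if w: "w:gV G0" for w
 proof -
  have "w:cV ` gV H" using w cV_im by simp
  then have "{v:gV H. cV v = w} ~= {}" by blast
  then show ?thesis using fV by (simp add: Suc_le_eq card_gt_0_iff)
 qed
 have V: "card (gV H) = (\<Sum>w\<in>gV G0. card {v:gV H. cV v = w})"
 proof -
  have "gV H = (\<Union>w\<in>gV G0. {v:gV H. cV v = w})" using cV_in by blast
  then have "card (gV H) = card (\<Union>w\<in>gV G0. {v:gV H. cV v = w})" by simp
  also have "... = (\<Sum>w\<in>gV G0. card {v:gV H. cV v = w})" by (rule card_UN_disjoint) (use f0 fV in auto)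
  finally show ?thesis .
 qed
 have "nset H cE = (\<Union>w\<in>gV G0. {e:gE H. cE e = None & cV (gorg H e) = w})"
  using cV_in serreD(1)[OF oHs] by (auto simp: nset_def)
 then have "card (nset H cE) = card (\<Union>w\<in>gV G0. {e:gE H. cE e = None & cV (gorg H e) = w})" by simp
 also have "... = (\<Sum>w\<in>gV G0. card {e:gE H. cE e = None & cV (gorg H e) = w})"
  by (rule card_UN_disjoint) (use f0 fV in auto)
 also have "... = (\<Sum>w\<in>gV G0. 2*(card {v:gV H. cV v = w}-1))" by (rule sum.cong[OF refl tree])
 finally have "card (nset H cE)+2 * card (gV G0) = (\<Sum>w\<in>gV G0. 2*(card {v:gV H. cV v = w}-1)+2)"
  unfolding sum.distrib by simp
 also have "... = (\<Sum>w\<in>gV G0. 2 * card {v:gV H. cV v = w})"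
 proof (rule sum.cong[OF refl])
  fix w assume "w:gV G0"
  from ne[OF this] show "2*(card {v:gV H. cV v = w}-1)+2 = 2 * card {v:gV H. cV v = w}" by linarith
 qed
 also have "... = 2 * card (gV H)" unfolding V by (simp add: sum_distrib_left)
 finally have N: "card (nset H cE)+2 * card (gV G0) = 2 * card (gV H)" .
 have "card (gE H-nset H cE) <= card (gE G0)"
 proof (rule card_inj_on_le[of "%e. the (cE e)"])
  show "inj_on (%e. the (cE e)) (gE H-nset H cE)"
   by (rule inj_onI) (use edge_uniq in \<open>auto simp: nset_def\<close>)
  show "(%e. the (cE e)) ` (gE H-nset H cE) <= gE G0"
  proof (rule image_subsetI)
   fix e assume e: "e:gE H-nset H cE"
   then obtain f where "cE e = Some f" by (auto simp: nset_def)
   then show "the (cE e):gE G0" using edge_Some[of e f] e by simp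
  qed
 qed (rule f0)
 moreover have "card (gE H) = card (nset H cE)+card (gE H-nset H cE)"
  using fV nE by (metis card_Diff_subset card_mono finite_subset le_add_diff_inverse)
 ultimately have E: "card (gE H)+2 * card (gV G0) <= 2 * card (gV H)+card (gE G0)" using N by linarith
 have "3 * card (gV H) = (\<Sum>v\<in>gV H. 3)" by simp
 also have "... <= (\<Sum>v\<in>gV H. card {e:gE H. gorg H e = v})" by (rule sum_mono[OF outerD(3)[OF oH]])
 also have "... = card (\<Union>v\<in>gV H. {e:gE H. gorg H e = v})" by (rule card_UN_disjoint[symmetric]) (use fV in auto)
 also have "... <= card (gE H)" by (rule card_mono) (use fV in auto)
 finally have "3 * card (gV H) <= card (gE H)" .
 then show "card (gV H) <= card (gE G0)" "card (gE H) <= 3 * card (gE G0)" using E by linarith+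
qed

text \<open>Length vectors are functions on all natural numbers; their product topology sees only
  finitely many coordinates at a time.\<close>

lemma open_fun_box:
 fixes a :: "nat => real"
 assumes "open T" "a:T"
 shows "EX J \<delta>. finite J & \<delta> > 0 & (ALL f. (ALL i:J. \<bar>f i-a i\<bar> < \<delta>) --> f:T)"
proof -
 have "openin (product_topology (%i. euclidean) UNIV) T" using assms(1) by (simp add: open_fun_def)
 from product_topology_open_contains_basis[OF this assms(2)]
 obtain X where X: "a:(\<Pi>\<^sub>E i\<in>UNIV. X i)" "!!i. openin euclidean (X i)" "finite {i. X i ~= topspace (euclidean::real topology)}" "(\<Pi>\<^sub>E i\<in>UNIV. X i) <= T"
  by blast
 let ?J = "{i. X i ~= topspace (euclidean::real topology)}"
 have "ALL i. EX d>0. ALL y. \<bar>y-a i\<bar> < d --> y:X i"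
 proof
  fix i
  have "open (X i)" "a i:X i" using X(1) X(2)[of i] by (auto simp: PiE_def)
  then show "EX d>0. ALL y. \<bar>y-a i\<bar> < d --> y:X i" unfolding open_dist dist_real_def by blast
 qed
 then obtain d where d: "!!i. d i > 0" "!!i y. \<bar>y-a i\<bar> < d i ==> y:X i" by metis
 define \<delta> where "\<delta> = Min (insert 1 (d ` ?J))"
 have d0: "\<delta> > 0" unfolding \<delta>_def using X(3) d(1) by (subst Min_gr_iff) auto
 have "f:T" if f: "ALL i:?J. \<bar>f i-a i\<bar> < \<delta>" for f
 proof -
  have "f i:X i" for i
  proof (cases "i:?J")
   case True
   have "\<delta> <= d i" unfolding \<delta>_def using X(3) True by (intro Min_le) auto
   then show ?thesis using f True d(2)[of "f i" i] by fastforce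
  next
   case False
   then show ?thesis by simp
  qed
  then show ?thesis using X(4) by (auto simp: PiE_def)
 qed
 then show ?thesis using X(3) d0 by blast
qed

text \<open>For one collapse from \<open>H\<close> to \<open>G0\<close> all compatible markings of
  \<open>H\<close> are equivalent (\<open>comp_mequiv_inj\<close>), so a radius found in the closed
  cell of a single marking \<open>N\<close> is valid for all of them.\<close>

lemma nbhd_one_collapse:
 assumes W: "weak_open r W" "cls r (G0,M0,l0):W" and v0: "valid_mmg r (G0,M0,l0)"
 shows "EX \<delta>>0. ALL M l. valid_mmg r (H,M,l) & mdom H M G0 M0 cV cE &
   (ALL e:gE H. \<bar>len H l e-len H (pullback H cE G0 l0) e\<bar> < \<delta>) --> cls r (H,M,l):W"
proof (cases "EX M l. valid_mmg r (H,M,l) & mdom H M G0 M0 cV cE")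
 case False
 then show ?thesis by (intro exI[of _ 1]) auto
next
 case True
 then obtain N l1 where N: "valid_mmg r (H,N,l1)" "mdom H N G0 M0 cV cE" by blast
 note D = valid_mmgD[OF N(1)] note D0 = valid_mmgD[OF v0]
 interpret coll2 H G0 cV cE using D D0 N by unfold_locales (auto simp: mdom_def)
 let ?C = "{lam. EX x. cell_rel r H N lam x}" and ?W = "{lam. EX x:W. cell_rel r H N lam x}" and ?a = "pullback H cE G0 l0"
 have "openin (top_of_set ?C) ?W" using W(1) D(1,3) unfolding weak_open_def by blast
 then obtain T where T: "open T" "?W = ?C \<inter> T" unfolding openin_open by blast
 have "?a:?W" using cell_relI[OF D(2) v0 N(2)] W(2) by blast
 then have "?a:T" using T(2) by blast
 from open_fun_box[OF T(1) this] obtain J \<delta> where d: "\<delta> > 0" "!!f. (ALL i:J. \<bar>f i-?a i\<bar> < \<delta>) ==> f:T" by blast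
 have "cls r (H,M,l):W" if M: "valid_mmg r (H,M,l)" "mdom H M G0 M0 cV cE"
  "ALL e:gE H. \<bar>len H l e-len H ?a e\<bar> < \<delta>" for M l
 proof -
  note DM = valid_mmgD[OF M(1)]
  have 1: "marking_equiv G0 (comp_marking G0 cV cE M) M0"
   by (rule mequiv_sym[OF D0(2) D0(4)]) (use M(2) in \<open>simp add: mdom_def\<close>)
  have 2: "marking_equiv G0 M0 (comp_marking G0 cV cE N)" using N(2) by (simp add: mdom_def)
  have "marking_equiv G0 (comp_marking G0 cV cE M) (comp_marking G0 cV cE N)"
   by (rule mequiv_trans[OF D0(2) comp_wfm[OF DM(4)] 1 2])
  then have MN: "marking_equiv H M N" by (rule comp_mequiv_inj[OF DM(4) D(4)])
  have vN: "valid_mmg r (H,N,l)" using N(1) M(1) by (simp add: valid_mmg_def)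
  have "mdom H N H M id Some"
  proof -
   have "comp_marking H id Some N = N"
   proof -
    obtain v ws where Nv: "N = (v,ws)" by (metis surj_pair)
    have "map (%w. red H (subst (cmap Some) w)) ws = ws"
     using D(4) cp_Some[of "%e. e"] unfolding Nv wfm_def by (intro nth_equalityI) (auto simp: red_id)
    then show ?thesis unfolding Nv by (simp add: comp_marking_def collapse_path_subst)
   qed
   then show ?thesis using coll_id[OF D(2)] MN by (simp add: mdom_def)
  qed
  then have "meq (H,N,l) (H,M,l)" unfolding meq_def prod.case by (intro exI[of _ id] exI[of _ Some]) auto
  then have eq: "cls r (H,N,l) = cls r (H,M,l)" using cls_eq_iff[OF vN M(1)] by simp
  have lp: "l = pullback H Some H l"
   by (rule pull_eqI[OF D(2,2) coll_id[OF D(2)]]) (use DM(5) in \<open>auto simp: lengths_def\<close>)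
  have cr: "cell_rel r H N l (cls r (H,N,l))" using cell_relI[OF D(2) vN mdom_id[OF D(2,4)]] lp by simp
  have "\<bar>l i-?a i\<bar> < \<delta>" for i
  proof (cases "i:gEp H")
   case True
   then have "i:gE H" using serre_fin(3)[OF D(2)] by blast
   then show ?thesis using M(3) True by (force simp: len_def)
  next
   case False
   then show ?thesis using DM(5) d(1) by (simp add: lengths_def pullback_def)
  qed
  then have "l:T" using d(2) by blast
  then have "l:?W" using T(2) cr by blast
  then obtain x where "x:W" "cell_rel r H N l x" by blast
  then show ?thesis using cell_rel_fun[OF D(1,3) cr] eq by simp
 qed
 then show ?thesis using d(1) by blast
qed

lemma coll_cong:
 assumes sG: "serre_graph G" and sH: "serre_graph H" and c: "coll G H cV cE"
  and V: "!!v. v:gV G ==> dV v = cV v" and E: "!!e. e:gE G ==> dE e = cE e"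
 shows "coll G H dV dE"
proof -
 interpret c: coll2 G H cV cE using sG sH c by unfold_locales
 have ns: "nset G dE = nset G cE" using E by (auto simp: nset_def)
 have 1: "dV ` gV G = gV H" using c.cV_im V by (simp cong: image_cong)
 have 2: "case dE e of
     Some f => f:gE H & gorg H f = dV (gorg G e) & dE (gbar G e) = Some (gbar H f)
    | None => dV (gorg G e) = dV (tm G e) & dE (gbar G e) = None" if e: "e:gE G" for e
 proof -
  note s = serreD[OF sG e]
  show ?thesis using c.edge_Some[OF e] c.edge_None[OF e] E[OF e] E[OF s(2)] V[OF s(1)] V[OF s(5)]
   by (cases "cE e") auto
 qed
 have 3: "EX! e. e:gE G & dE e = Some f" if f: "f:gE H" for f
 proof -
  obtain e where e: "e:gE G" "cE e = Some f" using c.edge_ex[OF f] by blast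
  show ?thesis
  proof (rule ex1I[of _ e])
   show "e:gE G & dE e = Some f" using e E by simp
   show "e' = e" if "e':gE G & dE e' = Some f" for e'
    using c.edge_uniq[of e' e f] e E[of e'] that by auto
  qed
 qed
 have 4: "EX p. walk G (nset G dE) p x y" if "x:gV G" "y:gV G" "dV x = dV y" for x y
  unfolding ns by (rule c.fib_conn) (use that V in auto)
 have 5: "p = []" if "walk G (nset G dE) p x x" "reduced G p" for p x
  using c.fib_acyc that unfolding ns by blast
 show ?thesis unfolding coll_def
  by (intro conjI ballI allI impI)
   (rule 1, rule 2, assumption, rule 3, assumption, rule 4, assumption, assumption, assumption,
    elim conjE, rule 5, assumption, assumption)
qed

context coll2
begin

lemma coll_connected: "connected_graph G ==> connected_graph H"
 unfolding connected_graph_def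
proof (intro ballI)
 assume con: "ALL a:gV G. ALL b:gV G. EX p. walk G (gE G) p a b"
 fix a b assume "a:gV H" "b:gV H"
 then have "a:cV ` gV G" "b:cV ` gV G" using cV_im by simp_all
 then obtain u w where uw: "u:gV G" "w:gV G" "a = cV u" "b = cV w" by blast
 then obtain p where "walk G (gE G) p u w" using con by blast
 from cwalk[OF this] show "EX p. walk H (gE H) p a b" using uw by blast
qed

lemma lift_connected: "connected_graph H ==> connected_graph G"
 unfolding connected_graph_def
proof (intro ballI)
 assume con: "ALL a:gV H. ALL b:gV H. EX p. walk H (gE H) p a b"
 fix a b assume ab: "a:gV G" "b:gV G"
 then obtain q where "walk H (gE H) q (cV a) (cV b)" using con cV_in by blast
 from lift[OF this ab] show "EX p. walk G (gE G) p a b" by blast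
qed

end

lemma iso_outer:
 assumes oG: "outer_graph G" and sH: "serre_graph H" and i: "graph_iso G H fV fE"
 shows "outer_graph H"
proof -
 note sG = outerD(1)[OF oG]
 interpret c: coll2 G H fV "%e. Some (fE e)" using sG sH iso_coll[OF sG sH i] by unfold_locales
 have V: "bij_betw fV (gV G) (gV H)" and E: "bij_betw fE (gE G) (gE H)"
  and ed: "!!e. e:gE G ==> gorg H (fE e) = fV (gorg G e)"
  using i by (auto simp: graph_iso_def)
 have "connected_graph H" by (rule c.coll_connected[OF outerD(2)[OF oG]])
 moreover have "card {e:gE H. gorg H e = v} >= 3" if v: "v:gV H" for v
 proof -
  have "v:fV ` gV G" using v c.cV_im by simp
  then obtain u where u: "u:gV G" "v = fV u" by blast
  have "fE ` {e:gE G. gorg G e = u} <= {e:gE H. gorg H e = v}"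
   using E ed u by (auto simp: bij_betw_def)
  then have "card (fE ` {e:gE G. gorg G e = u}) <= card {e:gE H. gorg H e = v}"
   by (rule card_mono[rotated]) (use serre_fin(2)[OF sH] in simp)
  moreover have "card (fE ` {e:gE G. gorg G e = u}) = card {e:gE G. gorg G e = u}"
   by (rule card_image) (rule inj_on_subset[of _ "gE G"], use E in \<open>auto simp: bij_betw_def\<close>)
  ultimately show ?thesis using outerD(3)[OF oG u(1)] by simp
 qed
 ultimately show ?thesis using sH by (simp add: outer_graph_def)
qed

text \<open>Vertices and edges are initial segments and the maps vanish outside. These conventions
  make the set finite, while graphs of bounded size still have isomorphic copies in it
  (\<open>standardize\<close>).\<close>

definition std_graphs :: "nat => sgraph set" where
 "std_graphs N = {H. (EX n<=N. gV H = {..<n}) & (EX m<=N. gE H = {..<m}) & gEp H <= {..<N} &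
   (ALL x. (x:{..<N} --> gorg H x:{..N}) & (x ~: {..<N} --> gorg H x = 0)) &
   (ALL x. (x:{..<N} --> gbar H x:{..N}) & (x ~: {..<N} --> gbar H x = 0))}"

lemma finite_std_graphs: "finite (std_graphs N)"
proof -
 let ?F = "{f :: nat => nat. ALL x. (x:{..<N} --> f x:{..N}) & (x ~: {..<N} --> f x = 0)}"
 let ?mk = "%(n,m,o',b,P). \<lparr>gV = {..<n::nat},gE = {..<m::nat},gorg = o',gbar = b,gEp = P\<rparr> :: sgraph"
 have "finite ?F" by (rule finite_set_of_finite_funs) auto
 then have "finite ({..N} \<times> {..N} \<times> ?F \<times> ?F \<times> Pow {..<N})" by simp
 moreover have "std_graphs N <= ?mk ` ({..N} \<times> {..N} \<times> ?F \<times> ?F \<times> Pow {..<N})"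
 proof
  fix H assume H: "H:std_graphs N"
  obtain n where n: "n <= N" "gV H = {..<n}" using H unfolding std_graphs_def by blast
  obtain m where m: "m <= N" "gE H = {..<m}" using H unfolding std_graphs_def by blast
  have o: "gorg H:?F" "gbar H:?F" "gEp H:Pow {..<N}" using H unfolding std_graphs_def by blast+
  have "H = ?mk (n,m,gorg H,gbar H,gEp H)" using n m by simp
  moreover have "(n,m,gorg H,gbar H,gEp H):{..N} \<times> {..N} \<times> ?F \<times> ?F \<times> Pow {..<N}" using n m o by simp
  ultimately show "H:?mk ` ({..N} \<times> {..N} \<times> ?F \<times> ?F \<times> Pow {..<N})" by (rule image_eqI)
 qed
 ultimately show ?thesis using finite_surj by blast
qed

lemma standardize:
 assumes v: "valid_mmg r (G,M,l)" and N: "card (gV G) <= N" "card (gE G) <= N"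
 shows "EX H M' l'. H:std_graphs N & valid_mmg r (H,M',l') & cls r (G,M,l) = cls r (H,M',l')"
proof -
 note D = valid_mmgD[OF v]
 note F = serre_fin[OF D(2)]
 obtain fV where fV: "bij_betw fV (gV G) {..<card (gV G)}" using ex_bij_betw_finite_nat[OF F(1)] by (auto simp: atLeast0LessThan)
 obtain fE where fE: "bij_betw fE (gE G) {..<card (gE G)}" using ex_bij_betw_finite_nat[OF F(2)] by (auto simp: atLeast0LessThan)
 define g where "g = inv_into (gE G) fE"
 have g: "g x:gE G" "fE (g x) = x" if "x < card (gE G)" for x
  unfolding g_def using fE that by (auto simp: bij_betw_def inv_into_into f_inv_into_f)
 have gf: "g (fE e) = e" if "e:gE G" for e
  unfolding g_def using fE that by (simp add: bij_betw_def inv_into_f_f)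
 have fEr: "fE e < card (gE G)" if "e:gE G" for e using fE that by (auto simp: bij_betw_def)
 have fVr: "fV u < card (gV G)" if "u:gV G" for u using fV that by (auto simp: bij_betw_def)
 define H where "H = \<lparr>gV = {..<card (gV G)},gE = {..<card (gE G)},gorg = (%x. if x < card (gE G) then fV (gorg G (g x)) else 0),
   gbar = (%x. if x < card (gE G) then fE (gbar G (g x)) else 0),gEp = fE ` gEp G\<rparr>"
 have Hs: "gV H = {..<card (gV G)}" "gE H = {..<card (gE G)}" "gEp H = fE ` gEp G"
  "!!e. e:gE G ==> gorg H (fE e) = fV (gorg G e)" "!!e. e:gE G ==> gbar H (fE e) = fE (gbar G e)"
  using fEr gf by (auto simp: H_def)
 have inj: "fE e = fE e' \<longleftrightarrow> e = e'" if "e:gE G" "e':gE G" for e e' using gf that by metis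
 have Ep: "fE e:gEp H \<longleftrightarrow> e:gEp G" if "e:gE G" for e
  using that inj F(3) unfolding Hs(3) by auto
 have sH: "serre_graph H" unfolding serre_graph_def
 proof (intro conjI ballI)
  show "finite (gV H)" "finite (gE H)" by (auto simp: Hs)
  show "gV H ~= {}" using F(1,4) by (simp add: Hs card_gt_0_iff lessThan_empty_iff)
  show "gEp H <= gE H" using F(3) fEr by (auto simp: Hs)
  fix x assume "x:gE H"
  then have x: "x < card (gE G)" by (simp add: Hs)
  define e where "e = g x"
  have e: "e:gE G" "x = fE e" using g[OF x] by (auto simp: e_def)
  note s = serreD[OF D(2) e(1)]
  show "gorg H x:gV H" using Hs(4)[OF e(1)] e(2) fVr[OF s(1)] by (simp add: Hs(1))
  show "gbar H x:gE H" using Hs(5)[OF e(1)] e(2) fEr[OF s(2)] by (simp add: Hs(2))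
  show "gbar H x ~= x" using Hs(5)[OF e(1)] e(2) inj[OF s(2) e(1)] s(3) by simp
  show "gbar H (gbar H x) = x" using Hs(5)[OF e(1)] Hs(5)[OF s(2)] e(2) s(4) by simp
  show "(x:gEp H) = (gbar H x ~: gEp H)" using Hs(5)[OF e(1)] e(2) Ep[OF e(1)] Ep[OF s(2)] serre_Ep[OF D(2) e(1)] by simp
 qed
 have iso: "graph_iso G H fV fE" unfolding graph_iso_def using fV fE Hs by simp
 have oH: "outer_graph H" by (rule iso_outer[OF D(1) sH iso])
 interpret c: coll2 G H fV "%e. Some (fE e)" using D(2) sH iso_coll[OF D(2) sH iso] by unfold_locales
 define M' where "M' = comp_marking H fV (%e. Some (fE e)) M"
 have vM': "valid_marking r H M'" unfolding M'_def by (rule c.comp_valid[OF D(3)])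
 define l' where "l' x = (if x:gEp H then l (g x) else 0)" for x
 have "l' x > 0" if "x:gEp H" for x
 proof -
  obtain e where "e:gEp G" "x = fE e" using \<open>x : gEp H\<close> Hs(3) by blast
  then show ?thesis using D(5) F(3) gf[of e] \<open>x : gEp H\<close> by (auto simp: l'_def lengths_def)
 qed
 then have l': "l':lengths H" by (simp add: lengths_def l'_def)
 have vH: "valid_mmg r (H,M',l')" using oH vM' l' by (simp add: valid_mmg_def)
 have "len H l' (fE e) = len G l e" if e: "e:gE G" for e
 proof -
  note s = serreD[OF D(2) e]
  show ?thesis using Ep[OF e] Ep[OF s(2)] Hs(5)[OF e] gf[OF e] gf[OF s(2)] serre_Ep[OF D(2) e]
   by (simp add: len_def l'_def)
 qed
 moreover have "mdom G M H M' fV (%e. Some (fE e))"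
  unfolding mdom_def M'_def using c.co mequiv_refl[OF sH c.comp_wfm[OF D(4)]] by simp
 ultimately have "meq (G,M,l) (H,M',l')" unfolding meq_def prod.case
  by (intro exI[of _ fV] exI[of _ "%e. Some (fE e)"]) simp
 then have eq: "cls r (G,M,l) = cls r (H,M',l')" using cls_eq_iff[OF v vH] by simp
 have "gorg H x <= N" "gbar H x <= N" if "x < card (gE G)" for x
 proof -
  have "gorg G (g x):gV G" "gbar G (g x):gE G" using serreD[OF D(2) g(1)[OF that]] by auto
  then show "gorg H x <= N" "gbar H x <= N" using fVr[of "gorg G (g x)"] fEr[of "gbar G (g x)"] N that by (auto simp: H_def)
 qed
 moreover have "gorg H x = 0" "gbar H x = 0" if "~ x < card (gE G)" for x using that by (auto simp: H_def)
 ultimately have io: "gorg H x <= N" "gbar H x <= N" for x by (metis le0)+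
 have "H:std_graphs N" unfolding std_graphs_def
 proof (intro CollectI conjI allI impI)
  show "EX n<=N. gV H = {..<n}" "EX m<=N. gE H = {..<m}" using N Hs(1,2) by blast+
  show "gEp H <= {..<N}" using fEr F(3) N(2) unfolding Hs(3) by fastforce
  fix x
  show "gorg H x:{..N}" "gbar H x:{..N}" using io by auto
  show "gorg H x = 0" "gbar H x = 0" if "x ~: {..<N}" using that N(2) by (auto simp: H_def)
 qed
 then show ?thesis using vH eq by blast
qed

text \<open>Graphs in the star have bounded size, so up to isomorphism only finitely many pairs of a
  graph and a collapse onto \<open>G0\<close> occur, and the radius is a minimum over them. Markings
  do not enter the minimum, since the radius in \<open>nbhd_one_collapse\<close> is uniform in
  them.\<close>

lemma star_nbhd_small:
 assumes W: "weak_open r W" "cls r (G0,M0,l0):W" and v0: "valid_mmg r (G0,M0,l0)"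
 shows "EX \<delta>>0. star_nbhd r G0 M0 l0 \<delta> <= W"
proof -
 note D0 = valid_mmgD[OF v0]
 note F0 = serre_fin[OF D0(2)]
 define N where "N = 3 * card (gE G0)"
 let ?V = "{f :: nat => nat. ALL x. (x:{..<N} --> f x:insert 0 (gV G0)) & (x ~: {..<N} --> f x = 0)}"
 let ?E = "{f :: nat => nat option. ALL x. (x:{..<N} --> f x:insert None (Some ` gE G0)) & (x ~: {..<N} --> f x = None)}"
 have fin: "finite (std_graphs N \<times> ?V \<times> ?E)"
  using F0 by (intro finite_cartesian_product finite_std_graphs finite_set_of_finite_funs) auto
 define P where "P \<kappa> \<delta> \<longleftrightarrow> \<delta> > 0 & (ALL M l. valid_mmg r (fst \<kappa>,M,l) & mdom (fst \<kappa>) M G0 M0 (fst (snd \<kappa>)) (snd (snd \<kappa>)) &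
   (ALL e:gE (fst \<kappa>). \<bar>len (fst \<kappa>) l e-len (fst \<kappa>) (pullback (fst \<kappa>) (snd (snd \<kappa>)) G0 l0) e\<bar> < \<delta>) --> cls r (fst \<kappa>,M,l):W)"
  for \<kappa> :: "sgraph \<times> (nat => nat) \<times> (nat => nat option)" and \<delta> :: real
 have "ALL \<kappa>. EX \<delta>. P \<kappa> \<delta>"
  unfolding P_def by (intro allI) (rule nbhd_one_collapse[OF W v0])
 from choice[OF this] obtain \<Delta> where PD: "ALL \<kappa>. P \<kappa> (\<Delta> \<kappa>)" ..
 have D1: "\<Delta> \<kappa> > 0" for \<kappa> using spec[OF PD, of \<kappa>] by (simp only: P_def)
 have D2: "cls r (H,M,l):W" if "valid_mmg r (H,M,l)" "mdom H M G0 M0 cV cE"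
   "ALL e:gE H. \<bar>len H l e-len H (pullback H cE G0 l0) e\<bar> < \<Delta> (H,cV,cE)" for H M l cV cE
  using spec[OF PD, of "(H,cV,cE)"] that unfolding P_def fst_conv snd_conv by (cases M) simp
 define \<delta> where "\<delta> = Min (insert 1 (\<Delta> ` (std_graphs N \<times> ?V \<times> ?E)))"
 have d0: "\<delta> > 0" unfolding \<delta>_def using fin D1 by (subst Min_gr_iff) auto
 have dle: "\<delta> <= \<Delta> \<kappa>" if "\<kappa>:std_graphs N \<times> ?V \<times> ?E" for \<kappa>
  unfolding \<delta>_def by (rule Min_le) (use fin that in auto)
 have "y:W" if y: "y:star_nbhd r G0 M0 l0 \<delta>" for y
 proof -
  obtain G M l cV cE where G: "valid_mmg r (G,M,l)" "mdom G M G0 M0 cV cE" "y = cls r (G,M,l)"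
   using y unfolding star_nbhd_def by blast
  note DG = valid_mmgD[OF G(1)]
  have "coll G G0 cV cE" using G(2) by (simp add: mdom_def)
  from coll_card_bound[OF DG(1) D0(2) this] have "card (gV G) <= N" "card (gE G) <= N" by (auto simp: N_def)
  from standardize[OF G(1) this] obtain H M' l' where H: "H:std_graphs N" "valid_mmg r (H,M',l')" "y = cls r (H,M',l')"
   using G(3) by blast
  note DH = valid_mmgD[OF H(2)]
  obtain bV bE where b: "mdom H M' G0 M0 bV bE" "!!e. e:gE H ==> \<bar>len H l' e-len H (pullback H bE G0 l0) e\<bar> < \<delta>"
   using y star_nbhd_mem[OF H(2) v0] H(3) by blast
  have cb: "coll H G0 bV bE" using b(1) by (simp add: mdom_def)
  interpret c: coll2 H G0 bV bE using DH D0 cb by unfold_locales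
  \<comment> \<open>Values outside the graph are replaced by defaults, so that the collapse belongs
    to the finite sets \<open>?V\<close> and \<open>?E\<close>.\<close>
  define dV where "dV x = (if x:gV H then bV x else 0)" for x
  define dE where "dE x = (if x:gE H then bE x else None)" for x
  have sub: "gV H <= {..<N}" "gE H <= {..<N}" using H(1) unfolding std_graphs_def by auto
  have cd: "coll H G0 dV dE" by (rule coll_cong[OF DH(2) D0(2) cb]) (auto simp: dV_def dE_def)
  have "comp_marking G0 dV dE M' = comp_marking G0 bV bE M'"
  proof (rule comp_cong)
   show "dV (fst M') = bV (fst M')" using DH(4) by (simp add: dV_def wfm_def)
   fix e u assume u: "u:set (snd M')" "e:set u"
   then obtain i where "i < r" "u = snd M' ! i" using DH(4) by (auto simp: in_set_conv_nth wfm_def)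
   then have "walk H (gE H) u (fst M') (fst M')" using DH(4) by (simp add: wfm_def)
   then have "e:gE H" using walk_E[OF DH(2)] u(2) by blast
   then show "dE e = bE e" by (simp add: dE_def)
  qed
  then have md: "mdom H M' G0 M0 dV dE" using b(1) cd by (simp add: mdom_def)
  have "pullback H dE G0 l0 = pullback H bE G0 l0"
   using serre_fin(3)[OF DH(2)] unfolding pullback_def dE_def by (intro ext) auto
  then have near: "\<bar>len H l' e-len H (pullback H dE G0 l0) e\<bar> < \<delta>" if "e:gE H" for e using b(2)[OF that] by simp
  have dVm: "dV:?V" using sub(1) c.cV_in by (auto simp: dV_def)
  have dEm: "dE:?E"
  proof (intro CollectI allI conjI impI)
   fix x
   show "dE x:insert None (Some ` gE G0)" using c.edge_Some[of x] by (cases "bE x") (auto simp: dE_def)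
   show "dE x = None" if "x ~: {..<N}" using that sub(2) by (auto simp: dE_def)
  qed
  have "\<delta> <= \<Delta> (H,dV,dE)" by (rule dle) (use H(1) dVm dEm in blast)
  then have "ALL e:gE H. \<bar>len H l' e-len H (pullback H dE G0 l0) e\<bar> < \<Delta> (H,dV,dE)" using near by force
  from D2[OF H(2) md this] show ?thesis unfolding H(3) .
 qed
 then show ?thesis using d0 by blast
qed

section \<open>Weakly open sets are metrically open\<close>

lemma outer_space1_valid:
 assumes "x:outer_space1 r"
 shows "EX G M l. valid_mmg r (G,M,l) & entropy G l = 1 & x = cls r (G,M,l)"
 using assms unfolding outer_space1_def by blast

text \<open>Differentiating the root equation along the path shows that the velocity is tangent, as
  the formulas for the Hessian require.\<close>

lemma piece_data:
 assumes og: "outer_graph G" and ab: "t:{a<..<b}"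
  and L: "!!t. t:{a<..<b} ==> L t:lengths G & entropy G (L t) = 1"
  and sm: "!!e. e:gEp G ==> smooth_on {a<..<b} (%t. L t e)"
 shows "i:gEp G ==> ((%s. L s i) has_real_derivative deriv (%s. L s i) t) (at t)"
  "hess_form G (L t) (%e. deriv (%s. L s e) t) >= 0"
  "m >= 0 ==> ALL i:gEp G. L t i <= m ==> card (gE G) <= N ==> i:gEp G ==>
   \<bar>deriv (%s. L s i) t\<bar> <= lower_const N m * sqrt (hess_form G (L t) (%e. deriv (%s. L s e) t))"
proof -
 let ?v = "%e. deriv (%s. L s e) t"
 obtain e0 where "e0:gE G" using outer_edge[OF og] by blast
 then interpret outer_loops G e0 using og by unfold_locales
 have pos: "ALL i:gEp G. L s i > 0" and rt: "root (L s)" if s: "s:{a<..<b}" for s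
 proof -
  show p: "ALL i:gEp G. L s i > 0" using L[OF s] by (simp add: lengths_def)
  show "root (L s)" using entropy_1_iff[OF p] L[OF s] by simp
 qed
 have D: "((%s. L s i) has_real_derivative ?v i) (at t)" if i: "i:gEp G" for i
 proof -
  have "(%s. L s i) differentiable (at t)" using sm[OF i] ab unfolding smooth_on_def by (metis funpow_0)
  then show ?thesis using DERIV_imp_deriv by (auto simp: real_differentiable_def)
 qed
 then show "i:gEp G ==> ((%s. L s i) has_real_derivative ?v i) (at t)" .
 have g: "good (L t)" by (rule root_good[OF rt[OF ab]])
 have FD: "((%y. F (%_. 1) (L y)) has_real_derivative-(\<Sum>i\<in>gEp G. ?v i * F (%p. 1 * cnt G p i) (L t))) (at t)"
  by (rule F_DERIV[OF D g pol_const])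
 have ev: "eventually (%y. F (%_. 1) (L y) = 1) (nhds t)"
  using eventually_nhds_in_open[OF open_greaterThanLessThan ab] by eventually_elim (use rt root_def in blast)
 have "((%y. F (%_. 1) (L y)) has_real_derivative 0) (at t)"
  by (rule iffD2[OF DERIV_cong_ev[OF refl ev refl] DERIV_const])
 then have "(\<Sum>i\<in>gEp G. ?v i * F (%p. 1 * cnt G p i) (L t)) = 0" using DERIV_unique[OF FD, of 0] by simp
 then have tan: "F (ev ?v) (L t) = 0" unfolding F_linear1[OF g] by simp
 show "hess_form G (L t) ?v >= 0" by (rule hess_form_nonneg[OF pos[OF ab] rt[OF ab] tan])
 assume m: "m >= 0" "ALL i:gEp G. L t i <= m" "card (gE G) <= N" "i:gEp G"
 show "\<bar>?v i\<bar> <= lower_const N m * sqrt (hess_form G (L t) ?v)"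
  by (rule hess_lower_bound[OF pos[OF ab] rt[OF ab] tan m])
qed

lemma smooth_pieceE:
 assumes "smooth_piece r a b \<gamma> I"
 obtains G M L f where "outer_graph G" "valid_marking r G M"
  "!!t. t:{a<..<b} ==> L t:lengths G & entropy G (L t) = 1 & \<gamma> t = cls r (G,M,L t)"
  "!!e. e:gEp G ==> smooth_on {a<..<b} (%t. L t e)"
  "!!t. t:{a<..<b} ==> f t = sqrt (hess_form G (L t) (%e. deriv (%s. L s e) t))"
  "!!t. f t >= 0" "(f has_integral I) {a..b}" "0 <= I"
proof -
 obtain G M L where L: "outer_graph G" "valid_marking r G M"
   "!!t. t:{a<..<b} ==> L t:lengths G & entropy G (L t) = 1 & \<gamma> t = cls r (G,M,L t)"
   "!!e. e:gEp G ==> smooth_on {a<..<b} (%t. L t e)"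
   "((%t. sqrt (hess_form G (L t) (%e. deriv (%s. L s e) t))) has_integral I) {a..b}"
  using assms unfolding smooth_piece_def by blast
 \<comment> \<open>The curve \<open>L\<close> is controlled on the open interval only; setting the
   integrand to 0 elsewhere makes it nonnegative and leaves the integral unchanged.\<close>
 define f where "f t = (if t:{a<..<b} then sqrt (hess_form G (L t) (%e. deriv (%s. L s e) t)) else 0)" for t
 have f0: "f t >= 0" for t
 proof (cases "t:{a<..<b}")
  case True
  have "hess_form G (L t) (%e. deriv (%s. L s e) t) >= 0"
   by (rule piece_data(2)[OF L(1) True _ L(4)]) (simp_all add: L(3))
  then show ?thesis using True by (simp add: f_def)
 next
  case False
  then show ?thesis by (simp only: f_def if_False)
 qed
 have fi: "(f has_integral I) {a..b}"
  by (rule has_integral_spike_finite[of "{a,b}", OF _ _ L(5)]) (auto simp: f_def)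
 have "0 <= I" by (rule has_integral_nonneg[OF fi]) (use f0 in auto)
 then show ?thesis using that[of G M L f] L(1-4) f0 fi by (simp add: f_def)
qed

lemma weak_cont_near:
 assumes "weak_cont r \<gamma>" "weak_open r S" "t:{0..1}" "\<gamma> t:S"
 shows "EX d>0. ALL s:{0..1}. \<bar>s-t\<bar> < d --> \<gamma> s:S"
proof -
 obtain T where T: "open T" "{t:{0..1}. \<gamma> t:S} = {0..1} \<inter> T"
  using assms(1,2) unfolding weak_cont_def openin_open by blast
 have "t:T" using T(2) assms(3,4) by blast
 then obtain d where d: "d > 0" "!!s. dist s t < d ==> s:T" using T(1) unfolding open_dist by blast
 have "\<gamma> s:S" if "s:{0..1}" "\<bar>s-t\<bar> < d" for s
 proof -
  have "s:{0..1} \<inter> T" using d(2)[of s] that by (simp add: dist_real_def)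
  then have "s:{t:{0..1}. \<gamma> t:S}" using T(2) by simp
  then show ?thesis by simp
 qed
 then show ?thesis using d(1) by blast
qed

lemma star_nbhd_self:
 assumes v: "valid_mmg r (G,M,l)" and "\<eta> > 0"
 shows "cls r (G,M,l):star_nbhd r G M l \<eta>"
proof -
 note D = valid_mmgD[OF v]
 have "l = pullback G Some G l"
  by (rule pull_eqI[OF D(2,2) coll_id[OF D(2)]]) (use D(5) in \<open>auto simp: lengths_def\<close>)
 then have "ALL e:gE G. \<bar>len G l e-len G (pullback G Some G l) e\<bar> < \<eta>" using assms(2) by simp
 then show ?thesis using star_nbhd_mem[OF v v] mdom_id[OF D(2,4)] by blast
qed

text \<open>A piece runs inside one open cell, but its ends may lie in faces of it. The radius grows
  by \<open>C * I\<close> for the movement inside the cell and by an arbitrary \<eta> for the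
  passage to the end point. As long as it is below \<delta>, no edge of \<open>G0\<close> can be
  collapsed, so the star of \<open>G0\<close> is not left.\<close>

lemma piece_step:
 assumes v0: "valid_mmg r (G0,M0,l0)"
  and m: "!!e. e:gE G0 ==> len G0 l0 e+\<delta> <= m" and \<delta>: "\<delta> > 0" "!!e. e:gE G0 ==> \<delta> <= len G0 l0 e"
 defines "C \<equiv> \<bar>lower_const (3 * card (gE G0)) m\<bar>"
 assumes \<gamma>: "weak_cont r \<gamma>" and ab: "0 <= a" "a < b" "b <= 1" and p: "smooth_piece r a b \<gamma> I"
  and gb: "\<gamma> b:outer_space1 r" and ga: "\<gamma> a:star_nbhd r G0 M0 l0 \<rho>" and \<eta>: "\<eta> > 0" "\<rho>+C * I+\<eta> < \<delta>"
 shows "\<gamma> b:star_nbhd r G0 M0 l0 (\<rho>+C * I+\<eta>)"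
proof -
 note D0 = valid_mmgD[OF v0]
 obtain G M L f where L: "outer_graph G" "valid_marking r G M"
  "!!t. t:{a<..<b} ==> L t:lengths G & entropy G (L t) = 1 & \<gamma> t = cls r (G,M,L t)"
  "!!e. e:gEp G ==> smooth_on {a<..<b} (%t. L t e)"
  "!!t. t:{a<..<b} ==> f t = sqrt (hess_form G (L t) (%e. deriv (%s. L s e) t))"
  "!!t. f t >= 0" "(f has_integral I) {a..b}" "0 <= I"
  using smooth_pieceE[OF p] by blast
 note sg = outerD(1)[OF L(1)]
 have C0: "C >= 0" by (simp add: C_def)
 have vL: "valid_mmg r (G,M,L t)" if "t:{a<..<b}" for t using L(1,2) L(3)[OF that] by (simp add: valid_mmg_def)
 obtain d1 where d1: "d1 > 0" "!!s. s:{0..1} ==> \<bar>s-a\<bar> < d1 ==> \<gamma> s:star_nbhd r G0 M0 l0 \<rho>"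
  using weak_cont_near[OF \<gamma> star_nbhd_open[OF v0] _ ga] ab by auto
 \<comment> \<open>A time just after \<open>a\<close>, where weak continuity still places the path
   in the star; it shows that the cell of the piece collapses to \<open>G0\<close>.\<close>
 define t1 where "t1 = a+min (d1/2) ((b-a)/2)"
 have t1: "a < t1" "t1 < b" "\<bar>t1-a\<bar> < d1" using d1(1) ab by (auto simp: t1_def min_def field_simps)
 have t1ab: "t1:{a<..<b}" using t1 by simp
 have "cls r (G,M,L t1):star_nbhd r G0 M0 l0 \<rho>" using d1(2)[of t1] L(3)[OF t1ab] t1 ab by simp
 then obtain cV cE where c: "mdom G M G0 M0 cV cE" "!!e. e:gE G ==> \<bar>len G (L t1) e-len G (pullback G cE G0 l0) e\<bar> < \<rho>"
  using star_nbhd_mem[OF vL[OF t1ab] v0] by blast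
 define q where "q = pullback G cE G0 l0"
 have cc: "coll G G0 cV cE" using c(1) by (simp add: mdom_def)
 interpret k: coll2 G G0 cV cE using sg D0 cc by unfold_locales
 have N: "card (gE G) <= 3 * card (gE G0)" by (rule coll_card_bound(1)[OF L(1) D0(2) cc])
 obtain g where gE: "g:gE G0" using outer_edge[OF D0(1)] by blast
 have md: "m-\<delta> >= 0" using m[OF gE] \<delta>(2)[OF gE] \<delta>(1) by linarith
 have qm: "len G q e <= m-\<delta>" if e: "e:gE G" for e
 proof (cases "cE e")
  case None
  then show ?thesis using len_pull[OF sg D0(2) cc e, of l0] md by (simp add: q_def)
 next
  case (Some f')
  then have "f':gE G0" using k.edge_Some[OF e] by simp
  then show ?thesis using len_pull[OF sg D0(2) cc e, of l0] Some m[of f'] by (simp add: q_def)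
 qed
 have EpE: "i:gE G" "len G x i = x i" if "i:gEp G" for i x using that serre_fin(3)[OF sg] by (auto simp: len_def)
 define R where "R = \<rho>+C * I"
 have Rd: "R < \<delta>" using \<eta> by (simp add: R_def)
 have near1: "\<bar>L t1 i-q i\<bar> < \<rho>" if "i:gEp G" for i using c(2)[OF EpE(1)[OF that]] EpE(2)[OF that] by (simp add: q_def)
 have LL: "L t:lengths G & entropy G (L t) = 1" if "t:{a<..<b}" for t using L(3)[OF that] by simp
 have Lc: "isCont (%s. L s i) t" if "i:gEp G" "t:{a<..<b}" for i t
  by (rule DERIV_isCont[OF piece_data(1)[OF L(1) that(2) LL L(4) that(1)]])
 \<comment> \<open>Under the provisional bound \<open>m\<close> on the lengths up to time
   \<open>t\<close> the speed controls each coordinate, and integration gives the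
   displacement.\<close>
 have move: "\<bar>L t i-L t1 i\<bar> <= C * I"
  if t: "t1 <= t" "t < b" and bd: "!!s j. t1 <= s ==> s <= t ==> j:gEp G ==> L s j <= m" and i: "i:gEp G" for t i
 proof -
  let ?v = "%s. deriv (%s. L s i) s"
  have sub: "s:{a<..<b}" if "s:{t1..t}" for s using that t t1 by auto
  have "(?v has_integral (L t i-L t1 i)) {t1..t}"
  proof (rule fundamental_theorem_of_calculus[OF t(1)])
   fix s assume s: "s:{t1..t}"
   have "((%s. L s i) has_real_derivative ?v s) (at s)"
    by (rule piece_data(1)[OF L(1) sub[OF s] LL L(4) i])
   then show "((%s. L s i) has_vector_derivative ?v s) (at s within {t1..t})"
    by (rule has_vector_derivative_at_within[OF iffD1[OF has_real_derivative_iff_has_vector_derivative]])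
  qed
  then have vi: "?v integrable_on {t1..t}" "integral {t1..t} ?v = L t i-L t1 i" by (auto simp: integral_unique)
  have fab: "f integrable_on {a..b}" using L(7) by blast
  have fi: "f integrable_on {t1..t}" by (rule integrable_subinterval_real[OF fab]) (use t t1 in auto)
  have "norm (integral {t1..t} ?v) <= integral {t1..t} (%s. C * f s)"
  proof (rule integral_norm_bound_integral[OF vi(1)])
   show "(%s. C * f s) integrable_on {t1..t}" using integrable_cmul[OF fi, of C] by simp
   fix s assume s: "s:{t1..t}"
   have "\<bar>?v s\<bar> <= lower_const (3 * card (gE G0)) m * sqrt (hess_form G (L s) (%e. deriv (%s. L s e) s))"
    by (rule piece_data(3)[OF L(1) sub[OF s] LL L(4)]) (use N i bd s md \<delta>(1) in auto)
   also have "... = lower_const (3 * card (gE G0)) m * f s" using L(5)[OF sub[OF s]] by simp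
   also have "... <= C * f s" unfolding C_def using L(6) by (intro mult_right_mono) auto
   finally show "norm (?v s) <= C * f s" by simp
  qed
  also have "integral {t1..t} (%s. C * f s) = C * integral {t1..t} f" by simp
  also have "... <= C * integral {a..b} f"
   using t t1 L(6) fi fab C0 by (intro mult_left_mono integral_subset_le) auto
  also have "integral {a..b} f = I" by (rule integral_unique[OF L(7)])
  finally show ?thesis using vi(2) by simp
 qed
 \<comment> \<open>The speed bound presupposes lengths at most \<open>m\<close>, which in turn
   follows from the estimate to be proved. The first exit time \<open>s0\<close> resolves this:
   before it the lengths are at most \<open>m\<close>, at it by continuity, and then
   \<open>move\<close> shows that no exit takes place.\<close>
 have track: "\<bar>L t i-q i\<bar> < R" if t: "t1 <= t" "t < b" and i: "i:gEp G" for t i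
 proof (rule ccontr)
  assume bad: "~ \<bar>L t i-q i\<bar> < R"
  define S where "S = (\<Union>j\<in>gEp G. {s:{t1..t}. R <= \<bar>L s j-q j\<bar>})"
  have "closed {s:{t1..t}. R <= \<bar>L s j-q j\<bar>}" if j: "j:gEp G" for j
  proof -
   have "continuous_on {t1..t} (%s. L s j)"
    by (rule continuous_at_imp_continuous_on) (use Lc[OF j] t t1 in auto)
   then have "continuous_on {t1..t} (%s. \<bar>L s j-q j\<bar>)" by (intro continuous_intros)
   then show ?thesis
    using continuous_closed_preimage[OF _ closed_atLeastAtMost closed_atLeast, of t1 t "%s. \<bar>L s j-q j\<bar>" R]
    by (simp add: vimage_def Int_def)
  qed
  then have "closed S" unfolding S_def using serre_fin(5)[OF sg] by (intro closed_UN) auto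
  moreover have "bounded S" by (rule bounded_subset[of "{t1..t}"]) (auto simp: S_def)
  ultimately have cS: "compact S" by (simp add: compact_eq_bounded_closed)
  have "t:S" unfolding S_def using bad t i by (intro UN_I[OF i]) simp
  then have "S ~= {}" by blast
  from compact_attains_inf[OF cS this] obtain s0 where s0: "s0:S" "!!s. s:S ==> s0 <= s" by blast
  have s0r: "t1 <= s0" "s0 <= t" using s0(1) by (auto simp: S_def)
  have CI: "0 <= C * I" using C0 L(8) by simp
  have "t1 ~: S" using near1 CI by (fastforce simp: S_def R_def)
  then have lt: "t1 < s0" using s0(1) s0r by (cases "s0 = t1") auto
  have before: "L s j <= m" if "t1 <= s" "s < s0" "j:gEp G" for s j
  proof -
   have "s ~: S" using s0(2)[of s] that by auto
   then have "\<bar>L s j-q j\<bar> < R" using that s0r by (auto simp: S_def)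
   then show ?thesis using qm[OF EpE(1)[OF that(3)]] EpE(2)[OF that(3), of q] Rd by linarith
  qed
  have at: "L s0 j <= m" if j: "j:gEp G" for j
  proof -
   have s0ab: "s0:{a<..<b}" using s0r t t1 by auto
   have "((%s. L s j) \<longlongrightarrow> L s0 j) (at_left s0)"
    using Lc[OF j s0ab] unfolding isCont_def by (rule tendsto_mono[rotated]) (rule at_le, simp)
   moreover have "eventually (%s. L s j <= m) (at_left s0)"
    by (rule eventually_at_leftI[OF _ lt]) (use before j in auto)
   ultimately show ?thesis by (rule tendsto_upperbound) simp
  qed
  have "\<bar>L s0 j-L t1 j\<bar> <= C * I" if j: "j:gEp G" for j
  proof (rule move[OF s0r(1) _ _ j])
   show "s0 < b" using s0r t by simp
   show "L s j' <= m" if "t1 <= s" "s <= s0" "j':gEp G" for s j'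
    using before at that by (cases "s = s0") auto
  qed
  then have "\<bar>L s0 j-q j\<bar> < R" if "j:gEp G" for j using near1[OF that] that unfolding R_def by fastforce
  then show False using s0(1) by (force simp: S_def)
 qed
 obtain Gz Mz lz where z: "valid_mmg r (Gz,Mz,lz)" "\<gamma> b = cls r (Gz,Mz,lz)" using outer_space1_valid[OF gb] by blast
 note Dz = valid_mmgD[OF z(1)]
 have "\<gamma> b:star_nbhd r Gz Mz lz \<eta>" unfolding z(2) by (rule star_nbhd_self[OF z(1) \<eta>(1)])
 then obtain d2 where d2: "d2 > 0" "!!s. s:{0..1} ==> \<bar>s-b\<bar> < d2 ==> \<gamma> s:star_nbhd r Gz Mz lz \<eta>"
  using weak_cont_near[OF \<gamma> star_nbhd_open[OF z(1)], of b \<eta>] ab by auto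
 \<comment> \<open>A time just before \<open>b\<close>: there the cell of the piece is seen to
   collapse onto the graph \<open>Gz\<close> of the end point, with lengths within \<eta>.\<close>
 define t3 where "t3 = b-min (d2/2) ((b-t1)/2)"
 have t3: "t1 < t3" "t3 < b" "\<bar>t3-b\<bar> < d2" using d2(1) t1 by (auto simp: t3_def min_def field_simps)
 have t3ab: "t3:{a<..<b}" using t3 t1 by simp
 have "cls r (G,M,L t3):star_nbhd r Gz Mz lz \<eta>" using d2(2)[of t3] L(3)[OF t3ab] t3 t1 ab by simp
 then obtain dV dE where d: "mdom G M Gz Mz dV dE" "!!e. e:gE G ==> \<bar>len G (L t3) e-len G (pullback G dE Gz lz) e\<bar> < \<eta>"
  using star_nbhd_mem[OF vL[OF t3ab] z(1)] by blast
 have n3: "\<bar>len G (L t3) e-len G q e\<bar> < R" if "e:gE G" for e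
  by (rule len_near[OF sg _ that]) (use track t3 in auto)
 have nz: "\<bar>len G (pullback G dE Gz lz) e-len G q e\<bar> < R+\<eta>" if "e:gE G" for e
  using d(2)[OF that] n3[OF that] by linarith
 show ?thesis unfolding z(2) R_def[symmetric]
 proof (rule star_nbhd_factor[OF L(1,2) z(1) d(1) v0 c(1)])
  fix e assume e: "e:gE G"
  show "\<bar>len G (pullback G dE Gz lz) e-len G (pullback G cE G0 l0) e\<bar> < R+\<eta>" using nz[OF e] by (simp add: q_def)
  show "cE e = None" if dn: "dE e = None"
  proof (rule ccontr)
   assume "cE e ~= None"
   then obtain f' where f': "cE e = Some f'" by blast
   then have "f':gE G0" using k.edge_Some[OF e] by simp
   then have "\<delta> <= len G q e" using len_pull[OF sg D0(2) cc e, of l0] f' \<delta>(2)[of f'] by (simp add: q_def)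
   moreover have "len G (pullback G dE Gz lz) e = 0" using mdom_len_pull[OF sg Dz(2) d(1) e, of lz] dn by simp
   ultimately show False using nz[OF e] \<eta>(2) unfolding R_def by linarith
  qed
 qed
qed

lemma weak_open_metric_open:
 assumes W: "weak_open r W" and x: "x:W" "x:outer_space1 r"
 shows "EX \<epsilon>>0. ALL y:outer_space1 r. d_h r x y < ereal \<epsilon> --> y:W"
proof -
 obtain G0 M0 l0 where v0: "valid_mmg r (G0,M0,l0)" "x = cls r (G0,M0,l0)" using outer_space1_valid[OF x(2)] by blast
 note D0 = valid_mmgD[OF v0(1)]
 obtain \<delta>0 where d0: "\<delta>0 > 0" "star_nbhd r G0 M0 l0 \<delta>0 <= W" using star_nbhd_small[OF W _ v0(1)] x(1) v0(2) by blast
 let ?S = "len G0 l0 ` gE G0"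
 have fS: "finite ?S" using serre_fin(2)[OF D0(2)] by simp
 have neS: "?S ~= {}" using outer_edge[OF D0(1)] by blast
 define \<delta> where "\<delta> = min \<delta>0 (Min ?S)"
 have d: "\<delta> > 0" "\<delta> <= \<delta>0" "!!e. e:gE G0 ==> \<delta> <= len G0 l0 e"
 proof -
  have "Min ?S > 0" using fS neS len_lengths_pos[OF D0(2,5)] by (subst Min_gr_iff) auto
  then show "\<delta> > 0" "\<delta> <= \<delta>0" using d0(1) by (auto simp: \<delta>_def)
  fix e assume "e:gE G0"
  then have "Min ?S <= len G0 l0 e" using fS by (intro Min_le) auto
  then show "\<delta> <= len G0 l0 e" unfolding \<delta>_def by linarith
 qed
 define m where "m = Max ?S+\<delta>"
 have m: "len G0 l0 e+\<delta> <= m" if "e:gE G0" for e unfolding m_def using fS that by simp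
 define C where "C = \<bar>lower_const (3 * card (gE G0)) m\<bar>"
 have C0: "C >= 0" by (simp add: C_def)
 \<comment> \<open>The summand 1 in the denominator makes \<open>C*\<epsilon> < \<delta>\<close>
   strict and covers the case that \<open>C\<close> is 0.\<close>
 define \<epsilon> where "\<epsilon> = \<delta>/(C+1)"
 have e: "\<epsilon> > 0" "C*\<epsilon> < \<delta>" using d(1) C0 by (auto simp: \<epsilon>_def field_simps)
 have "y:W" if y: "y:outer_space1 r" "d_h r x y < ereal \<epsilon>" for y
 proof -
  obtain s where s: "s:path_lengths r x y" "s < \<epsilon>" using y(2) unfolding d_h_def INF_less_iff by auto
  obtain \<gamma> ts I where g: "\<gamma> 0 = x" "\<gamma> 1 = y" "!!t. t:{0..1} ==> \<gamma> t:outer_space1 r" "weak_cont r \<gamma>"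
   "length ts >= 2" "hd ts = 0" "last ts = 1" "sorted_wrt (<) ts"
   "!!k. Suc k < length ts ==> smooth_piece r (ts ! k) (ts ! Suc k) \<gamma> (I k)" "s = (\<Sum>k<length ts-1. I k)"
   using s(1) unfolding path_lengths_def by blast
  have ne: "ts ~= []" using g(5) by auto
  have I0: "I k >= 0" if "Suc k < length ts" for k using smooth_pieceE[OF g(9)[OF that]] by blast
  have lt: "ts ! i < ts ! j" if "i < j" "j < length ts" for i j using sorted_wrt_nth_less[OF g(8) that] .
  have ts0: "ts ! 0 = 0" using g(6) hd_conv_nth[OF ne] by simp
  have ts1: "ts ! (length ts-1) = 1" using g(7) last_conv_nth[OF ne] by simp
  have ge0: "0 <= ts ! k" if "k < length ts" for k using lt[of 0 k] ts0 that by (cases "k = 0") auto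
  have le1: "ts ! k <= 1" if "k < length ts" for k
  proof (cases "k = length ts-1")
   case False
   then have "k < length ts-1" "length ts-1 < length ts" using that by linarith+
   from lt[OF this] ts1 show ?thesis by simp
  qed (use ts1 in simp)
  have "C * s <= C*\<epsilon>" using s(2) C0 by (intro mult_left_mono) auto
  then have Cs: "C * s < \<delta>" using e(2) by linarith
  define n where "n = real (length ts)+1"
  \<comment> \<open>The slack left by the length of the path is shared among the starting point and
    the pieces, fewer than \<open>n\<close> portions in all; the factor 2 keeps their total strictly
    below the slack.\<close>
  define \<eta> where "\<eta> = (\<delta>-C * s)/(2 * n)"
  have n0: "n > 0" by (simp add: n_def)
  have eta: "\<eta> > 0" "n*\<eta> < \<delta>-C * s" using Cs n0 by (auto simp: \<eta>_def field_simps)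
  have sum_le: "C*(\<Sum>j<k. I j) <= C * s" if "k < length ts" for k
   unfolding g(10) using that I0 C0 by (intro mult_left_mono sum_mono2) auto
  have tot: "C*(\<Sum>j<k. I j)+real (k+1)*\<eta> < \<delta>" if "k < length ts" for k
  proof -
   have "real (k+1)*\<eta> <= n*\<eta>" using that eta(1) by (intro mult_right_mono) (auto simp: n_def)
   then show ?thesis using sum_le[OF that] eta(2) by linarith
  qed
  have ind: "k < length ts ==> \<gamma> (ts ! k):star_nbhd r G0 M0 l0 (C*(\<Sum>j<k. I j)+real (k+1)*\<eta>)" for k
  proof (induction k)
   case 0
   then show ?case using star_nbhd_self[OF v0(1) eta(1)] ts0 g(1) v0(2) by simp
  next
   case (Suc k)
   let ?\<rho> = "C*(\<Sum>j<k. I j)+real (k+1)*\<eta>"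
   have k: "Suc k < length ts" "k < length ts" using Suc.prems by auto
   have eq: "?\<rho>+C * I k+\<eta> = C*(\<Sum>j<Suc k. I j)+real (Suc k+1)*\<eta>" by (simp add: algebra_simps)
   have "\<gamma> (ts ! Suc k):star_nbhd r G0 M0 l0 (?\<rho>+C * I k+\<eta>)"
    unfolding C_def
   proof (rule piece_step[OF v0(1) m d(1,3) g(4) ge0[OF k(2)] lt[of k "Suc k"] le1[OF k(1)] g(9)[OF k(1)]])
    show "k < Suc k" "Suc k < length ts" using k by auto
    show "\<gamma> (ts ! Suc k):outer_space1 r" using g(3) ge0[OF k(1)] le1[OF k(1)] by simp
    show "\<gamma> (ts ! k):star_nbhd r G0 M0 l0 (\<bar>lower_const (3 * card (gE G0)) m\<bar>*(\<Sum>j<k. I j)+real (k+1)*\<eta>)"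
     using Suc.IH[OF k(2)] unfolding C_def .
    show "\<eta> > 0" by (rule eta(1))
    show "\<bar>lower_const (3 * card (gE G0)) m\<bar>*(\<Sum>j<k. I j)+real (k+1)*\<eta>+\<bar>lower_const (3 * card (gE G0)) m\<bar> * I k+\<eta> < \<delta>"
     using tot[OF k(1)] eq unfolding C_def by simp
   qed
   then show ?case unfolding eq .
  qed
  have last: "length ts-1 < length ts" using ne by simp
  have "y:star_nbhd r G0 M0 l0 (C*(\<Sum>j<length ts-1. I j)+real (length ts-1+1)*\<eta>)"
   using ind[OF last] ts1 g(2) by simp
  moreover have "star_nbhd r G0 M0 l0 \<alpha> <= star_nbhd r G0 M0 l0 \<beta>" if "\<alpha> <= \<beta>" for \<alpha> \<beta>
   using that unfolding star_nbhd_def by (force intro: less_le_trans)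
  ultimately have "y:star_nbhd r G0 M0 l0 \<delta>0" using tot[OF last] d(2) by (meson less_imp_le order_trans subsetD)
  then show ?thesis using d0(2) by blast
 qed
 then show ?thesis using e(1) by blast
qed

section \<open>Labelled graphs\<close>

declare rose_sel [simp del]

text \<open>A labelling records a homotopy inverse of the marking: the edge labels are words in the free
 group, and every petal of the rose returns to itself up to conjugation by one fixed word.\<close>

definition labelling :: "nat => sgraph => (nat => nat list) => bool" where
 "labelling r G \<mu> \<longleftrightarrow> (ALL e:gE G. set (\<mu> e) <= gE (rose r) & reduced (rose r) (\<mu> e) & \<mu> (gbar G e) = rev_path (rose r) (\<mu> e))"

definition inverts :: "nat => sgraph => nat list list => (nat => nat list) => nat list => bool" where
 "inverts r G ws \<mu> g \<longleftrightarrow> set g <= gE (rose r) &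
   (ALL x:gE (rose r). red (rose r) (subst \<mu> (petal G ws x)) = red (rose r) (rev_path (rose r) g@[x]@g))"

lemma labellingD:
 assumes "labelling r G \<mu>" "e:gE G"
 shows "set (\<mu> e) <= gE (rose r)" "reduced (rose r) (\<mu> e)" "\<mu> (gbar G e) = rev_path (rose r) (\<mu> e)"
 using assms unfolding labelling_def by blast+

lemma labelling_hom: "labelling r G \<mu> ==> hom_map G (rose r) \<mu>"
 unfolding labelling_def hom_map_def by simp

lemma labelling_set: "labelling r G \<mu> ==> set p <= gE G ==> set (subst \<mu> p) <= gE (rose r)"
 by (rule set_subst[OF labelling_hom])

lemma red_conj:
 assumes "serre_graph R" "set g <= gE R" "set p <= gE R"
 shows "red R (rev_path R g@p@g@rev_path R g@q) = red R (rev_path R g@p@q)"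
proof -
 have "red R ((rev_path R g@p)@red R (g@rev_path R g@q)) = red R ((rev_path R g@p)@red R q)"
  by (simp only: red_rev_path_right[OF assms(1,2)])
 then show ?thesis unfolding red_append_right by simp
qed

lemma red_conj_inverse:
 assumes "serre_graph R" "set g <= gE R" "set p <= gE R"
 shows "red R (g@rev_path R g@p@g@rev_path R g) = red R p"
proof -
 have "red R (p@red R (g@rev_path R g)) = red R p" using red_rev_path_Nil(1)[OF assms(1,2)] by simp
 then show ?thesis unfolding red_append_right red_rev_path_right[OF assms(1,2)] by simp
qed

locale marked =
 fixes r :: nat and G :: sgraph and v :: nat and ws :: "nat list list"
 assumes sG: "serre_graph G" and va: "valid_marking r G (v,ws)"
begin

lemma R: "serre_graph (rose r)" by (rule rose_serre)

lemma petal_w: "set q <= gE (rose r) ==> walk G (gE G) (subst (petal G ws) q) v v"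
 by (rule set_petal_subst[OF sG va])

lemma petal_set: "set q <= gE (rose r) ==> set (subst (petal G ws) q) <= gE G"
 using walk_E[OF sG petal_w] .

lemma hom_petal: "hom_map (rose r) G (petal G ws)"
 by (rule petal_hom[OF sG valid_markingD(3)[OF va]])

lemma msurj:
 assumes "walk G (gE G) c v v"
 shows "EX q. set q <= gE (rose r) & reduced (rose r) q & red G (subst (petal G ws) q) = red G c"
proof -
 have "walk G (gE G) (red G c) v v & reduced G (red G c)" using walk_red[OF sG order_refl assms] by simp
 then obtain q where q: "set q <= gE (rose r)" "red G (subst (petal G ws) q) = red G c"
  using va unfolding valid_marking_iff by blast
 then show ?thesis using red_subst_red[OF R sG hom_petal q(1)] set_red[of "rose r" q]
  by (intro exI[of _ "red (rose r) q"]) auto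
qed

lemma minj:
 assumes q: "set q <= gE (rose r)" "set q' <= gE (rose r)" and e: "red G (subst (petal G ws) q) = red G (subst (petal G ws) q')"
 shows "red (rose r) q = red (rose r) q'"
proof -
 let ?p = "petal G ws"
 let ?z = "q@rev_path (rose r) q'"
 have z: "set ?z <= gE (rose r)" using q set_rev_path[OF R q(2)] by simp
 note S = petal_set[OF q(1)] petal_set[OF q(2)]
 have "red G (subst ?p ?z) = red G (subst ?p q@red G (subst ?p (rev_path (rose r) q')))"
  by (simp add: red_append_right)
 also have "... = red G (subst ?p q@rev_path G (subst ?p q'))"
  unfolding red_subst_rev_path[OF R sG hom_petal q(2)] by (rule red_append_right)
 also have "... = []" using e red_eq_iff[OF sG S] by simp
 finally have "red G (subst ?p (red (rose r) ?z)) = []" using red_subst_red[OF R sG hom_petal z] by simp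
 moreover have "set (red (rose r) ?z) <= gE (rose r)" using set_red[of "rose r" ?z] z by (rule order_trans)
 ultimately have "red (rose r) ?z = []" using va unfolding valid_marking_iff by (meson red_reduced)
 then show ?thesis using red_eq_iff[OF R q] by simp
qed

lemma labelling_petal:
 assumes l: "labelling r G \<mu>" and i: "inverts r G ws \<mu> g" and q: "set q <= gE (rose r)"
 shows "red (rose r) (subst \<mu> (subst (petal G ws) q)) = red (rose r) (rev_path (rose r) g@q@g)"
 using q
proof (induction q)
 case Nil
 show ?case using i red_rev_path_Nil(2)[OF R] by (simp add: inverts_def)
next
 case (Cons x q)
 have g: "set g <= gE (rose r)" using i by (simp add: inverts_def)
 have x: "x:gE (rose r)" "set q <= gE (rose r)" using Cons.prems by auto
 have "set (petal G ws x) <= gE G" using petal_set[of "[x]"] x by simp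
 then have 1: "set (subst \<mu> (petal G ws x)) <= gE (rose r)" by (rule labelling_set[OF l])
 have 2: "set (rev_path (rose r) g@[x]@g) <= gE (rose r)" using g x set_rev_path[OF R g] by simp
 have 3: "red (rose r) (subst \<mu> (petal G ws x)) = red (rose r) (rev_path (rose r) g@[x]@g)"
  using i x(1) by (simp add: inverts_def)
 have "red (rose r) (subst \<mu> (subst (petal G ws) (x#q))) =
   red (rose r) ((rev_path (rose r) g@[x]@g)@rev_path (rose r) g@q@g)"
  unfolding subst_simps by (rule red_append_cong[OF R 1 2 3 Cons.IH[OF x(2)]])
 also have "... = red (rose r) (rev_path (rose r) g@[x]@q@g)"
  using red_conj[OF R g, of "[x]" "q@g"] x(1) by simp
 finally show ?case by simp
qed

lemma labelling_surj:
 assumes l: "labelling r G \<mu>" and i: "inverts r G ws \<mu> g" and y: "set y <= gE (rose r)"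
 shows "EX p. walk G (gE G) p v v & reduced G p & red (rose r) (subst \<mu> p) = red (rose r) y"
proof -
 have g: "set g <= gE (rose r)" using i by (simp add: inverts_def)
 let ?q = "g@y@rev_path (rose r) g"
 have q: "set ?q <= gE (rose r)" using g y set_rev_path[OF R g] by simp
 let ?p = "red G (subst (petal G ws) ?q)"
 have "red (rose r) (subst \<mu> ?p) = red (rose r) (subst \<mu> (subst (petal G ws) ?q))"
  by (rule red_subst_red[OF sG R labelling_hom[OF l] petal_set[OF q]])
 also have "... = red (rose r) (rev_path (rose r) g@?q@g)" by (rule labelling_petal[OF l i q])
 also have "... = red (rose r) (y@rev_path (rose r) g@g)"
  using red_rev_path_left[OF R g, of "y@rev_path (rose r) g@g"] by simp
 also have "... = red (rose r) (y@red (rose r) (rev_path (rose r) g@g))" by (simp only: red_append_right)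
 finally have "red (rose r) (subst \<mu> ?p) = red (rose r) y" using red_rev_path_Nil(2)[OF R g] by simp
 then show ?thesis using walk_red[OF sG order_refl petal_w[OF q]] by (intro exI[of _ ?p]) simp
qed

text \<open>The labels along a loop spell its class in the free group up to conjugation by
  \<open>g\<close>. With \<open>labelling_surj\<close> they therefore detect the fundamental group
  exactly.\<close>

lemma labelling_inj:
 assumes l: "labelling r G \<mu>" and i: "inverts r G ws \<mu> g" and p: "walk G (gE G) p v v" "red (rose r) (subst \<mu> p) = []"
 shows "red G p = []"
proof -
 have g: "set g <= gE (rose r)" using i by (simp add: inverts_def)
 obtain q where q: "set q <= gE (rose r)" "reduced (rose r) q" "red G (subst (petal G ws) q) = red G p"
  using msurj[OF p(1)] by blast
 have "red (rose r) (rev_path (rose r) g@q@g) = red (rose r) (subst \<mu> (subst (petal G ws) q))"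
  using labelling_petal[OF l i q(1)] by simp
 also have "... = red (rose r) (subst \<mu> p)"
  by (rule red_subst_cong[OF sG R labelling_hom[OF l] petal_set[OF q(1)] walk_E[OF sG p(1)] q(3)])
 finally have 0: "red (rose r) (rev_path (rose r) g@q@g) = []" using p(2) by simp
 have s: "set (rev_path (rose r) g@q@g) <= gE (rose r)" using g q(1) set_rev_path[OF R g] by simp
 have "red (rose r) q = red (rose r) (g@(rev_path (rose r) g@q@g)@rev_path (rose r) g)"
  using red_conj_inverse[OF R g q(1)] by simp
 also have "... = red (rose r) (g@red (rose r) ((rev_path (rose r) g@q@g)@rev_path (rose r) g))"
  by (simp only: red_append_right)
 also have "... = red (rose r) (g@red (rose r) (red (rose r) (rev_path (rose r) g@q@g)@rev_path (rose r) g))"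
  by (simp only: red_append_left[OF R s])
 also have "... = []" unfolding 0 red_append_right append_Nil by (rule red_rev_path_Nil(1)[OF R g])
 finally have "q = []" using red_id[OF q(2)] by simp
 then show ?thesis using q(3) by simp
qed

text \<open>Join the base point to each vertex by a path \<open>P\<close>. The label of
  \<open>e\<close> is the word of the loop that goes out along \<open>P\<close>, crosses
  \<open>e\<close> and returns. Choosing \<open>P v\<close> empty makes the conjugating word
  empty.\<close>

lemma labelling_ex:
 assumes con: "connected_graph G"
 shows "EX \<mu>. labelling r G \<mu> & inverts r G ws \<mu> []"
proof -
 have v: "v:gV G" by (rule valid_markingD(1)[OF va])
 define P where "P w = (if w = v then [] else SOME p. walk G (gE G) p v w)" for w
 have P: "walk G (gE G) (P w) v w" if "w:gV G" for w
  using con v that someI_ex[of "%p. walk G (gE G) p v w"] unfolding connected_graph_def P_def by auto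
 have PE: "set (P w) <= gE G" if "w:gV G" for w by (rule walk_E[OF sG P[OF that]])
 define c where "c e = P (gorg G e)@[e]@rev_path G (P (tm G e))" for e
 have c: "walk G (gE G) (c e) v v" if e: "e:gE G" for e
 proof -
  note s = serreD[OF sG e]
  have "walk G (gE G) [e] (gorg G e) (tm G e)" using e s by simp
  then show ?thesis unfolding c_def using P[OF s(1)] walk_rev_E[OF sG P[OF s(5)]] walk_append[OF sG order_refl] by blast
 qed
 have "ALL e:gE G. EX q. set q <= gE (rose r) & reduced (rose r) q & red G (subst (petal G ws) q) = red G (c e)"
  using msurj[OF c] by blast
 from bchoice[OF this] obtain \<mu> where L: "!!e. e:gE G ==> set (\<mu> e) <= gE (rose r)" "!!e. e:gE G ==> reduced (rose r) (\<mu> e)"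
  "!!e. e:gE G ==> red G (subst (petal G ws) (\<mu> e)) = red G (c e)" by blast
 have lab: "labelling r G \<mu>" unfolding labelling_def
 proof (intro ballI conjI)
  fix e assume e: "e:gE G"
  note s = serreD[OF sG e]
  show "set (\<mu> e) <= gE (rose r)" "reduced (rose r) (\<mu> e)" using L e by auto
  have cE: "set (c e) <= gE G" by (rule walk_E[OF sG c[OF e]])
  have rc: "rev_path G (c e) = c (gbar G e)"
   using s rev_path_rev_path[OF sG PE[OF s(5)]] by (simp add: c_def)
  have "red G (subst (petal G ws) (rev_path (rose r) (\<mu> e))) = red G (rev_path G (subst (petal G ws) (\<mu> e)))"
   by (rule red_subst_rev_path[OF R sG hom_petal L(1)[OF e]])
  also have "... = rev_path G (red G (c e))" unfolding red_rev_path[OF sG petal_set[OF L(1)[OF e]]] L(3)[OF e] ..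
  also have "... = red G (c (gbar G e))" unfolding red_rev_path[OF sG cE, symmetric] rc ..
  also have "... = red G (subst (petal G ws) (\<mu> (gbar G e)))" using L(3)[OF s(2)] by simp
  finally have "red (rose r) (rev_path (rose r) (\<mu> e)) = red (rose r) (\<mu> (gbar G e))"
   by (rule minj[OF set_rev_path[OF R L(1)[OF e]] L(1)[OF s(2)]])
  then show "\<mu> (gbar G e) = rev_path (rose r) (\<mu> e)"
   using red_id[OF L(2)[OF s(2)]] red_id[OF reduced_rev_path[OF R L(1)[OF e] L(2)[OF e]]] by simp
 qed
 have key: "walk G (gE G) p a b ==> red G (subst (petal G ws) (subst \<mu> p)) = red G (P a@p@rev_path G (P b))" for p a b
 proof (induction p arbitrary: a)
  case Nil
  then show ?case using red_rev_path_Nil(1)[OF sG PE, of b] by auto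
 next
  case (Cons e p)
  then have e: "e:gE G" "gorg G e = a" "walk G (gE G) p (tm G e) b" by auto
  note s = serreD[OF sG e(1)]
  have IH: "red G (subst (petal G ws) (subst \<mu> p)) = red G (P (tm G e)@p@rev_path G (P b))" by (rule Cons.IH[OF e(3)])
  have "red G (subst (petal G ws) (subst \<mu> (e#p))) = red G (c e@P (tm G e)@p@rev_path G (P b))"
   unfolding subst_simps
   by (rule red_append_cong[OF sG petal_set[OF L(1)[OF e(1)]] walk_E[OF sG c[OF e(1)]] L(3)[OF e(1)] IH])
  also have "... = red G ((P a@[e])@red G (rev_path G (P (tm G e))@P (tm G e)@p@rev_path G (P b)))"
   unfolding red_append_right by (simp add: c_def e(2))
  also have "... = red G (P a@(e#p)@rev_path G (P b))"
   unfolding red_rev_path_left[OF sG PE[OF s(5)]] red_append_right by simp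
  finally show ?case .
 qed
 have "red (rose r) (subst \<mu> (petal G ws x)) = red (rose r) [x]" if x: "x:gE (rose r)" for x
 proof (rule minj)
  have w: "walk G (gE G) (petal G ws x) v v" using petal_w[of "[x]"] x by simp
  show "set (subst \<mu> (petal G ws x)) <= gE (rose r)"
   by (rule labelling_set[OF lab walk_E[OF sG w]])
  show "set [x] <= gE (rose r)" using x by simp
  show "red G (subst (petal G ws) (subst \<mu> (petal G ws x))) = red G (subst (petal G ws) [x])"
   using key[OF w] by (simp add: P_def)
 qed
 then have "inverts r G ws \<mu> []" by (simp add: inverts_def)
 then show ?thesis using lab by blast
qed

text \<open>A loop edge with empty label would be trivial in the fundamental group, but a single
  edge is a reduced path. Hence edges with empty label have distinct ends and can be
  collapsed.\<close>

lemma loop_label_nonempty: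
 assumes con: "connected_graph G" and l: "labelling r G \<mu>" and i: "inverts r G ws \<mu> g"
  and e: "e:gE G" "\<mu> e = []"
 shows "gorg G e ~= tm G e"
proof
 assume eq: "gorg G e = tm G e"
 note s = serreD[OF sG e(1)]
 obtain x where x: "walk G (gE G) x v (gorg G e)" using con valid_markingD(1)[OF va] s(1) unfolding connected_graph_def by blast
 have xE: "set x <= gE G" by (rule walk_E[OF sG x])
 let ?p = "x@[e]@rev_path G x"
 have "walk G (gE G) [e] (gorg G e) (gorg G e)" using e s eq by simp
 then have w: "walk G (gE G) ?p v v" using x walk_rev_E[OF sG x] walk_append[OF sG order_refl] by blast
 have "red (rose r) (subst \<mu> ?p) = red (rose r) (subst \<mu> x@red (rose r) (subst \<mu> (rev_path G x)))"
  using e(2) by (simp add: red_append_right)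
 also have "... = []" unfolding red_subst_rev_path[OF sG R labelling_hom[OF l] xE] red_append_right
  by (rule red_rev_path_Nil(1)[OF R labelling_set[OF l xE]])
 finally have 0: "red G ?p = []" by (rule labelling_inj[OF l i w])
 have pE: "set ?p <= gE G" by (rule walk_E[OF sG w])
 have "red G [e] = red G ((rev_path G x@x)@[e]@rev_path G x@x)"
 proof -
  have "red G ([e]@red G (rev_path G x@x)) = red G [e]" using red_rev_path_Nil(2)[OF sG xE] by simp
  then show ?thesis unfolding red_append_right using red_rev_path_left[OF sG xE, of "[e]@rev_path G x@x"] by simp
 qed
 also have "... = red G (rev_path G x@red G (?p@x))" unfolding red_append_right by simp
 also have "... = red G (rev_path G x@red G (red G ?p@x))" unfolding red_append_left[OF sG pE] ..
 also have "... = []" unfolding 0 append_Nil red_append_right by (rule red_rev_path_Nil(2)[OF sG xE])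
 finally show False by (simp add: red_id)
qed

end

text \<open>Labels describe an equivariant map from the universal cover to the Cayley tree of the
  free group. The operation moves the images of the lifts of \<open>u\<close> across the edge
  \<open>a\<close>: labels leaving \<open>u\<close> are multiplied on the left by the inverse of
  \<open>a\<close>, labels arriving at \<open>u\<close> on the right by \<open>a\<close>.\<close>

definition gauge :: "nat => sgraph => nat => nat => (nat => nat list) => nat => nat list" where
 "gauge r G u a \<mu> d = red (rose r) (rev_path (rose r) (if gorg G d = u then [a] else [])@\<mu> d@(if tm G d = u then [a] else []))"

lemma gauge_labelling:
 assumes sG: "serre_graph G" and l: "labelling r G \<mu>" and a: "a:gE (rose r)"
 shows "labelling r G (gauge r G u a \<mu>)"
 unfolding labelling_def
proof (intro ballI conjI)
 define A where "A w = (if w = u then [a] else [])" for w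
 note R = rose_serre[of r]
 have A: "set (A w) <= gE (rose r)" for w using a by (auto simp: A_def)
 note A' = set_rev_path[OF R A]
 fix e assume e: "e:gE G"
 note s = serreD[OF sG e] and L = labellingD[OF l e]
 have g: "gauge r G u a \<mu> d = red (rose r) (rev_path (rose r) (A (gorg G d))@\<mu> d@A (tm G d))" for d
  by (simp add: gauge_def A_def)
 have X: "set (rev_path (rose r) (A (gorg G e))@\<mu> e@A (tm G e)) <= gE (rose r)" using A A' L(1) by simp
 show "set (gauge r G u a \<mu> e) <= gE (rose r)" unfolding g using set_red X by (rule order_trans)
 show "reduced (rose r) (gauge r G u a \<mu> e)" unfolding g by simp
 have "rev_path (rose r) (gauge r G u a \<mu> e) = red (rose r) (rev_path (rose r) (rev_path (rose r) (A (gorg G e))@\<mu> e@A (tm G e)))"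
  unfolding g using red_rev_path[OF R X] by simp
 also have "... = gauge r G u a \<mu> (gbar G e)"
  unfolding g s(6,7) L(3) by (simp add: rev_path_rev_path[OF R A])
 finally show "gauge r G u a \<mu> (gbar G e) = rev_path (rose r) (gauge r G u a \<mu> e)" ..
qed

lemma gauge_walk:
 assumes sG: "serre_graph G" and l: "labelling r G \<mu>" and a: "a:gE (rose r)" and p: "walk G (gE G) p x y"
 shows "red (rose r) (subst (gauge r G u a \<mu>) p) =
  red (rose r) (rev_path (rose r) (if x = u then [a] else [])@subst \<mu> p@(if y = u then [a] else []))"
proof -
 define A where "A w = (if w = u then [a] else [])" for w
 note R = rose_serre[of r]
 have A: "set (A w) <= gE (rose r)" for w using a by (auto simp: A_def)
 note A' = set_rev_path[OF R A]
 have g: "gauge r G u a \<mu> d = red (rose r) (rev_path (rose r) (A (gorg G d))@\<mu> d@A (tm G d))" for d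
  by (simp add: gauge_def A_def)
 have "red (rose r) (subst (gauge r G u a \<mu>) p) = red (rose r) (rev_path (rose r) (A x)@subst \<mu> p@A y)"
  using p
 proof (induction p arbitrary: x)
  case Nil
  then show ?case using red_rev_path_Nil(2)[OF R A] by simp
 next
  case (Cons e p)
  then have e: "e:gE G" "gorg G e = x" "walk G (gE G) p (tm G e) y" by auto
  let ?t = "tm G e"
  have X: "set (rev_path (rose r) (A x)@\<mu> e@A ?t) <= gE (rose r)" using A A' labellingD(1)[OF l e(1)] by simp
  have "red (rose r) (subst (gauge r G u a \<mu>) (e#p)) =
    red (rose r) ((rev_path (rose r) (A x)@\<mu> e@A ?t)@red (rose r) (subst (gauge r G u a \<mu>) p))"
   unfolding red_append_right subst_simps g e(2) by (rule red_append_left[OF R X])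
  also have "... = red (rose r) ((rev_path (rose r) (A x)@\<mu> e)@red (rose r) (A ?t@rev_path (rose r) (A ?t)@subst \<mu> p@A y))"
   unfolding Cons.IH[OF e(3)] red_append_right by simp
  also have "... = red (rose r) (rev_path (rose r) (A x)@subst \<mu> (e#p)@A y)"
   unfolding red_rev_path_right[OF R A] red_append_right by simp
  finally show ?case .
 qed
 then show ?thesis by (simp add: A_def)
qed

lemma (in marked) gauge_inverts:
 assumes l: "labelling r G \<mu>" and a: "a:gE (rose r)" and i: "inverts r G ws \<mu> g"
 shows "EX g. inverts r G ws (gauge r G u a \<mu>) g"
proof -
 define A where "A = (if v = u then [a] else [])"
 have g: "set g <= gE (rose r)" using i by (simp add: inverts_def)
 have A: "set A <= gE (rose r)" using a by (auto simp: A_def)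
 have "red (rose r) (subst (gauge r G u a \<mu>) (petal G ws x)) =
   red (rose r) (rev_path (rose r) (g@A)@[x]@(g@A))" if x: "x:gE (rose r)" for x
 proof -
  have w: "walk G (gE G) (petal G ws x) v v" using petal_w[of "[x]"] x by simp
  have S: "set (subst \<mu> (petal G ws x)) <= gE (rose r)"
   by (rule labelling_set[OF l walk_E[OF sG w]])
  have T: "set (rev_path (rose r) g@[x]@g) <= gE (rose r)" using g x set_rev_path[OF R g] by simp
  have E: "red (rose r) (subst \<mu> (petal G ws x)) = red (rose r) (rev_path (rose r) g@[x]@g)" using i x by (simp add: inverts_def)
  have "red (rose r) (subst (gauge r G u a \<mu>) (petal G ws x)) = red (rose r) (rev_path (rose r) A@red (rose r) (subst \<mu> (petal G ws x)@A))"
   unfolding A_def red_append_right by (rule gauge_walk[OF sG l a w])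
  also have "red (rose r) (subst \<mu> (petal G ws x)@A) = red (rose r) ((rev_path (rose r) g@[x]@g)@A)"
   by (rule red_append_cong[OF R S T E refl])
  finally show ?thesis unfolding red_append_right by simp
 qed
 moreover have "set (g@A) <= gE (rose r)" using g A by simp
 ultimately show ?thesis unfolding inverts_def by blast
qed

text \<open>\<open>c d\<close> accounts for the end of \<open>d\<close> at its origin: -1 if a
  leading letter \<open>a\<close> cancels, 1 if a letter is added, 0 away from \<open>u\<close>. The
  reversed edge accounts for the other end, and further reduction only shortens.\<close>

lemma gauge_length:
 fixes c :: "nat => int"
 assumes sG: "serre_graph G" and l: "labelling r G \<mu>" and a: "a:gE (rose r)" and d: "d:gE G"
  and c: "!!d. c d = (if gorg G d = u then if \<mu> d ~= [] & hd (\<mu> d) = a then-1 else 1 else 0)"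
 shows "int (length (gauge r G u a \<mu> d)) <= int (length (\<mu> d))+c d+c (gbar G d)"
proof -
 note R = rose_serre[of r]
 note s = serreD[OF sG d] and L = labellingD[OF l d] and ra = serreD[OF R a]
 define b where "b = gbar (rose r) a"
 have front: "red (rose r) (b#a#z) = red (rose r) z" for z
  using red_rev_path_left[OF R, of "[a]" z] a by (simp add: b_def)
 have rear: "red (rose r) (z@[b,a]) = red (rose r) z" for z
 proof -
  have "red (rose r) (z@red (rose r) [b,a]) = red (rose r) (z@red (rose r) [])" by (simp only: front[of "[]"])
  then show ?thesis unfolding red_append_right by simp
 qed
 have hl: "\<mu> (gbar G d) ~= [] & hd (\<mu> (gbar G d)) = a \<longleftrightarrow> \<mu> d ~= [] & last (\<mu> d) = b"
 proof (cases "\<mu> d = []")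
  case False
  then have "last (\<mu> d):gE (rose r)" using L(1) last_in_set by blast
  then have "gbar (rose r) (last (\<mu> d)) = a \<longleftrightarrow> last (\<mu> d) = b" using gbar_eq_iff(2)[OF R _ a] by (simp add: b_def)
  then show ?thesis using False unfolding L(3) by (simp add: rev_path_def hd_rev last_map)
 qed (simp add: L(3))
 let ?w = "\<mu> d"
 define X where "X = (if gorg G d = u then [b] else [])@?w@(if tm G d = u then [a] else [])"
 have g: "gauge r G u a \<mu> d = red (rose r) X" by (simp add: gauge_def X_def b_def)
 have "EX Y. red (rose r) X = red (rose r) Y & int (length Y) <= int (length ?w)+c d+c (gbar G d)"
 proof (cases "gorg G d = u & ?w ~= [] & hd ?w = a")
  case True
  then obtain t where t: "?w = a#t" by (metis list.collapse)
  have c1: "c d = - 1" using True by (simp add: c)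
  show ?thesis
  proof (cases "tm G d = u & last ?w = b")
   case e: True
   \<comment> \<open>The one-letter word \<open>a\<close> cannot end in the inverse of
     \<open>a\<close>, so the two cancellations affect different letters.\<close>
   have "t ~= []" using e t ra(3) by (auto simp: b_def)
   then obtain z where z: "t = z@[b]" using e t by (metis append_butlast_last_id last_ConsR)
   have "X = b#a#z@[b,a]" using True e by (simp add: X_def t z)
   then have "red (rose r) X = red (rose r) z" by (simp only: front rear)
   moreover have "c (gbar G d) = - 1" using hl e t s by (simp add: c)
   ultimately show ?thesis using c1 by (intro exI[of _ z]) (simp add: t z)
  next
   case e: False
   let ?A = "if tm G d = u then [a] else []"
   have "X = b#a#t@?A" using True by (simp add: X_def t)
   then have "red (rose r) X = red (rose r) (t@?A)" by (simp only: front)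
   moreover have "c (gbar G d) = int (length ?A)" using e hl t s by (simp add: c)
   ultimately show ?thesis using c1 by (intro exI[of _ "t@?A"]) (simp add: t)
  qed
 next
  case n: False
  let ?B = "if gorg G d = u then [b] else []"
  have c1: "c d = int (length ?B)" using n by (auto simp: c)
  show ?thesis
  proof (cases "tm G d = u & ?w ~= [] & last ?w = b")
   case e: True
   then obtain z where z: "?w = z@[b]" by (metis append_butlast_last_id)
   have "X = (?B@z)@[b,a]" using e by (simp add: X_def z)
   then have "red (rose r) X = red (rose r) (?B@z)" by (simp only: rear)
   moreover have "c (gbar G d) = - 1" using hl e s by (simp add: c)
   ultimately show ?thesis using c1 by (intro exI[of _ "?B@z"]) (simp add: z)
  next
   case e: False
   have "c (gbar G d) = int (length (if tm G d = u then [a] else []))" using e hl s by (auto simp: c)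
   then show ?thesis using c1 by (intro exI[of _ X]) (simp add: X_def)
  qed
 qed
 then obtain Y where Y: "red (rose r) X = red (rose r) Y" "int (length Y) <= int (length ?w)+c d+c (gbar G d)" by blast
 have "length (gauge r G u a \<mu> d) <= length Y" unfolding g Y(1) by (rule length_red)
 then show ?thesis using Y(2) by linarith
qed

text \<open>When more than half of the directions at \<open>u\<close> have labels beginning with
  \<open>a\<close>, the sum of \<open>c\<close> is negative; the total change is at most twice that
  sum, because every edge counts with both orientations.\<close>

lemma gauge_size:
 assumes sG: "serre_graph G" and l: "labelling r G \<mu>" and a: "a:gE (rose r)"
  and S: "S = {d:gE G. gorg G d = u & \<mu> d ~= [] & hd (\<mu> d) = a}"
  and T: "card ({d:gE G. gorg G d = u}-S) < card S"
 shows "(\<Sum>d\<in>gE G. length (gauge r G u a \<mu> d)) < (\<Sum>d\<in>gE G. length (\<mu> d))"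
proof -
 define c :: "nat => int" where "c d = (if gorg G d = u then if \<mu> d ~= [] & hd (\<mu> d) = a then-1 else 1 else 0)" for d
 let ?D = "{d:gE G. gorg G d = u}"
 have fE: "finite (gE G)" by (rule serre_fin(2)[OF sG])
 have fD: "finite ?D" using fE by simp
 have bij: "bij_betw (gbar G) (gE G) (gE G)"
  by (rule bij_betwI[of _ _ _ "gbar G"]) (auto simp: serreD[OF sG])
 have cb: "(\<Sum>d\<in>gE G. c (gbar G d)) = (\<Sum>d\<in>gE G. c d)" by (rule sum.reindex_bij_betw[OF bij])
 have "(\<Sum>d\<in>gE G. c d) = (\<Sum>d\<in>?D. c d)" by (rule sum.mono_neutral_right) (auto simp: fE c_def)
 also have "... = (\<Sum>d\<in>?D-S. c d)+(\<Sum>d\<in>S. c d)"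
  by (rule sum.subset_diff[OF _ fD]) (use S in blast)
 also have "(\<Sum>d\<in>?D-S. c d) = (\<Sum>d\<in>?D-S. 1)" by (rule sum.cong) (auto simp: S c_def)
 also have "(\<Sum>d\<in>S. c d) = (\<Sum>d\<in>S. - 1)" by (rule sum.cong) (auto simp: S c_def)
 finally have neg: "(\<Sum>d\<in>gE G. c d) < 0" using T by simp
 have "(\<Sum>d\<in>gE G. int (length (gauge r G u a \<mu> d))) <= (\<Sum>d\<in>gE G. int (length (\<mu> d))+c d+c (gbar G d))"
  by (rule sum_mono) (rule gauge_length[OF sG l a _ c_def])
 also have "... = (\<Sum>d\<in>gE G. int (length (\<mu> d)))+2*(\<Sum>d\<in>gE G. c d)"
  by (simp add: sum.distrib cb)
 also have "... < (\<Sum>d\<in>gE G. int (length (\<mu> d)))" using neg by simp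
 finally show ?thesis by (simp flip: of_nat_sum)
qed

text \<open>Shared by the collapse of an edge with empty label, where \<open>S\<close> is built from
  \<open>B\<close>, and by the blow-up, where \<open>B\<close> is built from
  \<open>S\<close>.\<close>

lemma single_collapse:
 assumes sB: "serre_graph B" and sS: "serre_graph S" and e: "\<epsilon>:gE B" and ne: "gorg B \<epsilon> ~= tm B \<epsilon>"
  and E: "gE S = gE B-{\<epsilon>,gbar B \<epsilon>}" and bar: "!!e. e:gE S ==> gbar S e = gbar B e"
  and V: "gV S = gV B-{gorg B \<epsilon>}"
  and org: "!!e. e:gE S ==> gorg S e = (if gorg B e = gorg B \<epsilon> then tm B \<epsilon> else gorg B e)"
 shows "coll B S (%x. if x = gorg B \<epsilon> then tm B \<epsilon> else x) (%e. if e:{\<epsilon>,gbar B \<epsilon>} then None else Some e)"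
  (is "coll B S ?V ?E")
proof -
 note s = serreD[OF sB e]
 have im: "?V ` gV B = gV S"
 proof
  show "?V ` gV B <= gV S" using s ne V by auto
  show "gV S <= ?V ` gV B" using V by auto
 qed
 have pair: "gbar B x:{\<epsilon>,gbar B \<epsilon>} \<longleftrightarrow> x:{\<epsilon>,gbar B \<epsilon>}" if "x:gE B" for x
  using gbar_eq_iff[OF sB that e] serreD(4)[OF sB that] s(4) by auto
 have ed: "case ?E x of
     Some f => f:gE S & gorg S f = ?V (gorg B x) & ?E (gbar B x) = Some (gbar S f)
    | None => ?V (gorg B x) = ?V (tm B x) & ?E (gbar B x) = None" if x: "x:gE B" for x
 proof (cases "x:{\<epsilon>,gbar B \<epsilon>}")
  case True
  then have "?V (gorg B x) = ?V (tm B x)" using s by auto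
  then show ?thesis using True pair[OF x] by simp
 next
  case False
  then have "x:gE S" using x E by simp
  then show ?thesis using False pair[OF x] org bar by simp
 qed
 have uq: "EX! x. x:gE B & ?E x = Some f" if "f:gE S" for f
  using that E by (intro ex1I[of _ f]) (auto split: if_splits)
 have N: "nset B ?E = {\<epsilon>,gbar B \<epsilon>}" using e s by (auto simp: nset_def)
 have conn: "EX p. walk B (nset B ?E) p a b" if ab: "a:gV B" "b:gV B" "?V a = ?V b" for a b
 proof -
  consider "a = b" | "a = gorg B \<epsilon>" "b = tm B \<epsilon>" | "a = tm B \<epsilon>" "b = gorg B \<epsilon>" using ab(3) by (auto split: if_splits)
  then show ?thesis
  proof cases
   case 1
   then show ?thesis using ab by (intro exI[of _ "[]"]) simp
  next
   case 2
   then show ?thesis using s N by (intro exI[of _ "[\<epsilon>]"]) simp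
  next
   case 3
   then show ?thesis using s N by (intro exI[of _ "[gbar B \<epsilon>]"]) simp
  qed
 qed
 have nl: "gorg B x ~= tm B x" if "x:{\<epsilon>,gbar B \<epsilon>}" for x using that s ne by auto
 have acyc: "p = []" if w: "walk B (nset B ?E) p a a" and rd: "reduced B p" for p a
 proof (cases p)
  case (Cons x q)
  have x: "x:{\<epsilon>,gbar B \<epsilon>}" "gorg B x = a" "walk B (nset B ?E) q (tm B x) a" using w Cons N by auto
  show ?thesis
  proof (cases q)
   case Nil
   then show ?thesis using x nl[OF x(1)] by simp
  next
   case (Cons y z)
   then have y: "y:{\<epsilon>,gbar B \<epsilon>}" "gorg B y = tm B x" using x N by auto
   have "y ~= x" using y(2) nl[OF x(1)] by auto
   then have "y = gbar B x" using x(1) y(1) s by auto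
   then show ?thesis using rd Cons \<open>p = x # q\<close> by (simp add: reduced_Cons)
  qed
 qed simp
 show ?thesis unfolding coll_def
  by (intro conjI ballI allI impI) (rule im, erule ed, erule uq, erule (2) conn, erule conjE, erule (1) acyc)
qed

text \<open>Collapsed edges carry the empty word, so a path and its image spell the same word, and
  the same \<open>g\<close> serves above and below.\<close>

lemma (in coll2) label_transfer:
 assumes E: "!!e. e:gE G ==> \<mu> e = (case cE e of None => [] | Some f => \<nu> f)"
  and l: "labelling r H \<nu>" and va: "valid_marking r G (v,ws)"
 shows "inverts r H (map (%w. red H (cp w)) ws) \<nu> g \<longleftrightarrow> inverts r G ws \<mu> g"
proof -
 let ?ws = "map (%w. red H (cp w)) ws"
 have sub: "subst \<nu> (cp p) = subst \<mu> p" if "set p <= gE G" for p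
  using that by (induction p) (auto simp: E cmap_def split: option.splits)
 have w: "!!i. i < r ==> walk G (gE G) (ws ! i) v v" "length ws = r" using valid_markingD[OF va] by auto
 interpret m: marked r G v ws using sG va by unfold_locales
 have "valid_marking r H (cV v,?ws)" using comp_valid[OF va] by (simp add: comp_marking_eq)
 then interpret n: marked r H "cV v" ?ws using sH by unfold_locales
 have "red (rose r) (subst \<nu> (petal H ?ws x)) = red (rose r) (subst \<mu> (petal G ws x))" if x: "x:gE (rose r)" for x
 proof -
  have xs: "set [x] <= gE (rose r)" using x by simp
  have pG: "set (petal G ws x) <= gE G" using m.petal_set[OF xs] by simp
  have pH: "set (petal H ?ws x) <= gE H" using n.petal_set[OF xs] by simp
  have "red H (petal H ?ws x) = red H (cp (petal G ws x))" using petal_comp[OF w xs] by simp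
  from red_subst_cong[OF sH rose_serre labelling_hom[OF l] pH set_subst[OF hom pG] this]
  show ?thesis unfolding sub[OF pG] .
 qed
 then show ?thesis unfolding inverts_def by simp
qed

text \<open>Merging two vertices of valence at least 3 along an edge leaves at least 2 + 2
  directions, so the result is again an admissible graph.\<close>

lemma collapse_step:
 assumes oB: "outer_graph B" and va: "valid_marking r B (v,ws)" and l: "labelling r B \<mu>" and i: "inverts r B ws \<mu> g"
  and e: "\<epsilon>:gE B" "\<mu> \<epsilon> = []" and ne: "gorg B \<epsilon> ~= tm B \<epsilon>"
 shows "EX S v' ws' cV cE. outer_graph S & valid_marking r S (v',ws') & labelling r S \<mu> & inverts r S ws' \<mu> g &
  mdom B (v,ws) S (v',ws') cV cE & gE S \<subset> gE B"
proof -
 note sB = outerD(1)[OF oB]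
 note F = serre_fin[OF sB]
 note s = serreD[OF sB e(1)]
 define S where "S = \<lparr>gV = gV B-{gorg B \<epsilon>},gE = gE B-{\<epsilon>,gbar B \<epsilon>},
  gorg = (%x. if gorg B x = gorg B \<epsilon> then tm B \<epsilon> else gorg B x),gbar = gbar B,gEp = gEp B-{\<epsilon>,gbar B \<epsilon>}\<rparr>"
 have sel: "gV S = gV B-{gorg B \<epsilon>}" "gE S = gE B-{\<epsilon>,gbar B \<epsilon>}"
  "!!x. gorg S x = (if gorg B x = gorg B \<epsilon> then tm B \<epsilon> else gorg B x)" "!!x. gbar S x = gbar B x" "gEp S = gEp B-{\<epsilon>,gbar B \<epsilon>}"
  by (auto simp: S_def)
 have pair: "gbar B x ~: {\<epsilon>,gbar B \<epsilon>}" if "x:gE B" "x ~: {\<epsilon>,gbar B \<epsilon>}" for x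
  using gbar_eq_iff[OF sB that(1) e(1)] that s(4) serreD(4)[OF sB that(1)] by auto
 have sS: "serre_graph S" unfolding serre_graph_def
 proof (intro conjI ballI)
  show "finite (gV S)" "finite (gE S)" "gEp S <= gE S" using F by (auto simp: sel)
  show "gV S ~= {}" using s(5) ne by (auto simp: sel)
  fix x assume "x:gE S"
  then have x: "x:gE B" "x ~: {\<epsilon>,gbar B \<epsilon>}" by (auto simp: sel)
  note sx = serreD[OF sB x(1)]
  show "gorg S x:gV S" using sx s ne by (simp add: sel)
  show "gbar S x:gE S" using sx pair[OF x] by (simp add: sel)
  show "gbar S x ~= x" "gbar S (gbar S x) = x" using sx by (simp_all add: sel)
  show "(x:gEp S) = (gbar S x ~: gEp S)" using serre_Ep[OF sB x(1)] x pair[OF x] by (simp add: sel)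
 qed
 define cV where "cV x = (if x = gorg B \<epsilon> then tm B \<epsilon> else x)" for x
 define cE where "cE x = (if x:{\<epsilon>,gbar B \<epsilon>} then None else Some x)" for x
 have "coll B S cV cE" unfolding cV_def cE_def by (rule single_collapse[OF sB sS e(1) ne]) (auto simp: sel)
 then interpret c: coll2 B S cV cE using sB sS by unfold_locales
 have out3: "card {x:gE B. gorg B x = w} >= 3" if "w:gV B" for w by (rule outerD(3)[OF oB that])
 have "card {x:gE S. gorg S x = w} >= 3" if w: "w:gV S" for w
 proof (cases "w = tm B \<epsilon>")
  case True
  let ?X = "{x:gE B. gorg B x = gorg B \<epsilon>}-{\<epsilon>}" and ?Y = "{x:gE B. gorg B x = tm B \<epsilon>}-{gbar B \<epsilon>}"
  have "card ?X >= 2" "card ?Y >= 2" using out3[OF s(1)] out3[OF s(5)] e s F by auto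
  moreover have "card (?X \<union> ?Y) = card ?X+card ?Y" by (rule card_Un_disjoint) (use F ne in auto)
  moreover have "card (?X \<union> ?Y) <= card {x:gE S. gorg S x = w}"
   by (rule card_mono) (use F ne True s in \<open>auto simp: sel\<close>)
  ultimately show ?thesis by linarith
 next
  case False
  have "{x:gE B. gorg B x = w} <= {x:gE S. gorg S x = w}" using w False s by (auto simp: sel)
  then have "card {x:gE B. gorg B x = w} <= card {x:gE S. gorg S x = w}" by (rule card_mono[rotated]) (use F in \<open>simp add: sel\<close>)
  then show ?thesis using out3[of w] w by (simp add: sel)
 qed
 then have oS: "outer_graph S" using sS c.coll_connected[OF outerD(2)[OF oB]] by (simp add: outer_graph_def)
 let ?ws = "map (%w. red S (c.cp w)) ws"
 have cm: "comp_marking S cV cE (v,ws) = (cV v,?ws)" by (rule c.comp_marking_eq)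
 have vS: "valid_marking r S (cV v,?ws)" using c.comp_valid[OF va] unfolding cm .
 have lS: "labelling r S \<mu>" unfolding labelling_def using labellingD[OF l] by (simp add: sel)
 have iS: "inverts r S ?ws \<mu> g"
 proof (rule iffD2[OF c.label_transfer[OF _ lS va] i])
  fix x assume "x:gE B"
  then show "\<mu> x = (case cE x of None => [] | Some f => \<mu> f)"
   using e(2) labellingD(3)[OF l e(1)] by (auto simp: cE_def)
 qed
 have "mdom B (v,ws) S (cV v,?ws) cV cE"
  unfolding mdom_def cm using c.co mequiv_refl[OF sS valid_wfm[OF vS]] by blast
 moreover have "gE S \<subset> gE B" using e(1) by (auto simp: sel)
 ultimately show ?thesis using oS vS lS iS by blast
qed

text \<open>A blow-up that prepares a fold: the directions in \<open>S\<close> move to a new vertex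
  \<open>u'\<close>, joined to \<open>u\<close> by an edge \<epsilon> with empty label. The two
  bounds by 2 keep all valences at least 3. The total label length is unchanged, but at
  \<open>u'\<close> every direction except \<epsilon> lies in \<open>S\<close>, so
  \<open>gauge_size\<close> applies there when the labels in \<open>S\<close> share their first
  letter.\<close>

lemma expand_step:
 assumes oG: "outer_graph G" and va: "valid_marking r G (v,ws)" and l: "labelling r G \<mu>" and i: "inverts r G ws \<mu> g"
  and S: "S <= {d:gE G. gorg G d = u}" "card S >= 2" "card ({d:gE G. gorg G d = u}-S) >= 2"
 shows "EX B v' ws' \<mu>' u' \<epsilon> cV cE. outer_graph B & valid_marking r B (v',ws') & labelling r B \<mu>' & inverts r B ws' \<mu>' g &
  mdom B (v',ws') G (v,ws) cV cE & (\<Sum>d\<in>gE B. length (\<mu>' d)) = (\<Sum>d\<in>gE G. length (\<mu> d)) &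
  {d:gE B. gorg B d = u'} = insert \<epsilon> S & \<mu>' \<epsilon> = [] & (ALL d:S. \<mu>' d = \<mu> d)"
proof -
 note sG = outerD(1)[OF oG]
 note F = serre_fin[OF sG]
 obtain u' where u': "u' ~: gV G" using ex_new_if_finite[OF infinite_UNIV_nat F(1)] by blast
 obtain \<epsilon> where \<epsilon>: "\<epsilon> ~: gE G" using ex_new_if_finite[OF infinite_UNIV_nat F(2)] by blast
 have "finite (insert \<epsilon> (gE G))" using F by simp
 from ex_new_if_finite[OF infinite_UNIV_nat this] obtain \<epsilon>' where "\<epsilon>' ~: insert \<epsilon> (gE G)" by blast
 then have \<epsilon>': "\<epsilon>' ~: gE G" "\<epsilon>' ~= \<epsilon>" by auto
 have fS: "finite S" by (rule finite_subset[OF S(1)]) (use F in simp)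
 have SE: "S <= gE G" "!!d. d:S ==> gorg G d = u" using S(1) by auto
 have "S ~= {}" using S(2) by auto
 then have u: "u:gV G" using S(1) serreD(1)[OF sG] by blast
 have uu: "u ~= u'" using u u' by blast
 define B where "B = \<lparr>gV = insert u' (gV G),gE = gE G \<union> {\<epsilon>,\<epsilon>'},
  gorg = (%e. if e = \<epsilon> then u' else if e = \<epsilon>' then u else if e:S then u' else gorg G e),
  gbar = (%e. if e = \<epsilon> then \<epsilon>' else if e = \<epsilon>' then \<epsilon> else gbar G e),gEp = insert \<epsilon> (gEp G)\<rparr>"
 have sel: "gV B = insert u' (gV G)" "gE B = gE G \<union> {\<epsilon>,\<epsilon>'}" "gEp B = insert \<epsilon> (gEp G)"
  "gorg B \<epsilon> = u'" "gorg B \<epsilon>' = u" "!!e. e:gE G ==> gorg B e = (if e:S then u' else gorg G e)"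
  "gbar B \<epsilon> = \<epsilon>'" "gbar B \<epsilon>' = \<epsilon>" "!!e. e:gE G ==> gbar B e = gbar G e"
  using \<epsilon> \<epsilon>' by (auto simp: B_def)
 have EpG: "\<epsilon> ~: gEp G" "\<epsilon>' ~: gEp G" using \<epsilon> \<epsilon>' F(3) by auto
 have sB: "serre_graph B" unfolding serre_graph_def
 proof (intro conjI ballI)
  show "finite (gV B)" "finite (gE B)" "gEp B <= gE B" "gV B ~= {}" using F by (auto simp: sel)
  fix x assume "x:gE B"
  then consider "x:gE G" | "x = \<epsilon>" | "x = \<epsilon>'" by (auto simp: sel)
  then have "gorg B x:gV B & gbar B x:gE B & gbar B x ~= x & gbar B (gbar B x) = x & (x:gEp B) = (gbar B x ~: gEp B)"
  proof cases
   case 1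
   note sx = serreD[OF sG 1]
   have "gbar G x ~= \<epsilon>" "x ~= \<epsilon>" using \<epsilon> 1 sx(2) by auto
   then show ?thesis using sx serre_Ep[OF sG 1] 1 by (auto simp: sel)
  next
   case 2
   then show ?thesis using \<epsilon>' EpG by (simp add: sel)
  next
   case 3
   then show ?thesis using \<epsilon>' EpG u by (simp add: sel)
  qed
  then show "gorg B x:gV B" "gbar B x:gE B" "gbar B x ~= x" "gbar B (gbar B x) = x" "(x:gEp B) = (gbar B x ~: gEp B)" by auto
 qed
 have tm: "tm B \<epsilon> = u" by (simp add: tm_def sel)
 define cV where "cV x = (if x = gorg B \<epsilon> then tm B \<epsilon> else x)" for x
 define cE where "cE x = (if x:{\<epsilon>,gbar B \<epsilon>} then None else Some x)" for x
 have "coll B G cV cE" unfolding cV_def cE_def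
 proof (rule single_collapse[OF sB sG])
  show "\<epsilon>:gE B" by (simp add: sel)
  show "gorg B \<epsilon> ~= tm B \<epsilon>" using uu by (simp add: tm sel)
  show "gE G = gE B-{\<epsilon>,gbar B \<epsilon>}" using \<epsilon> \<epsilon>' by (auto simp: sel)
  show "gV G = gV B-{gorg B \<epsilon>}" using u' by (auto simp: sel)
  fix e assume e: "e:gE G"
  show "gbar G e = gbar B e" using e by (simp add: sel)
  have "gorg G e ~= u'" using serreD(1)[OF sG e] u' by auto
  then show "gorg G e = (if gorg B e = gorg B \<epsilon> then tm B \<epsilon> else gorg B e)" using e SE(2) by (simp add: sel tm)
 qed
 then interpret c: coll2 B G cV cE using sB sG by unfold_locales
 have D': "{d:gE B. gorg B d = u'} = insert \<epsilon> S"
  using uu SE u' serreD(1)[OF sG] by (auto simp: sel split: if_splits)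
 let ?D = "{d:gE G. gorg G d = u}"
 have "card {x:gE B. gorg B x = w} >= 3" if w: "w:gV B" for w
 proof -
  consider "w = u'" | "w = u" | "w:gV G" "w ~= u" "w ~= u'" using w sel(1) by blast
  then show ?thesis
  proof cases
   case 1
   have "\<epsilon> ~: S" using SE(1) \<epsilon> by blast
   then show ?thesis using S(2) fS unfolding 1 D' by simp
  next
   case 2
   have "insert \<epsilon>' (?D-S) <= {x:gE B. gorg B x = w}" unfolding 2 by (auto simp: sel)
   then have "card (insert \<epsilon>' (?D-S)) <= card {x:gE B. gorg B x = w}" by (rule card_mono[rotated]) (use F in \<open>simp add: sel\<close>)
   moreover have "card (insert \<epsilon>' (?D-S)) = Suc (card (?D-S))" using F \<epsilon>' by (intro card_insert_disjoint) auto
   ultimately show ?thesis using S(3) by linarith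
  next
   case 3
   have "{x:gE G. gorg G x = w} <= {x:gE B. gorg B x = w}" using SE(2) 3 by (auto simp: sel)
   then have "card {x:gE G. gorg G x = w} <= card {x:gE B. gorg B x = w}" by (rule card_mono[rotated]) (use F in \<open>simp add: sel\<close>)
   then show ?thesis using outerD(3)[OF oG 3(1)] by linarith
  qed
 qed
 then have oB: "outer_graph B" using sB c.lift_connected[OF outerD(2)[OF oG]] by (simp add: outer_graph_def)
 obtain M where M: "valid_marking r B M" "comp_marking G cV cE M = (v,ws)" using c.marking_lift[OF va] by blast
 obtain v' ws' where M': "M = (v',ws')" by (cases M) auto
 have vB: "valid_marking r B (v',ws')" using M(1) M' by simp
 have ws: "map (%w. red G (c.cp w)) ws' = ws" using M(2) unfolding M' c.comp_marking_eq by simp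
 define \<mu>' where "\<mu>' e = (if e:gE G then \<mu> e else [])" for e
 have lB: "labelling r B \<mu>'" unfolding labelling_def
 proof
  fix e assume "e:gE B"
  then consider "e:gE G" | "e = \<epsilon>" | "e = \<epsilon>'" by (auto simp: sel)
  then show "set (\<mu>' e) <= gE (rose r) & reduced (rose r) (\<mu>' e) & \<mu>' (gbar B e) = rev_path (rose r) (\<mu>' e)"
   by cases (use labellingD[OF l] serreD(2)[OF sG] \<epsilon> \<epsilon>' in \<open>auto simp: sel \<mu>'_def\<close>)
 qed
 have iB: "inverts r B ws' \<mu>' g"
 proof (rule iffD1[OF c.label_transfer[OF _ l vB]])
  show "inverts r G (map (%w. red G (c.cp w)) ws') \<mu> g" unfolding ws by (rule i)
  fix x assume "x:gE B"
  then show "\<mu>' x = (case cE x of None => [] | Some f => \<mu> f)" using \<epsilon> \<epsilon>' by (auto simp: \<mu>'_def cE_def sel)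
 qed
 have md: "mdom B (v',ws') G (v,ws) cV cE"
  unfolding mdom_def using c.co M(2) M' mequiv_refl[OF sG valid_wfm[OF va]] by simp
 have sm: "(\<Sum>d\<in>gE B. length (\<mu>' d)) = (\<Sum>d\<in>gE G. length (\<mu> d))"
  by (rule sum.mono_neutral_cong_right) (use F in \<open>auto simp: sel \<mu>'_def\<close>)
 have "\<mu>' \<epsilon> = []" "ALL d:S. \<mu>' d = \<mu> d" using \<epsilon> SE(1) by (auto simp: \<mu>'_def)
 then show ?thesis using oB vB lB iB md sm D' by blast
qed

section \<open>Connectedness\<close>

definition std_marking :: "nat => nat \<times> nat list list" where
 "std_marking r = (0,map (%i. [2 * i]) [0..<r])"

lemma rose_valid:
 assumes "r >= 2"
 shows "outer_graph (rose r)" "valid_marking r (rose r) (std_marking r)"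
proof -
 note R = rose_serre[of r]
 have "connected_graph (rose r)" unfolding connected_graph_def rose_sel by (auto intro!: exI[of _ "[]"] simp: rose_sel)
 moreover have "{e:gE (rose r). gorg (rose r) e = 0} = {..<2 * r}" by (auto simp: rose_sel)
 ultimately show "outer_graph (rose r)" using R assms by (simp add: outer_graph_def rose_sel)
 let ?ws = "map (%i. [2 * i]) [0..<r]"
 have pe: "petal (rose r) ?ws x = [x]" if "x:gE (rose r)" for x
 proof -
  have "x div 2 < r" using that by (simp add: rose_sel)
  then show ?thesis by (simp add: petal_def rose_sel)
 qed
 have sub: "subst (petal (rose r) ?ws) q = q" if "set q <= gE (rose r)" for q using that by (induction q) (auto simp: pe)
 show "valid_marking r (rose r) (std_marking r)" unfolding std_marking_def valid_marking_iff
 proof (intro conjI allI impI; (elim conjE)?)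
  show "0:gV (rose r)" "length ?ws = r" by (auto simp: rose_sel)
  fix i assume "i < r"
  then show "walk (rose r) (gE (rose r)) (?ws ! i) 0 0" "reduced (rose r) (?ws ! i)" by (auto simp: rose_sel)
 next
  fix c assume c: "walk (rose r) (gE (rose r)) c 0 0" "reduced (rose r) c"
  have "set c <= gE (rose r)" by (rule walk_E[OF R c(1)])
  then show "EX q. set q <= gE (rose r) & red (rose r) (subst (petal (rose r) ?ws) q) = c"
   using red_id[OF c(2)] sub by (intro exI[of _ c]) simp
 next
  fix q assume "set q <= gE (rose r)" "reduced (rose r) q" "red (rose r) (subst (petal (rose r) ?ws) q) = []"
  then show "q = []" using sub red_id by simp
 qed
qed

text \<open>When no label can be shortened, the labels of reduced paths are reduced, so the loops realising the
 generators are single edges and exhaust the graph.\<close>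
lemma (in marked) terminal_rose:
 assumes con: "connected_graph G" and l: "labelling r G \<mu>" and i: "inverts r G ws \<mu> g"
  and ne: "!!e. e:gE G ==> \<mu> e ~= []"
  and dist: "!!d d'. d:gE G ==> d':gE G ==> gorg G d = gorg G d' ==> hd (\<mu> d) = hd (\<mu> d') ==> d = d'"
 shows "EX cV cE. mdom (rose r) (std_marking r) G (v,ws) cV cE"
proof -
 have g: "set g <= gE (rose r)" using i by (simp add: inverts_def)
 have v: "v:gV G" by (rule valid_markingD(1)[OF va])
 have redS: "walk G (gE G) p a b ==> reduced G p ==> reduced (rose r) (subst \<mu> p)" for p a b
 proof (induction p arbitrary: a)
  case (Cons e p)
  have e: "e:gE G" "walk G (gE G) p (tm G e) b" using Cons.prems by auto
  note s = serreD[OF sG e(1)] and L = labellingD[OF l e(1)]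
  have IH: "reduced (rose r) (subst \<mu> p)" using Cons.IH[OF e(2)] Cons.prems(2) by (simp add: reduced_Cons)
  show ?case
  proof (cases p)
   case Nil
   then show ?thesis using L by simp
  next
   case (Cons f q)
   have f: "f:gE G" "gorg G f = tm G e" using e(2) Cons by auto
   have "f ~= gbar G e" using Cons.prems(2) Cons by (simp add: reduced_Cons)
   then have "hd (\<mu> f) ~= hd (\<mu> (gbar G e))" using dist[OF f(1) s(2)] f(2) s(7) by auto
   also have "hd (\<mu> (gbar G e)) = gbar (rose r) (last (\<mu> e))"
    unfolding L(3) rev_path_def using ne[OF e(1)] by (simp add: hd_rev last_map)
   finally have "hd (subst \<mu> p) ~= gbar (rose r) (last (\<mu> e))" using ne[OF f(1)] Cons by simp
   then show ?thesis using L(2) IH by (simp add: reduced_append)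
  qed
 qed simp
 have single: "EX e. z = [e] & e:gE G & gorg G e = v & tm G e = v & \<mu> e = [x]"
  if z: "walk G (gE G) z v v" "reduced G z" "red (rose r) (subst \<mu> z) = [x]" for z x
 proof -
  have sz: "subst \<mu> z = [x]" using z(3) red_id[OF redS[OF z(1,2)]] by simp
  obtain e q where q: "z = e#q" using sz by (cases z) auto
  have e: "e:gE G" "gorg G e = v" "walk G (gE G) q (tm G e) v" using z(1) q by auto
  have m: "\<mu> e = [x]" "subst \<mu> q = []" using sz q ne[OF e(1)] by (auto simp: append_eq_Cons_conv)
  have "q = []"
  proof (cases q)
   case (Cons f q')
   then have "f:gE G" using e(3) by simp
   then show ?thesis using ne[of f] m(2) Cons by simp
  qed
  then show ?thesis using q e m by simp
 qed
 have "EX e. e:gE G & gorg G e = v & tm G e = v & \<mu> e = [x]" if x: "x:gE (rose r)" for x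
 proof -
  obtain p where p: "walk G (gE G) p v v" "reduced G p" "red (rose r) (subst \<mu> p) = red (rose r) [x]"
   using labelling_surj[OF l i, of "[x]"] x by auto
  have "red (rose r) (subst \<mu> p) = [x]" using p(3) by (simp add: red_id)
  from single[OF p(1,2) this] show ?thesis by blast
 qed
 then have "ALL x:gE (rose r). EX e. e:gE G & gorg G e = v & tm G e = v & \<mu> e = [x]" by blast
 from bchoice[OF this] obtain E where E: "!!x. x:gE (rose r) ==> E x:gE G" "!!x. x:gE (rose r) ==> gorg G (E x) = v"
  "!!x. x:gE (rose r) ==> tm G (E x) = v" "!!x. x:gE (rose r) ==> \<mu> (E x) = [x]" by blast
 have outv: "hd (\<mu> e):gE (rose r)" "e = E (hd (\<mu> e))" if e: "e:gE G" "gorg G e = v" for e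
 proof -
  show h: "hd (\<mu> e):gE (rose r)" using labellingD(1)[OF l e(1)] hd_in_set[OF ne[OF e(1)]] by blast
  show "e = E (hd (\<mu> e))" by (rule dist[OF e(1) E(1)[OF h]]) (simp_all add: e E(2,4) h)
 qed
 have "walk G (gE G) p a w ==> a = v ==> w = v" for p a w
 proof (induction p arbitrary: a)
  case (Cons e p)
  then have e: "e:gE G" "gorg G e = v" "walk G (gE G) p (tm G e) w" by auto
  have "tm G e = v" using outv[OF e(1,2)] E(3) by metis
  then show ?case by (rule Cons.IH[OF e(3)])
 qed simp
 then have V: "gV G = {v}" using con v unfolding connected_graph_def by blast
 have gv: "gorg G e = v" if "e:gE G" for e using serreD(1)[OF sG that] V by simp
 have iso: "graph_iso (rose r) G (%_. v) E" unfolding graph_iso_def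
 proof (intro conjI ballI)
  show "bij_betw (%_. v) (gV (rose r)) (gV G)" by (simp add: V rose_sel bij_betw_def)
  have "inj_on E (gE (rose r))" by (rule inj_onI) (metis E(4) list.inject)
  moreover have "E ` gE (rose r) = gE G" using E(1) outv gv by blast
  ultimately show "bij_betw E (gE (rose r)) (gE G)" by (simp add: bij_betw_def)
  fix x assume x: "x:gE (rose r)"
  show "gorg G (E x) = v" by (rule E(2)[OF x])
  have b: "gbar G (E x):gE G" by (rule serreD(2)[OF sG E(1)[OF x]])
  have "\<mu> (gbar G (E x)) = [gbar (rose r) x]" using labellingD(3)[OF l E(1)[OF x]] E(4)[OF x] by simp
  then show "E (gbar (rose r) x) = gbar G (E x)" using outv(2)[OF b gv[OF b]] by simp
 qed
 have subE: "subst \<mu> (map E q) = q" if "set q <= gE (rose r)" for q using that by (induction q) (auto simp: E(4))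
 have wE: "walk G (gE G) p v v" if "set p <= gE G" for p
  using that
 proof (induction p)
  case (Cons e p)
  then have "e:gE G" "tm G e = v" using serreD(5)[OF sG] V by auto
  then show ?case using Cons gv by simp
 qed (simp add: v)
 have r0: "wfm r (rose r) (std_marking r)" by (auto simp: wfm_def std_marking_def rose_sel)
 \<comment> \<open>A path whose label is inverse to \<open>g\<close>; a change of base point along
   it undoes the conjugation in \<open>inverts\<close>.\<close>
 define p where "p = map E (rev_path (rose r) g)"
 have g': "set (rev_path (rose r) g) <= gE (rose r)" by (rule set_rev_path[OF R g])
 have pE: "set p <= gE G" unfolding p_def using g' E(1) by auto
 have sp: "subst \<mu> p = rev_path (rose r) g" unfolding p_def by (rule subE[OF g'])
 have eq: "[E (2 * j)] = red G (rev_path G p@ws ! j@p)" if j: "j < r" for j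
 proof -
  have x: "2 * j:gE (rose r)" using j by (simp add: rose_sel)
  have wj: "set (ws ! j) <= gE G" by (rule walk_E[OF sG valid_markingD(3)[OF va j]])
  let ?Z = "rev_path G p@ws ! j@p"
  have Z: "set ?Z <= gE G" using pE wj set_rev_path[OF sG pE] by simp
  have 1: "red (rose r) (subst \<mu> (rev_path G p)) = red (rose r) g"
   unfolding red_subst_rev_path[OF sG R labelling_hom[OF l] pE] sp by (simp add: rev_path_rev_path[OF R g])
  have 2: "red (rose r) (subst \<mu> (ws ! j)) = red (rose r) (rev_path (rose r) g@[2 * j]@g)"
   using i x unfolding inverts_def by (force simp: petal_def)
  have C: "set (rev_path (rose r) g@[2 * j]@g) <= gE (rose r)" using g g' x by simp
  have "red (rose r) (subst \<mu> ?Z) = red (rose r) (g@(rev_path (rose r) g@[2 * j]@g)@rev_path (rose r) g)"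
   unfolding subst_simps
   by (rule red_append_cong[OF R labelling_set[OF l set_rev_path[OF sG pE]] g 1
      red_append_cong[OF R labelling_set[OF l wj] C 2]]) (simp add: sp)
  also have "... = [2 * j]" using red_conj_inverse[OF R g, of "[2 * j]"] x by (simp add: red_id)
  finally have "red (rose r) (subst \<mu> (red G ?Z)) = [2 * j]"
   using red_subst_red[OF sG R labelling_hom[OF l] Z] by simp
  from single[OF walk_red[OF sG order_refl wE[OF Z]] red_reduced this]
  obtain e where e: "red G ?Z = [e]" "e:gE G" "\<mu> e = [2 * j]" by blast
  then show ?thesis using outv(2)[OF e(2) gv[OF e(2)]] by simp
 qed
 have "marking_equiv G (v,ws) (v,map (map E) (map (%i. [2 * i]) [0..<r]))"
  unfolding mequiv_iff using valid_markingD(2)[OF va] wE[OF pE] eq by (intro conjI exI[of _ p]) auto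
 then have "mdom (rose r) (std_marking r) G (v,ws) (%_. v) (%e. Some (E e))"
  unfolding mdom_def using iso_coll[OF R sG iso] iso_comp[OF R sG iso r0] by (simp add: std_marking_def)
 then show ?thesis by blast
qed

text \<open>Reachability is compared from all starting points. Symmetry and transitivity are then
  immediate, and only single pieces have to be reversed, in \<open>onep_sym\<close>.\<close>

definition joined :: "nat => mmg => mmg => bool" where
 "joined r t t' \<longleftrightarrow> (ALL x. path_lengths r x (nrm r t) ~= {} \<longleftrightarrow> path_lengths r x (nrm r t') ~= {})"

lemma joined_sym: "joined r t t' ==> joined r t' t" by (simp add: joined_def)

lemma joined_trans: "joined r t t' ==> joined r t' t'' ==> joined r t t''" by (simp add: joined_def)

lemma joined_mdom:
 assumes "valid_mmg r (G,M,l)" "valid_mmg r (G0,M0,l0)" "mdom G M G0 M0 cV cE"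
 shows "joined r (G,M,l) (G0,M0,l0)"
proof -
 have o: "onep r (nrm r (G0,M0,l0)) (nrm r (G,M,l))" by (rule onep_dominated[OF assms(2,1,3)])
 show ?thesis unfolding joined_def using path_extend[OF _ o] path_extend[OF _ onep_sym[OF o]] by (intro allI iffI)
qed

text \<open>An arbitrary choice of lengths: points of one cell are joined by
  \<open>joined_mdom\<close> with the identity collapse.\<close>

definition unit_len :: "sgraph => nat => real" where
 "unit_len G e = (if e:gEp G then 1 else 0)"

lemma unit_valid: "outer_graph G ==> valid_marking r G M ==> valid_mmg r (G,M,unit_len G)"
 by (simp add: valid_mmg_def lengths_def unit_len_def)

text \<open>Induction on the total label length and, for equal length, on the number of edges. An
  edge with empty label is collapsed. If two directions at a vertex share their first letter, a
  change of gauge shortens the labels, after a blow-up when several other directions are present.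
  Otherwise \<open>terminal_rose\<close> identifies the graph with the rose.\<close>

lemma joined_rose:
 assumes r: "r >= 2"
 shows "outer_graph G ==> valid_marking r G (v,ws) ==> labelling r G \<mu> ==> inverts r G ws \<mu> g ==>
  (\<Sum>d\<in>gE G. length (\<mu> d)) = n ==>
  joined r (G,(v,ws),unit_len G) (rose r,std_marking r,unit_len (rose r))"
proof (induction n arbitrary: G v ws \<mu> g rule: less_induct)
 case (less n)
 note IH1 = less.IH
 from less.prems show ?case
 proof (induction "card (gE G)" arbitrary: G v ws \<mu> g rule: less_induct)
  case less
  note IH2 = less.hyps
  note oG = less.prems(1) and va = less.prems(2) and l = less.prems(3) and i = less.prems(4) and n = less.prems(5)
  note sG = outerD(1)[OF oG]
  note F = serre_fin[OF sG]
  interpret marked r G v ws using sG va by unfold_locales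
  consider (A) "EX e:gE G. \<mu> e = []"
   | (B) "EX d:gE G. EX d':gE G. d ~= d' & gorg G d = gorg G d' & hd (\<mu> d) = hd (\<mu> d')" "ALL e:gE G. \<mu> e ~= []"
   | (C) "ALL e:gE G. \<mu> e ~= []" "ALL d:gE G. ALL d':gE G. gorg G d = gorg G d' & hd (\<mu> d) = hd (\<mu> d') --> d = d'" by blast
  then show ?case
  proof cases
   case A
   then obtain e where e: "e:gE G" "\<mu> e = []" by blast
   have "gorg G e ~= tm G e" by (rule loop_label_nonempty[OF outerD(2)[OF oG] l i e])
   from collapse_step[OF oG va l i e this] obtain S v' ws' cV cE where
    S: "outer_graph S" "valid_marking r S (v',ws')" "labelling r S \<mu>" "inverts r S ws' \<mu> g"
     "mdom G (v,ws) S (v',ws') cV cE" "gE S \<subset> gE G" by blast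
   have le: "(\<Sum>d\<in>gE S. length (\<mu> d)) <= n" unfolding n[symmetric] using S(6) F by (intro sum_mono2) auto
   have "joined r (S,(v',ws'),unit_len S) (rose r,std_marking r,unit_len (rose r))"
   proof (cases "(\<Sum>d\<in>gE S. length (\<mu> d)) = n")
    case True
    show ?thesis by (rule IH2[OF psubset_card_mono[OF F(2) S(6)] S(1-4) True])
   next
    case False
    then have "(\<Sum>d\<in>gE S. length (\<mu> d)) < n" using le by simp
    from IH1[OF this S(1-4) refl] show ?thesis .
   qed
   then show ?thesis using joined_mdom[OF unit_valid[OF oG va] unit_valid[OF S(1,2)] S(5)] joined_trans by blast
  next
   case B
   then obtain d d' where d: "d:gE G" "d':gE G" "d ~= d'" "gorg G d = gorg G d'" "hd (\<mu> d) = hd (\<mu> d')" by blast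
   define u where "u = gorg G d"
   define a where "a = hd (\<mu> d)"
   have a: "a:gE (rose r)" using labellingD(1)[OF l d(1)] B(2) d(1) by (auto simp: a_def)
   define S where "S = {d:gE G. gorg G d = u & \<mu> d ~= [] & hd (\<mu> d) = a}"
   let ?D = "{d:gE G. gorg G d = u}"
   have "{d,d'} <= S" using d B(2) by (auto simp: S_def u_def a_def)
   then have "card {d,d'} <= card S" by (rule card_mono[rotated]) (use F in \<open>simp add: S_def\<close>)
   then have S2: "card S >= 2" using d(3) by simp
   show ?thesis
   \<comment> \<open>With at most one other direction the gauge at \<open>u\<close> shortens at
     once, as \<open>S\<close> has at least two elements; with two or more the blow-up respects the
     valence condition.\<close>
   proof (cases "card (?D-S) <= 1")
    case True
    then have "card (?D-S) < card S" using S2 by linarith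
    from gauge_size[OF sG l a S_def this] have lt: "(\<Sum>d\<in>gE G. length (gauge r G u a \<mu> d)) < n" using n by simp
    obtain g' where "inverts r G ws (gauge r G u a \<mu>) g'" using gauge_inverts[OF l a i] by blast
    from IH1[OF lt oG va gauge_labelling[OF sG l a] this refl] show ?thesis .
   next
    case False
    then have D2: "card (?D-S) >= 2" by linarith
    have SD: "S <= ?D" by (auto simp: S_def)
    from expand_step[OF oG va l i SD S2 D2] obtain B v' ws' \<mu>' u' \<epsilon> cV cE where
     B: "outer_graph B" "valid_marking r B (v',ws')" "labelling r B \<mu>'" "inverts r B ws' \<mu>' g"
     "mdom B (v',ws') G (v,ws) cV cE" "(\<Sum>d\<in>gE B. length (\<mu>' d)) = (\<Sum>d\<in>gE G. length (\<mu> d))"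
     "{d:gE B. gorg B d = u'} = insert \<epsilon> S" "\<mu>' \<epsilon> = []" "ALL d:S. \<mu>' d = \<mu> d" by blast
    note sB = outerD(1)[OF B(1)]
    interpret b: marked r B v' ws' using sB B(2) by unfold_locales
    have "{d:gE B. gorg B d = u' & \<mu>' d ~= [] & hd (\<mu>' d) = a} = {d:insert \<epsilon> S. \<mu>' d ~= [] & hd (\<mu>' d) = a}"
     unfolding B(7)[symmetric] by blast
    also have "... = S" using B(8,9) by (auto simp: S_def)
    finally have SB: "S = {d:gE B. gorg B d = u' & \<mu>' d ~= [] & hd (\<mu>' d) = a}" ..
    have "card ({d:gE B. gorg B d = u'}-S) <= card {\<epsilon>}" unfolding B(7) by (rule card_mono) auto
    then have "card ({d:gE B. gorg B d = u'}-S) < card S" using S2 by simp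
    from gauge_size[OF sB B(3) a SB this] have lt: "(\<Sum>d\<in>gE B. length (gauge r B u' a \<mu>' d)) < n" using n B(6) by simp
    obtain g' where "inverts r B ws' (gauge r B u' a \<mu>') g'" using b.gauge_inverts[OF B(3) a B(4)] by blast
    from IH1[OF lt B(1,2) gauge_labelling[OF sB B(3) a] this refl]
    have "joined r (B,(v',ws'),unit_len B) (rose r,std_marking r,unit_len (rose r))" .
    moreover have "joined r (G,(v,ws),unit_len G) (B,(v',ws'),unit_len B)"
     by (rule joined_sym[OF joined_mdom[OF unit_valid[OF B(1,2)] unit_valid[OF oG va] B(5)]])
    ultimately show ?thesis by (rule joined_trans[rotated])
   qed
  next
   case C
   have "EX cV cE. mdom (rose r) (std_marking r) G (v,ws) cV cE"
    by (rule terminal_rose[OF outerD(2)[OF oG] l i]) (use C in auto)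
   then obtain cV cE where "mdom (rose r) (std_marking r) G (v,ws) cV cE" by blast
   from joined_sym[OF joined_mdom[OF unit_valid[OF rose_valid[OF r]] unit_valid[OF oG va] this]] show ?thesis .
  qed
 qed
qed

lemma onep_path_lengths:
 assumes "onep r x y"
 shows "path_lengths r x y ~= {}"
proof -
 obtain \<gamma> I where g: "\<gamma> 0 = x" "\<gamma> 1 = y" "ALL t:{0..1}. \<gamma> t:outer_space1 r" "weak_cont r \<gamma>" "smooth_piece r 0 1 \<gamma> I"
  using assms unfolding onep_def by blast
 have "I:path_lengths r x y" unfolding path_lengths_def
  by (intro CollectI exI[of _ \<gamma>] exI[of _ "[0,1]"] exI[of _ "%_. I"]) (use g in \<open>auto simp: less_Suc_eq\<close>)
 then show ?thesis by blast
qed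

lemma path_lengths_nonempty:
 assumes r: "r >= 2" and x: "x:outer_space1 r" and y: "y:outer_space1 r"
 shows "path_lengths r x y ~= {}"
proof -
 \<comment> \<open>\<open>joined\<close> only compares nonemptiness of path sets, so the connection
   \<open>onep r x x\<close> is needed to start from a nonempty one.\<close>
 have *: "EX t. x = nrm r t & onep r x x & joined r t (rose r,std_marking r,unit_len (rose r))" if x: "x:outer_space1 r" for x
 proof -
  obtain G M l where G: "valid_mmg r (G,M,l)" "entropy G l = 1" "x = cls r (G,M,l)" using outer_space1_valid[OF x] by blast
  note D = valid_mmgD[OF G(1)]
  obtain v ws where M: "M = (v,ws)" by (cases M) auto
  have va: "valid_marking r G (v,ws)" using D(3) M by simp
  interpret marked r G v ws using D(2) va by unfold_locales
  have xn: "x = nrm r (G,M,l)" using G(2,3) by (simp add: nrm_def)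
  note id = mdom_id[OF D(2,4)]
  obtain \<mu> where mu: "labelling r G \<mu>" "inverts r G ws \<mu> []" using labelling_ex[OF outerD(2)[OF D(1)]] by blast
  have "joined r (G,M,l) (G,M,unit_len G)" by (rule joined_mdom[OF G(1) unit_valid[OF D(1,3)] id])
  from joined_trans[OF this joined_rose[OF r D(1) va mu refl, folded M]]
  have "joined r (G,M,l) (rose r,std_marking r,unit_len (rose r))" .
  moreover have "onep r x x" unfolding xn by (rule onep_dominated[OF G(1,1) id])
  ultimately show ?thesis using xn by blast
 qed
 obtain s where s: "x = nrm r s" "onep r x x" "joined r s (rose r,std_marking r,unit_len (rose r))" using *[OF x] by blast
 obtain t where t: "y = nrm r t" "joined r t (rose r,std_marking r,unit_len (rose r))" using *[OF y] by blast
 have "joined r s t" by (rule joined_trans[OF s(3) joined_sym[OF t(2)]])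
 then have "path_lengths r x (nrm r s) ~= {} \<longleftrightarrow> path_lengths r x (nrm r t) ~= {}" by (simp only: joined_def)
 then show ?thesis using onep_path_lengths[OF s(2)] s(1) t(1) by simp
qed

theorem mainTheorem10:
  fixes r :: nat
  assumes "r \<ge> 2"
  shows "(\<forall>x\<in>outer_space1 r. \<forall>y\<in>outer_space1 r. d_h r x y < \<infinity>) \<and>
         (\<forall>U. U \<subseteq> outer_space1 r \<longrightarrow>
            ((\<forall>x\<in>U. \<exists>\<epsilon>>0. \<forall>y\<in>outer_space1 r. d_h r x y < ereal \<epsilon> \<longrightarrow> y \<in> U) \<longleftrightarrow>
             (\<exists>V. weak_open r V \<and> U = V \<inter> outer_space1 r)))"
proof (intro conjI ballI allI impI iffI)
 fix x y assume "x:outer_space1 r" "y:outer_space1 r"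
 then obtain s where "s:path_lengths r x y" using path_lengths_nonempty[OF assms] by blast
 then have "d_h r x y <= ereal s" unfolding d_h_def by (intro Inf_lower) simp
 then show "d_h r x y < \<infinity>" by (rule le_less_trans) simp
next
 fix U assume "U <= outer_space1 r" "ALL x:U. EX \<epsilon>>0. ALL y:outer_space1 r. d_h r x y < ereal \<epsilon> --> y:U"
 then show "EX V. weak_open r V & U = V \<inter> outer_space1 r" by (rule metric_open_weak_open)
next
 fix U x assume "EX V. weak_open r V & U = V \<inter> outer_space1 r" and x: "x:U"
 then obtain V where V: "weak_open r V" "U = V \<inter> outer_space1 r" by blast
 have xV: "x:V" "x:outer_space1 r" using x V(2) by auto
 from weak_open_metric_open[OF V(1) xV] obtain \<epsilon> where "\<epsilon> > 0" "ALL y:outer_space1 r. d_h r x y < ereal \<epsilon> --> y:V" by blast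
 then show "EX \<epsilon>>0. ALL y:outer_space1 r. d_h r x y < ereal \<epsilon> --> y:U" unfolding V(2) by (intro exI[of _ \<epsilon>]) simp
qed

end
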